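(* Let $N\ge3$ be an integer, $2\le\beta<N$, and $-\frac{\pi}{2}<\alpha<\frac{\pi}{2}$. Let $H$ be a Finsler norm on $\mathbb{R}^{N-1}$ with dual norm $H^0$, let $\Phi^0(x,t)=\sqrt{H^0(x)^2+t^2}$ and $\Phi(\xi,t)=\sqrt{H(\xi)^2+t^2}$, and let $$C_\alpha=\{(x,t)\in\mathbb{R}^{N-1}\times\mathbb{R}:\ t>(\tan\alpha)\,H^0(x)\}.$$ Then there exists a constant $K(N,\alpha,\beta)\in\mathbb{R}$ such that for every $u\in W^{1,2}(C_\alpha)$, $$K(N,\alpha,\beta)\sqrt{1+\tan^2\alpha}\int_{\partial C_\alpha}\frac{u^2(x,t)}{\Phi^0(x,t)}\,\frac{d\sigma_{x,t}}{\sqrt{1+(\tan^2\alpha)|\nabla H^0(x)|^2}}\le\int_{C_\alpha}\Phi^2(\nabla u)\,dx\,dt-\frac{(\beta-2)^2}{4}\int_{C_\alpha}\frac{u^2(x,t)}{[\Phi^0(x,t)]^2}\,dx\,dt .$$ The constant is given by $$K(N,\alpha,\beta)=-(\sin2\alpha)\,\frac{w'(\sin^2\alpha)}{A_{\alpha,\beta}},$$ where (for $\alpha=0$ the right-hand side being understood as its limit as $\alpha\to0^+$) $$w(y)=F\left(\tfrac{N+\beta}{4}-1,\tfrac{N-\beta}{4},\tfrac12;y\right)-K(N,\beta)\sqrt{y}\,F\left(\tfrac{N+\beta}{4}-\tfrac12,\tfrac{N-\beta}{4}+\tfrac12,\tfrac32;y\right),$$ $$A_{\alpha,\beta}=F\left(\tfrac{N+\beta}{4}-1,\tfrac{N-\beta}{4},\tfrac12;\sin^2\alpha\right)-K(N,\beta)\,|\sin\alpha|\,F\left(\tfrac{N+\beta}{4}-\tfrac12,\tfrac{N-\beta}{4}+\tfrac12,\tfrac32;\sin^2\alpha\right),$$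 $$K(N,\beta)=2\,\frac{\Gamma\left(\frac{N+\beta}{4}-\frac12\right)\Gamma\left(\frac{N-\beta}{4}+\frac12\right)}{\Gamma\left(\frac{N+\beta}{4}-1\right)\Gamma\left(\frac{N-\beta}{4}\right)}.$$
   Context: Finsler norm: a function $H:\mathbb{R}^n\to[0,\infty)$, $H\in C^2(\mathbb{R}^n\setminus\{0\})$, continuous, with $H(\lambda\xi)=|\lambda|H(\xi)$ for all $\xi\in\mathbb{R}^n$, $\lambda\in\mathbb{R}$, with $\gamma_1|\xi|\le H(\xi)\le\gamma_2|\xi|$ for some constants $0<\gamma_1\le\gamma_2<\infty$, and strictly convex (in the sense appropriate to norms: $H$ is convex and its unit ball $\{H<1\}$ is strictly convex, equivalently $H^2$ is strictly convex). Its dual (polar) norm is $H^0(x)=\sup_{\xi\ne0}\langle\xi,x\rangle/H(\xi)$, where $\langle\cdot,\cdot\rangle$ is the Euclidean inner product on $\mathbb{R}^n$. Here $n=N-1$. $W^{1,2}(C_\alpha)$ is the usual Sobolev space of real-valued functions on the open cone $C_\alpha$; $\nabla u=(\nabla_xu,\partial u/\partial t)$; on $\partial C_\alpha=\{t=(\tan\alpha)H^0(x)\}$ the values of $u$ are in the sense of traces, and $d\sigma_{x,t}=\sqrt{1+(\tan^2\alpha)|\nabla H^0(x)|^2}\,dx$, $x\in\mathbb{R}^{N-1}$, is the $(N-1)$-dimensional surface measure on $\partial C_\alpha$ parametrized by $x\mapsto(x,(\tan\alpha)H^0(x))$. Thus the left-hand side of the inequality equals $K(N,\alpha,\beta)\int_{\mathbb{R}^{N-1}}\frac{u^2(x,(\tan\alpha)H^0(x))}{H^0(x)}\,dx$.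 $F$ is the hypergeometric series $F(a,b,c;y)=1+\frac{\Gamma(c)}{\Gamma(a)\Gamma(b)}\sum_{k=1}^\infty\frac{\Gamma(a+k)\Gamma(b+k)}{\Gamma(c+k)}\frac{y^k}{k!}$, $0\le y<1$; $\Gamma$ is the Euler Gamma function; $w'$ is the derivative of $w$ on $(0,1)$. *)

theory Defs
  imports "HOL-Analysis.Analysis"
begin

subsection \<open>Smooth functions and gradients\<close>

definition grad :: "('a::real_inner \<Rightarrow> real) \<Rightarrow> 'a \<Rightarrow> 'a" where
  "grad f x = (THE D. GDERIV f x :> D)"

text \<open>Intended for open sets \<open>S\<close>: all partial derivatives up to order \<open>k\<close> exist and are
  continuous on \<open>S\<close>.\<close>

primrec Ck_on :: "nat \<Rightarrow> 'a::euclidean_space set \<Rightarrow> ('a \<Rightarrow> real) \<Rightarrow> bool" where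
  "Ck_on 0 S f \<longleftrightarrow> continuous_on S f"
| "Ck_on (Suc k) S f \<longleftrightarrow>
     (\<forall>x\<in>S. f differentiable (at x)) \<and> (\<forall>b\<in>Basis. Ck_on k S (\<lambda>x. grad f x \<bullet> b))"

definition test_functions :: "'a::euclidean_space set \<Rightarrow> ('a \<Rightarrow> real) set" where
  "test_functions \<Omega> =
     {\<phi>. (\<forall>k. Ck_on k UNIV \<phi>) \<and> compact (closure {x. \<phi> x \<noteq> 0}) \<and> closure {x. \<phi> x \<noteq> 0} \<subseteq> \<Omega>}"


subsection \<open>The Sobolev space and traces\<close>

definition sq_integrable :: "'a measure \<Rightarrow> ('a \<Rightarrow> 'b::euclidean_space) \<Rightarrow> bool" where
  "sq_integrable M f \<longleftrightarrow> f \<in> borel_measurable M \<and> integrable M (\<lambda>x. (norm (f x))\<^sup>2)"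

definition is_weak_grad ::
    "'a::euclidean_space set \<Rightarrow> ('a \<Rightarrow> real) \<Rightarrow> ('a \<Rightarrow> 'a) \<Rightarrow> bool" where
  "is_weak_grad \<Omega> u g \<longleftrightarrow>
     sq_integrable (lebesgue_on \<Omega>) g \<and>
     (\<forall>\<phi>\<in>test_functions \<Omega>. \<forall>b\<in>Basis.
        (\<integral>x. u x * (grad \<phi> x \<bullet> b) \<partial>lebesgue_on \<Omega>) =
        - (\<integral>x. (g x \<bullet> b) * \<phi> x \<partial>lebesgue_on \<Omega>))"

definition W12 :: "'a::euclidean_space set \<Rightarrow> ('a \<Rightarrow> real) set" where
  "W12 \<Omega> = {u. sq_integrable (lebesgue_on \<Omega>) u \<and> (\<exists>g. is_weak_grad \<Omega> u g)}"

text \<open>The choice is unique up to null sets.\<close>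

definition weak_grad :: "'a::euclidean_space set \<Rightarrow> ('a \<Rightarrow> real) \<Rightarrow> 'a \<Rightarrow> 'a" where
  "weak_grad \<Omega> u = (SOME g. is_weak_grad \<Omega> u g)"

text \<open>For a surface measure \<open>\<sigma>\<close> on the boundary of \<open>\<Omega>\<close>, the trace is the continuous extension
  of the restriction map, so it is the \<open>L\<^sup>2(\<sigma>)\<close>-limit of the boundary values of smooth
  functions on the whole space whose restrictions to \<open>\<Omega>\<close> converge to \<open>u\<close> in \<open>W\<^sup>1\<^sup>,\<^sup>2(\<Omega>)\<close>. For
  the domain above a Lipschitz graph and its surface measure such a limit exists for
  every \<open>u\<close> in \<open>W\<^sup>1\<^sup>,\<^sup>2(\<Omega>)\<close> and is unique \<open>\<sigma>\<close>-almost everywhere.\<close>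

definition is_trace ::
    "'a::euclidean_space set \<Rightarrow> 'a measure \<Rightarrow> ('a \<Rightarrow> real) \<Rightarrow> ('a \<Rightarrow> real) \<Rightarrow> bool" where
  "is_trace \<Omega> \<sigma> u g \<longleftrightarrow>
     sq_integrable \<sigma> g \<and>
     (\<exists>v :: nat \<Rightarrow> 'a \<Rightarrow> real.
        (\<forall>k. v k \<in> test_functions UNIV) \<and>
        (\<lambda>k. \<integral>x. (v k x - u x)\<^sup>2 \<partial>lebesgue_on \<Omega>) \<longlonglongrightarrow> 0 \<and>
        (\<lambda>k. \<integral>x. (norm (grad (v k) x - weak_grad \<Omega> u x))\<^sup>2 \<partial>lebesgue_on \<Omega>) \<longlonglongrightarrow> 0 \<and>
        (\<lambda>k. \<integral>x. (v k x - g x)\<^sup>2 \<partial>\<sigma>) \<longlonglongrightarrow> 0)"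

definition trace_on ::
    "'a::euclidean_space set \<Rightarrow> 'a measure \<Rightarrow> ('a \<Rightarrow> real) \<Rightarrow> 'a \<Rightarrow> real" where
  "trace_on \<Omega> \<sigma> u = (SOME g. is_trace \<Omega> \<sigma> u g)"


subsection \<open>Finsler norms\<close>

definition strictly_convex_set :: "'a::euclidean_space set \<Rightarrow> bool" where
  "strictly_convex_set B \<longleftrightarrow>
     (\<forall>x\<in>closure B. \<forall>y\<in>closure B. x \<noteq> y \<longrightarrow> open_segment x y \<subseteq> interior B)"

definition finsler_norm :: "('a::euclidean_space \<Rightarrow> real) \<Rightarrow> bool" where
  "finsler_norm H \<longleftrightarrow>
     (\<forall>\<xi>. 0 \<le> H \<xi>) \<and>
     continuous_on UNIV H \<and>
     Ck_on 2 (- {0}) H \<and>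
     (\<forall>c \<xi>. H (c *\<^sub>R \<xi>) = \<bar>c\<bar> * H \<xi>) \<and>
     (\<exists>\<gamma>1 \<gamma>2. 0 < \<gamma>1 \<and> \<gamma>1 \<le> \<gamma>2 \<and> (\<forall>\<xi>. \<gamma>1 * norm \<xi> \<le> H \<xi> \<and> H \<xi> \<le> \<gamma>2 * norm \<xi>)) \<and>
     convex_on UNIV H \<and>
     strictly_convex_set {\<xi>. H \<xi> < 1}"

definition dual_norm :: "('a::euclidean_space \<Rightarrow> real) \<Rightarrow> 'a \<Rightarrow> real" where
  "dual_norm H x = (SUP \<xi>\<in>-{0}. (\<xi> \<bullet> x) / H \<xi>)"

text \<open>Both \<open>\<Phi>\<close> (from \<open>H\<close>) and \<open>\<Phi>\<^sup>0\<close> (from the dual norm of \<open>H\<close>) are instances of this.\<close>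

definition ext_norm :: "('a \<Rightarrow> real) \<Rightarrow> 'a \<times> real \<Rightarrow> real" where
  "ext_norm H z = sqrt ((H (fst z))\<^sup>2 + (snd z)\<^sup>2)"


subsection \<open>The cone and the surface measure of its boundary\<close>

text \<open>In the following, \<open>H0\<close> is the dual norm.\<close>

definition cone_dom :: "('a \<Rightarrow> real) \<Rightarrow> real \<Rightarrow> ('a \<times> real) set" where
  "cone_dom H0 \<alpha> = {(x, t). t > tan \<alpha> * H0 x}"

definition area_factor :: "('a::real_inner \<Rightarrow> real) \<Rightarrow> real \<Rightarrow> 'a \<Rightarrow> real" where
  "area_factor H0 \<alpha> x = sqrt (1 + (tan \<alpha>)\<^sup>2 * (norm (grad H0 x))\<^sup>2)"

definition cone_surface :: "('a::euclidean_space \<Rightarrow> real) \<Rightarrow> real \<Rightarrow> ('a \<times> real) measure" where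
  "cone_surface H0 \<alpha> =
     distr (density lborel (\<lambda>x. ennreal (area_factor H0 \<alpha> x))) borel (\<lambda>x. (x, tan \<alpha> * H0 x))"


subsection \<open>The constant\<close>

definition hypergeom :: "real \<Rightarrow> real \<Rightarrow> real \<Rightarrow> real \<Rightarrow> real" where
  "hypergeom a b c y =
     1 + Gamma c / (Gamma a * Gamma b) *
       (\<Sum>j. let k = Suc j in
          Gamma (a + real k) * Gamma (b + real k) / Gamma (c + real k) * (y ^ k / fact k))"

definition K_NB :: "nat \<Rightarrow> real \<Rightarrow> real" where
  "K_NB N \<beta> =
     2 * (Gamma ((real N + \<beta>) / 4 - 1 / 2) * Gamma ((real N - \<beta>) / 4 + 1 / 2)) /
         (Gamma ((real N + \<beta>) / 4 - 1) * Gamma ((real N - \<beta>) / 4))"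

definition w_fun :: "nat \<Rightarrow> real \<Rightarrow> real \<Rightarrow> real" where
  "w_fun N \<beta> y =
     hypergeom ((real N + \<beta>) / 4 - 1) ((real N - \<beta>) / 4) (1 / 2) y -
     K_NB N \<beta> * sqrt y *
       hypergeom ((real N + \<beta>) / 4 - 1 / 2) ((real N - \<beta>) / 4 + 1 / 2) (3 / 2) y"

definition A_const :: "nat \<Rightarrow> real \<Rightarrow> real \<Rightarrow> real" where
  "A_const N \<alpha> \<beta> =
     hypergeom ((real N + \<beta>) / 4 - 1) ((real N - \<beta>) / 4) (1 / 2) ((sin \<alpha>)\<^sup>2) -
     K_NB N \<beta> * \<bar>sin \<alpha>\<bar> *
       hypergeom ((real N + \<beta>) / 4 - 1 / 2) ((real N - \<beta>) / 4 + 1 / 2) (3 / 2) ((sin \<alpha>)\<^sup>2)"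

definition K_formula :: "nat \<Rightarrow> real \<Rightarrow> real \<Rightarrow> real" where
  "K_formula N \<alpha> \<beta> = - sin (2 * \<alpha>) * (deriv (w_fun N \<beta>) ((sin \<alpha>)\<^sup>2) / A_const N \<alpha> \<beta>)"

text \<open>The formula defines the constant for nonzero \<open>\<alpha>\<close> (with a nonzero denominator); for
  \<open>\<alpha> = 0\<close> the constant is its right limit.\<close>

definition is_K_const :: "nat \<Rightarrow> real \<Rightarrow> real \<Rightarrow> real \<Rightarrow> bool" where
  "is_K_const N \<alpha> \<beta> K \<longleftrightarrow>
     (if \<alpha> = 0 then ((\<lambda>a. K_formula N a \<beta>) \<longlongrightarrow> K) (at_right 0)
      else A_const N \<alpha> \<beta> \<noteq> 0 \<and> K = K_formula N \<alpha> \<beta>)"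

end

theory Submission
  imports Defs
begin

text \<open>For any vector field \<open>Y\<close> the duality \<open>\<langle>\<xi>, Y\<rangle> \<le> \<Phi>(\<xi>) \<Phi>\<^sup>0(Y)\<close> gives
  \<open>\<Phi>(\<nabla>v)\<^sup>2 \<ge> \<langle>\<nabla>(v\<^sup>2), Y\<rangle> - v\<^sup>2 \<Phi>\<^sup>0(Y)\<^sup>2\<close>. With \<open>r = \<Phi>\<^sup>0(z)\<close> and \<open>s = t / r\<close>, take for \<open>Y\<close>
  the logarithmic gradient of \<open>r\<^bsup>-(N-2)/2\<^esup> G(s)\<close>, which is a combination of \<open>z\<close> and of the vertical unit
  vector with coefficients involving only \<open>r\<close>, \<open>s\<close> and \<open>m = G'/G\<close>. The \<open>z\<close>-part is integrated by
  parts by dilation and the vertical part line by line, so no derivative of \<open>H\<^sup>0\<close> enters, and the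
  inequality reduces to a Riccati inequality for \<open>m\<close>, that is, to the hypergeometric equation for \<open>G\<close>.
  The constant \<open>K(N,\<beta>)\<close> is the limit at \<open>s = 1\<close> of the quotient of the even and the odd solution; for
  every smaller value the solution has a critical point, beyond which \<open>m\<close> is continued by \<open>0\<close>.
  For \<open>\<alpha> < 0\<close> the constant is nonpositive and \<open>m = 0\<close> suffices.
  Density of smooth functions comes from mollifying with a kernel that shifts into the cone.\<close>

section \<open>The hypergeometric equation\<close>

text \<open>With a = (N+\<beta>)/4 - 1 and b = (N-\<beta>)/4 one has a + b = (N-2)/2 and (a+b)^2 -
  4ab = (\<beta>-2)^2/4, which is how the coefficient in the theorem arises. The obstacle is s = 1,
  where the equation is singular and both basic solutions blow up. No connection formula is used
  there. The Taylor coefficients of the even and the odd solution have quotients tending to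
  K(N,\<beta>), and since a + b >= 1/2 the odd series diverges at 1. So with a smaller parameter the
  solution tends to infinity, which forces its critical point, and with a larger one it becomes
  negative. Sign statements at the exact constant follow by comparison with these neighbours; the
  sharp inequality follows, for each fixed test function, by continuity in the parameter.
  Integrability of the weighted terms is part of the claim, but the sharp inequality does not give
  it when one of its coefficients is 0, as for \<beta> = 2 or \<alpha> < 0. A cruder inequality with
  two positive coefficients supplies it.\<close>

definition hcoef :: "real \<Rightarrow> real \<Rightarrow> real \<Rightarrow> nat \<Rightarrow> real" where
  "hcoef a b c j = pochhammer a j * pochhammer b j / (pochhammer c j * fact j)"

lemma hcoef_0 [simp]: "hcoef a b c 0 = 1"
  by (simp add: hcoef_def)

lemma hcoef_Suc:
  assumes "c > 0"
  shows "hcoef a b c (Suc j) = hcoef a b c j * ((a + j) * (b + j) / ((c + j) * (1 + j)))"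
proof -
  have "pochhammer c j \<noteq> 0" "c + real j \<noteq> 0" "1 + real j \<noteq> 0"
    using pochhammer_pos[OF assms, of j] assms by auto
  then show ?thesis
    by (simp add: hcoef_def pochhammer_Suc field_simps)
qed

lemma hcoef_pos: "a > 0 \<Longrightarrow> b > 0 \<Longrightarrow> c > 0 \<Longrightarrow> hcoef a b c j > 0"
  unfolding hcoef_def by (intro divide_pos_pos mult_pos_pos pochhammer_pos) auto

lemma summable_hcoef:
  fixes y :: real
  assumes "a > 0" "b > 0" "c > 0" "\<bar>y\<bar> < 1"
  shows "summable (\<lambda>j. hcoef a b c j * y ^ j)"
proof -
  have "(\<lambda>j. norm (hcoef a b c j) / norm (hcoef a b c (Suc j))) \<longlonglongrightarrow> 1"
  proof -
    have ratio: "norm (hcoef a b c j) / norm (hcoef a b c (Suc j)) =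
        ((c / j + 1) * (1 / j + 1)) / ((a / j + 1) * (b / j + 1))" if "j > 0" for j
    proof -
      have "norm (hcoef a b c j) / norm (hcoef a b c (Suc j)) = ((c + j) * (1 + j)) / ((a + j) * (b + j))"
        using hcoef_pos[OF assms(1-3), of j] assms that
        by (simp add: hcoef_Suc abs_mult)
      also have "\<dots> = ((c + j) / j * ((1 + j) / j)) / ((a + j) / j * ((b + j) / j))"
        using that by simp
      also have "\<dots> = ((c / j + 1) * (1 / j + 1)) / ((a / j + 1) * (b / j + 1))"
        using that by (simp add: add_divide_distrib)
      finally show ?thesis .
    qed
    then have "eventually (\<lambda>j. ((c / j + 1) * (1 / j + 1)) / ((a / j + 1) * (b / j + 1)) =
        norm (hcoef a b c j) / norm (hcoef a b c (Suc j))) sequentially"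
      by (intro eventually_mono[OF eventually_gt_at_top[of 0]]) (simp only: ratio)
    moreover have "(\<lambda>j. ((c / real j + 1) * (1 / real j + 1)) / ((a / real j + 1) * (b / real j + 1)))
        \<longlonglongrightarrow> ((0 + 1) * (0 + 1)) / ((0 + 1) * (0 + 1))"
      by (intro tendsto_intros lim_const_over_n) auto
    ultimately show ?thesis
      by (simp add: tendsto_cong)
  qed
  then have "conv_radius (hcoef a b c) = 1"
    using hcoef_pos[OF assms(1-3)]
    by (intro conv_radius_ratio_limit) (auto simp: one_ereal_def less_imp_neq[symmetric])
  then show ?thesis
    using assms(4) by (intro summable_in_conv_radius) (auto simp: one_ereal_def)
qed

text \<open>The quotient \<open>Gamma (z + k) / Gamma z\<close> is the rising factorial; positive
  parameters keep away from the poles of Gamma. The term j = 0 is the leading 1 that the definition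
  writes separately.\<close>

lemma hypergeom_eq_suminf:
  assumes "a > 0" "b > 0" "c > 0" "\<bar>y\<bar> < 1"
  shows "hypergeom a b c y = (\<Sum>j. hcoef a b c j * y ^ j)"
proof -
  have nz: "a \<notin> \<int>\<^sub>\<le>\<^sub>0" "b \<notin> \<int>\<^sub>\<le>\<^sub>0" "c \<notin> \<int>\<^sub>\<le>\<^sub>0"
    using assms(1-3) by (auto simp: nonpos_Ints_def)
  have pos: "Gamma a > 0" "Gamma b > 0" "Gamma c > 0"
    using assms by (auto intro: Gamma_real_pos)
  have cf: "Gamma c / (Gamma a * Gamma b) * (Gamma (a + real k) * Gamma (b + real k) / Gamma (c + real k) *
      (y ^ k / fact k)) = hcoef a b c k * y ^ k" for k
    using pos Gamma_real_pos[of "c + real k"] assms(3)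
    unfolding hcoef_def pochhammer_Gamma[OF nz(1)] pochhammer_Gamma[OF nz(2)] pochhammer_Gamma[OF nz(3)]
    by (simp add: field_simps)
  have sm: "summable (\<lambda>j. hcoef a b c j * y ^ j)"
    by (rule summable_hcoef[OF assms])
  have "hypergeom a b c y = 1 + (\<Sum>j. hcoef a b c (Suc j) * y ^ Suc j)"
  proof -
    have sm2: "summable (\<lambda>j. (Gamma a * Gamma b / Gamma c) * (hcoef a b c (Suc j) * y ^ Suc j))"
      using sm by (intro summable_mult) (simp only: summable_Suc_iff[where f="\<lambda>j. hcoef a b c j * y ^ j"])
    have eq: "(Gamma a * Gamma b / Gamma c) * (hcoef a b c k * y ^ k) =
       Gamma (a + real k) * Gamma (b + real k) / Gamma (c + real k) * (y ^ k / fact k)" for k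
      unfolding cf[symmetric] using pos by (simp add: field_simps)
    from sm2 have "summable (\<lambda>j. Gamma (a + real (Suc j)) * Gamma (b + real (Suc j)) / Gamma (c + real (Suc j)) *
      (y ^ Suc j / fact (Suc j)))"
      unfolding eq .
    then show ?thesis
      unfolding hypergeom_def Let_def by (subst suminf_mult[symmetric]) (auto simp only: cf)
  qed
  also have "\<dots> = (\<Sum>j. hcoef a b c j * y ^ j)"
    using suminf_split_head[OF sm] by simp
  finally show ?thesis .
qed

text \<open>This is K(N,\<beta>) in the parameters a = (N+\<beta>)/4 - 1, b = (N-\<beta>)/4, for
  which a + 1/2 = (N+\<beta>)/4 - 1/2.\<close>

definition Gamma_ratio :: "real \<Rightarrow> real \<Rightarrow> real" where
  "Gamma_ratio a b = 2 * (Gamma (a + 1/2) * Gamma (b + 1/2)) / (Gamma a * Gamma b)"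

text \<open>Both coefficient sequences grow like n^(a + b - 3/2), so in the quotient all powers of n
  and all factorials cancel and only Gamma values remain. The factor 2 of \<open>Gamma_ratio\<close>
  is Gamma(1/2) / Gamma(3/2).\<close>

lemma hcoef_ratio_tendsto:
  assumes "a > 0" "b > 0"
  shows "(\<lambda>j. hcoef a b (1/2) j / hcoef (a + 1/2) (b + 1/2) (3/2) j) \<longlonglongrightarrow> Gamma_ratio a b"
proof -
  define S where "S z n = (Gamma_series z n :: real)" for z n
  have S: "S z \<longlonglongrightarrow> Gamma z" for z unfolding S_def by (rule Gamma_series_LIMSEQ)
  \<comment> \<open>Euler's limit for Gamma involves the rising factorial of length n + 1; hence the
    quotient is computed at \<open>Suc n\<close> and the index is shifted back at the end.\<close>
  have poch: "pochhammer z (Suc n) = fact n * real n powr z / S z n" if "z > 0" "n > 0" for z n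
    using that pochhammer_pos[of z "Suc n"]
    by (auto simp: S_def Gamma_series_def powr_def field_simps)
  have Spos: "S z n > 0" if "z > 0" "n > 0" for z n
    using that pochhammer_pos[of z "Suc n"] by (auto simp: S_def Gamma_series_def)
  have ratio: "hcoef a b (1/2) (Suc n) / hcoef (a + 1/2) (b + 1/2) (3/2) (Suc n) =
      S (a + 1/2) n * S (b + 1/2) n * S (1/2) n / (S a n * S b n * S (3/2) n)" if "n > 0" for n
  proof -
    have sp: "S a n > 0" "S b n > 0" "S (a+1/2) n > 0" "S (b+1/2) n > 0" "S (1/2) n > 0" "S (3/2) n > 0"
      using assms that by (auto intro: Spos)
    have 32: "(3/2::real) = 1/2 + (1/2 + 1/2)" by simp
    have n: "real n powr (a + 1/2) = real n powr a * real n powr (1/2)"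
      "real n powr (b + 1/2) = real n powr b * real n powr (1/2)"
      "real n powr (3/2) = real n powr (1/2) * (real n powr (1/2) * real n powr (1/2))"
      unfolding 32 by (simp_all only: powr_add)
    have nn: "real n powr a > 0" "real n powr b > 0" "real n powr (1/2) > 0"
      using that by auto
    have p: "pochhammer a (Suc n) = fact n * real n powr a / S a n"
      "pochhammer b (Suc n) = fact n * real n powr b / S b n"
      "pochhammer (1/2) (Suc n) = fact n * real n powr (1/2) / S (1/2) n"
      "pochhammer (a+1/2) (Suc n) = fact n * real n powr (a+1/2) / S (a+1/2) n"
      "pochhammer (b+1/2) (Suc n) = fact n * real n powr (b+1/2) / S (b+1/2) n"
      "pochhammer (3/2) (Suc n) = fact n * real n powr (3/2) / S (3/2) n"
      using assms that by (auto intro!: poch)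
    show ?thesis
      unfolding hcoef_def p n using sp nn that by (simp add: divide_simps)
  qed
  then have ev: "eventually (\<lambda>n. S (a + 1/2) n * S (b + 1/2) n * S (1/2) n / (S a n * S b n * S (3/2) n) =
     hcoef a b (1/2) (Suc n) / hcoef (a + 1/2) (b + 1/2) (3/2) (Suc n)) sequentially"
    by (intro eventually_mono[OF eventually_gt_at_top[of 0]]) (simp only: ratio)
  have "(\<lambda>n. S (a + 1/2) n * S (b + 1/2) n * S (1/2) n / (S a n * S b n * S (3/2) n)) \<longlonglongrightarrow>
      Gamma (a + 1/2) * Gamma (b + 1/2) * Gamma (1/2) / (Gamma a * Gamma b * Gamma (3/2))"
    using assms by (intro tendsto_intros S) (auto simp: less_imp_neq[OF Gamma_real_pos, symmetric])
  also have "Gamma (a + 1/2) * Gamma (b + 1/2) * Gamma (1/2) / (Gamma a * Gamma b * Gamma (3/2)) = Gamma_ratio a b"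
  proof -
    have "(1/2 :: real) \<notin> \<int>\<^sub>\<le>\<^sub>0" by (rule ccontr) (auto elim!: nonpos_Ints_cases)
    then have "Gamma (3/2) = 1/2 * Gamma (1/2 :: real)"
      using Gamma_plus1[of "1/2 :: real"] by simp
    then have g: "Gamma (1/2 :: real) = 2 * Gamma (3/2)" by simp
    have "Gamma (3/2 :: real) \<noteq> 0" "Gamma a \<noteq> 0" "Gamma b \<noteq> 0"
      using assms by (auto simp: less_imp_neq[OF Gamma_real_pos, symmetric])
    then show ?thesis unfolding g Gamma_ratio_def by simp
  qed
  finally have "(\<lambda>n. hcoef a b (1/2) (Suc n) / hcoef (a + 1/2) (b + 1/2) (3/2) (Suc n)) \<longlonglongrightarrow> Gamma_ratio a b"
    using ev by (simp add: tendsto_cong)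
  then show ?thesis
    by (subst (asm) filterlim_sequentially_Suc)
qed

section \<open>Power series solutions in the variable s\<close>

definition gcoef :: "real \<Rightarrow> real \<Rightarrow> real \<Rightarrow> nat \<Rightarrow> real" where
  "gcoef a b K n = (if even n then hcoef a b (1/2) (n div 2)
     else - K * hcoef (a + 1/2) (b + 1/2) (3/2) ((n - 1) div 2))"

text \<open>The substitution y = s^2 turns w(y) into G(s) for s >= 0: the factor sqrt y becomes s,
  and the two hypergeometric series interleave to a single power series, with value 1 and slope -K
  at 0. The parameter K is left free because the argument compares different values of it.\<close>

definition Gfun :: "real \<Rightarrow> real \<Rightarrow> real \<Rightarrow> real \<Rightarrow> real" where
  "Gfun a b K s = (\<Sum>n. gcoef a b K n * s ^ n)"

definition dGfun :: "real \<Rightarrow> real \<Rightarrow> real \<Rightarrow> real \<Rightarrow> real" where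
  "dGfun a b K s = (\<Sum>n. diffs (gcoef a b K) n * s ^ n)"

definition ddGfun :: "real \<Rightarrow> real \<Rightarrow> real \<Rightarrow> real \<Rightarrow> real" where
  "ddGfun a b K s = (\<Sum>n. diffs (diffs (gcoef a b K)) n * s ^ n)"

text \<open>The two hypergeometric recurrences in j become one recurrence in n = 2j and n = 2j + 1:
  the shift of the parameters by 1/2 in the odd series is exactly what makes them agree. Parities
  never mix, so K drops out.\<close>

lemma gcoef_recurrence:
  assumes "a > 0" "b > 0"
  shows "real (Suc (Suc n)) * real (Suc n) * gcoef a b K (Suc (Suc n)) =
    (real n + 2 * a) * (real n + 2 * b) * gcoef a b K n"
proof (cases "even n")
  case True
  then obtain j where j: "n = 2 * j" by blast
  have d: "Suc (Suc n) div 2 = Suc j" by (simp add: j)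
  have nz: "(1 / 2 + real j) * (1 + real j) \<noteq> 0" by (auto simp: add_nonneg_eq_0_iff)
  have "gcoef a b K (Suc (Suc n)) = hcoef a b (1/2) j * ((a + j) * (b + j) / ((1/2 + j) * (1 + j)))"
    using True unfolding gcoef_def d by (simp add: hcoef_Suc)
  moreover have "gcoef a b K n = hcoef a b (1/2) j" using True by (simp add: gcoef_def j)
  moreover have "real (Suc (Suc n)) * real (Suc n) = 4 * ((1/2 + j) * (1 + j))"
    by (simp add: j algebra_simps)
  moreover have "(real n + 2 * a) * (real n + 2 * b) = 4 * ((a + j) * (b + j))"
    by (simp add: j algebra_simps)
  ultimately show ?thesis
    using nz by (simp only:) (simp add: field_simps)
next
  case False
  then obtain j where j: "n = 2 * j + 1" by (blast elim: oddE)
  have d: "(Suc (Suc n) - 1) div 2 = Suc j" "(n - 1) div 2 = j" by (simp_all add: j)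
  have nz: "(3 / 2 + real j) * (1 + real j) \<noteq> 0" by (auto simp: add_nonneg_eq_0_iff)
  have "gcoef a b K (Suc (Suc n)) = - K * (hcoef (a+1/2) (b+1/2) (3/2) j *
      ((a + 1/2 + j) * (b + 1/2 + j) / ((3/2 + j) * (1 + j))))"
    using False unfolding gcoef_def d by (simp add: hcoef_Suc)
  moreover have "gcoef a b K n = - K * hcoef (a+1/2) (b+1/2) (3/2) j" using False unfolding gcoef_def d by simp
  moreover have "real (Suc (Suc n)) * real (Suc n) = 4 * ((3/2 + j) * (1 + j))"
    by (simp add: j algebra_simps)
  moreover have "(real n + 2 * a) * (real n + 2 * b) = 4 * ((a + 1/2 + j) * (b + 1/2 + j))"
    by (simp add: j algebra_simps)
  ultimately show ?thesis
    using nz by (simp only:) (simp add: field_simps)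
qed

lemma gcoef_sums:
  assumes "a > 0" "b > 0" "\<bar>s\<bar> < 1"
  shows "(\<lambda>n. gcoef a b K n * s ^ n) sums
    (hypergeom a b (1/2) (s\<^sup>2) - K * s * hypergeom (a+1/2) (b+1/2) (3/2) (s\<^sup>2))"
proof -
  have s2: "\<bar>s\<^sup>2\<bar> < 1" using assms(3) by (simp add: abs_square_less_1)
  have 1: "(\<lambda>j. hcoef a b (1/2) j * (s\<^sup>2) ^ j) sums hypergeom a b (1/2) (s\<^sup>2)"
    using assms s2 by (simp add: hypergeom_eq_suminf summable_hcoef summable_sums)
  have 2: "(\<lambda>j. hcoef (a+1/2) (b+1/2) (3/2) j * (s\<^sup>2) ^ j) sums hypergeom (a+1/2) (b+1/2) (3/2) (s\<^sup>2)"
    using assms s2 by (simp add: hypergeom_eq_suminf summable_hcoef summable_sums)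
  have "(\<lambda>n. if even n then hcoef a b (1/2) (n div 2) * (s\<^sup>2) ^ (n div 2)
      else - K * s * (hcoef (a+1/2) (b+1/2) (3/2) ((n - 1) div 2) * (s\<^sup>2) ^ ((n - 1) div 2))) sums
     (- K * s * hypergeom (a+1/2) (b+1/2) (3/2) (s\<^sup>2) + hypergeom a b (1/2) (s\<^sup>2))"
    by (rule sums_if[OF sums_mult[OF 2] 1])
  moreover have "(if even n then hcoef a b (1/2) (n div 2) * (s\<^sup>2) ^ (n div 2)
      else - K * s * (hcoef (a+1/2) (b+1/2) (3/2) ((n - 1) div 2) * (s\<^sup>2) ^ ((n - 1) div 2))) =
      gcoef a b K n * s ^ n" for n
    by (auto simp: gcoef_def power_mult[symmetric] elim!: evenE oddE)
  ultimately show ?thesis by (simp add: algebra_simps)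
qed

lemma Gfun_eq:
  assumes "a > 0" "b > 0" "\<bar>s\<bar> < 1"
  shows "Gfun a b K s = hypergeom a b (1/2) (s\<^sup>2) - K * s * hypergeom (a+1/2) (b+1/2) (3/2) (s\<^sup>2)"
  unfolding Gfun_def using gcoef_sums[OF assms] by (simp add: sums_iff)

context
  fixes a b :: real
  assumes ab: "a > 0" "b > 0"
begin

lemma summable_gcoef:
  fixes s :: real
  assumes "\<bar>s\<bar> < 1"
  shows "summable (\<lambda>n. gcoef a b K n * s ^ n)" "summable (\<lambda>n. diffs (gcoef a b K) n * s ^ n)"
    "summable (\<lambda>n. diffs (diffs (gcoef a b K)) n * s ^ n)"
proof -
  have 1: "summable (\<lambda>n. gcoef a b K n * s ^ n)" if "\<bar>s\<bar> < 1" for s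
    using gcoef_sums[OF ab that] by (rule sums_summable)
  have 2: "summable (\<lambda>n. diffs (gcoef a b K) n * s ^ n)" if "\<bar>s\<bar> < 1" for s
    by (rule termdiff_converges[where K=1]) (use that 1 in auto)
  have 3: "summable (\<lambda>n. diffs (diffs (gcoef a b K)) n * s ^ n)" if "\<bar>s\<bar> < 1" for s
    by (rule termdiff_converges[where K=1]) (use that 2 in auto)
  show "summable (\<lambda>n. gcoef a b K n * s ^ n)" "summable (\<lambda>n. diffs (gcoef a b K) n * s ^ n)"
    "summable (\<lambda>n. diffs (diffs (gcoef a b K)) n * s ^ n)"
    using 1 2 3 assms by auto
qed

lemma DERIV_Gfun:
  assumes "\<bar>s\<bar> < 1"
  shows "(Gfun a b K has_real_derivative dGfun a b K s) (at s)"
  unfolding Gfun_def[abs_def] dGfun_def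
  by (rule termdiffs_strong'[where K=1]) (use assms summable_gcoef in auto)

lemma DERIV_dGfun:
  assumes "\<bar>s\<bar> < 1"
  shows "(dGfun a b K has_real_derivative ddGfun a b K s) (at s)"
  unfolding dGfun_def[abs_def] ddGfun_def
  by (rule termdiffs_strong'[where K=1]) (use assms summable_gcoef in auto)

text \<open>Coefficientwise this is \<open>gcoef_recurrence\<close>, since (n + 2a)(n + 2b) = n(n-1)
  + (2(a+b)+1) n + 4ab.\<close>

lemma Gfun_ODE:
  assumes s: "\<bar>s\<bar> < 1"
  shows "(1 - s\<^sup>2) * ddGfun a b K s = (2 * (a + b) + 1) * s * dGfun a b K s + 4 * a * b * Gfun a b K s"
proof -
  let ?e = "gcoef a b K"
  have e0: "(\<lambda>n. ?e n * s ^ n) sums Gfun a b K s"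
    unfolding Gfun_def by (intro summable_sums summable_gcoef s)
  have e1: "(\<lambda>n. diffs ?e n * s ^ n) sums dGfun a b K s"
    unfolding dGfun_def by (intro summable_sums summable_gcoef s)
  have e2: "(\<lambda>n. diffs (diffs ?e) n * s ^ n) sums ddGfun a b K s"
    unfolding ddGfun_def by (intro summable_sums summable_gcoef s)
  have "(\<lambda>n. real (Suc n) * ?e (Suc n) * s ^ Suc n) sums (s * dGfun a b K s)"
    using sums_mult[OF e1, of s] by (simp add: diffs_def algebra_simps)
  then have f1: "(\<lambda>n. real n * ?e n * s ^ n) sums (s * dGfun a b K s)"
    by (subst (asm) sums_Suc_iff) simp
  \<comment> \<open>The series for s^2 G'' starts at n = 2; both index shifts can be undone because
    n (n - 1) vanishes at n = 0 and n = 1.\<close>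
  have "(\<lambda>n. real (Suc (Suc n)) * real (Suc n) * ?e (Suc (Suc n)) * s ^ Suc (Suc n)) sums (s\<^sup>2 * ddGfun a b K s)"
    using sums_mult[OF e2, of "s\<^sup>2"] by (simp add: diffs_def power2_eq_square algebra_simps)
  then have "(\<lambda>n. real (Suc n) * real n * ?e (Suc n) * s ^ Suc n) sums (s\<^sup>2 * ddGfun a b K s)"
    by (subst (asm) sums_Suc_iff[where f="\<lambda>n. real (Suc n) * real n * ?e (Suc n) * s ^ Suc n"]) simp
  then have f2: "(\<lambda>n. real n * (real n - 1) * ?e n * s ^ n) sums (s\<^sup>2 * ddGfun a b K s)"
    using sums_Suc_iff[where f="\<lambda>n. real n * (real n - 1) * ?e n * s ^ n"] by simp
  have "(\<lambda>n. real n * (real n - 1) * ?e n * s ^ n + (2 * (a + b) + 1) * (real n * ?e n * s ^ n) + 4 * a * b * (?e n * s ^ n))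
      sums (s\<^sup>2 * ddGfun a b K s + (2 * (a + b) + 1) * (s * dGfun a b K s) + 4 * a * b * Gfun a b K s)"
    by (intro sums_add sums_mult f1 f2 e0)
  moreover have "real n * (real n - 1) * ?e n * s ^ n + (2 * (a + b) + 1) * (real n * ?e n * s ^ n) + 4 * a * b * (?e n * s ^ n)
      = diffs (diffs ?e) n * s ^ n" for n
  proof -
    have "real n * (real n - 1) * ?e n * s ^ n + (2 * (a + b) + 1) * (real n * ?e n * s ^ n) + 4 * a * b * (?e n * s ^ n)
       = ((real n + 2 * a) * (real n + 2 * b) * ?e n) * s ^ n"
      by (simp add: algebra_simps)
    also have "\<dots> = diffs (diffs ?e) n * s ^ n"
      unfolding gcoef_recurrence[OF ab, symmetric] diffs_def by (simp only: of_nat_Suc mult_ac)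
    finally show ?thesis .
  qed
  ultimately have "(\<lambda>n. diffs (diffs ?e) n * s ^ n)
      sums (s\<^sup>2 * ddGfun a b K s + (2 * (a + b) + 1) * (s * dGfun a b K s) + 4 * a * b * Gfun a b K s)"
    by simp
  with e2 have "ddGfun a b K s = s\<^sup>2 * ddGfun a b K s + (2 * (a + b) + 1) * (s * dGfun a b K s) + 4 * a * b * Gfun a b K s"
    by (rule sums_unique2)
  then show ?thesis by (simp add: algebra_simps)
qed

end

section \<open>Behaviour of the solutions near s = 1\<close>

lemma Gamma_ratio_pos: "a > 0 \<Longrightarrow> b > 0 \<Longrightarrow> Gamma_ratio a b > 0"
  by (auto simp: Gamma_ratio_def intro!: divide_pos_pos mult_pos_pos Gamma_real_pos)

text \<open>The bound is the coefficient of the \<open>artanh\<close> series.\<close>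

lemma hcoef_lower_bound:
  assumes "a > 0" "b > 0" "a + b \<ge> 1/2"
  shows "hcoef (a + 1/2) (b + 1/2) (3/2) j \<ge> 1 / (2 * real j + 1)"
proof (induction j)
  case (Suc j)
  let ?x = "real j"
  have "(?x + 1/2) * (?x + 1) \<le> (a + 1/2 + ?x) * (b + 1/2 + ?x)"
  proof -
    have "0 \<le> (a + b - 1/2) * (?x + 1/2)" "0 \<le> a * b"
      using assms by auto
    moreover have "(a + 1/2 + ?x) * (b + 1/2 + ?x) - (?x + 1/2) * (?x + 1) = (a + b - 1/2) * (?x + 1/2) + a * b"
      by (simp add: field_simps)
    ultimately show ?thesis by linarith
  qed
  then have "(?x + 1/2) * (?x + 1) / ((3/2 + ?x) * (1 + ?x)) \<le> (a + 1/2 + ?x) * (b + 1/2 + ?x) / ((3/2 + ?x) * (1 + ?x))"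
    by (intro divide_right_mono) auto
  also have "(?x + 1/2) * (?x + 1) / ((3/2 + ?x) * (1 + ?x)) = (2 * ?x + 1) / (2 * ?x + 3)"
    by (simp add: divide_simps) (simp add: algebra_simps)
  finally have "1 / (2 * ?x + 1) * ((2 * ?x + 1) / (2 * ?x + 3)) \<le>
      hcoef (a + 1/2) (b + 1/2) (3/2) j * ((a + 1/2 + ?x) * (b + 1/2 + ?x) / ((3/2 + ?x) * (1 + ?x)))"
    using Suc hcoef_pos[of "a + 1/2" "b + 1/2" "3/2" j] assms by (intro mult_mono) auto
  moreover have "1 / (2 * ?x + 1) * ((2 * ?x + 1) / (2 * ?x + 3)) = 1 / (2 * real (Suc j) + 1)"
    by (simp add: divide_simps) 
  ultimately show ?case by (simp add: hcoef_Suc add.commute[of _ 3])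
qed simp

lemma not_summable_odd_harmonic: "\<not> summable (\<lambda>j. 1 / (2 * real j + 1))"
proof
  assume "summable (\<lambda>j. 1 / (2 * real j + 1))"
  then have "summable (\<lambda>j. 2 * (1 / (2 * real j + 1)))" by (rule summable_mult)
  then have "summable (\<lambda>n. inverse (of_nat (Suc n)) :: real)"
    by (rule summable_comparison_test_ev[rotated]) (auto simp: divide_simps)
  then show False
    using not_summable_harmonic[where 'a=real] by (simp only: summable_Suc_iff[where f="\<lambda>n. inverse (of_nat n) :: real"])
qed

text \<open>A partial sum at y = 1 exceeds any bound, hence also near 1 by continuity of
  polynomials, and the nonnegative tail can only increase it.\<close>

lemma powser_at_top_at_left_1:
  fixes f :: "nat \<Rightarrow> real"
  assumes nonneg: "\<And>j. f j \<ge> 0" and div: "\<not> summable f"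
    and sm: "\<And>y. \<bar>y\<bar> < 1 \<Longrightarrow> summable (\<lambda>j. f j * y ^ j)"
  shows "filterlim (\<lambda>y. \<Sum>j. f j * y ^ j) at_top (at_left 1)"
  unfolding filterlim_at_top_gt[where c=0]
proof (intro allI impI)
  fix Z :: real assume "Z > 0"
  have "\<exists>n. (\<Sum>j<n. f j) > Z"
  proof (rule ccontr)
    assume "\<not> ?thesis"
    then have "summable f"
      by (intro bounded_imp_summable[where B=Z] nonneg) (auto simp: not_less, metis lessThan_Suc_atMost)
    with div show False by simp
  qed
  then obtain n where n: "(\<Sum>j<n. f j) > Z" by blast
  have "((\<lambda>y. \<Sum>j<n. f j * y ^ j) \<longlongrightarrow> (\<Sum>j<n. f j * 1 ^ j)) (at_left 1)"
    by (intro tendsto_intros)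
  then have "eventually (\<lambda>y. (\<Sum>j<n. f j * y ^ j) > Z) (at_left 1)"
    using n by (intro order_tendstoD(1)[where y="\<Sum>j<n. f j * 1 ^ j"]) auto
  moreover have "eventually (\<lambda>y::real. y \<in> {0<..<1}) (at_left 1)"
    by (rule eventually_at_leftI[of 0]) auto
  ultimately show "eventually (\<lambda>y. Z \<le> (\<Sum>j. f j * y ^ j)) (at_left 1)"
  proof eventually_elim
    case (elim y)
    then have "(\<Sum>j<n. f j * y ^ j) \<le> (\<Sum>j. f j * y ^ j)"
      by (intro sum_le_suminf sm) (auto intro!: mult_nonneg_nonneg nonneg)
    with elim show ?case by simp
  qed
qed

text \<open>Only finitely many coefficients can be negative, and each of their terms is bounded by
  its coefficient on [0, 1).\<close>

lemma powser_bounded_below: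
  fixes f :: "nat \<Rightarrow> real"
  assumes ev: "eventually (\<lambda>j. f j \<ge> 0) sequentially"
    and sm: "\<And>y. \<bar>y\<bar> < 1 \<Longrightarrow> summable (\<lambda>j. f j * y ^ j)"
  obtains C where "\<And>y. 0 \<le> y \<Longrightarrow> y < 1 \<Longrightarrow> (\<Sum>j. f j * y ^ j) \<ge> - C"
proof -
  obtain n where n: "\<And>j. j \<ge> n \<Longrightarrow> f j \<ge> 0" using ev by (auto simp: eventually_sequentially)
  have "(\<Sum>j. f j * y ^ j) \<ge> - (\<Sum>j<n. \<bar>f j\<bar>)" if y: "0 \<le> y" "y < 1" for y
  proof -
    have "- (\<Sum>j<n. \<bar>f j\<bar>) \<le> (\<Sum>j<n. f j * y ^ j)"
      unfolding sum_negf[symmetric]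
    proof (rule sum_mono)
      fix j
      have "\<bar>f j * y ^ j\<bar> \<le> \<bar>f j\<bar> * 1"
        unfolding abs_mult using y by (intro mult_left_mono) (auto intro: power_le_one)
      then show "- \<bar>f j\<bar> \<le> f j * y ^ j" by linarith
    qed
    also have "\<dots> \<le> (\<Sum>j. f j * y ^ j)"
      using y by (intro sum_le_suminf sm) (auto intro!: mult_nonneg_nonneg n simp: not_less)
    finally show ?thesis .
  qed
  then show ?thesis by (rule that)
qed

text \<open>The quantity \<open>(1 - s\<^sup>2) powr (d / 2) * g'\<close> increases as long as \<open>g > 0\<close>.\<close>

lemma ODE_derivative_pos:
  fixes g g' g'' :: "real \<Rightarrow> real"
  assumes g: "\<And>s. s \<in> {0<..<1} \<Longrightarrow> (g has_real_derivative g' s) (at s)"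
    and g': "\<And>s. s \<in> {0<..<1} \<Longrightarrow> (g' has_real_derivative g'' s) (at s)"
    and ode: "\<And>s. s \<in> {0<..<1} \<Longrightarrow> (1 - s\<^sup>2) * g'' s = d * s * g' s + \<mu> * g s"
    and mu: "\<mu> \<ge> 0" and s0: "s0 \<in> {0<..<1}" "g s0 > 0" "g' s0 > 0" and s: "s0 \<le> s" "s < 1"
  shows "g' s > 0 \<and> g s > 0"
proof -
  define P where "P s = (1 - s\<^sup>2) powr (d / 2) * g' s" for s
  have s2: "1 - s\<^sup>2 > 0" if "s \<in> {0<..<1}" for s :: real
    using that by (simp add: power_less_one_iff abs_square_less_1)
  have P: "(P has_real_derivative (1 - s\<^sup>2) powr (d / 2 - 1) * (\<mu> * g s)) (at s)" if "s \<in> {0<..<1}" for s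
  proof -
    have e: "(1 - s\<^sup>2) powr (d / 2) = (1 - s\<^sup>2) powr (d / 2 - 1) * (1 - s\<^sup>2)"
      using s2[OF that] by (simp add: powr_diff)
    have "(P has_real_derivative (d / 2) * (1 - s\<^sup>2) powr (d / 2 - 1) * (- (2 * s)) * g' s + (1 - s\<^sup>2) powr (d / 2) * g'' s) (at s)"
      unfolding P_def[abs_def] using s2[OF that]
      by (auto intro!: derivative_eq_intros g'[OF that] simp: powr_diff)
    also have "(d / 2) * (1 - s\<^sup>2) powr (d / 2 - 1) * (- (2 * s)) * g' s + (1 - s\<^sup>2) powr (d / 2) * g'' s
       = (1 - s\<^sup>2) powr (d / 2 - 1) * ((1 - s\<^sup>2) * g'' s - d * s * g' s)"
      unfolding e by (simp add: algebra_simps)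
    finally show ?thesis using ode[OF that] by simp
  qed
  have main: "g' t > 0" if t: "s0 \<le> t" "t < 1" for t
  proof (rule ccontr)
    assume neg: "\<not> g' t > 0"
    \<comment> \<open>Argument by the first point x where g' fails to be positive: up to x the
      function g increases and stays positive, so P does not decrease there, yet P is positive at
      \<open>s0\<close> and nonpositive at x.\<close>
    define A where "A = {x \<in> {s0..t}. g' x \<le> 0}"
    have in01: "x \<in> {0<..<1}" if "x \<in> {s0..t}" for x using that s0 t by auto
    have "continuous_on {s0..t} g'"
      using g' in01 by (meson DERIV_isCont continuous_at_imp_continuous_on)
    then have "closed ({s0..t} \<inter> g' -` {..0})" by (rule continuous_closed_preimage) auto
    moreover have "{s0..t} \<inter> g' -` {..0} = A" by (auto simp: A_def)
    ultimately have "closed A" by simp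
    moreover have "t \<in> A" using neg t by (auto simp: A_def)
    moreover have "bdd_below A" by (auto simp: A_def intro: bdd_belowI[of _ s0])
    ultimately have I: "Inf A \<in> A" by (intro closed_contains_Inf) auto
    define x where "x = Inf A"
    have x: "x \<in> {s0..t}" "g' x \<le> 0" using I by (auto simp: A_def x_def)
    have lt: "g' y > 0" if "s0 \<le> y" "y < x" for y
    proof (rule ccontr)
      assume "\<not> g' y > 0"
      then have "y \<in> A" using that x by (auto simp: A_def)
      then have "x \<le> y" unfolding x_def using \<open>bdd_below A\<close> by (rule cInf_lower)
      with that show False by simp
    qed
    have xs: "s0 < x" using x s0 by (cases "x = s0") auto
    have gp: "g y > 0" if "s0 \<le> y" "y \<le> x" for y
    proof -
      have "g s0 < g y" if "s0 < y"
      proof (rule DERIV_pos_imp_increasing_open[OF that])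
        show "continuous_on {s0..y} g"
          by (intro continuous_at_imp_continuous_on ballI DERIV_isCont[OF g] in01) (use \<open>s0 \<le> y\<close> \<open>y \<le> x\<close> x in auto)
        show "\<exists>z. (g has_real_derivative z) (at u) \<and> 0 < z" if "s0 < u" "u < y" for u
          using g[OF in01, of u] lt[of u] that \<open>y \<le> x\<close> x by force
      qed
      with s0 \<open>s0 \<le> y\<close> show ?thesis by (cases "y = s0") auto
    qed
    have "P s0 \<le> P x"
    proof (rule DERIV_nonneg_imp_nondecreasing[where f=P])
      show "\<exists>z. (P has_real_derivative z) (at u) \<and> 0 \<le> z" if "s0 \<le> u" "u \<le> x" for u
        by (rule exI, rule conjI, rule P) (use that x s0 t gp[of u] mu in \<open>auto intro!: mult_nonneg_nonneg\<close>)
    qed (use xs in auto)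
    moreover have "P s0 > 0" unfolding P_def using s0 s2[of s0] by auto
    moreover have "P x \<le> 0" unfolding P_def using x s2[of x] by (auto intro: mult_nonneg_nonpos)
    ultimately show False by simp
  qed
  have "g s0 \<le> g s"
  proof (rule DERIV_nonneg_imp_nondecreasing[OF s(1), where f=g])
    show "\<exists>z. (g has_real_derivative z) (at u) \<and> 0 \<le> z" if "s0 \<le> u" "u \<le> s" for u
      by (rule exI, rule conjI, rule g) (use that s s0 main[of u] in auto)
  qed
  with main[OF s] s0 show ?thesis by simp
qed

context
  fixes a b :: real
  assumes ab: "a > 0" "b > 0" "a + b \<ge> 1/2"
begin

text \<open>G is affine in K: \<open>Gfun a b 0\<close> is the even solution and
  \<open>Gfun a b 0 s - Gfun a b 1 s\<close> is the odd one. This yields continuity in K at fixed s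
  and reduces positivity of G to the quotient of the two.\<close>

lemma Gfun_split: "\<bar>s\<bar> < 1 \<Longrightarrow> Gfun a b K s = Gfun a b 0 s - K * (Gfun a b 0 s - Gfun a b 1 s)"
  using ab by (simp add: Gfun_eq)

lemma dGfun_split:
  assumes "\<bar>s\<bar> < 1" shows "dGfun a b K s = dGfun a b 0 s - K * (dGfun a b 0 s - dGfun a b 1 s)"
proof -
  have "((\<lambda>s. Gfun a b 0 s - K * (Gfun a b 0 s - Gfun a b 1 s)) has_real_derivative
     dGfun a b 0 s - K * (dGfun a b 0 s - dGfun a b 1 s)) (at s)"
    by (auto intro!: derivative_eq_intros DERIV_Gfun ab assms)
  then have "(Gfun a b K has_real_derivative dGfun a b 0 s - K * (dGfun a b 0 s - dGfun a b 1 s)) (at s)"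
  proof (rule has_field_derivative_transform_within_open[where S="{-1<..<1}"])
    show "Gfun a b 0 x - K * (Gfun a b 0 x - Gfun a b 1 x) = Gfun a b K x" if "x \<in> {-1<..<1}" for x
      using that Gfun_split[of x K] by auto
  qed (use assms in auto)
  then show ?thesis using DERIV_Gfun[OF ab(1,2) assms] by (rule DERIV_unique[rotated])
qed

text \<open>The coefficients dominate 1 / (2j + 1) by \<open>hcoef_lower_bound\<close>, so the
  series diverges at 1. This is where a + b >= 1/2 enters.\<close>

lemma odd_solution_at_top:
  "filterlim (\<lambda>y. hypergeom (a + 1/2) (b + 1/2) (3/2) y) at_top (at_left 1)"
proof -
  have "filterlim (\<lambda>y. \<Sum>j. hcoef (a + 1/2) (b + 1/2) (3/2) j * y ^ j) at_top (at_left 1)"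
  proof (rule powser_at_top_at_left_1)
    show "hcoef (a + 1/2) (b + 1/2) (3/2) j \<ge> 0" for j
      using ab by (intro less_imp_le hcoef_pos) auto
    show "\<not> summable (hcoef (a + 1/2) (b + 1/2) (3/2))"
    proof
      assume "summable (hcoef (a + 1/2) (b + 1/2) (3/2))"
      then have "summable (\<lambda>j. 1 / (2 * real j + 1))"
        by (rule summable_comparison_test_ev[rotated]) (use hcoef_lower_bound[OF ab] in auto)
      with not_summable_odd_harmonic show False ..
    qed
  qed (use ab in \<open>auto intro!: summable_hcoef\<close>)
  moreover have "eventually (\<lambda>y::real. y \<in> {0<..<1}) (at_left 1)"
    by (rule eventually_at_leftI[of 0]) auto
  then have "eventually (\<lambda>y. (\<Sum>j. hcoef (a + 1/2) (b + 1/2) (3/2) j * y ^ j) = hypergeom (a + 1/2) (b + 1/2) (3/2) y) (at_left 1)"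
    by eventually_elim (use ab in \<open>auto intro!: hypergeom_eq_suminf[symmetric]\<close>)
  ultimately show ?thesis by (simp add: filterlim_cong)
qed

lemma filterlim_square_at_left_1: "filterlim (\<lambda>s::real. s\<^sup>2) (at_left 1) (at_left 1)"
proof -
  have "((\<lambda>s::real. s\<^sup>2) \<longlongrightarrow> 1\<^sup>2) (at_left 1)" by (intro tendsto_intros)
  moreover have "eventually (\<lambda>s::real. s \<in> {0<..<1}) (at_left 1)"
    by (rule eventually_at_leftI[of 0]) auto
  then have "eventually (\<lambda>s::real. s\<^sup>2 \<in> {..<1} \<and> s\<^sup>2 \<noteq> 1) (at_left 1)"
    by eventually_elim (auto simp: abs_square_less_1 abs_square_eq_1)
  ultimately show ?thesis by (auto simp: filterlim_at)
qed

text \<open>The sign \<epsilon> serves both directions: with 1 it bounds the even series below by L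
  times the odd one (L under the limit quotient), with -1 it bounds it above (L over the limit
  quotient).\<close>

lemma hypergeom_diff_bounded_below:
  assumes "eventually (\<lambda>j. \<epsilon> * (hcoef a b (1/2) j - L * hcoef (a + 1/2) (b + 1/2) (3/2) j) \<ge> 0) sequentially"
  obtains C where "\<And>y. 0 \<le> y \<Longrightarrow> y < 1 \<Longrightarrow>
    \<epsilon> * (hypergeom a b (1/2) y - L * hypergeom (a + 1/2) (b + 1/2) (3/2) y) \<ge> - C"
proof -
  let ?f = "\<lambda>j. \<epsilon> * (hcoef a b (1/2) j - L * hcoef (a + 1/2) (b + 1/2) (3/2) j)"
  have s: "(\<lambda>j. ?f j * y ^ j) sums (\<epsilon> * (hypergeom a b (1/2) y - L * hypergeom (a + 1/2) (b + 1/2) (3/2) y))"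
    if "\<bar>y\<bar> < 1" for y
  proof -
    have 1: "(\<lambda>j. hcoef a b (1/2) j * y ^ j) sums hypergeom a b (1/2) y"
      using ab that by (simp add: hypergeom_eq_suminf summable_hcoef summable_sums)
    have 2: "(\<lambda>j. hcoef (a+1/2) (b+1/2) (3/2) j * y ^ j) sums hypergeom (a+1/2) (b+1/2) (3/2) y"
      using ab that by (simp add: hypergeom_eq_suminf summable_hcoef summable_sums)
    show ?thesis
      using sums_mult[OF sums_diff[OF 1 sums_mult[OF 2, of L]], of \<epsilon>] by (simp add: algebra_simps)
  qed
  show ?thesis
  proof (rule powser_bounded_below[OF assms])
    show "summable (\<lambda>j. ?f j * y ^ j)" if "\<bar>y\<bar> < 1" for y using s[OF that] by (rule sums_summable)
    fix C assume C: "\<And>y. 0 \<le> y \<Longrightarrow> y < 1 \<Longrightarrow> (\<Sum>j. ?f j * y ^ j) \<ge> - C"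
    show thesis
    proof (rule that)
      fix y :: real assume y: "0 \<le> y" "y < 1"
      then have "(\<Sum>j. ?f j * y ^ j) = \<epsilon> * (hypergeom a b (1/2) y - L * hypergeom (a + 1/2) (b + 1/2) (3/2) y)"
        using s[of y] by (simp add: sums_iff)
      with C[OF y] show "\<epsilon> * (hypergeom a b (1/2) y - L * hypergeom (a + 1/2) (b + 1/2) (3/2) y) \<ge> - C" by simp
    qed
  qed
qed

lemma Gfun_at_top:
  assumes K: "0 \<le> K" "K < Gamma_ratio a b"
  shows "filterlim (Gfun a b K) at_top (at_left 1)"
proof -
  let ?A = "hcoef a b (1/2)" and ?B = "hcoef (a + 1/2) (b + 1/2) (3/2)"
  let ?F2 = "hypergeom (a + 1/2) (b + 1/2) (3/2)"
  \<comment> \<open>An intermediate value leaves the positive margin L - K in front of the divergent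
    odd series.\<close>
  obtain L where L: "K < L" "L < Gamma_ratio a b" using dense K by blast
  have "eventually (\<lambda>j. ?A j / ?B j > L) sequentially"
    using hcoef_ratio_tendsto[OF ab(1,2)] L by (intro order_tendstoD(1)) auto
  then have "eventually (\<lambda>j. 1 * (?A j - L * ?B j) \<ge> 0) sequentially"
  proof eventually_elim
    case (elim j)
    have "?B j > 0" using ab by (intro hcoef_pos) auto
    with elim show ?case by (simp add: field_simps)
  qed
  then obtain C where C: "\<And>y. 0 \<le> y \<Longrightarrow> y < 1 \<Longrightarrow>
      1 * (hypergeom a b (1/2) y - L * ?F2 y) \<ge> - C"
    by (rule hypergeom_diff_bounded_below) blast
  have "filterlim (\<lambda>s. - C + (L - K) * ?F2 (s\<^sup>2)) at_top (at_left 1)"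
    using L by (intro filterlim_tendsto_add_at_top[OF tendsto_const]
      filterlim_tendsto_pos_mult_at_top[OF tendsto_const] filterlim_compose[OF odd_solution_at_top filterlim_square_at_left_1]) auto
  moreover have "eventually (\<lambda>s. - C + (L - K) * ?F2 (s\<^sup>2) \<le> Gfun a b K s) (at_left 1)"
  proof -
  have "eventually (\<lambda>s::real. s \<in> {0<..<1}) (at_left 1)"
    by (rule eventually_at_leftI[of 0]) auto
  moreover have "eventually (\<lambda>s. ?F2 (s\<^sup>2) \<ge> 0) (at_left 1)"
    using filterlim_compose[OF odd_solution_at_top filterlim_square_at_left_1] by (simp add: filterlim_at_top)
  ultimately show ?thesis
  proof eventually_elim
    case (elim s)
    then have "s\<^sup>2 < 1" by (auto simp: abs_square_less_1)
    then have "- C \<le> hypergeom a b (1/2) (s\<^sup>2) - L * ?F2 (s\<^sup>2)" using C[of "s\<^sup>2"] by simp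
    moreover have "K * s * ?F2 (s\<^sup>2) \<le> K * ?F2 (s\<^sup>2)"
      using elim K by (intro mult_right_mono) (auto intro: mult_left_le)
    ultimately show ?case using elim ab by (simp add: Gfun_eq algebra_simps)
  qed
  qed
  ultimately show ?thesis using filterlim_at_top_mono by blast
qed

lemma Gfun_neg_near_1:
  assumes K: "Gamma_ratio a b < K"
  shows "eventually (\<lambda>s. Gfun a b K s < 0) (at_left 1)"
proof -
  let ?A = "hcoef a b (1/2)" and ?B = "hcoef (a + 1/2) (b + 1/2) (3/2)"
  let ?F2 = "hypergeom (a + 1/2) (b + 1/2) (3/2)"
  have K0: "K > 0" using Gamma_ratio_pos[OF ab(1,2)] K by simp
  obtain L where L: "Gamma_ratio a b < L" "L < K" using dense K by blast
  \<comment> \<open>The odd solution carries the factor s < 1, so K s only exceeds values below K;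
    the second intermediate value absorbs this loss and still leaves the margin L' - L.\<close>
  obtain L' where L': "L < L'" "L' < K" using dense L by blast
  have "eventually (\<lambda>j. ?A j / ?B j < L) sequentially"
    using hcoef_ratio_tendsto[OF ab(1,2)] L by (intro order_tendstoD(2)) auto
  then have "eventually (\<lambda>j. -1 * (?A j - L * ?B j) \<ge> 0) sequentially"
  proof eventually_elim
    case (elim j)
    have "?B j > 0" using ab by (intro hcoef_pos) auto
    with elim show ?case by (simp add: field_simps)
  qed
  then obtain C where C: "\<And>y. 0 \<le> y \<Longrightarrow> y < 1 \<Longrightarrow>
      -1 * (hypergeom a b (1/2) y - L * ?F2 y) \<ge> - C"
    by (rule hypergeom_diff_bounded_below) blast
  have F2: "filterlim (\<lambda>s. ?F2 (s\<^sup>2)) at_top (at_left 1)"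
    by (rule filterlim_compose[OF odd_solution_at_top filterlim_square_at_left_1])
  have "((\<lambda>s. K * s) \<longlongrightarrow> K * 1) (at_left 1)" by (intro tendsto_intros)
  then have "eventually (\<lambda>s. K * s > L') (at_left 1)"
    using L' by (intro order_tendstoD(1)) auto
  moreover have "eventually (\<lambda>s::real. s \<in> {0<..<1}) (at_left 1)"
    by (rule eventually_at_leftI[of 0]) auto
  moreover have "eventually (\<lambda>s. ?F2 (s\<^sup>2) > max 0 (C / (L' - L))) (at_left 1)"
    using F2 by (simp only: filterlim_at_top_dense)
  ultimately show ?thesis
  proof eventually_elim
    case (elim s)
    then have "s\<^sup>2 < 1" by (auto simp: abs_square_less_1)
    then have "hypergeom a b (1/2) (s\<^sup>2) \<le> C + L * ?F2 (s\<^sup>2)" using C[of "s\<^sup>2"] by simp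
    moreover have "L' * ?F2 (s\<^sup>2) \<le> K * s * ?F2 (s\<^sup>2)"
      using elim by (intro mult_right_mono) auto
    moreover have "C < (L' - L) * ?F2 (s\<^sup>2)" using elim L' by (simp add: field_simps)
    ultimately have "hypergeom a b (1/2) (s\<^sup>2) < K * s * ?F2 (s\<^sup>2)" by (simp add: left_diff_distrib)
    then show ?case using elim ab by (simp add: Gfun_eq)
  qed
qed

end

section \<open>Positivity, monotonicity and the Riccati subsolution\<close>

context
  fixes a b :: real
  assumes ab: "a > 0" "b > 0" "a + b \<ge> 1/2"
begin

lemma Gfun_0: "Gfun a b K 0 = 1" and dGfun_0: "dGfun a b K 0 = - K"
  by (simp_all add: Gfun_def dGfun_def diffs_def gcoef_def)

lemma hypergeom_pos:
  assumes "p > 0" "q > 0" "c > 0" "0 \<le> y" "y < 1"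
  shows "hypergeom p q c y > 0"
proof -
  have "0 < hcoef p q c 0 * y ^ 0" by simp
  also have "\<dots> = (\<Sum>j<1. hcoef p q c j * y ^ j)" by simp
  also have "\<dots> \<le> (\<Sum>j. hcoef p q c j * y ^ j)"
    using assms by (intro sum_le_suminf summable_hcoef) (auto intro!: mult_nonneg_nonneg less_imp_le[OF hcoef_pos])
  also have "\<dots> = hypergeom p q c y" using assms by (intro hypergeom_eq_suminf[symmetric]) auto
  finally show ?thesis .
qed

lemma Gfun_odd_pos: "0 < s \<Longrightarrow> s < 1 \<Longrightarrow> Gfun a b 0 s - Gfun a b 1 s > 0"
  using ab by (simp add: Gfun_eq hypergeom_pos abs_square_less_1)

text \<open>Abel's formula: the Wronskian W of the solutions with K = 0 and K = 1, multiplied by (1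
  - s^2)^(a + b + 1/2), is constant, and at s = 0 it equals -1. The expression in the statement is W
  itself.\<close>

lemma Wronskian_neg:
  assumes s: "\<bar>s\<bar> < 1"
  shows "dGfun a b 0 s * (Gfun a b 0 s - Gfun a b 1 s) - Gfun a b 0 s * (dGfun a b 0 s - dGfun a b 1 s) < 0"
proof -
  let ?d = "2 * (a + b) + 1"
  define W where "W s = Gfun a b 0 s * dGfun a b 1 s - dGfun a b 0 s * Gfun a b 1 s" for s
  define P where "P s = (1 - s\<^sup>2) powr (?d / 2) * W s" for s
  have P: "(P has_real_derivative 0) (at s)" if "\<bar>s\<bar> < 1" for s
  proof -
    have s2: "1 - s\<^sup>2 > 0" using that by (simp add: abs_square_less_1)
    have pm1: "x powr k = x powr (k - 1) * x" if "x > 0" for x k :: real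
      using that by (simp add: powr_diff)
    have e: "(1 - s\<^sup>2) powr (?d / 2) = (1 - s\<^sup>2) powr (?d / 2 - 1) * (1 - s\<^sup>2)"
      by (rule pm1[OF s2])
    have W: "(W has_real_derivative Gfun a b 0 s * ddGfun a b 1 s - ddGfun a b 0 s * Gfun a b 1 s) (at s)"
      unfolding W_def[abs_def]
      by (auto intro!: derivative_eq_intros DERIV_Gfun DERIV_dGfun ab that)
    have "(P has_real_derivative (?d / 2) * (1 - s\<^sup>2) powr (?d / 2 - 1) * (- (2 * s)) * W s +
        (1 - s\<^sup>2) powr (?d / 2) * (Gfun a b 0 s * ddGfun a b 1 s - ddGfun a b 0 s * Gfun a b 1 s)) (at s)"
      unfolding P_def[abs_def] using s2
      by (auto intro!: derivative_eq_intros W simp: powr_diff)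
    also have "(?d / 2) * (1 - s\<^sup>2) powr (?d / 2 - 1) * (- (2 * s)) * W s +
        (1 - s\<^sup>2) powr (?d / 2) * (Gfun a b 0 s * ddGfun a b 1 s - ddGfun a b 0 s * Gfun a b 1 s)
      = (1 - s\<^sup>2) powr (?d / 2 - 1) * (Gfun a b 0 s * ((1 - s\<^sup>2) * ddGfun a b 1 s) - ((1 - s\<^sup>2) * ddGfun a b 0 s) * Gfun a b 1 s
        - ?d * s * W s)"
    proof -
      have gen: "(d / 2) * Y * (- (2 * s)) * w + (Y * u) * (g * x - y * h) = Y * (g * (u * x) - (u * y) * h - d * s * w)"
        for d Y w u g x y h :: real by (simp add: algebra_simps)
      show ?thesis unfolding e by (rule gen)
    qed
    also have "\<dots> = 0"
      unfolding Gfun_ODE[OF ab(1,2) that] W_def by (simp add: algebra_simps)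
    finally show ?thesis .
  qed
  have "\<exists>c. \<forall>x\<in>{-1<..<1}. P x = c"
    by (rule has_field_derivative_zero_constant) (auto intro!: has_field_derivative_at_within P)
  then obtain c where c: "\<And>x. x \<in> {-1<..<1} \<Longrightarrow> P x = c" by blast
  have "s \<in> {-1<..<1}" using s by auto
  then have "P s = P 0" using c[of s] c[of 0] by simp
  also have "P 0 = -1" by (simp add: P_def W_def Gfun_0 dGfun_0)
  finally have "(1 - s\<^sup>2) powr (?d / 2) * W s < 0" by (simp add: P_def)
  moreover have "(1 - s\<^sup>2) powr (?d / 2) \<ge> 0" by simp
  ultimately have "W s < 0" by (simp add: mult_less_0_iff)
  then show ?thesis by (simp add: W_def algebra_simps)
qed

text \<open>The derivative of even over odd solution is their Wronskian over the square of the odd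
  one.\<close>

lemma solution_ratio_decreasing:
  assumes "0 < s" "s < t" "t < 1"
  shows "Gfun a b 0 t / (Gfun a b 0 t - Gfun a b 1 t) < Gfun a b 0 s / (Gfun a b 0 s - Gfun a b 1 s)"
proof (rule DERIV_neg_imp_decreasing[OF assms(2)])
  fix x assume x: "s \<le> x" "x \<le> t"
  then have x1: "\<bar>x\<bar> < 1" and pos: "Gfun a b 0 x - Gfun a b 1 x > 0"
    using assms Gfun_odd_pos[of x] by auto
  let ?D = "(dGfun a b 0 x * (Gfun a b 0 x - Gfun a b 1 x) - Gfun a b 0 x * (dGfun a b 0 x - dGfun a b 1 x)) /
      ((Gfun a b 0 x - Gfun a b 1 x) * (Gfun a b 0 x - Gfun a b 1 x))"
  have "((\<lambda>x. Gfun a b 0 x / (Gfun a b 0 x - Gfun a b 1 x)) has_real_derivative ?D) (at x)"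
    by (rule DERIV_divide) (use pos in \<open>auto intro!: derivative_intros DERIV_Gfun ab x1\<close>)
  moreover have "?D < 0"
    using Wronskian_neg[OF x1] pos by (intro divide_neg_pos) auto
  ultimately show "\<exists>y. ((\<lambda>x. Gfun a b 0 x / (Gfun a b 0 x - Gfun a b 1 x)) has_real_derivative y) (at x) \<and> y < 0"
    by blast
qed

text \<open>G > 0 at s > 0 means that K lies below the quotient R of even and odd solution. R
  decreases, and near 1 it exceeds every value below \<open>Gamma_ratio a b\<close> because the
  corresponding solution tends to infinity; hence R stays at or above this constant.\<close>

lemma Gfun_pos:
  assumes s: "0 \<le> s" "s < 1" and K: "K \<le> Gamma_ratio a b"
  shows "Gfun a b K s > 0"
proof (cases "s = 0")
  case False
  \<comment> \<open>A point strictly between s and 1 turns the weak bound R t >=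
    \<open>Gamma_ratio a b\<close> into a strict one at s, so the endpoint K =
    \<open>Gamma_ratio a b\<close> is covered.\<close>
  define t where "t = (1 + s) / 2"
  let ?R = "\<lambda>s. Gfun a b 0 s / (Gfun a b 0 s - Gfun a b 1 s)"
  have t: "s < t" "t < 1" using s by (auto simp: t_def)
  have "?R t \<ge> Gamma_ratio a b"
  proof (rule field_le_epsilon)
    fix e :: real assume e: "e > 0"
    \<comment> \<open>The maximum with 0 keeps L in the range 0 <= L required by
      \<open>Gfun_at_top\<close>.\<close>
    define L where "L = max 0 (Gamma_ratio a b - e)"
    have L: "0 \<le> L" "L < Gamma_ratio a b" using e Gamma_ratio_pos[OF ab(1,2)] by (auto simp: L_def)
    have "eventually (\<lambda>x. Gfun a b L x > 0) (at_left 1)"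
      using Gfun_at_top[OF ab L] by (simp only: filterlim_at_top_dense)
    moreover have "eventually (\<lambda>x. x \<in> {t<..<1}) (at_left 1)"
      using t by (intro eventually_at_leftI[of t]) auto
    ultimately have "eventually (\<lambda>x. Gfun a b L x > 0 \<and> x \<in> {t<..<1}) (at_left 1)" by eventually_elim auto
    then obtain x where x: "Gfun a b L x > 0" "t < x" "x < 1"
      using eventually_happens'[OF trivial_limit_at_left_real] by fastforce
    have "Gfun a b L x = Gfun a b 0 x - L * (Gfun a b 0 x - Gfun a b 1 x)"
      using x t s by (intro Gfun_split ab) auto
    with x have "L < ?R x" using Gfun_odd_pos[of x] t s by (simp add: field_simps)
    also have "?R x < ?R t" using x t s by (intro solution_ratio_decreasing) auto
    finally show "Gamma_ratio a b \<le> ?R t + e" by (auto simp: L_def)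
  qed
  moreover have "?R t < ?R s" using t s False by (intro solution_ratio_decreasing) auto
  ultimately have "K < ?R s" using K by simp
  then have "K * (Gfun a b 0 s - Gfun a b 1 s) < Gfun a b 0 s"
    using Gfun_odd_pos[of s] s False by (simp add: pos_less_divide_eq)
  then show ?thesis using Gfun_split[OF ab, of s K] s by auto
qed (simp add: Gfun_0)

text \<open>If the slope were positive at s, then by continuity both G and G' would be positive at s
  for some slightly larger K. By \<open>ODE_derivative_pos\<close> they would stay positive up to 1,
  contradicting \<open>Gfun_neg_near_1\<close>.\<close>

lemma dGfun_nonpos:
  assumes s: "0 \<le> s" "s < 1"
  shows "dGfun a b (Gamma_ratio a b) s \<le> 0"
proof (cases "s = 0")
  case True
  then show ?thesis using Gamma_ratio_pos[OF ab(1,2)] by (simp add: dGfun_0)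
next
  case False
  let ?K = "Gamma_ratio a b"
  have s1: "\<bar>s\<bar> < 1" "0 < s" using s False by auto
  show ?thesis
  proof (rule ccontr)
    assume "\<not> ?thesis"
    then have pos: "dGfun a b ?K s > 0" by simp
    have "((\<lambda>K. Gfun a b 0 s - K * (Gfun a b 0 s - Gfun a b 1 s)) \<longlongrightarrow> Gfun a b 0 s - ?K * (Gfun a b 0 s - Gfun a b 1 s)) (at_right ?K)"
      by (intro tendsto_intros)
    then have "((\<lambda>K. Gfun a b K s) \<longlongrightarrow> Gfun a b ?K s) (at_right ?K)"
      by (simp only: flip: Gfun_split[OF ab s1(1)])
    then have 1: "eventually (\<lambda>K. Gfun a b K s > 0) (at_right ?K)"
      using Gfun_pos[OF s, of ?K] by (intro order_tendstoD(1)) auto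
    have "((\<lambda>K. dGfun a b 0 s - K * (dGfun a b 0 s - dGfun a b 1 s)) \<longlongrightarrow> dGfun a b 0 s - ?K * (dGfun a b 0 s - dGfun a b 1 s)) (at_right ?K)"
      by (intro tendsto_intros)
    then have "((\<lambda>K. dGfun a b K s) \<longlongrightarrow> dGfun a b ?K s) (at_right ?K)"
      by (simp only: flip: dGfun_split[OF ab s1(1)])
    then have 2: "eventually (\<lambda>K. dGfun a b K s > 0) (at_right ?K)"
      using pos by (intro order_tendstoD(1)) auto
    have 3: "eventually (\<lambda>K. K > ?K) (at_right ?K)" by (simp add: eventually_at_right_less)
    from 1 2 3 have "eventually (\<lambda>K. Gfun a b K s > 0 \<and> dGfun a b K s > 0 \<and> K > ?K) (at_right ?K)"
      by eventually_elim auto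
    then obtain K where K: "Gfun a b K s > 0" "dGfun a b K s > 0" "K > ?K"
      using eventually_happens'[OF trivial_limit_at_right_real] by fastforce
    have ode: "(1 - t\<^sup>2) * ddGfun a b K t = (2 * (a + b) + 1) * t * dGfun a b K t + 4 * a * b * Gfun a b K t"
      if "t \<in> {0<..<1}" for t
      using that by (intro Gfun_ODE ab) auto
    have p: "dGfun a b K x > 0 \<and> Gfun a b K x > 0" if "s \<le> x" "x < 1" for x
    proof -
      have g: "(Gfun a b K has_real_derivative dGfun a b K t) (at t)"
        "(dGfun a b K has_real_derivative ddGfun a b K t) (at t)" if "t \<in> {0<..<1}" for t
        using that by (auto intro!: DERIV_Gfun DERIV_dGfun ab)
      have "4 * a * b \<ge> 0" "s \<in> {0<..<1}" using ab s1 by auto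
      from ODE_derivative_pos[OF g ode this K(1,2) that] show ?thesis by simp
    qed
    have "eventually (\<lambda>x. x \<in> {s<..<1}) (at_left 1)"
      using s by (intro eventually_at_leftI[of s]) auto
    with Gfun_neg_near_1[OF ab K(3)] have "eventually (\<lambda>x. False) (at_left (1::real))"
      by eventually_elim (use p in \<open>auto simp: not_less less_imp_le dest: order.asym\<close>)
    then show False by simp
  qed
qed

text \<open>Since G tends to infinity at 1, its slope is positive somewhere beyond
  \<open>s0\<close>; the intermediate value theorem gives the zero.\<close>

lemma dGfun_zero_ex:
  assumes K: "0 \<le> K" "K < Gamma_ratio a b" and s0: "0 \<le> s0" "s0 < 1" and neg: "dGfun a b K s0 \<le> 0"
  obtains s1 where "s0 \<le> s1" "s1 < 1" "dGfun a b K s1 = 0"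
proof -
  have "eventually (\<lambda>x. Gfun a b K x > Gfun a b K s0) (at_left 1)"
    using Gfun_at_top[OF ab K] by (simp only: filterlim_at_top_dense)
  moreover have "eventually (\<lambda>x. x \<in> {s0<..<1}) (at_left 1)"
    using s0 by (intro eventually_at_leftI[of s0]) auto
  ultimately have "eventually (\<lambda>x. Gfun a b K x > Gfun a b K s0 \<and> x \<in> {s0<..<1}) (at_left 1)" by eventually_elim auto
  then obtain x where x: "Gfun a b K x > Gfun a b K s0" "s0 < x" "x < 1"
    using eventually_happens'[OF trivial_limit_at_left_real] by fastforce
  have "\<exists>z. z > s0 \<and> z < x \<and> Gfun a b K x - Gfun a b K s0 = (x - s0) * dGfun a b K z"
    using x s0 by (intro MVT2 DERIV_Gfun ab) auto
  then obtain z where z: "z > s0" "z < x" "Gfun a b K x - Gfun a b K s0 = (x - s0) * dGfun a b K z" by blast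
  then have "(x - s0) * dGfun a b K z > 0" using x by simp
  then have "dGfun a b K z > 0" using x by (simp add: zero_less_mult_iff)
  have "\<exists>y\<ge>s0. y \<le> z \<and> dGfun a b K y = 0"
  proof (rule IVT')
    show "continuous_on {s0..z} (dGfun a b K)"
      by (intro continuous_at_imp_continuous_on ballI DERIV_isCont[OF DERIV_dGfun] ab) (use s0 z x in auto)
  qed (use \<open>dGfun a b K z > 0\<close> neg z in auto)
  then show ?thesis using that z x by force
qed

text \<open>The logarithmic derivative of the solution solves the Riccati equation; after its zero it is
  continued by the subsolution \<open>0\<close>, which keeps it bounded near \<open>s = 1\<close>.\<close>

lemma Riccati_subsolution_ex:
  assumes K: "0 \<le> K" "K < Gamma_ratio a b" and s0: "0 \<le> s0" "s0 < 1" and neg: "dGfun a b K s0 \<le> 0"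
  obtains m md :: "real \<Rightarrow> real" and M s1 where
    "continuous_on UNIV m" "md \<in> borel_measurable borel" "\<And>s. \<bar>m s\<bar> \<le> M" "\<And>s. \<bar>md s\<bar> \<le> M"
    "m s0 = dGfun a b K s0 / Gfun a b K s0"
    "\<And>s. s0 < s \<Longrightarrow> s \<noteq> s1 \<Longrightarrow> (m has_real_derivative md s) (at s)"
    "\<And>s. s0 < s \<Longrightarrow> (1 - s\<^sup>2) * (md s + (m s)\<^sup>2) - (2 * (a + b) + 1) * s * m s \<le> 4 * a * b"
proof -
  obtain s1 where s1: "s0 \<le> s1" "s1 < 1" "dGfun a b K s1 = 0"
    using dGfun_zero_ex[OF assms] by blast
  have abs1: "\<bar>s\<bar> < 1" if "s \<in> {s0..s1}" for s using that s0 s1 by auto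
  define q where "q s = dGfun a b K s / Gfun a b K s" for s
  define qd where "qd s = ddGfun a b K s / Gfun a b K s - (q s)\<^sup>2" for s
  have Gpos: "Gfun a b K s > 0" if "s \<in> {s0..s1}" for s
    using that s0 s1 K by (intro Gfun_pos) auto
  have q: "(q has_real_derivative qd s) (at s)" if "s \<in> {s0..s1}" for s
  proof -
    have "(q has_real_derivative (ddGfun a b K s * Gfun a b K s - dGfun a b K s * dGfun a b K s) / (Gfun a b K s * Gfun a b K s)) (at s)"
      unfolding q_def[abs_def] by (rule DERIV_divide)
        (use Gpos[OF that] abs1[OF that] in \<open>auto intro!: DERIV_Gfun DERIV_dGfun ab\<close>)
    also have "(ddGfun a b K s * Gfun a b K s - dGfun a b K s * dGfun a b K s) / (Gfun a b K s * Gfun a b K s) = qd s"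
      using Gpos[OF that] by (simp add: qd_def q_def field_simps power2_eq_square)
    finally show ?thesis .
  qed
  have qc: "continuous_on {s0..s1} q"
    using q by (meson DERIV_isCont continuous_at_imp_continuous_on)
  have Gc: "continuous_on {s0..s1} (Gfun a b K)" "continuous_on {s0..s1} (dGfun a b K)"
    by (intro continuous_at_imp_continuous_on ballI DERIV_isCont[OF DERIV_Gfun] DERIV_isCont[OF DERIV_dGfun] ab abs1; simp)+
  have sq: "1 - s\<^sup>2 > 0" if "s \<in> {s0..s1}" for s using abs1[OF that] by (simp add: abs_square_less_1)
  \<comment> \<open>Continuity of the second derivative is read off from the differential equation,
    which expresses it through G and G'.\<close>
  have qdc: "continuous_on {s0..s1} qd"
  proof -
    have "continuous_on {s0..s1} (\<lambda>s. ((2 * (a + b) + 1) * s * dGfun a b K s + 4 * a * b * Gfun a b K s) / (1 - s\<^sup>2) / Gfun a b K s - (q s)\<^sup>2)"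
      by (intro continuous_intros Gc qc ballI) (use Gpos sq in force)+
    moreover have "((2 * (a + b) + 1) * s * dGfun a b K s + 4 * a * b * Gfun a b K s) / (1 - s\<^sup>2) / Gfun a b K s - (q s)\<^sup>2 = qd s"
      if "s \<in> {s0..s1}" for s
      using Gfun_ODE[OF ab(1,2) abs1[OF that], of K, symmetric] sq[OF that] by (simp add: qd_def)
    ultimately show ?thesis by (subst continuous_on_cong[OF refl, symmetric]) auto
  qed
  have ric: "(1 - s\<^sup>2) * (qd s + (q s)\<^sup>2) - (2 * (a + b) + 1) * s * q s = 4 * a * b" if "s \<in> {s0..s1}" for s
  proof -
    have "(1 - s\<^sup>2) * (qd s + (q s)\<^sup>2) - (2 * (a + b) + 1) * s * q s =
        ((1 - s\<^sup>2) * ddGfun a b K s - (2 * (a + b) + 1) * s * dGfun a b K s) / Gfun a b K s"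
      by (simp add: qd_def q_def diff_divide_distrib)
    also have "\<dots> = 4 * a * b"
      unfolding Gfun_ODE[OF ab(1,2) abs1[OF that]] using Gpos[OF that] by simp
    finally show ?thesis .
  qed
  \<comment> \<open>Clamping to [s0, s1] extends q continuously to the whole line: constant to the
    left, and equal to q s1 = 0 to the right. The derivative \<open>md\<close> is claimed only for s
    > s0 away from the corner s1.\<close>
  define cl where "cl s = max s0 (min s1 s)" for s
  have cl: "cl s \<in> {s0..s1}" for s using s1 by (auto simp: cl_def)
  define m where "m s = q (cl s)" for s
  define md where "md s = (if s \<in> {s0..s1} then qd s else 0)" for s
  obtain M1 where M1: "\<forall>s\<in>{s0..s1}. \<bar>q s\<bar> \<le> M1"
    using compact_imp_bounded[OF compact_continuous_image[OF qc]] by (auto simp: bounded_iff)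
  obtain M2 where M2: "\<forall>s\<in>{s0..s1}. \<bar>qd s\<bar> \<le> M2"
    using compact_imp_bounded[OF compact_continuous_image[OF qdc]] by (auto simp: bounded_iff)
  have qs1: "q s1 = 0" by (simp add: q_def s1)
  show ?thesis
  proof (rule that)
    show "continuous_on UNIV m"
      unfolding m_def by (rule continuous_on_compose2[OF qc]) (use cl in \<open>auto simp: cl_def intro!: continuous_intros\<close>)
    have "(\<lambda>s. indicator {s0..s1} s *\<^sub>R qd s) \<in> borel_measurable borel"
      by (rule borel_measurable_continuous_on_indicator[OF _ qdc]) simp
    moreover have "(\<lambda>s. indicator {s0..s1} s *\<^sub>R qd s) = md" by (auto simp: md_def fun_eq_iff)
    ultimately show "md \<in> borel_measurable borel" by simp
    show "\<bar>m s\<bar> \<le> max M1 M2" for s using M1 cl[of s] by (fastforce simp: m_def)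
    show "\<bar>md s\<bar> \<le> max M1 M2" for s
      using bspec[OF M2, of s] bspec[OF M2, of s0] s1 by (auto simp: md_def)
    show "m s0 = dGfun a b K s0 / Gfun a b K s0"
      using s1 by (simp add: m_def cl_def q_def)
    fix s assume s: "s0 < s"
    show "(m has_real_derivative md s) (at s)" if "s \<noteq> s1"
    proof (cases "s < s1")
      case True
      have "(q has_real_derivative md s) (at s)" using q[of s] s True by (simp add: md_def)
      then show ?thesis
        by (rule has_field_derivative_transform_within_open[where S="{s0<..<s1}"])
          (use s True in \<open>auto simp: m_def cl_def\<close>)
    next
      case False
      have "((\<lambda>_. 0) has_real_derivative md s) (at s)" using that False by (auto simp: md_def)
      then show ?thesis
        by (rule has_field_derivative_transform_within_open[where S="{s1<..}"])
          (use s s1 False that qs1 in \<open>auto simp: m_def cl_def min_def max_def\<close>)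
    qed
    show "(1 - s\<^sup>2) * (md s + (m s)\<^sup>2) - (2 * (a + b) + 1) * s * m s \<le> 4 * a * b"
    proof (cases "s \<le> s1")
      case True
      then show ?thesis using ric[of s] s by (simp add: md_def m_def cl_def)
    next
      \<comment> \<open>Beyond the zero of G' the Riccati expression of the constant 0 is 0, which
        is below 4ab.\<close>
      case False
      then have "m s = 0" using s1 qs1 by (simp add: m_def cl_def)
      then show ?thesis using False ab by (simp add: md_def)
    qed
  qed
qed

end

section \<open>Identification of the constant\<close>

lemma w_fun_deriv:
  assumes ab: "(real N + \<beta>) / 4 - 1 > 0" "(real N - \<beta>) / 4 > 0" and s: "0 < s" "s < 1"
  defines "a \<equiv> (real N + \<beta>) / 4 - 1" and "b \<equiv> (real N - \<beta>) / 4"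
  shows "deriv (w_fun N \<beta>) (s\<^sup>2) = dGfun a b (Gamma_ratio a b) s / (2 * s)"
proof -
  have ap: "a > 0" "b > 0" using ab by (simp_all add: a_def b_def)
  have a2: "(real N + \<beta>) / 4 - 1 / 2 = a + 1/2" by (simp add: a_def)
  have K: "K_NB N \<beta> = Gamma_ratio a b"
    by (simp add: K_NB_def Gamma_ratio_def a2) (simp add: a_def b_def)
  have w: "w_fun N \<beta> y = Gfun a b (Gamma_ratio a b) (sqrt y)" if "y \<in> {0<..<1}" for y
  proof -
    have "\<bar>sqrt y\<bar> < 1" "(sqrt y)\<^sup>2 = y" using that by auto
    then show ?thesis
      unfolding w_fun_def K a2 using Gfun_eq[OF ap, of "sqrt y"] by (simp add: a_def b_def)
  qed
  have s2: "s\<^sup>2 \<in> {0<..<1}" using s by (auto simp: abs_square_less_1)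
  have "((\<lambda>y. Gfun a b (Gamma_ratio a b) (sqrt y)) has_real_derivative
      dGfun a b (Gamma_ratio a b) (sqrt (s\<^sup>2)) * (inverse (sqrt (s\<^sup>2)) / 2)) (at (s\<^sup>2))"
    by (rule DERIV_chain2[OF DERIV_Gfun[OF ap] DERIV_real_sqrt]) (use s in auto)
  then have "(w_fun N \<beta> has_real_derivative
      dGfun a b (Gamma_ratio a b) (sqrt (s\<^sup>2)) * (inverse (sqrt (s\<^sup>2)) / 2)) (at (s\<^sup>2))"
    by (rule has_field_derivative_transform_within_open[where S="{0<..<1}"]) (use s2 w in auto)
  then show ?thesis using s by (simp add: DERIV_imp_deriv field_simps)
qed

lemma A_const_eq:
  assumes ab: "(real N + \<beta>) / 4 - 1 > 0" "(real N - \<beta>) / 4 > 0" and s: "\<bar>sin \<alpha>\<bar> < 1"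
  defines "a \<equiv> (real N + \<beta>) / 4 - 1" and "b \<equiv> (real N - \<beta>) / 4"
  shows "A_const N \<alpha> \<beta> = Gfun a b (Gamma_ratio a b) \<bar>sin \<alpha>\<bar>"
proof -
  have ap: "a > 0" "b > 0" using ab by (simp_all add: a_def b_def)
  have a2: "(real N + \<beta>) / 4 - 1 / 2 = a + 1/2" by (simp add: a_def)
  have K: "K_NB N \<beta> = Gamma_ratio a b"
    by (simp add: K_NB_def Gamma_ratio_def a2) (simp add: a_def b_def)
  show ?thesis
    unfolding A_const_def K a2 using Gfun_eq[OF ap, of "\<bar>sin \<alpha>\<bar>"] s by (simp add: a_def b_def)
qed

text \<open>In the formula sin(2\<alpha>) = 2 sin \<alpha> cos \<alpha> meets w'(s^2) = G'(s) / (2s)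
  with s = |sin \<alpha>|; the factors |sin \<alpha>| cancel and only the sign of \<alpha> survives.
  The denominator is nonzero by \<open>Gfun_pos\<close>.\<close>

lemma is_K_const_ex:
  assumes N: "N \<ge> 3" and beta: "2 \<le> \<beta>" "\<beta> < real N" and alpha: "- pi / 2 < \<alpha>" "\<alpha> < pi / 2"
  defines "a \<equiv> (real N + \<beta>) / 4 - 1" and "b \<equiv> (real N - \<beta>) / 4"
  shows "is_K_const N \<alpha> \<beta> (- (if \<alpha> < 0 then -1 else 1) * cos \<alpha> * dGfun a b (Gamma_ratio a b) \<bar>sin \<alpha>\<bar> / Gfun a b (Gamma_ratio a b) \<bar>sin \<alpha>\<bar>)"
proof -
  have ab: "a > 0" "b > 0" "a + b \<ge> 1/2" using assms by (auto simp: field_simps)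
  note ab' = ab(1,2)[unfolded a_def b_def]
  have cos: "cos x > 0" if "- pi / 2 < x" "x < pi / 2" for x
    using that by (intro cos_gt_zero_pi) auto
  have sin1: "\<bar>sin x\<bar> < 1" if "- pi / 2 < x" "x < pi / 2" for x
  proof -
    have "(sin x)\<^sup>2 < 1" using cos[OF that] by (simp add: sin_squared_eq)
    then show ?thesis by (simp add: abs_square_less_1)
  qed
  have main: "K_formula N x \<beta> = - (if x < 0 then -1 else 1) * cos x * dGfun a b (Gamma_ratio a b) \<bar>sin x\<bar> / Gfun a b (Gamma_ratio a b) \<bar>sin x\<bar>"
    if x: "- pi / 2 < x" "x < pi / 2" "x \<noteq> 0" for x
  proof -
    have sg: "sin x = (if x < 0 then -1 else 1) * \<bar>sin x\<bar>" "\<bar>sin x\<bar> > 0"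
      using x sin_gt_zero[of x] sin_gt_zero[of "-x"] by (cases "x > 0"; force)+
    have "deriv (w_fun N \<beta>) ((sin x)\<^sup>2) = dGfun a b (Gamma_ratio a b) \<bar>sin x\<bar> / (2 * \<bar>sin x\<bar>)"
      using w_fun_deriv[OF ab' sg(2) sin1[OF x(1,2)]] by (simp add: a_def b_def)
    then have "K_formula N x \<beta> = - (2 * (if x < 0 then -1 else 1) * \<bar>sin x\<bar> * cos x) * (dGfun a b (Gamma_ratio a b) \<bar>sin x\<bar> / (2 * \<bar>sin x\<bar>) / A_const N x \<beta>)"
      unfolding K_formula_def sin_double using sg(1) by (simp only: mult.assoc)
    also have "\<dots> = - (if x < 0 then -1 else 1) * cos x * dGfun a b (Gamma_ratio a b) \<bar>sin x\<bar> / A_const N x \<beta>"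
    proof -
      have gen: "- (2 * e * S * c) * (D / (2 * S) / A) = - e * c * D / A" if "S > 0" for e S c D A :: real
        using that by simp
      show ?thesis by (rule gen[OF sg(2)])
    qed
    finally show ?thesis unfolding A_const_eq[OF ab' sin1[OF x(1,2)], folded a_def b_def] .
  qed
  show ?thesis
  proof (cases "\<alpha> = 0")
    case False
    have "A_const N \<alpha> \<beta> > 0"
      unfolding A_const_eq[OF ab' sin1[OF alpha], folded a_def b_def]
      by (intro Gfun_pos ab) (use sin1[OF alpha] in auto)
    with False main[OF alpha False] show ?thesis by (simp add: is_K_const_def)
  next
    case True
    \<comment> \<open>Without the singular factor 1 / sin the expression is continuous at 0, so the
      right limit is its value there. The convention of sign 1 at \<alpha> = 0 matches the approach
      from the right.\<close>
    let ?f = "\<lambda>x. - cos x * dGfun a b (Gamma_ratio a b) (sin x) / Gfun a b (Gamma_ratio a b) (sin x)"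
    have "isCont ?f 0"
      by (intro continuous_intros isCont_o2[OF isCont_sin, where g="dGfun a b (Gamma_ratio a b)"]
        isCont_o2[OF isCont_sin, where g="Gfun a b (Gamma_ratio a b)"]
        DERIV_isCont[OF DERIV_Gfun] DERIV_isCont[OF DERIV_dGfun] ab) (simp_all add: Gfun_0[OF ab])
    then have "(?f \<longlongrightarrow> ?f 0) (at 0)" by (simp only: isCont_def)
    then have "(?f \<longlongrightarrow> ?f 0) (at_right 0)" by (rule filterlim_mono) (auto simp: at_le)
    moreover have "eventually (\<lambda>x. ?f x = K_formula N x \<beta>) (at_right 0)"
    proof (rule eventually_at_rightI[of 0 "pi / 2"])
      fix x :: real assume x: "x \<in> {0<..<pi/2}"
      then have "sin x > 0" using sin_gt_zero[of x] by auto
      then show "?f x = K_formula N x \<beta>" using main[of x] x by auto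
    qed auto
    ultimately have "((\<lambda>x. K_formula N x \<beta>) \<longlongrightarrow> ?f 0) (at_right 0)"
      by (simp add: tendsto_cong)
    then show ?thesis using True by (simp add: is_K_const_def)
  qed
qed

section \<open>Test functions and mollification\<close>

lemma GDERIV_unique: "GDERIV f x :> D \<Longrightarrow> GDERIV f x :> D' \<Longrightarrow> D = D'"
proof -
  assume 1: "GDERIV f x :> D" and 2: "GDERIV f x :> D'"
  have "(\<lambda>h. h \<bullet> D) = (\<lambda>h. h \<bullet> D')"
    using 1 2 unfolding gderiv_def by (rule has_derivative_unique)
  from fun_cong[OF this, of D'] fun_cong[OF this, of D]
  have "(D' - D) \<bullet> (D' - D) = 0" by (simp add: algebra_simps inner_commute)
  then show "D = D'" by simp
qed

lemma grad_eqI: "GDERIV f x :> D \<Longrightarrow> grad f x = D"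
  unfolding grad_def by (rule the_equality) (auto intro: GDERIV_unique)

text \<open>A linear functional on a Euclidean space is the inner product with the vector of its
  values on the basis, so differentiability alone makes \<open>grad\<close> the true
  gradient.\<close>

lemma GDERIV_grad:
  fixes f :: "'a::euclidean_space \<Rightarrow> real"
  assumes "f differentiable (at x)"
  shows "GDERIV f x :> grad f x"
proof -
  from assms obtain f' where f': "(f has_derivative f') (at x)" by (auto simp: differentiable_def)
  interpret f': bounded_linear f' by (rule has_derivative_bounded_linear[OF f'])
  have "f' h = h \<bullet> (\<Sum>b\<in>Basis. f' b *\<^sub>R b)" for h
  proof -
    have "f' h = f' (\<Sum>b\<in>Basis. (h \<bullet> b) *\<^sub>R b)" by (simp add: euclidean_representation)
    also have "\<dots> = h \<bullet> (\<Sum>b\<in>Basis. f' b *\<^sub>R b)"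
      by (simp add: f'.sum f'.scaleR inner_sum_right mult.commute)
    finally show ?thesis .
  qed
  then have "GDERIV f x :> (\<Sum>b\<in>Basis. f' b *\<^sub>R b)"
    using f' unfolding gderiv_def by (metis (no_types, lifting) ext)
  then show ?thesis by (simp add: grad_eqI)
qed

lemma GDERIV_D: "GDERIV f x :> D \<Longrightarrow> f differentiable (at x) \<and> grad f x = D"
  by (auto simp: grad_eqI differentiable_def gderiv_def)

section \<open>Closure properties of smooth functions\<close>

lemma Ck_on_SucI:
  assumes "\<And>x. GDERIV f x :> D x" "\<And>b. b \<in> Basis \<Longrightarrow> Ck_on k UNIV (\<lambda>x. D x \<bullet> b)"
  shows "Ck_on (Suc k) UNIV f"
  using assms GDERIV_D[OF assms(1)] by simp

lemma Ck_on_Suc_imp: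
  fixes f :: "'a::euclidean_space \<Rightarrow> real"
  shows "Ck_on (Suc k) UNIV f \<Longrightarrow> Ck_on k UNIV f"
proof (induction k arbitrary: f)
  case 0
  then show ?case
    by (auto intro!: continuous_at_imp_continuous_on differentiable_imp_continuous_within)
next
  case (Suc k)
  then show ?case by (metis Ck_on.simps(2))
qed

lemma Ck_on_const: "Ck_on k UNIV (\<lambda>x::'a::euclidean_space. c)"
proof (induction k arbitrary: c)
  case (Suc k)
  show ?case by (rule Ck_on_SucI[OF GDERIV_const]) (simp add: Suc)
qed simp

lemma Ck_on_inner: "Ck_on k UNIV (\<lambda>x::'a::euclidean_space. x \<bullet> b)"
proof (induction k)
  case 0
  show ?case by (simp add: continuous_intros)
next
  case (Suc k)
  have "GDERIV (\<lambda>x. x \<bullet> b) x :> b" for x :: 'a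
    unfolding gderiv_def by (rule bounded_linear_imp_has_derivative) (rule bounded_linear_inner_left)
  then show ?case by (rule Ck_on_SucI) (rule Ck_on_const)
qed

lemma Ck_on_add: "Ck_on k UNIV f \<Longrightarrow> Ck_on k UNIV g \<Longrightarrow> Ck_on k UNIV (\<lambda>x::'a::euclidean_space. f x + g x)"
proof (induction k arbitrary: f g)
  case (Suc k)
  show ?case
    by (rule Ck_on_SucI[OF GDERIV_add[OF GDERIV_grad GDERIV_grad]])
      (use Suc in \<open>auto simp: inner_add_left\<close>)
qed (simp add: continuous_on_add)

lemma Ck_on_mult: "Ck_on k UNIV f \<Longrightarrow> Ck_on k UNIV g \<Longrightarrow> Ck_on k UNIV (\<lambda>x::'a::euclidean_space. f x * g x)"
proof (induction k arbitrary: f g)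
  case (Suc k)
  \<comment> \<open>The product rule contains f and g themselves, whose order is lowered by one
    before the induction hypothesis applies.\<close>
  have "Ck_on k UNIV (\<lambda>x. f x * (grad g x \<bullet> b) + g x * (grad f x \<bullet> b))" if "b \<in> Basis" for b
    using Suc.prems[THEN Ck_on_Suc_imp] Suc.prems that by (intro Ck_on_add Suc.IH) auto
  then show ?case
    by (intro Ck_on_SucI[OF GDERIV_mult[OF GDERIV_grad GDERIV_grad]])
      (use Suc.prems in \<open>auto simp: inner_add_left\<close>)
qed (simp add: continuous_on_mult)

lemma Ck_on_diff: "Ck_on k UNIV f \<Longrightarrow> Ck_on k UNIV g \<Longrightarrow> Ck_on k UNIV (\<lambda>x::'a::euclidean_space. f x - g x)"
  using Ck_on_add[of k f "\<lambda>x. (-1) * g x"] Ck_on_mult[OF Ck_on_const[of k "-1"], of g] by simp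

lemma GDERIV_affine:
  assumes "GDERIV f (c *\<^sub>R x + d) :> D"
  shows "GDERIV (\<lambda>x. f (c *\<^sub>R x + d)) x :> c *\<^sub>R D"
proof -
  have "((\<lambda>x. c *\<^sub>R x + d) has_derivative (\<lambda>h. c *\<^sub>R h)) (at x)"
    by (auto intro!: derivative_eq_intros)
  from has_derivative_compose[OF this assms[unfolded gderiv_def]] show ?thesis
    unfolding gderiv_def by simp
qed

lemma Ck_on_affine: "Ck_on k UNIV f \<Longrightarrow> Ck_on k UNIV (\<lambda>x::'a::euclidean_space. f (c *\<^sub>R x + d))"
proof (induction k arbitrary: f)
  case 0
  then have "continuous_on UNIV f" by simp
  then have "continuous_on UNIV (\<lambda>x. f (c *\<^sub>R x + d))"
    by (rule continuous_on_compose2) (auto intro!: continuous_intros)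
  then show ?case by simp
next
  case (Suc k)
  have "Ck_on k UNIV (\<lambda>x. c * (grad f (c *\<^sub>R x + d) \<bullet> b))" if "b \<in> Basis" for b
    using Suc.prems that by (intro Ck_on_mult Ck_on_const Suc.IH[of "\<lambda>x. grad f x \<bullet> b"]) auto
  then show ?case
    by (intro Ck_on_SucI[OF GDERIV_affine[OF GDERIV_grad]]) (use Suc in auto)
qed

section \<open>A smooth bump function\<close>

definition flat_exp :: "nat \<Rightarrow> real \<Rightarrow> real" where
  "flat_exp k x = (if x > 0 then exp (- (1 / x)) / x ^ k else 0)"

lemma flat_exp_div_tendsto: "((\<lambda>x. flat_exp k x / x) \<longlongrightarrow> 0) (at 0)"
proof -
  have "((\<lambda>y::real. y ^ Suc k / exp y) \<longlongrightarrow> 0) at_top" by (rule tendsto_power_div_exp_0)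
  then have "((\<lambda>x::real. (inverse x) ^ Suc k / exp (inverse x)) \<longlongrightarrow> 0) (at_right 0)"
    by (rule filterlim_compose) (rule filterlim_inverse_at_top_right)
  moreover have "eventually (\<lambda>x. (inverse x) ^ Suc k / exp (inverse x) = flat_exp k x / x) (at_right (0::real))"
    by (rule eventually_at_rightI[of 0 1]) (auto simp: flat_exp_def exp_minus field_simps)
  ultimately have 1: "((\<lambda>x. flat_exp k x / x) \<longlongrightarrow> 0) (at_right 0)" by (simp add: tendsto_cong)
  have "eventually (\<lambda>x. 0 = flat_exp k x / x) (at_left (0::real))"
    by (rule eventually_at_leftI[of "-1"]) (auto simp: flat_exp_def)
  then have 2: "((\<lambda>x. flat_exp k x / x) \<longlongrightarrow> 0) (at_left 0)"
    by (rule tendsto_cong[THEN iffD1]) simp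
  from 1 2 show ?thesis by (simp add: filterlim_at_split)
qed

text \<open>The family exp(-1/x) / x^k is closed under differentiation up to linear combinations,
  which is the reason for carrying the power k. At 0 the derivative vanishes because the exponential
  beats every power.\<close>

lemma DERIV_flat_exp:
  "(flat_exp k has_real_derivative (- real k * flat_exp (Suc k) x + flat_exp (Suc (Suc k)) x)) (at x)"
proof -
  consider "x > 0" | "x < 0" | "x = 0" by linarith
  then show ?thesis
  proof cases
    case 1
    have "((\<lambda>x. exp (- (1 / x)) / x ^ k) has_real_derivative
        (exp (- (1 / x)) * (1 / x\<^sup>2) * x ^ k - exp (- (1 / x)) * (real k * x ^ (k - 1))) / (x ^ k * x ^ k)) (at x)"
      using 1 by (auto intro!: derivative_eq_intros simp: power2_eq_square)
    also have "(exp (- (1 / x)) * (1 / x\<^sup>2) * x ^ k - exp (- (1 / x)) * (real k * x ^ (k - 1))) / (x ^ k * x ^ k)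
       = - real k * flat_exp (Suc k) x + flat_exp (Suc (Suc k)) x"
      using 1 by (cases k) (auto simp: flat_exp_def power2_eq_square divide_simps, auto simp: algebra_simps)
    finally show ?thesis
      by (rule has_field_derivative_transform_within_open[where S="{0<..}"]) (use 1 in \<open>auto simp: flat_exp_def\<close>)
  next
    case 2
    have "((\<lambda>x. 0) has_real_derivative (- real k * flat_exp (Suc k) x + flat_exp (Suc (Suc k)) x)) (at x)"
      using 2 by (auto simp: flat_exp_def)
    then show ?thesis
      by (rule has_field_derivative_transform_within_open[where S="{..<0}"]) (use 2 in \<open>auto simp: flat_exp_def\<close>)
  next
    case 3
    then show ?thesis
      using flat_exp_div_tendsto[of k] by (simp add: DERIV_def flat_exp_def)
  qed
qed

definition bump :: "'a::euclidean_space \<Rightarrow> real" where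
  "bump z = flat_exp 0 (1 - z \<bullet> z)"

lemma bump_nonneg: "bump z \<ge> 0" and bump_zero: "norm z \<ge> 1 \<Longrightarrow> bump z = 0" and bump_0: "bump 0 > 0"
proof -
  show "bump z \<ge> 0" "bump 0 > 0" by (auto simp: bump_def flat_exp_def)
  show "bump z = 0" if "norm z \<ge> 1"
  proof -
    have "norm z * norm z \<ge> 1 * 1" using that by (intro mult_mono) auto
    then show ?thesis by (simp add: bump_def flat_exp_def dot_square_norm power2_eq_square)
  qed
qed

text \<open>The induction on the order runs for all powers j at once, since each derivative raises
  j. The inner function 1 - z . z is a polynomial and causes no singularity at the origin.\<close>

lemma Ck_on_bump: "Ck_on k UNIV (bump :: 'a::euclidean_space \<Rightarrow> real)"
proof -
  have "Ck_on k UNIV (\<lambda>z::'a. flat_exp j (1 - z \<bullet> z))" for j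
  proof (induction k arbitrary: j)
    case 0
    have "continuous_on UNIV (flat_exp j)"
      by (intro continuous_at_imp_continuous_on ballI DERIV_isCont[OF DERIV_flat_exp])
    then have "continuous_on UNIV (\<lambda>z::'a. flat_exp j (1 - z \<bullet> z))"
      by (rule continuous_on_compose2) (auto intro!: continuous_intros)
    then show ?case by simp
  next
    case (Suc k)
    let ?d = "\<lambda>z::'a. - real j * flat_exp (Suc j) (1 - z \<bullet> z) + flat_exp (Suc (Suc j)) (1 - z \<bullet> z)"
    have g: "GDERIV (\<lambda>z::'a. flat_exp j (1 - z \<bullet> z)) x :> (?d x) *\<^sub>R ((-2) *\<^sub>R x)" for x
    proof -
      have "GDERIV (\<lambda>z::'a. 1 - z \<bullet> z) x :> (-2) *\<^sub>R x"
        unfolding gderiv_def by (auto intro!: derivative_eq_intros simp: inner_commute)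
      from GDERIV_DERIV_compose[OF this DERIV_flat_exp] show ?thesis .
    qed
    have "Ck_on k UNIV (\<lambda>z. ?d z * (-2 * (z \<bullet> b)))" for b
      by (intro Ck_on_mult Ck_on_add Ck_on_const Ck_on_inner Suc.IH)
    then show ?case by (intro Ck_on_SucI[OF g]) (simp only: inner_scaleR_left)
  qed
  then show ?thesis unfolding bump_def[abs_def] .
qed

section \<open>Closure properties and uniform bounds for test functions\<close>

lemma test_functionsI:
  fixes \<phi> :: "'a::euclidean_space \<Rightarrow> real"
  assumes "\<And>k. Ck_on k UNIV \<phi>" "\<And>z. z \<notin> S \<Longrightarrow> \<phi> z = 0" "compact S" "S \<subseteq> \<Omega>"
  shows "\<phi> \<in> test_functions \<Omega>"
proof -
  have "closure {x. \<phi> x \<noteq> 0} \<subseteq> S"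
    using assms by (intro closure_minimal compact_imp_closed) auto
  moreover from this have "compact (closure {x. \<phi> x \<noteq> 0})"
    using assms(3) by (meson bounded_subset closed_closure compact_eq_bounded_closed)
  ultimately show ?thesis using assms by (auto simp: test_functions_def)
qed

lemma test_functions_Ck: "\<phi> \<in> test_functions \<Omega> \<Longrightarrow> Ck_on k UNIV \<phi>"
  by (simp add: test_functions_def)

lemma test_functions_support:
  fixes \<phi> :: "'a::euclidean_space \<Rightarrow> real"
  assumes "\<phi> \<in> test_functions \<Omega>"
  obtains R where "R > 0" "\<And>z. norm z \<ge> R \<Longrightarrow> \<phi> z = 0"
proof -
  have "bounded (closure {x. \<phi> x \<noteq> 0})" using assms by (simp add: test_functions_def compact_imp_bounded)
  then obtain R where R: "R > 0" "\<forall>z\<in>closure {x. \<phi> x \<noteq> 0}. norm z < R"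
    unfolding bounded_pos_less by blast
  show ?thesis
  proof (rule that[OF R(1)])
    fix z :: 'a assume "norm z \<ge> R"
    with R(2) have "z \<notin> closure {x. \<phi> x \<noteq> 0}" by force
    then show "\<phi> z = 0" using closure_subset[of "{x. \<phi> x \<noteq> 0}"] by blast
  qed
qed

lemma test_functions_UNIV_I:
  fixes \<phi> :: "'a::euclidean_space \<Rightarrow> real"
  assumes "\<And>k. Ck_on k UNIV \<phi>" "\<And>z. norm z \<ge> R \<Longrightarrow> \<phi> z = 0"
  shows "\<phi> \<in> test_functions UNIV"
  by (rule test_functionsI[where S="cball 0 R"]) (use assms in auto)

lemma test_functions_diff:
  fixes f g :: "'a::euclidean_space \<Rightarrow> real"
  assumes "f \<in> test_functions UNIV" "g \<in> test_functions UNIV"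
  shows "(\<lambda>x. f x - g x) \<in> test_functions UNIV"
proof -
  obtain R where R: "\<And>z. norm z \<ge> R \<Longrightarrow> f z = 0" using test_functions_support[OF assms(1)] by metis
  obtain R' where R': "\<And>z. norm z \<ge> R' \<Longrightarrow> g z = 0" using test_functions_support[OF assms(2)] by metis
  show ?thesis
    by (rule test_functions_UNIV_I[where R="max R R'"])
      (use R R' in \<open>auto intro!: Ck_on_diff test_functions_Ck[OF assms(1)] test_functions_Ck[OF assms(2)]\<close>)
qed

lemma test_functions_mult:
  fixes f g :: "'a::euclidean_space \<Rightarrow> real"
  assumes "f \<in> test_functions UNIV" "\<And>k. Ck_on k UNIV g"
  shows "(\<lambda>x. f x * g x) \<in> test_functions UNIV"
proof -
  obtain R where R: "\<And>z. norm z \<ge> R \<Longrightarrow> f z = 0" using test_functions_support[OF assms(1)] by metis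
  show ?thesis
    by (rule test_functions_UNIV_I[where R=R])
      (use R assms(2) in \<open>auto intro!: Ck_on_mult test_functions_Ck[OF assms(1)]\<close>)
qed

lemma test_functions_affine:
  fixes f :: "'a::euclidean_space \<Rightarrow> real"
  assumes "f \<in> test_functions UNIV" "c \<noteq> 0"
  shows "(\<lambda>x. f (c *\<^sub>R x + d)) \<in> test_functions UNIV"
proof -
  obtain R where R: "\<And>z. norm z \<ge> R \<Longrightarrow> f z = 0" using test_functions_support[OF assms(1)] by metis
  show ?thesis
  proof (rule test_functions_UNIV_I[where R="(R + norm d) / \<bar>c\<bar>"])
    show "f (c *\<^sub>R z + d) = 0" if "(R + norm d) / \<bar>c\<bar> \<le> norm z" for z
    proof (rule R)
      have "R + norm d \<le> norm (c *\<^sub>R z)" using that assms(2) by (simp add: field_simps)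
      also have "\<dots> \<le> norm (c *\<^sub>R z + d) + norm d"
        using norm_triangle_ineq4[of "c *\<^sub>R z + d" d] by simp
      finally show "R \<le> norm (c *\<^sub>R z + d)" by simp
    qed
  qed (use assms in \<open>auto intro!: Ck_on_affine test_functions_Ck[OF assms(1)]\<close>)
qed

lemma bump_test: "bump \<in> test_functions (UNIV :: 'a::euclidean_space set)"
  by (rule test_functions_UNIV_I[where R=1]) (auto simp: Ck_on_bump bump_zero)

lemma test_functions_GDERIV:
  fixes \<phi> :: "'a::euclidean_space \<Rightarrow> real"
  shows "\<phi> \<in> test_functions \<Omega> \<Longrightarrow> GDERIV \<phi> x :> grad \<phi> x"
  using test_functions_Ck[of \<phi> \<Omega> "Suc 0"] by (intro GDERIV_grad) auto

lemma test_functions_continuous: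
  fixes \<phi> :: "'a::euclidean_space \<Rightarrow> real"
  shows "\<phi> \<in> test_functions \<Omega> \<Longrightarrow> continuous_on S \<phi>"
  using test_functions_Ck[of \<phi> \<Omega> 0] by (auto intro: continuous_on_subset)

lemma test_functions_partial_Ck:
  fixes \<phi> :: "'a::euclidean_space \<Rightarrow> real"
  shows "\<phi> \<in> test_functions \<Omega> \<Longrightarrow> b \<in> Basis \<Longrightarrow> Ck_on k UNIV (\<lambda>x. grad \<phi> x \<bullet> b)"
  using test_functions_Ck[of \<phi> \<Omega> "Suc k"] by auto

lemma test_functions_grad_continuous:
  fixes \<phi> :: "'a::euclidean_space \<Rightarrow> real"
  assumes "\<phi> \<in> test_functions \<Omega>"
  shows "continuous_on S (grad \<phi>)"
proof -
  have "continuous_on S (\<lambda>x. \<Sum>b\<in>Basis. (grad \<phi> x \<bullet> b) *\<^sub>R b)"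
  proof (intro continuous_on_sum continuous_on_scaleR continuous_on_const)
    fix b :: 'a assume "b \<in> Basis"
    then have "continuous_on UNIV (\<lambda>x. grad \<phi> x \<bullet> b)"
      using test_functions_partial_Ck[OF assms, of b 0] by simp
    then show "continuous_on S (\<lambda>x. grad \<phi> x \<bullet> b)" by (rule continuous_on_subset) simp
  qed
  then show ?thesis by (simp add: euclidean_representation)
qed

lemma grad_zero_outside:
  fixes \<phi> :: "'a::euclidean_space \<Rightarrow> real"
  assumes "\<And>z. norm z \<ge> R \<Longrightarrow> \<phi> z = 0" "norm x > R"
  shows "grad \<phi> x = 0"
proof (rule grad_eqI)
  have "((\<lambda>x. 0) has_derivative (\<lambda>h. h \<bullet> 0)) (at x)" by simp
  then have "(\<phi> has_derivative (\<lambda>h. h \<bullet> 0)) (at x)"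
  proof (rule has_derivative_transform_within_open[where s="- cball 0 R"])
    show "open (- cball (0::'a) R)" by (simp add: open_Compl)
  qed (use assms in auto)
  then show "GDERIV \<phi> x :> 0" unfolding gderiv_def .
qed

lemma test_functions_partial:
  fixes \<phi> :: "'a::euclidean_space \<Rightarrow> real"
  assumes "\<phi> \<in> test_functions UNIV" "b \<in> Basis"
  shows "(\<lambda>x. grad \<phi> x \<bullet> b) \<in> test_functions UNIV"
proof -
  obtain R where R: "\<And>z. norm z \<ge> R \<Longrightarrow> \<phi> z = 0" using test_functions_support[OF assms(1)] by metis
  show ?thesis
    by (rule test_functions_UNIV_I[where R="R + 1"])
      (use test_functions_partial_Ck[OF assms] grad_zero_outside[of R \<phi>] R in auto)
qed

lemma bounded_of_compact_support:
  fixes f :: "'a::euclidean_space \<Rightarrow> 'b::real_normed_vector"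
  assumes "continuous_on UNIV f" "\<And>z. norm z \<ge> R \<Longrightarrow> f z = 0"
  obtains B where "B > 0" "\<And>z. norm (f z) \<le> B"
proof -
  have "compact (f ` cball 0 R)"
    by (intro compact_continuous_image continuous_on_subset[OF assms(1)]) auto
  from compact_imp_bounded[OF this] obtain B where B: "B > 0" "\<And>z. z \<in> cball 0 R \<Longrightarrow> norm (f z) \<le> B"
    by (auto simp: bounded_pos)
  have "norm (f z) \<le> B" for z
    by (cases "norm z \<le> R") (use B assms(2)[of z] in auto)
  with B(1) show ?thesis by (rule that)
qed

lemma uniformly_continuous_of_compact_support:
  fixes f :: "'a::euclidean_space \<Rightarrow> 'b::real_normed_vector"
  assumes c: "continuous_on UNIV f" and R: "\<And>z. norm z \<ge> R \<Longrightarrow> f z = 0" and e: "e > 0"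
  obtains d where "d > 0" "\<And>x y. norm (x - y) < d \<Longrightarrow> norm (f x - f y) < e"
proof -
  have "uniformly_continuous_on (cball 0 (R + 1)) f"
    by (intro compact_uniformly_continuous continuous_on_subset[OF c]) auto
  then obtain d where d: "d > 0" "\<And>x y. x \<in> cball 0 (R + 1) \<Longrightarrow> y \<in> cball 0 (R + 1) \<Longrightarrow> dist y x < d \<Longrightarrow> dist (f y) (f x) < e"
    unfolding uniformly_continuous_on_def using e by metis
  \<comment> \<open>At distance below 1, either both points lie in the ball of radius R + 1, or both
    lie outside the ball of radius R, where f vanishes.\<close>
  have "norm (f x - f y) < e" if xy: "norm (x - y) < min d 1" for x y
  proof (cases "x \<in> cball 0 (R + 1) \<and> y \<in> cball 0 (R + 1)")
    case True
    then show ?thesis using d(2)[of y x] xy by (simp add: dist_norm)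
  next
    case False
    then have "norm x > R + 1 \<or> norm y > R + 1" by auto
    moreover have "norm x \<le> norm (x - y) + norm y" "norm y \<le> norm (x - y) + norm x"
      using norm_triangle_ineq[of "x - y" y] norm_triangle_ineq4[of x "x - y"] by (auto simp: norm_minus_commute)
    ultimately have "norm x \<ge> R" "norm y \<ge> R" using xy by auto
    then show ?thesis using R e by simp
  qed
  moreover have "min d 1 > 0" using d by simp
  ultimately show ?thesis by (rule that[rotated])
qed

lemma test_functions_bounds:
  fixes \<phi> :: "'a::euclidean_space \<Rightarrow> real"
  assumes "\<phi> \<in> test_functions \<Omega>"
  obtains B R where "B > 0" "R > 0" "\<And>z. \<bar>\<phi> z\<bar> \<le> B" "\<And>z. norm (grad \<phi> z) \<le> B"
    "\<And>z. norm z \<ge> R \<Longrightarrow> \<phi> z = 0" "\<And>z. norm z \<ge> R \<Longrightarrow> grad \<phi> z = 0"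
proof -
  obtain R where R: "R > 0" "\<And>z. norm z \<ge> R \<Longrightarrow> \<phi> z = 0" using test_functions_support[OF assms] by metis
  have R': "\<And>z. norm z \<ge> R + 1 \<Longrightarrow> grad \<phi> z = 0" using grad_zero_outside[of R \<phi>] R by auto
  obtain B1 where B1: "B1 > 0" "\<And>z. norm (\<phi> z) \<le> B1"
    using bounded_of_compact_support[OF test_functions_continuous[OF assms] R(2)] by metis
  obtain B2 where B2: "B2 > 0" "\<And>z. norm (grad \<phi> z) \<le> B2"
    using bounded_of_compact_support[OF test_functions_grad_continuous[OF assms] R'] by metis
  show ?thesis
    by (rule that[of "max B1 B2" "R + 1"]) (use B1 B2 R R' in \<open>auto simp: le_max_iff_disj\<close>)
qed

text \<open>Mean value theorem along the segment and uniform continuity of the gradient. The point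
  is that d is independent of y, which permits differentiation under an integral.\<close>

lemma test_functions_Taylor:
  fixes \<psi> :: "'a::euclidean_space \<Rightarrow> real"
  assumes "\<psi> \<in> test_functions UNIV" "e > 0"
  obtains d where "d > 0" "\<And>y h. norm h < d \<Longrightarrow> \<bar>\<psi> (y + h) - \<psi> y - h \<bullet> grad \<psi> y\<bar> \<le> e * norm h"
proof -
  obtain R where R: "\<And>z. norm z \<ge> R \<Longrightarrow> grad \<psi> z = 0" using test_functions_bounds[OF assms(1)] by metis
  obtain d where d: "d > 0" "\<And>x y. norm (x - y) < d \<Longrightarrow> norm (grad \<psi> x - grad \<psi> y) < e"
    using uniformly_continuous_of_compact_support[OF test_functions_grad_continuous[OF assms(1)] R assms(2)] by metis
  have "\<bar>\<psi> (y + h) - \<psi> y - h \<bullet> grad \<psi> y\<bar> \<le> e * norm h" if h: "norm h < d" for y h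
  proof -
    have D: "((\<lambda>t. \<psi> (y + t *\<^sub>R h)) has_real_derivative h \<bullet> grad \<psi> (y + t *\<^sub>R h)) (at t)" for t
    proof -
      have "((\<lambda>t. y + t *\<^sub>R h) has_derivative (\<lambda>s. s *\<^sub>R h)) (at t)" by (auto intro!: derivative_eq_intros)
      from has_derivative_compose[OF this test_functions_GDERIV[OF assms(1), unfolded gderiv_def]]
      show ?thesis by (simp add: has_field_derivative_def mult_commute_abs)
    qed
    have "\<exists>z. 0 < z \<and> z < 1 \<and> \<psi> (y + 1 *\<^sub>R h) - \<psi> (y + 0 *\<^sub>R h) = (1 - 0) * (h \<bullet> grad \<psi> (y + z *\<^sub>R h))"
      by (rule MVT2) (use D in auto)
    then obtain t where t: "0 < t" "t < 1" "\<psi> (y + h) - \<psi> y = h \<bullet> grad \<psi> (y + t *\<^sub>R h)" by auto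
    have "\<bar>\<psi> (y + h) - \<psi> y - h \<bullet> grad \<psi> y\<bar> = \<bar>h \<bullet> (grad \<psi> (y + t *\<^sub>R h) - grad \<psi> y)\<bar>"
      unfolding t by (simp add: inner_diff_right)
    also have "\<dots> \<le> norm h * norm (grad \<psi> (y + t *\<^sub>R h) - grad \<psi> y)" by (rule Cauchy_Schwarz_ineq2)
    also have "\<dots> \<le> norm h * e"
    proof (rule mult_left_mono[OF less_imp_le[OF d(2)]])
      have "norm (y + t *\<^sub>R h - y) = t * norm h" using t by simp
      also have "\<dots> \<le> 1 * norm h" using t by (intro mult_right_mono) auto
      finally show "norm (y + t *\<^sub>R h - y) < d" using h by simp
    qed simp
    finally show ?thesis by (simp add: mult.commute)
  qed
  with d(1) show ?thesis by (rule that)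
qed

section \<open>Convolution with test kernels\<close>

definition loc_integrable :: "('a::euclidean_space \<Rightarrow> real) \<Rightarrow> bool" where
  "loc_integrable f \<longleftrightarrow> f \<in> borel_measurable borel \<and> (\<forall>R. integrable lborel (\<lambda>w. indicator (cball 0 R) w * f w))"

lemma loc_integrable_mult:
  fixes g :: "'a::euclidean_space \<Rightarrow> 'b::euclidean_space"
  assumes f: "loc_integrable f" and g: "continuous_on UNIV g" "\<And>z. norm z \<ge> R \<Longrightarrow> g z = 0"
  shows "integrable lborel (\<lambda>w. f w *\<^sub>R g w)"
proof -
  obtain B where B: "B > 0" "\<And>z. norm (g z) \<le> B" using bounded_of_compact_support[OF g] by metis
  have [measurable]: "f \<in> borel_measurable borel" "g \<in> borel_measurable borel"
    using f g by (auto simp: loc_integrable_def intro: borel_measurable_continuous_onI)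
  have "integrable lborel (\<lambda>w. B * (indicator (cball 0 R) w * f w))"
    using f by (intro integrable_mult_right) (auto simp: loc_integrable_def)
  then show ?thesis
  proof (rule Bochner_Integration.integrable_bound)
    show "AE w in lborel. norm (f w *\<^sub>R g w) \<le> norm (B * (indicator (cball 0 R) w * f w))"
    proof (rule AE_I2)
      fix w
      show "norm (f w *\<^sub>R g w) \<le> norm (B * (indicator (cball 0 R) w * f w))"
        using B(1) mult_left_mono[OF B(2)[of w], of "\<bar>f w\<bar>"] g(2)[of w]
        by (cases "norm w \<le> R") (auto simp: indicator_def abs_mult mult_ac)
    qed
  qed simp
qed

definition conv :: "('a::euclidean_space \<Rightarrow> real) \<Rightarrow> ('a \<Rightarrow> real) \<Rightarrow> 'a \<Rightarrow> real" where
  "conv f \<psi> z = (LINT w|lborel. f w * \<psi> (z - w))"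

text \<open>The uniform Taylor remainder of the kernel is integrated against |f| over a ball that
  contains all supports involved.\<close>

lemma conv_GDERIV:
  fixes \<psi> :: "'a::euclidean_space \<Rightarrow> real"
  assumes f: "loc_integrable f" and \<psi>: "\<psi> \<in> test_functions UNIV"
  shows "GDERIV (conv f \<psi>) z :> (LINT w|lborel. f w *\<^sub>R grad \<psi> (z - w))"
proof -
  obtain B R where R: "R > 0" "\<And>z. norm z \<ge> R \<Longrightarrow> \<psi> z = 0" "\<And>z. norm z \<ge> R \<Longrightarrow> grad \<psi> z = 0"
    using test_functions_bounds[OF \<psi>] by metis
  have big: "norm (z - w) \<ge> R" if "norm w \<ge> R + norm z" for z w
    using that norm_triangle_ineq2[of w z] by (simp add: norm_minus_commute)
  have i1: "integrable lborel (\<lambda>w. f w *\<^sub>R \<psi> (z - w))" for z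
    by (rule loc_integrable_mult[OF f, where R="R + norm z"])
      (auto intro!: continuous_on_compose2[OF test_functions_continuous[OF \<psi>, of UNIV]] continuous_intros R big)
  have i2: "integrable lborel (\<lambda>w. f w *\<^sub>R grad \<psi> (z - w))"
    by (rule loc_integrable_mult[OF f, where R="R + norm z"])
      (auto intro!: continuous_on_compose2[OF test_functions_grad_continuous[OF \<psi>, of UNIV]] continuous_intros R big)
  let ?D = "LINT w|lborel. f w *\<^sub>R grad \<psi> (z - w)"
  let ?I = "LINT w|lborel. \<bar>indicator (cball 0 (R + norm z + 1)) w * f w\<bar>"
  have fi: "integrable lborel (\<lambda>w. indicator (cball 0 (R + norm z + 1)) w * f w)"
    using f by (simp add: loc_integrable_def)
  show ?thesis
    unfolding gderiv_def has_derivative_at_alt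
  proof (intro conjI allI impI)
    show "bounded_linear (\<lambda>h. h \<bullet> ?D)" by (rule bounded_linear_inner_left)
    fix e :: real assume e: "e > 0"
    have I: "?I \<ge> 0" by (rule integral_nonneg_AE) simp
    \<comment> \<open>The remainder gets multiplied by the mass of |f| on the ball; the added 1
      avoids a division by zero when f vanishes there.\<close>
    define e' where "e' = e / (?I + 1)"
    have e': "e' > 0" unfolding e'_def using e I by (intro divide_pos_pos add_nonneg_pos) auto
    obtain d where d: "d > 0" "\<And>y h. norm h < d \<Longrightarrow> \<bar>\<psi> (y + h) - \<psi> y - h \<bullet> grad \<psi> y\<bar> \<le> e' * norm h"
      using test_functions_Taylor[OF \<psi> e'] by metis
    show "\<exists>d>0. \<forall>y. norm (y - z) < d \<longrightarrow> norm (conv f \<psi> y - conv f \<psi> z - (y - z) \<bullet> ?D) \<le> e * norm (y - z)"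
    \<comment> \<open>Increments shorter than 1 keep the supports for y and for z inside the ball of
      radius R + |z| + 1.\<close>
    proof (intro exI[of _ "min d 1"] conjI allI impI)
      fix y assume y: "norm (y - z) < min d 1"
      define h where "h = y - z"
      have h: "norm h < d" "norm h < 1" "y = z + h" using y by (auto simp: h_def)
      have "conv f \<psi> y - conv f \<psi> z - h \<bullet> ?D
         = (LINT w|lborel. f w *\<^sub>R \<psi> (y - w) - f w *\<^sub>R \<psi> (z - w) - h \<bullet> (f w *\<^sub>R grad \<psi> (z - w)))"
      proof -
        have "integrable lborel (\<lambda>w. h \<bullet> (f w *\<^sub>R grad \<psi> (z - w)))"
          by (rule integrable_inner_right) (rule i2)
        moreover have "(LINT w|lborel. h \<bullet> (f w *\<^sub>R grad \<psi> (z - w))) = h \<bullet> ?D"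
          by (rule integral_inner_right) (rule i2)
        ultimately show ?thesis
          unfolding conv_def real_scaleR_def[symmetric]
          by (simp only: Bochner_Integration.integral_diff Bochner_Integration.integrable_diff i1)
      qed
      also have "\<bar>\<dots>\<bar> \<le> (LINT w|lborel. e' * norm h * \<bar>indicator (cball 0 (R + norm z + 1)) w * f w\<bar>)"
        unfolding real_norm_def[symmetric]
      proof (rule order_trans[OF integral_norm_bound], rule integral_mono)
        show "integrable lborel (\<lambda>w. norm (f w *\<^sub>R \<psi> (y - w) - f w *\<^sub>R \<psi> (z - w) - h \<bullet> (f w *\<^sub>R grad \<psi> (z - w))))"
          by (intro integrable_norm Bochner_Integration.integrable_diff i1 integrable_inner_right i2)
        show "integrable lborel (\<lambda>w. e' * norm h * norm (indicator (cball 0 (R + norm z + 1)) w * f w))"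
          using fi by (intro integrable_mult_right integrable_norm)
        fix w
        show "norm (f w *\<^sub>R \<psi> (y - w) - f w *\<^sub>R \<psi> (z - w) - h \<bullet> (f w *\<^sub>R grad \<psi> (z - w)))
           \<le> e' * norm h * norm (indicator (cball 0 (R + norm z + 1)) w * f w)"
        proof (cases "norm w \<le> R + norm z + 1")
          case True
          have "norm (f w *\<^sub>R \<psi> (y - w) - f w *\<^sub>R \<psi> (z - w) - h \<bullet> (f w *\<^sub>R grad \<psi> (z - w)))
             = \<bar>f w\<bar> * \<bar>\<psi> (z - w + h) - \<psi> (z - w) - h \<bullet> grad \<psi> (z - w)\<bar>"
            unfolding h(3) by (simp add: abs_mult[symmetric] algebra_simps)
          also have "\<dots> \<le> \<bar>f w\<bar> * (e' * norm h)" by (intro mult_left_mono d(2) h) auto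
          finally show ?thesis using True by (simp add: mult_ac)
        next
          case False
          have "norm y \<le> norm z + norm h" unfolding h(3) by (rule norm_triangle_ineq)
          then have "\<psi> (y - w) = 0" "\<psi> (z - w) = 0" "grad \<psi> (z - w) = 0"
            using False h by (auto intro!: R big)
          then show ?thesis using e' by simp
        qed
      qed
      also have "\<dots> = (e' * ?I) * norm h" by simp
      also have "\<dots> \<le> e * norm h"
      proof -
        have "e / (J + 1) * J \<le> e" if "J \<ge> 0" for J using e that by (simp add: field_simps)
        then show ?thesis unfolding e'_def by (rule mult_right_mono) (use I in auto)
      qed
      finally show "norm (conv f \<psi> y - conv f \<psi> z - (y - z) \<bullet> ?D) \<le> e * norm (y - z)"
        by (simp add: h_def)
    qed (use d in auto)
  qed
qed

text \<open>Every derivative falls on the kernel, and partial derivatives of test functions are test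
  functions again; f itself is never differentiated.\<close>

lemma conv_Ck:
  assumes f: "loc_integrable f" and \<psi>: "\<psi> \<in> test_functions UNIV"
  shows "Ck_on k UNIV (conv f \<psi>)"
  using \<psi>
proof (induction k arbitrary: \<psi>)
  case 0
  then show ?case
    using GDERIV_D[OF conv_GDERIV[OF f]]
    by (auto intro!: continuous_at_imp_continuous_on differentiable_imp_continuous_within)
next
  case (Suc k)
  obtain B R where R: "R > 0" "\<And>z. norm z \<ge> R \<Longrightarrow> grad \<psi> z = 0"
    using test_functions_bounds[OF Suc.prems] by metis
  have big: "norm (z - w) \<ge> R" if "norm w \<ge> R + norm z" for z w
    using that norm_triangle_ineq2[of w z] by (simp add: norm_minus_commute)
  have i2: "integrable lborel (\<lambda>w. f w *\<^sub>R grad \<psi> (z - w))" for z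
    by (rule loc_integrable_mult[OF f, where R="R + norm z"])
      (auto intro!: continuous_on_compose2[OF test_functions_grad_continuous[OF Suc.prems, of UNIV]] continuous_intros R big)
  have "(LINT w|lborel. f w *\<^sub>R grad \<psi> (z - w)) \<bullet> b = conv f (\<lambda>x. grad \<psi> x \<bullet> b) z" for z b
    unfolding conv_def using integral_inner_left[OF i2[of z], of b] by simp
  then show ?case
    by (intro Ck_on_SucI[OF conv_GDERIV[OF f Suc.prems]])
      (simp add: Suc.IH test_functions_partial[OF Suc.prems])
qed

section \<open>Continuity of translations in the mean\<close>

lemma ennreal_tendsto_0I:
  fixes f :: "'a \<Rightarrow> ennreal"
  assumes "\<And>e::real. e > 0 \<Longrightarrow> eventually (\<lambda>x. f x \<le> ennreal e) F"
  shows "(f \<longlongrightarrow> 0) F"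
proof (rule order_tendstoI)
  fix a :: ennreal assume "0 < a"
  then obtain e :: real where e: "0 < e" "ennreal e < a"
    by (metis dense ennreal_cases ennreal_less_zero_iff less_top_ennreal not_less_iff_gr_or_eq order.strict_trans)
  from assms[OF e(1)] show "eventually (\<lambda>x. f x < a) F"
    by eventually_elim (use e in auto)
qed simp

lemma nn_integral_lborel_affine:
  fixes t :: "'a::euclidean_space"
  assumes [measurable]: "f \<in> borel_measurable borel" and c: "c \<noteq> 0"
  shows "(\<integral>\<^sup>+x. f x \<partial>lborel) = ennreal (\<bar>c\<bar> ^ DIM('a)) * (\<integral>\<^sup>+x. f (t + c *\<^sub>R x) \<partial>lborel)"
  by (subst lborel_affine[OF c, of t])
     (simp add: nn_integral_density nn_integral_distr nn_integral_cmult)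

lemma nn_integral_lborel_translate:
  fixes t :: "'a::euclidean_space"
  assumes [measurable]: "f \<in> borel_measurable borel"
  shows "(\<integral>\<^sup>+x. f (x + t) \<partial>lborel) = (\<integral>\<^sup>+x. f x \<partial>lborel)"
  using nn_integral_lborel_affine[OF assms, of 1 t] by (simp add: add.commute)

lemma lborel_integral_affine:
  fixes t :: "'a::euclidean_space" and f :: "'a \<Rightarrow> real"
  assumes [measurable]: "f \<in> borel_measurable borel" and c: "c \<noteq> 0"
  shows "(LINT x|lborel. f x) = \<bar>c\<bar> ^ DIM('a) * (LINT x|lborel. f (t + c *\<^sub>R x))"
  by (subst lborel_affine[OF c, of t])
     (simp add: integral_density integral_distr)

text \<open>Stated for sequences of shifts, so that dominated convergence applies directly.\<close>

definition translation_cont :: "('a::euclidean_space \<Rightarrow> real) \<Rightarrow> bool" where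
  "translation_cont F \<longleftrightarrow> F \<in> borel_measurable borel \<and>
     (\<forall>X. X \<longlonglongrightarrow> 0 \<longrightarrow> (\<lambda>n::nat. \<integral>\<^sup>+z. ennreal \<bar>F (z + X n) - F z\<bar> \<partial>lborel) \<longlonglongrightarrow> 0)"

text \<open>Three-term estimate: the shifted approximation error equals the unshifted one by
  translation invariance, so both outer terms are small uniformly in the shift.\<close>

lemma translation_cont_approx:
  assumes [measurable]: "F \<in> borel_measurable borel"
    and approx: "\<And>e::real. e > 0 \<Longrightarrow> \<exists>g. translation_cont g \<and> (\<integral>\<^sup>+z. ennreal \<bar>F z - g z\<bar> \<partial>lborel) \<le> ennreal e"
  shows "translation_cont F"
  unfolding translation_cont_def
proof (intro conjI allI impI assms(1) ennreal_tendsto_0I)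
  fix X :: "nat \<Rightarrow> 'a" and e :: real assume X: "X \<longlonglongrightarrow> 0" and e: "e > 0"
  obtain g where g: "translation_cont g" "(\<integral>\<^sup>+z. ennreal \<bar>F z - g z\<bar> \<partial>lborel) \<le> ennreal (e / 3)"
    using approx[of "e / 3"] e by auto
  have [measurable]: "g \<in> borel_measurable borel" using g by (simp add: translation_cont_def)
  have "(\<lambda>n. \<integral>\<^sup>+z. ennreal \<bar>g (z + X n) - g z\<bar> \<partial>lborel) \<longlonglongrightarrow> 0"
    using g X by (auto simp: translation_cont_def)
  then have "eventually (\<lambda>n. (\<integral>\<^sup>+z. ennreal \<bar>g (z + X n) - g z\<bar> \<partial>lborel) < ennreal (e / 3)) sequentially"
    by (rule order_tendstoD) (use e in auto)
  then show "eventually (\<lambda>n. (\<integral>\<^sup>+z. ennreal \<bar>F (z + X n) - F z\<bar> \<partial>lborel) \<le> ennreal e) sequentially"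
  proof eventually_elim
    case (elim n)
    have "(\<integral>\<^sup>+z. ennreal \<bar>F (z + X n) - F z\<bar> \<partial>lborel) \<le>
      (\<integral>\<^sup>+z. ennreal \<bar>F (z + X n) - g (z + X n)\<bar> + ennreal \<bar>g (z + X n) - g z\<bar> + ennreal \<bar>F z - g z\<bar> \<partial>lborel)"
      by (intro nn_integral_mono) (auto simp: ennreal_plus[symmetric] simp del: ennreal_plus intro!: ennreal_leI)
    also have "\<dots> = (\<integral>\<^sup>+z. ennreal \<bar>F (z + X n) - g (z + X n)\<bar> \<partial>lborel) + (\<integral>\<^sup>+z. ennreal \<bar>g (z + X n) - g z\<bar> \<partial>lborel) + (\<integral>\<^sup>+z. ennreal \<bar>F z - g z\<bar> \<partial>lborel)"
      by (simp add: nn_integral_add)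
    also have "(\<integral>\<^sup>+z. ennreal \<bar>F (z + X n) - g (z + X n)\<bar> \<partial>lborel) = (\<integral>\<^sup>+z. ennreal \<bar>F z - g z\<bar> \<partial>lborel)"
      by (rule nn_integral_lborel_translate[of "\<lambda>z. ennreal \<bar>F z - g z\<bar>"]) simp
    also have "(\<integral>\<^sup>+z. ennreal \<bar>F z - g z\<bar> \<partial>lborel) + (\<integral>\<^sup>+z. ennreal \<bar>g (z + X n) - g z\<bar> \<partial>lborel) + (\<integral>\<^sup>+z. ennreal \<bar>F z - g z\<bar> \<partial>lborel)
       \<le> ennreal (e / 3) + ennreal (e / 3) + ennreal (e / 3)"
      using g(2) elim by (intro add_mono) auto
    also have "\<dots> = ennreal e" using e by (simp add: ennreal_plus[symmetric] del: ennreal_plus)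
    finally show ?case .
  qed
qed

lemma translation_cont_add:
  assumes "translation_cont F" "translation_cont G"
  shows "translation_cont (\<lambda>z. F z + G z)"
proof -
  have [measurable]: "F \<in> borel_measurable borel" "G \<in> borel_measurable borel"
    using assms by (auto simp: translation_cont_def)
  have "(\<lambda>n. \<integral>\<^sup>+z. ennreal \<bar>F (z + X n) + G (z + X n) - (F z + G z)\<bar> \<partial>lborel) \<longlonglongrightarrow> 0" if X: "X \<longlonglongrightarrow> 0" for X
  proof (rule tendsto_sandwich[OF _ _ tendsto_const])
    show "(\<lambda>n. (\<integral>\<^sup>+z. ennreal \<bar>F (z + X n) - F z\<bar> \<partial>lborel) + (\<integral>\<^sup>+z. ennreal \<bar>G (z + X n) - G z\<bar> \<partial>lborel)) \<longlonglongrightarrow> 0"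
      using tendsto_add[of "\<lambda>n. \<integral>\<^sup>+z. ennreal \<bar>F (z + X n) - F z\<bar> \<partial>lborel" 0 _ "\<lambda>n. \<integral>\<^sup>+z. ennreal \<bar>G (z + X n) - G z\<bar> \<partial>lborel" 0] assms X
      by (auto simp: translation_cont_def)
    show "eventually (\<lambda>n. (\<integral>\<^sup>+z. ennreal \<bar>F (z + X n) + G (z + X n) - (F z + G z)\<bar> \<partial>lborel) \<le>
      (\<integral>\<^sup>+z. ennreal \<bar>F (z + X n) - F z\<bar> \<partial>lborel) + (\<integral>\<^sup>+z. ennreal \<bar>G (z + X n) - G z\<bar> \<partial>lborel)) sequentially"
    proof (intro always_eventually allI)
      fix n
      show "(\<integral>\<^sup>+z. ennreal \<bar>F (z + X n) + G (z + X n) - (F z + G z)\<bar> \<partial>lborel) \<le>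
        (\<integral>\<^sup>+z. ennreal \<bar>F (z + X n) - F z\<bar> \<partial>lborel) + (\<integral>\<^sup>+z. ennreal \<bar>G (z + X n) - G z\<bar> \<partial>lborel)"
        by (subst nn_integral_add[symmetric])
          (auto simp: ennreal_plus[symmetric] simp del: ennreal_plus intro!: ennreal_leI nn_integral_mono)
    qed
  qed auto
  then show ?thesis by (simp add: translation_cont_def)
qed

lemma translation_cont_scale:
  assumes "translation_cont F"
  shows "translation_cont (\<lambda>z. F z * c)"
proof -
  have [measurable]: "F \<in> borel_measurable borel" using assms by (auto simp: translation_cont_def)
  have "(\<lambda>n. \<integral>\<^sup>+z. ennreal \<bar>F (z + X n) * c - F z * c\<bar> \<partial>lborel) \<longlonglongrightarrow> 0" if X: "X \<longlonglongrightarrow> 0" for X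
  proof -
    have "(\<lambda>n. ennreal \<bar>c\<bar> * (\<integral>\<^sup>+z. ennreal \<bar>F (z + X n) - F z\<bar> \<partial>lborel)) \<longlonglongrightarrow> ennreal \<bar>c\<bar> * 0"
      using assms X by (intro ennreal_tendsto_cmult) (auto simp: translation_cont_def)
    moreover have "ennreal \<bar>c\<bar> * (\<integral>\<^sup>+z. ennreal \<bar>F (z + X n) - F z\<bar> \<partial>lborel) = (\<integral>\<^sup>+z. ennreal \<bar>F (z + X n) * c - F z * c\<bar> \<partial>lborel)" for n
      by (subst nn_integral_cmult[symmetric]) (auto simp: ennreal_mult[symmetric] abs_mult[symmetric] algebra_simps intro!: nn_integral_cong)
    ultimately show ?thesis by simp
  qed
  then show ?thesis by (simp add: translation_cont_def)
qed

text \<open>A point of an open set stays in it under small shifts, so the part of U that leaves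
  tends to 0 by dominated convergence. The part that enters has the same mass, because U and its
  translate have equal measure.\<close>

lemma translation_cont_open:
  fixes U :: "'a::euclidean_space set"
  assumes U: "open U" "emeasure lborel U < \<infinity>"
  shows "translation_cont (indicator U)"
  unfolding translation_cont_def
proof (intro conjI allI impI)
  have [measurable]: "U \<in> sets borel" using U by simp
  show "indicator U \<in> borel_measurable (borel :: 'a measure)" by simp
  fix X :: "nat \<Rightarrow> 'a" assume X: "X \<longlonglongrightarrow> 0"
  let ?a = "\<lambda>n z. ennreal (indicator U z * (1 - indicator U (z + X n)))"
  let ?b = "\<lambda>n z. ennreal (indicator U (z + X n) * (1 - indicator U z))"
  let ?m = "\<lambda>n z. ennreal (indicator U z * indicator U (z + X n))"
  have fin: "(\<integral>\<^sup>+z. ennreal (indicator U z) \<partial>lborel) < \<infinity>"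
    using U by (simp add: ennreal_indicator)
  have "(\<lambda>n. \<integral>\<^sup>+z. ?a n z \<partial>lborel) \<longlonglongrightarrow> (\<integral>\<^sup>+z. 0 \<partial>(lborel :: 'a measure))"
  proof (rule nn_integral_dominated_convergence[where w="\<lambda>z. ennreal (indicator U z)"])
    show "AE z in lborel. (\<lambda>n. ?a n z) \<longlonglongrightarrow> 0"
    proof (rule AE_I2)
      fix z :: 'a
      show "(\<lambda>n. ?a n z) \<longlonglongrightarrow> 0"
      proof (cases "z \<in> U")
        case True
        have "(\<lambda>n. z + X n) \<longlonglongrightarrow> z + 0" by (intro tendsto_intros X)
        then have "eventually (\<lambda>n. z + X n \<in> U) sequentially"
          using U(1) True by (intro topological_tendstoD) auto
        then have "eventually (\<lambda>n. ?a n z = 0) sequentially" by eventually_elim simp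
        then show ?thesis by (rule tendsto_eventually)
      qed simp
    qed
  qed (use fin in \<open>auto intro!: ennreal_leI mult_left_le simp: indicator_def\<close>)
  then have a: "(\<lambda>n. \<integral>\<^sup>+z. ?a n z \<partial>lborel) \<longlonglongrightarrow> 0" by simp
  have ab: "(\<integral>\<^sup>+z. ?b n z \<partial>lborel) = (\<integral>\<^sup>+z. ?a n z \<partial>lborel)" for n
  proof -
    \<comment> \<open>Finiteness of the mass of the common part is what allows it to be
      cancelled.\<close>
    have mfin: "(\<integral>\<^sup>+z. ?m n z \<partial>lborel) \<noteq> \<infinity>"
      by (rule order.strict_implies_not_eq, rule le_less_trans[OF nn_integral_mono fin]) (auto simp: indicator_def)
    have "(\<integral>\<^sup>+z. ?a n z \<partial>lborel) + (\<integral>\<^sup>+z. ?m n z \<partial>lborel) = (\<integral>\<^sup>+z. ennreal (indicator U z) \<partial>lborel)"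
      by (subst nn_integral_add[symmetric]) (auto intro!: nn_integral_cong simp: indicator_def)
    also have "\<dots> = (\<integral>\<^sup>+z. ennreal (indicator U (z + X n)) \<partial>lborel)"
      by (rule nn_integral_lborel_translate[symmetric]) simp
    also have "\<dots> = (\<integral>\<^sup>+z. ?b n z \<partial>lborel) + (\<integral>\<^sup>+z. ?m n z \<partial>lborel)"
      by (subst nn_integral_add[symmetric]) (auto intro!: nn_integral_cong simp: indicator_def)
    finally have "(\<integral>\<^sup>+z. ?m n z \<partial>lborel) + (\<integral>\<^sup>+z. ?b n z \<partial>lborel) = (\<integral>\<^sup>+z. ?m n z \<partial>lborel) + (\<integral>\<^sup>+z. ?a n z \<partial>lborel)"
      by (simp only: add.commute)
    then show ?thesis using mfin unfolding ennreal_add_left_cancel by blast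
  qed
  have "(\<integral>\<^sup>+z. ennreal \<bar>indicator U (z + X n) - indicator U z\<bar> \<partial>lborel) = (\<integral>\<^sup>+z. ?a n z \<partial>lborel) + (\<integral>\<^sup>+z. ?b n z \<partial>lborel)" for n
    by (subst nn_integral_add[symmetric]) (auto intro!: nn_integral_cong simp: indicator_def)
  then have "(\<integral>\<^sup>+z. ennreal \<bar>indicator U (z + X n) - indicator U z\<bar> \<partial>lborel) = (\<integral>\<^sup>+z. ?a n z \<partial>lborel) + (\<integral>\<^sup>+z. ?a n z \<partial>lborel)" for n
    by (simp only: ab)
  with tendsto_add[OF a a] show "(\<lambda>n. \<integral>\<^sup>+z. ennreal \<bar>indicator U (z + X n) - indicator U z\<bar> \<partial>lborel) \<longlonglongrightarrow> 0"
    by simp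
qed

text \<open>Induction over integrable functions: sets of finite measure are approximated from
  outside by open sets, and the general case follows from
  \<open>translation_cont_approx\<close>.\<close>

lemma integrable_translation_cont:
  fixes F :: "'a::euclidean_space \<Rightarrow> real"
  assumes "integrable lborel F"
  shows "translation_cont F"
  using assms
proof (induction F rule: integrable_induct)
  case (base A c)
  have A: "A \<in> sets borel" "emeasure lborel A < \<infinity>" using base by auto
  have "translation_cont (indicator A)"
  proof (rule translation_cont_approx)
    show "indicator A \<in> borel_measurable (borel :: 'a measure)" using A by simp
    fix e :: real assume e: "e > 0"
    obtain U where U: "open U" "A \<subseteq> U" "emeasure lebesgue (U - A) < ennreal e"
      using sets_lebesgue_outer_open[of A e] A e by (metis sets_completionI_sets sets_lborel)
    have UA: "emeasure lborel (U - A) < ennreal e" using U A by simp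
    have "emeasure lborel U \<le> emeasure lborel A + emeasure lborel (U - A)"
      using U A by (subst plus_emeasure) (auto simp: Un_absorb1)
    also have "\<dots> < \<infinity>" using A UA by (simp add: less_top[symmetric]) (metis less_irrefl top.not_eq_extremum order.strict_trans)
    finally have "translation_cont (indicator U)" by (intro translation_cont_open U)
    moreover have "(\<integral>\<^sup>+z. ennreal \<bar>indicator A z - indicator U z\<bar> \<partial>lborel) = (\<integral>\<^sup>+z. indicator (U - A) z \<partial>lborel)"
      using U by (intro nn_integral_cong) (auto simp: indicator_def)
    then have "(\<integral>\<^sup>+z. ennreal \<bar>indicator A z - indicator U z\<bar> \<partial>lborel) \<le> ennreal e"
      using UA U A by simp
    ultimately show "\<exists>g. translation_cont g \<and> (\<integral>\<^sup>+z. ennreal \<bar>indicator A z - g z\<bar> \<partial>lborel) \<le> ennreal e" by blast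
  qed
  then show ?case using translation_cont_scale[of "indicator A" c] by simp
next
  case (add f g)
  then show ?case by (intro translation_cont_add)
next
  case (lim f s)
  have [measurable]: "f \<in> borel_measurable borel" "\<And>i. s i \<in> borel_measurable borel" using lim by auto
  have fin: "(\<integral>\<^sup>+z. ennreal (3 * \<bar>f z\<bar>) \<partial>lborel) < \<infinity>"
  proof -
    have "(\<integral>\<^sup>+z. ennreal \<bar>f z\<bar> \<partial>lborel) < \<infinity>" using lim.hyps(4) by (auto simp: integrable_iff_bounded)
    then have "ennreal 3 * (\<integral>\<^sup>+z. ennreal \<bar>f z\<bar> \<partial>lborel) < \<infinity>" by (simp add: ennreal_mult_less_top)
    then show ?thesis by (subst (asm) nn_integral_cmult[symmetric]) (auto simp: ennreal_mult')
  qed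
  have "(\<lambda>i. \<integral>\<^sup>+z. ennreal \<bar>f z - s i z\<bar> \<partial>lborel) \<longlonglongrightarrow> (\<integral>\<^sup>+z. 0 \<partial>(lborel :: 'a measure))"
  proof (rule nn_integral_dominated_convergence[where w="\<lambda>z. ennreal (3 * \<bar>f z\<bar>)"])
    show "AE z in lborel. (\<lambda>i. ennreal \<bar>f z - s i z\<bar>) \<longlonglongrightarrow> 0"
    proof (rule AE_I2)
      fix z
      have "(\<lambda>i. ennreal \<bar>f z - s i z\<bar>) \<longlonglongrightarrow> ennreal \<bar>f z - f z\<bar>"
        by (intro tendsto_intros lim.hyps(2)) auto
      then show "(\<lambda>i. ennreal \<bar>f z - s i z\<bar>) \<longlonglongrightarrow> 0" by simp
    qed
    show "AE z in lborel. ennreal \<bar>f z - s j z\<bar> \<le> ennreal (3 * \<bar>f z\<bar>)" for j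
    proof (rule AE_I2)
      fix z
      show "ennreal \<bar>f z - s j z\<bar> \<le> ennreal (3 * \<bar>f z\<bar>)"
        using lim.hyps(3)[of z j] by (intro ennreal_leI) auto
    qed
  qed (use fin in auto)
  then have L: "(\<lambda>i. \<integral>\<^sup>+z. ennreal \<bar>f z - s i z\<bar> \<partial>lborel) \<longlonglongrightarrow> 0" by simp
  show ?case
  proof (rule translation_cont_approx)
    fix e :: real assume "e > 0"
    then have "eventually (\<lambda>i. (\<integral>\<^sup>+z. ennreal \<bar>f z - s i z\<bar> \<partial>lborel) < ennreal e) sequentially"
      using L by (intro order_tendstoD) auto
    then obtain i where "(\<integral>\<^sup>+z. ennreal \<bar>f z - s i z\<bar> \<partial>lborel) < ennreal e"
      by (auto simp: eventually_sequentially)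
    then show "\<exists>g. translation_cont g \<and> (\<integral>\<^sup>+z. ennreal \<bar>f z - g z\<bar> \<partial>lborel) \<le> ennreal e"
      using lim.IH by (intro exI[of _ "s i"]) auto
  qed simp
qed

text \<open>The substitution \<open>f \<bar>f\<bar>\<close> reduces continuity of translations in \<open>L\<^sup>2\<close> to \<open>L\<^sup>1\<close>.\<close>

lemma square_diff_le: "(a - b)\<^sup>2 \<le> 2 * \<bar>a * \<bar>a\<bar> - b * \<bar>b\<bar>\<bar>" for a b :: real
proof -
  consider "a \<ge> 0" "b \<ge> 0" | "a \<ge> 0" "b \<le> 0" | "a \<le> 0" "b \<ge> 0" | "a \<le> 0" "b \<le> 0" by linarith
  then show ?thesis
  proof cases
    case 1
    have "\<bar>a - b\<bar> * \<bar>a - b\<bar> \<le> \<bar>a - b\<bar> * \<bar>a + b\<bar>" using 1 by (intro mult_left_mono) auto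
    also have "\<dots> = \<bar>a * a - b * b\<bar>" by (simp add: abs_mult[symmetric] algebra_simps)
    also have "\<dots> \<le> 2 * \<bar>a * a - b * b\<bar>" by simp
    finally show ?thesis using 1 by (simp add: power2_eq_square)
  next
    case 2
    have "0 \<le> (a + b)\<^sup>2" by simp
    then have "(a - b)\<^sup>2 \<le> 2 * (a * a + b * b)" by (simp add: power2_eq_square algebra_simps)
    then show ?thesis using 2 by simp
  next
    case 3
    have "0 \<le> (a + b)\<^sup>2" by simp
    then have "(a - b)\<^sup>2 \<le> 2 * (a * a + b * b)" by (simp add: power2_eq_square algebra_simps)
    moreover have "\<bar>- (a * a) - b * b\<bar> = a * a + b * b" by (simp add: abs_if) (smt (verit) zero_le_square)
    ultimately show ?thesis using 3 by simp
  next
    case 4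
    have "\<bar>a - b\<bar> * \<bar>a - b\<bar> \<le> \<bar>a - b\<bar> * \<bar>a + b\<bar>" using 4 by (intro mult_left_mono) auto
    also have "\<dots> = \<bar>a * a - b * b\<bar>" by (simp add: abs_mult[symmetric] algebra_simps)
    also have "\<dots> \<le> 2 * \<bar>a * a - b * b\<bar>" by simp
    finally show ?thesis using 4 by (simp add: power2_eq_square abs_minus_commute)
  qed
qed

text \<open>On balls |f| <= 1 + f^2.\<close>

lemma L2_loc_integrable:
  fixes f :: "'a::euclidean_space \<Rightarrow> real"
  assumes [measurable]: "f \<in> borel_measurable borel" and f2: "integrable lborel (\<lambda>z. (f z)\<^sup>2)"
  shows "loc_integrable f"
  unfolding loc_integrable_def
proof (intro conjI allI assms(1))
  fix R :: real
  have "integrable lborel (\<lambda>w. indicator (cball 0 R) w + (f w)\<^sup>2)"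
    using f2 by (intro Bochner_Integration.integrable_add) (auto intro!: integrable_real_indicator emeasure_bounded_finite)
  then show "integrable lborel (\<lambda>w. indicator (cball 0 R) w * f w)"
  proof (rule Bochner_Integration.integrable_bound)
    show "AE w in lborel. norm (indicator (cball 0 R) w * f w) \<le> norm (indicator (cball 0 R) w + (f w)\<^sup>2)"
    proof (rule AE_I2)
      fix w
      have "0 \<le> (\<bar>f w\<bar> - 1)\<^sup>2 + (1 + (f w)\<^sup>2)" by (intro add_nonneg_nonneg) auto
      then have "\<bar>f w\<bar> \<le> 1 + (f w)\<^sup>2" by (simp add: power2_diff)
      then show "norm (indicator (cball 0 R) w * f w) \<le> norm (indicator (cball 0 R) w + (f w)\<^sup>2)"
        by (auto simp: indicator_def)
    qed
  qed (auto intro!: borel_measurable_times borel_measurable_indicator assms(1))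
qed

section \<open>Mollification in L2\<close>

definition dilate_kernel :: "('a::euclidean_space \<Rightarrow> real) \<Rightarrow> nat \<Rightarrow> 'a \<Rightarrow> real" where
  "dilate_kernel \<kappa> k y = real (Suc k) ^ DIM('a) * \<kappa> (real (Suc k) *\<^sub>R y)"

lemma conv_dilate_kernel:
  fixes f :: "'a::euclidean_space \<Rightarrow> real"
  assumes [measurable]: "f \<in> borel_measurable borel" "\<kappa> \<in> borel_measurable borel"
  shows "conv f (dilate_kernel \<kappa> k) z = (LINT y|lborel. f (z - y /\<^sub>R real (Suc k)) * \<kappa> y)"
proof -
  let ?c = "real (Suc k)"
  have "conv f (dilate_kernel \<kappa> k) z = \<bar>- (1 / ?c)\<bar> ^ DIM('a) *
     (LINT y|lborel. f (z + (- (1 / ?c)) *\<^sub>R y) * dilate_kernel \<kappa> k (z - (z + (- (1 / ?c)) *\<^sub>R y)))"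
    unfolding conv_def by (rule lborel_integral_affine) (auto simp: dilate_kernel_def[abs_def])
  also have "\<dots> = (LINT y|lborel. f (z - y /\<^sub>R ?c) * \<kappa> y)"
  proof -
    have "f (z + (- (1 / ?c)) *\<^sub>R y) * dilate_kernel \<kappa> k (z - (z + (- (1 / ?c)) *\<^sub>R y)) = ?c ^ DIM('a) * (f (z - y /\<^sub>R ?c) * \<kappa> y)" for y
      by (simp add: dilate_kernel_def divide_inverse)
    moreover have "\<bar>- (1 / ?c)\<bar> ^ DIM('a) * ?c ^ DIM('a) = 1"
      by (simp add: power_divide)
    ultimately show ?thesis by (simp only: integral_mult_right_zero) (simp only: mult.assoc[symmetric] mult_1)
  qed
  finally show ?thesis .
qed

text \<open>Since \<kappa> is a probability density, the squared error at z is at most the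
  \<kappa>-average of squared translation differences. Exchanging integrals leaves the average of
  \<omega> at the shifts -y/(k+1), which tends to 0 by dominated convergence.\<close>

lemma mollify_L2:
  fixes f \<kappa> :: "'a::euclidean_space \<Rightarrow> real"
  assumes f [measurable]: "f \<in> borel_measurable borel" and f2: "integrable lborel (\<lambda>z. (f z)\<^sup>2)"
    and \<kappa>: "\<kappa> \<in> test_functions UNIV" "\<And>y. \<kappa> y \<ge> 0" "(LINT y|lborel. \<kappa> y) = 1"
  shows "(\<lambda>k. \<integral>\<^sup>+z. ennreal ((conv f (dilate_kernel \<kappa> k) z - f z)\<^sup>2) \<partial>lborel) \<longlonglongrightarrow> 0"
proof -
  have [measurable]: "\<kappa> \<in> borel_measurable borel"
    using test_functions_continuous[OF \<kappa>(1)] by (rule borel_measurable_continuous_onI)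
  obtain R where R: "R > 0" "\<And>z. norm z \<ge> R \<Longrightarrow> \<kappa> z = 0" using test_functions_support[OF \<kappa>(1)] by metis
  \<comment> \<open>The integral of a non-integrable function is 0 by convention, so total mass 1
    already forces integrability.\<close>
  have \<kappa>i: "integrable lborel \<kappa>"
  proof (rule ccontr)
    assume "\<not> integrable lborel \<kappa>"
    then have "(LINT y|lborel. \<kappa> y) = 0" by (rule not_integrable_integral_eq)
    with \<kappa>(3) show False by simp
  qed
  have \<kappa>n: "(\<integral>\<^sup>+y. ennreal (\<kappa> y) \<partial>lborel) = 1"
    using \<kappa>i \<kappa>(2,3) by (simp add: nn_integral_eq_integral)
  define F where "F z = f z * \<bar>f z\<bar>" for z
  have [measurable]: "F \<in> borel_measurable borel" unfolding F_def[abs_def] by simp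
  have Fi: "integrable lborel F"
    by (rule Bochner_Integration.integrable_bound[OF f2]) (auto simp: F_def abs_mult power2_eq_square)
  have F: "translation_cont F" by (rule integrable_translation_cont[OF Fi])
  define \<omega> where "\<omega> h = (\<integral>\<^sup>+z. ennreal ((f (z + h) - f z)\<^sup>2) \<partial>lborel)" for h
  define I where "I = (\<integral>\<^sup>+z. ennreal \<bar>F z\<bar> \<partial>lborel)"
  have Ifin: "I < \<infinity>" using Fi by (simp add: integrable_iff_bounded I_def)
  have \<omega>F: "\<omega> h \<le> 2 * (\<integral>\<^sup>+z. ennreal \<bar>F (z + h) - F z\<bar> \<partial>lborel)" for h
  proof -
    have "\<omega> h \<le> (\<integral>\<^sup>+z. 2 * ennreal \<bar>F (z + h) - F z\<bar> \<partial>lborel)"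
      unfolding \<omega>_def F_def
    proof (rule nn_integral_mono)
      fix z
      show "ennreal ((f (z + h) - f z)\<^sup>2) \<le> 2 * ennreal \<bar>f (z + h) * \<bar>f (z + h)\<bar> - f z * \<bar>f z\<bar>\<bar>"
        using ennreal_leI[OF square_diff_le[of "f (z + h)" "f z"]] by (simp add: ennreal_mult)
    qed
    then show ?thesis by (simp add: nn_integral_cmult)
  qed
  \<comment> \<open>A bound independent of the shift; times \<kappa> it is the dominating function
    at the end.\<close>
  have \<omega>I: "\<omega> h \<le> 4 * I" for h
  proof -
    have "(\<integral>\<^sup>+z. ennreal \<bar>F (z + h) - F z\<bar> \<partial>lborel) \<le> (\<integral>\<^sup>+z. ennreal \<bar>F (z + h)\<bar> + ennreal \<bar>F z\<bar> \<partial>lborel)"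
      by (intro nn_integral_mono) (auto simp: ennreal_plus[symmetric] simp del: ennreal_plus intro!: ennreal_leI)
    also have "\<dots> = I + I"
      unfolding I_def using nn_integral_lborel_translate[of "\<lambda>z. ennreal \<bar>F z\<bar>" h] by (simp add: nn_integral_add)
    finally have "2 * (\<integral>\<^sup>+z. ennreal \<bar>F (z + h) - F z\<bar> \<partial>lborel) \<le> 2 * (I + I)" by (rule mult_left_mono) simp
    with \<omega>F[of h] have "\<omega> h \<le> 2 * (I + I)" by (rule order_trans)
    also have "2 * (I + I) = 4 * I" by (simp add: distrib_left mult_2[symmetric] mult.assoc[symmetric])
    finally show ?thesis .
  qed
  have \<omega>lim: "(\<lambda>k. \<omega> (X k)) \<longlonglongrightarrow> 0" if "X \<longlonglongrightarrow> 0" for X :: "nat \<Rightarrow> 'a"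
  proof (rule tendsto_sandwich[OF _ _ tendsto_const])
    have "(\<lambda>n. 2 * (\<integral>\<^sup>+z. ennreal \<bar>F (z + X n) - F z\<bar> \<partial>lborel)) \<longlonglongrightarrow> 2 * 0"
      using F that by (intro ennreal_tendsto_cmult) (auto simp: translation_cont_def)
    then show "(\<lambda>n. 2 * (\<integral>\<^sup>+z. ennreal \<bar>F (z + X n) - F z\<bar> \<partial>lborel)) \<longlonglongrightarrow> 0" by simp
  qed (use \<omega>F in auto)
  have [measurable]: "\<omega> \<in> borel_measurable borel"
    unfolding \<omega>_def[abs_def] by measurable
  have floc: "loc_integrable f" by (rule L2_loc_integrable[OF f f2])
  have main: "(\<integral>\<^sup>+z. ennreal ((conv f (dilate_kernel \<kappa> k) z - f z)\<^sup>2) \<partial>lborel) \<le> (\<integral>\<^sup>+y. ennreal (\<kappa> y) * \<omega> (- (y /\<^sub>R real (Suc k))) \<partial>lborel)" for k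
  proof -
    let ?c = "real (Suc k)"
    have "ennreal ((conv f (dilate_kernel \<kappa> k) z - f z)\<^sup>2) \<le> (\<integral>\<^sup>+y. ennreal (\<kappa> y * (f (z - y /\<^sub>R ?c) - f z)\<^sup>2) \<partial>lborel)" for z
    proof -
      let ?g = "\<lambda>y. (f (z - y /\<^sub>R ?c) - f z) * \<kappa> y"
      have i1: "integrable lborel (\<lambda>y. f (z - y /\<^sub>R ?c) * \<kappa> y)"
      proof -
        have "integrable lborel (\<lambda>w. f w *\<^sub>R dilate_kernel \<kappa> k (z - w))"
        proof (rule loc_integrable_mult[OF floc, where R="R + norm z"])
          show "continuous_on UNIV (\<lambda>w. dilate_kernel \<kappa> k (z - w))"
            unfolding dilate_kernel_def[abs_def]
            by (intro continuous_intros continuous_on_compose2[OF test_functions_continuous[OF \<kappa>(1), of UNIV]]) auto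
          show "dilate_kernel \<kappa> k (z - w) = 0" if "R + norm z \<le> norm w" for w
          proof -
            have "R \<le> norm (z - w)" using that norm_triangle_ineq2[of w z] by (simp add: norm_minus_commute)
            also have "\<dots> \<le> ?c * norm (z - w)" using mult_right_mono[of 1 ?c "norm (z - w)"] by simp
            finally show ?thesis using R(2)[of "?c *\<^sub>R (z - w)"] by (simp add: dilate_kernel_def)
          qed
        qed
        then have "integrable (density (distr lborel borel (\<lambda>y. z + (- (1 / ?c)) *\<^sub>R y)) (\<lambda>_. ennreal (\<bar>- (1 / ?c)\<bar> ^ DIM('a)))) (\<lambda>w. f w * dilate_kernel \<kappa> k (z - w))"
          using lborel_affine[of "- (1 / ?c)" z] by simp
        then have "integrable lborel (\<lambda>y. \<bar>- (1 / ?c)\<bar> ^ DIM('a) * (f (z + (- (1 / ?c)) *\<^sub>R y) * dilate_kernel \<kappa> k (z - (z + (- (1 / ?c)) *\<^sub>R y))))"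
          by (subst (asm) integrable_density) (auto simp: integrable_distr_eq dilate_kernel_def[abs_def])
        moreover have "\<bar>- (1 / ?c)\<bar> ^ DIM('a) * ?c ^ DIM('a) = 1"
          by (simp add: power_divide)
        then have "\<bar>- (1 / ?c)\<bar> ^ DIM('a) * (f (z + (- (1 / ?c)) *\<^sub>R y) * dilate_kernel \<kappa> k (z - (z + (- (1 / ?c)) *\<^sub>R y))) = f (z - y /\<^sub>R ?c) * \<kappa> y" for y
          by (simp add: dilate_kernel_def divide_inverse mult.assoc[symmetric])
        ultimately show ?thesis by (simp only:)
      qed
      have "conv f (dilate_kernel \<kappa> k) z - f z = (LINT y|lborel. f (z - y /\<^sub>R ?c) * \<kappa> y) - (LINT y|lborel. f z * \<kappa> y)"
        by (simp add: conv_dilate_kernel \<kappa>(3))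
      also have "\<dots> = (LINT y|lborel. ?g y)"
        using i1 \<kappa>i by (subst Bochner_Integration.integral_diff[symmetric]) (auto simp: left_diff_distrib)
      finally have eq: "conv f (dilate_kernel \<kappa> k) z - f z = (LINT y|lborel. ?g y)" .
      have gi: "integrable lborel ?g"
        using i1 \<kappa>i by (simp add: left_diff_distrib)
      \<comment> \<open>Jensen's inequality in the form of Cauchy-Schwarz: \<kappa> is split into
        two factors sqrt \<kappa>, one of which integrates to 1 after squaring.\<close>
      have "ennreal \<bar>LINT y|lborel. ?g y\<bar> \<le> (\<integral>\<^sup>+y. ennreal \<bar>?g y\<bar> \<partial>lborel)"
        using integral_norm_bound_ennreal[OF gi] by simp
      also have "\<dots> = (\<integral>\<^sup>+y. ennreal (\<bar>f (z - y /\<^sub>R ?c) - f z\<bar> * sqrt (\<kappa> y)) * ennreal (sqrt (\<kappa> y)) \<partial>lborel)"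
        using \<kappa>(2) by (intro nn_integral_cong) (simp add: ennreal_mult[symmetric] abs_mult mult.assoc)
      finally have "(ennreal \<bar>LINT y|lborel. ?g y\<bar>)\<^sup>2 \<le> (\<integral>\<^sup>+y. ennreal (\<bar>f (z - y /\<^sub>R ?c) - f z\<bar> * sqrt (\<kappa> y)) * ennreal (sqrt (\<kappa> y)) \<partial>lborel)\<^sup>2"
        by (intro power_mono) auto
      also have "\<dots> \<le> (\<integral>\<^sup>+y. (ennreal (\<bar>f (z - y /\<^sub>R ?c) - f z\<bar> * sqrt (\<kappa> y)))\<^sup>2 \<partial>lborel) * (\<integral>\<^sup>+y. (ennreal (sqrt (\<kappa> y)))\<^sup>2 \<partial>lborel)"
        by (rule Cauchy_Schwarz_nn_integral) auto
      also have "(\<integral>\<^sup>+y. (ennreal (sqrt (\<kappa> y)))\<^sup>2 \<partial>lborel) = 1"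
        using \<kappa>(2) \<kappa>n by (simp add: ennreal_power)
      also have "(\<integral>\<^sup>+y. (ennreal (\<bar>f (z - y /\<^sub>R ?c) - f z\<bar> * sqrt (\<kappa> y)))\<^sup>2 \<partial>lborel) = (\<integral>\<^sup>+y. ennreal (\<kappa> y * (f (z - y /\<^sub>R ?c) - f z)\<^sup>2) \<partial>lborel)"
        using \<kappa>(2) by (intro nn_integral_cong) (simp add: ennreal_power power_mult_distrib mult.commute)
      finally show ?thesis unfolding eq by (simp add: ennreal_power)
    qed
    then have "(\<integral>\<^sup>+z. ennreal ((conv f (dilate_kernel \<kappa> k) z - f z)\<^sup>2) \<partial>lborel) \<le>
       (\<integral>\<^sup>+z. (\<integral>\<^sup>+y. ennreal (\<kappa> y * (f (z - y /\<^sub>R ?c) - f z)\<^sup>2) \<partial>lborel) \<partial>lborel)"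
      by (intro nn_integral_mono)
    also have "\<dots> = (\<integral>\<^sup>+y. (\<integral>\<^sup>+z. ennreal (\<kappa> y * (f (z - y /\<^sub>R ?c) - f z)\<^sup>2) \<partial>lborel) \<partial>lborel)"
      by (rule lborel_pair.Fubini') simp
    also have "\<dots> = (\<integral>\<^sup>+y. ennreal (\<kappa> y) * \<omega> (- (y /\<^sub>R ?c)) \<partial>lborel)"
      unfolding \<omega>_def using \<kappa>(2)
      by (intro nn_integral_cong) (simp add: ennreal_mult nn_integral_cmult)
    finally show ?thesis .
  qed
  have "(\<lambda>k. \<integral>\<^sup>+y. ennreal (\<kappa> y) * \<omega> (- (y /\<^sub>R real (Suc k))) \<partial>lborel) \<longlonglongrightarrow> (\<integral>\<^sup>+y. 0 \<partial>(lborel :: 'a measure))"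
  proof (rule nn_integral_dominated_convergence[where w="\<lambda>y. ennreal (\<kappa> y) * (4 * I)"])
    show "(\<integral>\<^sup>+y. ennreal (\<kappa> y) * (4 * I) \<partial>lborel) < \<infinity>"
      using Ifin by (simp add: nn_integral_multc \<kappa>n ennreal_mult_less_top)
    show "AE y in lborel. ennreal (\<kappa> y) * \<omega> (- (y /\<^sub>R real (Suc j))) \<le> ennreal (\<kappa> y) * (4 * I)" for j
      by (intro AE_I2 mult_left_mono \<omega>I) auto
    show "AE y in lborel. (\<lambda>k. ennreal (\<kappa> y) * \<omega> (- (y /\<^sub>R real (Suc k)))) \<longlonglongrightarrow> 0"
    proof (rule AE_I2)
      fix y :: 'a
      have "(\<lambda>k. - ((1 / real (Suc k)) *\<^sub>R y)) \<longlonglongrightarrow> - (0 *\<^sub>R y)"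
        by (intro tendsto_intros LIMSEQ_Suc lim_const_over_n)
      then have "(\<lambda>k. - (y /\<^sub>R real (Suc k))) \<longlonglongrightarrow> 0" by (simp add: divide_inverse)
      then have "(\<lambda>k. ennreal (\<kappa> y) * \<omega> (- (y /\<^sub>R real (Suc k)))) \<longlonglongrightarrow> ennreal (\<kappa> y) * 0"
        by (intro ennreal_tendsto_cmult \<omega>lim) auto
      then show "(\<lambda>k. ennreal (\<kappa> y) * \<omega> (- (y /\<^sub>R real (Suc k)))) \<longlonglongrightarrow> 0" by simp
    qed
  qed auto
  then have "(\<lambda>k. \<integral>\<^sup>+y. ennreal (\<kappa> y) * \<omega> (- (y /\<^sub>R real (Suc k))) \<partial>lborel) \<longlonglongrightarrow> 0" by simp
  from tendsto_sandwich[OF _ _ tendsto_const this] show ?thesis using main by simp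
qed

section \<open>Passing between Lebesgue measure on an open set and Borel functions on the whole
  space\<close>

lemma lebesgue_on_borel_rep:
  fixes f :: "'a::euclidean_space \<Rightarrow> real"
  assumes \<Omega>: "open \<Omega>" and f: "f \<in> borel_measurable (lebesgue_on \<Omega>)"
  obtains f0 where "f0 \<in> borel_measurable borel" "\<And>x. x \<notin> \<Omega> \<Longrightarrow> f0 x = 0" "AE x in lborel. x \<in> \<Omega> \<longrightarrow> f x = f0 x"
proof -
  have \<Omega>m: "\<Omega> \<in> sets lebesgue" "\<Omega> \<in> sets borel" using \<Omega> by auto
  have "(\<lambda>x. if x \<in> \<Omega> then f x else 0) \<in> borel_measurable lebesgue"
    using f by (rule borel_measurable_if_I[OF _ \<Omega>m(1)])
  from completion_ex_borel_measurable_real[OF this] obtain g where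
    g: "g \<in> borel_measurable lborel" "AE x in lborel. (if x \<in> \<Omega> then f x else 0) = g x" by blast
  show ?thesis
  proof (rule that)
    show "(\<lambda>x. indicator \<Omega> x * g x) \<in> borel_measurable borel" using g(1) \<Omega>m by simp
    show "AE x in lborel. x \<in> \<Omega> \<longrightarrow> f x = indicator \<Omega> x * g x"
      using g(2) by eventually_elim (auto simp: indicator_def)
  qed auto
qed

lemma nn_integral_lebesgue_on_eq:
  fixes \<Omega> :: "'a::euclidean_space set"
  assumes \<Omega>: "open \<Omega>" and eq: "AE x in lborel. x \<in> \<Omega> \<longrightarrow> f x = f0 x" and "\<And>x. x \<notin> \<Omega> \<Longrightarrow> f0 x = 0"
  shows "(\<integral>\<^sup>+x. f x \<partial>lebesgue_on \<Omega>) = (\<integral>\<^sup>+x. f0 x \<partial>lborel)"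
proof -
  have "(\<integral>\<^sup>+x. f x \<partial>lebesgue_on \<Omega>) = (\<integral>\<^sup>+x. f x * indicator \<Omega> x \<partial>lebesgue)"
    using \<Omega> by (intro nn_integral_restrict_space) auto
  also have "\<dots> = (\<integral>\<^sup>+x. f x * indicator \<Omega> x \<partial>lborel)" by (rule nn_integral_completion)
  also have "\<dots> = (\<integral>\<^sup>+x. f0 x \<partial>lborel)"
    by (rule nn_integral_cong_AE) (use eq in eventually_elim, use assms(3) in \<open>auto simp: indicator_def\<close>)
  finally show ?thesis .
qed

lemma nn_integral_lebesgue_on_le:
  fixes \<Omega> :: "'a::euclidean_space set"
  assumes \<Omega>: "open \<Omega>" and le: "AE x in lborel. x \<in> \<Omega> \<longrightarrow> f x \<le> f0 x"
  shows "(\<integral>\<^sup>+x. f x \<partial>lebesgue_on \<Omega>) \<le> (\<integral>\<^sup>+x. f0 x \<partial>lborel)"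
proof -
  have "(\<integral>\<^sup>+x. f x \<partial>lebesgue_on \<Omega>) = (\<integral>\<^sup>+x. f x * indicator \<Omega> x \<partial>lebesgue)"
    using \<Omega> by (intro nn_integral_restrict_space) auto
  also have "\<dots> = (\<integral>\<^sup>+x. f x * indicator \<Omega> x \<partial>lborel)" by (rule nn_integral_completion)
  also have "\<dots> \<le> (\<integral>\<^sup>+x. f0 x \<partial>lborel)"
    by (rule nn_integral_mono_AE) (use le in eventually_elim, auto simp: indicator_def)
  finally show ?thesis .
qed

lemma integral_lebesgue_on_eq:
  fixes f f0 :: "'a::euclidean_space \<Rightarrow> real"
  assumes \<Omega>: "open \<Omega>" and f: "f \<in> borel_measurable (lebesgue_on \<Omega>)" and f0 [measurable]: "f0 \<in> borel_measurable borel"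
    and eq: "AE x in lborel. x \<in> \<Omega> \<longrightarrow> f x = f0 x" and z: "\<And>x. x \<notin> \<Omega> \<Longrightarrow> f0 x = 0"
  shows "(LINT x|lebesgue_on \<Omega>. f x) = (LINT x|lborel. f0 x)"
proof -
  have \<Omega>m: "\<Omega> \<in> sets lebesgue" using \<Omega> by auto
  have "(LINT x|lebesgue_on \<Omega>. f x) = (LINT x|lebesgue. indicator \<Omega> x *\<^sub>R f x)"
    by (rule integral_restrict_space) (use \<Omega>m in auto)
  also have "\<dots> = (LINT x|lebesgue. f0 x)"
  proof (rule integral_cong_AE)
    have "(\<lambda>x. if x \<in> \<Omega> then f x else 0) \<in> borel_measurable lebesgue"
      using f by (rule borel_measurable_if_I[OF _ \<Omega>m(1)])
    moreover have "(\<lambda>x. if x \<in> \<Omega> then f x else 0) = (\<lambda>x. indicator \<Omega> x *\<^sub>R f x)" by (auto simp: indicator_def)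
    ultimately show "(\<lambda>x. indicator \<Omega> x *\<^sub>R f x) \<in> borel_measurable lebesgue" by simp
    show "f0 \<in> borel_measurable lebesgue" using f0 by (simp add: measurable_completion)
    have "AE x in lborel. indicator \<Omega> x *\<^sub>R f x = f0 x"
      using eq by eventually_elim (auto simp: indicator_def z)
    then show "AE x in lebesgue. indicator \<Omega> x *\<^sub>R f x = f0 x" by (rule AE_completion)
  qed
  also have "\<dots> = (LINT x|lborel. f0 x)" using f0 by (intro integral_completion) simp
  finally show ?thesis .
qed

lemma borel_measurable_lebesgue_on:
  "f \<in> borel_measurable borel \<Longrightarrow> f \<in> borel_measurable (lebesgue_on \<Omega>)"
  by (intro measurable_restrict_space1 measurable_completion) simp

text \<open>A Bochner integral that does not exist is 0 by convention, and so is the real value of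
  an infinite integral; hence no integrability has to be checked for individual k.\<close>

lemma integral_tendsto_0:
  fixes h :: "nat \<Rightarrow> 'a \<Rightarrow> real"
  assumes "\<And>k. h k \<in> borel_measurable M" "\<And>k x. h k x \<ge> 0" "(\<lambda>k. \<integral>\<^sup>+x. ennreal (h k x) \<partial>M) \<longlonglongrightarrow> 0"
  shows "(\<lambda>k. LINT x|M. h k x) \<longlonglongrightarrow> 0"
proof -
  have "(\<lambda>k. enn2real (\<integral>\<^sup>+x. ennreal (h k x) \<partial>M)) \<longlonglongrightarrow> 0"
    using assms(3) by (intro tendsto_enn2real) auto
  moreover have "enn2real (\<integral>\<^sup>+x. ennreal (h k x) \<partial>M) = (LINT x|M. h k x)" for k
    using assms by (intro integral_eq_nn_integral[symmetric]) auto
  ultimately show ?thesis by simp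
qed

section \<open>Mollifying kernels and cutoff functions\<close>

lemma bump_le: "bump z \<le> bump 0"
  by (auto simp: bump_def flat_exp_def divide_simps)

lemma bump_integrable: "integrable lborel (bump :: 'a::euclidean_space \<Rightarrow> real)"
proof -
  have "loc_integrable (\<lambda>_::'a. 1)"
    by (auto simp: loc_integrable_def intro!: integrable_real_indicator emeasure_bounded_finite)
  from loc_integrable_mult[OF this test_functions_continuous[OF bump_test] bump_zero]
  show ?thesis by simp
qed

lemma bump_integral: "0 < integral\<^sup>L lborel (bump :: 'a::euclidean_space \<Rightarrow> real)"
proof -
  have "integral\<^sup>L lborel (bump :: 'a \<Rightarrow> real) \<noteq> 0"
  proof
    assume "integral\<^sup>L lborel (bump :: 'a \<Rightarrow> real) = 0"
    then have "AE z in lborel. bump (z :: 'a) = 0"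
      using integral_nonneg_eq_0_iff_AE[OF bump_integrable] bump_nonneg by auto
    then have "AE z in lborel. (z :: 'a) \<notin> ball 0 1"
    proof eventually_elim
      case (elim z)
      show ?case
      proof
        assume "z \<in> ball 0 1"
        then have "z \<bullet> z < 1" by (simp add: dot_square_norm abs_square_less_1)
        with elim show False by (simp add: bump_def flat_exp_def)
      qed
    qed
    then have "emeasure lborel (ball (0::'a) 1) = 0"
      by (subst (asm) AE_iff_measurable[of "ball 0 1"]) auto
    then show False using content_ball_pos[of 1 "0::'a"] by (simp add: measure_def)
  qed
  moreover have "integral\<^sup>L lborel (bump :: 'a \<Rightarrow> real) \<ge> 0" by (intro integral_nonneg_AE) (simp add: bump_nonneg)
  ultimately show ?thesis by simp
qed

text \<open>The support lies in the unit ball around -e. In a convolution the argument z - y/(k+1)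
  then moves from z by a small multiple of a vector within distance 1 of e, which is a direction
  pointing into the domain.\<close>

definition shifted_bump :: "'a::euclidean_space \<Rightarrow> 'a \<Rightarrow> real" where
  "shifted_bump e y = bump (y + e) * (1 / integral\<^sup>L lborel (bump :: 'a \<Rightarrow> real))"

lemma shifted_bump:
  fixes e :: "'a::euclidean_space"
  shows "shifted_bump e \<in> test_functions UNIV" "shifted_bump e y \<ge> 0" "(LINT y|lborel. shifted_bump e y) = 1"
    "norm (y + e) \<ge> 1 \<Longrightarrow> shifted_bump e y = 0"
proof -
  have b [measurable]: "(bump :: 'a \<Rightarrow> real) \<in> borel_measurable borel"
    using test_functions_continuous[OF bump_test] by (rule borel_measurable_continuous_onI)
  have "(\<lambda>y. bump (1 *\<^sub>R y + e) * (1 / integral\<^sup>L lborel (bump :: 'a \<Rightarrow> real))) \<in> test_functions UNIV"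
    by (intro test_functions_mult test_functions_affine bump_test Ck_on_const) auto
  then show "shifted_bump e \<in> test_functions UNIV" by (simp add: shifted_bump_def[abs_def])
  show "shifted_bump e y \<ge> 0" using bump_nonneg[of "y + e"] bump_integral[where 'a='a] by (simp add: shifted_bump_def)
  have "(LINT y|lborel. bump (y + e)) = (LINT y|lborel. bump (y :: 'a))"
    using lborel_integral_affine[OF b, of 1 e] by (simp add: add.commute)
  then show "(LINT y|lborel. shifted_bump e y) = 1"
    using bump_integral[where 'a='a] by (simp add: shifted_bump_def)
qed (simp add: shifted_bump_def bump_zero)

lemma dilate_kernel_test:
  fixes \<kappa> :: "'a::euclidean_space \<Rightarrow> real"
  assumes "\<kappa> \<in> test_functions UNIV"
  shows "dilate_kernel \<kappa> k \<in> test_functions UNIV"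
proof -
  have "(\<lambda>y. \<kappa> (real (Suc k) *\<^sub>R y + 0) * real (Suc k) ^ DIM('a)) \<in> test_functions UNIV"
    by (intro test_functions_mult test_functions_affine assms Ck_on_const) auto
  then show ?thesis by (simp add: dilate_kernel_def[abs_def] mult.commute)
qed

lemma bump_zero_pos: "0 < bump (0 :: 'a::euclidean_space)"
  by (rule bump_0)

definition cutoff :: "nat \<Rightarrow> 'a::euclidean_space \<Rightarrow> real" where
  "cutoff k z = bump ((1 / real (Suc k)) *\<^sub>R z) * (1 / bump (0::'a))"

lemma cutoff_test: "cutoff k \<in> test_functions (UNIV :: 'a::euclidean_space set)"
proof -
  have "(\<lambda>z::'a. bump ((1 / real (Suc k)) *\<^sub>R z + 0) * (1 / bump (0::'a))) \<in> test_functions UNIV"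
    by (intro test_functions_mult test_functions_affine bump_test Ck_on_const) auto
  then show ?thesis by (simp add: cutoff_def[abs_def])
qed

lemma cutoff_bounds: "0 \<le> cutoff k z" "cutoff k z \<le> 1"
  using bump_nonneg[of "(1 / real (Suc k)) *\<^sub>R z"] bump_le[of "(1 / real (Suc k)) *\<^sub>R z"] bump_zero_pos[where 'a='a]
  by (auto simp: cutoff_def)

lemma cutoff_tendsto: "(\<lambda>k. cutoff k z) \<longlonglongrightarrow> 1"
proof -
  have "(\<lambda>k. (1 / real (Suc k)) *\<^sub>R z) \<longlonglongrightarrow> 0 *\<^sub>R z"
    by (intro tendsto_intros LIMSEQ_Suc lim_const_over_n)
  then have "(\<lambda>k. bump ((1 / real (Suc k)) *\<^sub>R z)) \<longlonglongrightarrow> bump (0 *\<^sub>R z)"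
    by (rule continuous_on_tendsto_compose[OF test_functions_continuous[OF bump_test, of UNIV]]) auto
  then have "(\<lambda>k. bump ((1 / real (Suc k)) *\<^sub>R z) * (1 / bump (0::'a))) \<longlonglongrightarrow> bump (0 *\<^sub>R z) * (1 / bump (0::'a))"
    by (intro tendsto_intros)
  then show ?thesis using bump_zero_pos[where 'a='a] by (simp add: cutoff_def)
qed

text \<open>Dilation by k + 1 divides the gradient by k + 1; the decay makes the commutator term
  vanish in the density argument.\<close>

lemma cutoff_grad_bound:
  obtains B where "B > 0" "\<And>k z. norm (grad (cutoff k) (z :: 'a::euclidean_space)) \<le> B / real (Suc k)"
proof -
  obtain B where B: "B > 0" "\<And>z::'a. norm (grad bump z) \<le> B"
    using test_functions_bounds[OF bump_test] by metis
  have "norm (grad (cutoff k) z) \<le> (B / bump (0::'a)) / real (Suc k)" for k and z :: 'a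
  proof -
    have "GDERIV (\<lambda>z. bump ((1 / real (Suc k)) *\<^sub>R z + 0)) z :> (1 / real (Suc k)) *\<^sub>R grad bump ((1 / real (Suc k)) *\<^sub>R z + 0)"
      by (intro GDERIV_affine test_functions_GDERIV[OF bump_test])
    from GDERIV_mult[OF this GDERIV_const[of "1 / bump (0::'a)"]]
    have "grad (cutoff k) z = (1 / bump (0::'a)) *\<^sub>R ((1 / real (Suc k)) *\<^sub>R grad bump ((1 / real (Suc k)) *\<^sub>R z))"
      by (intro grad_eqI) (simp add: cutoff_def[abs_def])
    then show ?thesis
      using B(2)[of "(1 / real (Suc k)) *\<^sub>R z"] bump_zero_pos[where 'a='a] by (simp add: divide_simps)
  qed
  moreover have "B / bump (0::'a) > 0" using B bump_zero_pos[where 'a='a] by simp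
  ultimately show ?thesis by (rule that[rotated])
qed

lemma cutoff_L2:
  fixes f :: "'a::euclidean_space \<Rightarrow> real"
  assumes [measurable]: "f \<in> borel_measurable borel" and f2: "integrable lborel (\<lambda>z. (f z)\<^sup>2)"
  shows "(\<lambda>k. \<integral>\<^sup>+z. ennreal (((cutoff k z - 1) * f z)\<^sup>2) \<partial>lborel) \<longlonglongrightarrow> 0"
proof -
  have [measurable]: "(cutoff k :: 'a \<Rightarrow> real) \<in> borel_measurable borel" for k
    using test_functions_continuous[OF cutoff_test] by (rule borel_measurable_continuous_onI)
  have "(\<lambda>k. \<integral>\<^sup>+z. ennreal (((cutoff k z - 1) * f z)\<^sup>2) \<partial>lborel) \<longlonglongrightarrow> (\<integral>\<^sup>+z. 0 \<partial>(lborel :: 'a measure))"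
  proof (rule nn_integral_dominated_convergence[where w="\<lambda>z. ennreal ((f z)\<^sup>2)"])
    show "(\<integral>\<^sup>+z. ennreal ((f z)\<^sup>2) \<partial>lborel) < \<infinity>"
      using f2 by (simp add: integrable_iff_bounded)
    show "AE z in lborel. ennreal (((cutoff j z - 1) * f z)\<^sup>2) \<le> ennreal ((f z)\<^sup>2)" for j
    proof (rule AE_I2, rule ennreal_leI)
      fix z :: 'a
      have "(cutoff j z - 1)\<^sup>2 \<le> 1" using cutoff_bounds[of j z] by (simp add: abs_square_le_1)
      then show "((cutoff j z - 1) * f z)\<^sup>2 \<le> (f z)\<^sup>2"
        by (simp add: power_mult_distrib mult_left_le_one_le)
    qed
    show "AE z in lborel. (\<lambda>k. ennreal (((cutoff k z - 1) * f z)\<^sup>2)) \<longlonglongrightarrow> 0"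
    proof (rule AE_I2)
      fix z :: 'a
      have "(\<lambda>k. ennreal (((cutoff k z - 1) * f z)\<^sup>2)) \<longlonglongrightarrow> ennreal (((1 - 1) * f z)\<^sup>2)"
        by (intro tendsto_intros cutoff_tendsto)
      then show "(\<lambda>k. ennreal (((cutoff k z - 1) * f z)\<^sup>2)) \<longlonglongrightarrow> 0" by simp
    qed
  qed auto
  then show ?thesis by simp
qed

section \<open>Density of test functions in the Sobolev space of a domain with a uniform inner cone
  of directions\<close>

context
  fixes \<Omega> :: "'a::euclidean_space set" and e :: 'a and u :: "'a \<Rightarrow> real" and g :: "'a \<Rightarrow> 'a"
  assumes \<Omega>: "open \<Omega>"
    and cone: "\<And>z y c. z \<in> \<Omega> \<Longrightarrow> norm (y - e) \<le> 1 \<Longrightarrow> c > 0 \<Longrightarrow> z + c *\<^sub>R y \<in> \<Omega>"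
    and u: "sq_integrable (lebesgue_on \<Omega>) u" and g: "is_weak_grad \<Omega> u g"
begin

text \<open>For z in \<Omega> the reflected and translated kernel is a test function of \<Omega>,
  because its support is z plus a small multiple of the unit ball around e. So the definition of the
  weak gradient applies; its minus sign cancels the one from the reflection.\<close>

lemma conv_weak_grad:
  assumes f0: "f0 \<in> borel_measurable borel" "\<And>x. x \<notin> \<Omega> \<Longrightarrow> f0 x = 0" "AE x in lborel. x \<in> \<Omega> \<longrightarrow> u x = f0 x"
    and g0: "g0 \<in> borel_measurable borel" "\<And>x. x \<notin> \<Omega> \<Longrightarrow> g0 x = 0" "AE x in lborel. x \<in> \<Omega> \<longrightarrow> g x \<bullet> b = g0 x"
    and loc: "loc_integrable f0" and b: "b \<in> Basis" and z: "z \<in> \<Omega>"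
  shows "grad (conv f0 (dilate_kernel (shifted_bump e) k)) z \<bullet> b = conv g0 (dilate_kernel (shifted_bump e) k) z"
proof -
  define \<psi> where "\<psi> = dilate_kernel (shifted_bump e) k"
  have \<psi>: "\<psi> \<in> test_functions UNIV" unfolding \<psi>_def by (intro dilate_kernel_test shifted_bump)
  define \<phi> where "\<phi> w = \<psi> ((-1) *\<^sub>R w + z)" for w
  let ?c = "real (Suc k)"
  have \<phi>: "\<phi> \<in> test_functions \<Omega>"
  proof (rule test_functionsI[where S="cball (z + (1 / ?c) *\<^sub>R e) (1 / ?c)"])
    show "Ck_on j UNIV \<phi>" for j
      unfolding \<phi>_def by (intro Ck_on_affine test_functions_Ck[OF \<psi>])
    show "\<phi> w = 0" if "w \<notin> cball (z + (1 / ?c) *\<^sub>R e) (1 / ?c)" for w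
    proof -
      have "1 / ?c < norm (z + (1 / ?c) *\<^sub>R e - w)" using that by (simp add: dist_norm)
      then have "?c * (1 / ?c) < ?c * norm (z + (1 / ?c) *\<^sub>R e - w)" by (intro mult_strict_left_mono) auto
      then have "1 < norm (?c *\<^sub>R (z + (1 / ?c) *\<^sub>R e - w))" by simp
      also have "?c *\<^sub>R (z + (1 / ?c) *\<^sub>R e - w) = ?c *\<^sub>R ((-1) *\<^sub>R w + z) + e"
        by (simp add: scaleR_add_right scaleR_diff_right)
      finally show ?thesis unfolding \<phi>_def \<psi>_def dilate_kernel_def using shifted_bump(4)[of "?c *\<^sub>R ((-1) *\<^sub>R w + z)" e] by simp
    qed
    \<comment> \<open>Each point of this ball is z + (1/?c) y with |y - e| <= 1, which is the form
      required by the assumption \<open>cone\<close>.\<close>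
    show "cball (z + (1 / ?c) *\<^sub>R e) (1 / ?c) \<subseteq> \<Omega>"
    proof
      fix w assume "w \<in> cball (z + (1 / ?c) *\<^sub>R e) (1 / ?c)"
      then have "norm (w - z - (1 / ?c) *\<^sub>R e) \<le> 1 / ?c"
        by (simp add: dist_norm norm_minus_commute algebra_simps)
      then have "?c * norm (w - z - (1 / ?c) *\<^sub>R e) \<le> ?c * (1 / ?c)" by (intro mult_left_mono) auto
      then have "norm (?c *\<^sub>R (w - z - (1 / ?c) *\<^sub>R e)) \<le> 1" by simp
      then have "norm (?c *\<^sub>R (w - z) - e) \<le> 1" by (simp add: scaleR_diff_right)
      from cone[OF z this, of "1 / ?c"] show "w \<in> \<Omega>" by simp
    qed
  qed auto
  have grad\<phi>: "grad \<phi> w = - grad \<psi> (z - w)" for w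
  proof -
    have "GDERIV \<phi> w :> (-1) *\<^sub>R grad \<psi> ((-1) *\<^sub>R w + z)"
      unfolding \<phi>_def[abs_def] by (intro GDERIV_affine test_functions_GDERIV[OF \<psi>])
    from grad_eqI[OF this] show ?thesis by simp
  qed
  have um: "u \<in> borel_measurable (lebesgue_on \<Omega>)" using u by (simp add: sq_integrable_def)
  have gm: "(\<lambda>w. g w \<bullet> b) \<in> borel_measurable (lebesgue_on \<Omega>)"
    using g by (intro borel_measurable_inner) (auto simp: is_weak_grad_def sq_integrable_def)
  have c1: "(\<lambda>w. grad \<psi> (z - w) \<bullet> b) \<in> borel_measurable borel"
    by (intro borel_measurable_continuous_onI continuous_intros continuous_on_compose2[OF test_functions_grad_continuous[OF \<psi>, of UNIV]]) auto
  have c2: "(\<lambda>w. \<psi> (z - w)) \<in> borel_measurable borel"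
    by (intro borel_measurable_continuous_onI continuous_intros continuous_on_compose2[OF test_functions_continuous[OF \<psi>, of UNIV]]) auto
  obtain B R where R: "R > 0" "\<And>z. norm z \<ge> R \<Longrightarrow> grad \<psi> z = 0"
    using test_functions_bounds[OF \<psi>] by metis
  have big: "norm (z - w) \<ge> R" if "norm w \<ge> R + norm z" for w
    using that norm_triangle_ineq2[of w z] by (simp add: norm_minus_commute)
  have i2: "integrable lborel (\<lambda>w. f0 w *\<^sub>R grad \<psi> (z - w))"
    by (rule loc_integrable_mult[OF loc, where R="R + norm z"])
      (auto intro!: continuous_on_compose2[OF test_functions_grad_continuous[OF \<psi>, of UNIV]] continuous_intros R big)
  have "grad (conv f0 \<psi>) z \<bullet> b = (LINT w|lborel. f0 w *\<^sub>R grad \<psi> (z - w)) \<bullet> b"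
    using grad_eqI[OF conv_GDERIV[OF loc \<psi>]] by simp
  also have "\<dots> = (LINT w|lborel. f0 w * (grad \<psi> (z - w) \<bullet> b))"
    using integral_inner_left[OF i2, of b] by simp
  also have "\<dots> = (LINT w|lebesgue_on \<Omega>. u w * (grad \<psi> (z - w) \<bullet> b))"
  proof (rule integral_lebesgue_on_eq[OF \<Omega>, symmetric])
    show "(\<lambda>w. u w * (grad \<psi> (z - w) \<bullet> b)) \<in> borel_measurable (lebesgue_on \<Omega>)"
      by (intro borel_measurable_times um borel_measurable_lebesgue_on c1)
    show "AE x in lborel. x \<in> \<Omega> \<longrightarrow> u x * (grad \<psi> (z - x) \<bullet> b) = f0 x * (grad \<psi> (z - x) \<bullet> b)"
      using f0(3) by eventually_elim auto
  qed (use f0 c1 in auto)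
  also have "\<dots> = - (LINT w|lebesgue_on \<Omega>. u w * (grad \<phi> w \<bullet> b))"
    by (simp add: grad\<phi>)
  also have "\<dots> = (LINT w|lebesgue_on \<Omega>. (g w \<bullet> b) * \<phi> w)"
    using g \<phi> b by (simp add: is_weak_grad_def)
  also have "\<dots> = (LINT w|lborel. g0 w * \<psi> (z - w))"
  proof (rule integral_lebesgue_on_eq[OF \<Omega>])
    show "(\<lambda>w. g w \<bullet> b * \<phi> w) \<in> borel_measurable (lebesgue_on \<Omega>)"
      using c2 by (intro borel_measurable_times gm borel_measurable_lebesgue_on) (simp add: \<phi>_def)
    show "AE x in lborel. x \<in> \<Omega> \<longrightarrow> g x \<bullet> b * \<phi> x = g0 x * \<psi> (z - x)"
      using g0(3) by eventually_elim (auto simp: \<phi>_def)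
  qed (use g0 c2 in auto)
  finally show ?thesis by (simp add: \<psi>_def conv_def)
qed

text \<open>Mollify the extension of u by zero, then multiply by a cutoff. The extension may jump
  across the boundary, but for points of \<Omega> the shifted kernel only sees values inside
  \<Omega>.\<close>

lemma W12_density:
  obtains v :: "nat \<Rightarrow> 'a \<Rightarrow> real" where "\<And>k. v k \<in> test_functions UNIV"
    "(\<lambda>k. LINT x|lebesgue_on \<Omega>. (v k x - u x)\<^sup>2) \<longlonglongrightarrow> 0"
    "(\<lambda>k. LINT x|lebesgue_on \<Omega>. (norm (grad (v k) x - g x))\<^sup>2) \<longlonglongrightarrow> 0"
proof -
  have um: "u \<in> borel_measurable (lebesgue_on \<Omega>)" and u2: "integrable (lebesgue_on \<Omega>) (\<lambda>x. (u x)\<^sup>2)"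
    using u by (auto simp: sq_integrable_def)
  have gm: "g \<in> borel_measurable (lebesgue_on \<Omega>)" and g2: "integrable (lebesgue_on \<Omega>) (\<lambda>x. (norm (g x))\<^sup>2)"
    using g by (auto simp: is_weak_grad_def sq_integrable_def)
  have gbm: "(\<lambda>x. g x \<bullet> b) \<in> borel_measurable (lebesgue_on \<Omega>)" for b
    using gm by (intro borel_measurable_inner) auto
  have L2: "integrable lborel (\<lambda>x. (f0 x)\<^sup>2)"
    if f: "integrable (lebesgue_on \<Omega>) (\<lambda>x. (f x)\<^sup>2)" and f0: "f0 \<in> borel_measurable borel" "\<And>x. x \<notin> \<Omega> \<Longrightarrow> f0 x = 0" "AE x in lborel. x \<in> \<Omega> \<longrightarrow> f x = f0 x"
    for f f0 :: "'a \<Rightarrow> real"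
  proof -
    have "(\<integral>\<^sup>+x. ennreal ((f x)\<^sup>2) \<partial>lebesgue_on \<Omega>) = (\<integral>\<^sup>+x. ennreal ((f0 x)\<^sup>2) \<partial>lborel)"
      by (rule nn_integral_lebesgue_on_eq[OF \<Omega>]) (use f0(3) in eventually_elim, use f0 in auto)
    then show ?thesis using f f0(1) by (simp add: integrable_iff_bounded)
  qed
  obtain f0 where f0: "f0 \<in> borel_measurable borel" "\<And>x. x \<notin> \<Omega> \<Longrightarrow> f0 x = 0" "AE x in lborel. x \<in> \<Omega> \<longrightarrow> u x = f0 x"
    using lebesgue_on_borel_rep[OF \<Omega> um] by metis
  note f02 = L2[OF u2 f0]
  have "\<forall>b. \<exists>g0. g0 \<in> borel_measurable borel \<and> (\<forall>x. x \<notin> \<Omega> \<longrightarrow> g0 x = 0) \<and> (AE x in lborel. x \<in> \<Omega> \<longrightarrow> g x \<bullet> b = g0 x)"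
    using lebesgue_on_borel_rep[OF \<Omega> gbm] by metis
  then obtain g0 where g0: "\<And>b. g0 b \<in> borel_measurable borel" "\<And>b x. x \<notin> \<Omega> \<Longrightarrow> g0 b x = 0" "\<And>b. AE x in lborel. x \<in> \<Omega> \<longrightarrow> g x \<bullet> b = g0 b x"
    by metis
  have gb2: "integrable (lebesgue_on \<Omega>) (\<lambda>x. (g x \<bullet> b)\<^sup>2)" if "b \<in> Basis" for b
  proof (rule Bochner_Integration.integrable_bound[OF g2])
    show "AE x in lebesgue_on \<Omega>. norm ((g x \<bullet> b)\<^sup>2) \<le> norm ((norm (g x))\<^sup>2)"
      using Basis_le_norm[OF that] by (intro AE_I2) (simp add: abs_le_square_iff[symmetric])
  qed (use gbm in auto)
  note g02 = L2[OF gb2 g0]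
  define \<psi> where "\<psi> k = dilate_kernel (shifted_bump e) k" for k
  have \<psi>: "\<psi> k \<in> test_functions UNIV" for k unfolding \<psi>_def by (intro dilate_kernel_test shifted_bump)
  have loc: "loc_integrable f0" by (rule L2_loc_integrable[OF f0(1) f02])
  define F where "F k = conv f0 (\<psi> k)" for k
  have FC: "Ck_on j UNIV (F k)" for j k unfolding F_def by (rule conv_Ck[OF loc \<psi>])
  define v where "v k z = cutoff k z * F k z" for k z
  have v: "v k \<in> test_functions UNIV" for k
    unfolding v_def by (intro test_functions_mult cutoff_test FC)
  have [measurable]: "F k \<in> borel_measurable borel" for k
    using FC[of 0 k] by (simp add: borel_measurable_continuous_onI)
  have [measurable]: "(cutoff k :: 'a \<Rightarrow> real) \<in> borel_measurable borel" for k
    using test_functions_continuous[OF cutoff_test] by (rule borel_measurable_continuous_onI)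
  have [measurable]: "conv (g0 b) (\<psi> k) \<in> borel_measurable borel" if "b \<in> Basis" for b k
    using conv_Ck[OF L2_loc_integrable[OF g0(1) g02[OF that]] \<psi>, of 0 k] by (simp add: borel_measurable_continuous_onI)
  note [measurable] = f0(1) g0(1)
  obtain B where B: "B > 0" "\<And>k z. norm (grad (cutoff k) (z :: 'a)) \<le> B / real (Suc k)"
    by (rule cutoff_grad_bound) blast
  have gradv: "grad (v k) z = cutoff k z *\<^sub>R grad (F k) z + F k z *\<^sub>R grad (cutoff k) z" for k z
  proof -
    have "GDERIV (F k) z :> grad (F k) z" using FC[of "Suc 0" k] by (intro GDERIV_grad) auto
    from GDERIV_mult[OF test_functions_GDERIV[OF cutoff_test] this]
    show ?thesis unfolding v_def[abs_def] by (intro grad_eqI) simp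
  qed
  let ?m = "\<lambda>f k. \<integral>\<^sup>+z. ennreal ((conv f (\<psi> k) z - f z)\<^sup>2) \<partial>lborel"
  let ?c = "\<lambda>f k. \<integral>\<^sup>+z. ennreal (((cutoff k z - 1) * f z)\<^sup>2) \<partial>lborel"
  have m: "?m f \<longlonglongrightarrow> 0" if "f \<in> borel_measurable borel" "integrable lborel (\<lambda>z. (f z)\<^sup>2)" for f
    unfolding \<psi>_def by (rule mollify_L2[OF that shifted_bump(1-3)])
  have cc: "?c f \<longlonglongrightarrow> 0" if "f \<in> borel_measurable borel" "integrable lborel (\<lambda>z. (f z)\<^sup>2)" for f
    by (rule cutoff_L2[OF that])
  have sq3: "(p + q + r)\<^sup>2 \<le> 3 * (p\<^sup>2 + q\<^sup>2 + r\<^sup>2)" for p q r :: real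
  proof -
    have "0 \<le> (p - q)\<^sup>2 + (q - r)\<^sup>2 + (p - r)\<^sup>2" by simp
    then show ?thesis by (simp add: power2_eq_square algebra_simps)
  qed
  \<comment> \<open>The final estimate of the three error terms, isolated as a statement on real
    numbers: mollification, cutoff of the limit, and derivative of the cutoff.\<close>
  have arith: "S \<le> 3 * p' + 3 * q + 3 * 2 * X * Y"
    if "S \<le> 3 * (p + q + r)" "r \<le> 2 * X * Y" "p \<le> p'" for S p p' q r X Y :: real
  proof -
    have "S \<le> 3 * p' + 3 * q + 3 * Z" if "r \<le> Z" for Z
      using \<open>S \<le> 3 * (p + q + r)\<close> \<open>p \<le> p'\<close> that by argo
    from this[OF that(2)] show ?thesis by (simp only: mult.assoc)
  qed
  have cut: "(cutoff k z * x)\<^sup>2 \<le> x\<^sup>2" for k x and z :: 'a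
    unfolding power_mult_distrib using cutoff_bounds[of k z]
    by (intro mult_left_le_one_le) (auto simp: abs_square_le_1)
  have lim1: "(\<lambda>k. LINT x|lebesgue_on \<Omega>. (v k x - u x)\<^sup>2) \<longlonglongrightarrow> 0"
  proof (rule integral_tendsto_0)
    show "(\<lambda>x. (v k x - u x)\<^sup>2) \<in> borel_measurable (lebesgue_on \<Omega>)" for k
      by (intro borel_measurable_power borel_measurable_diff um borel_measurable_lebesgue_on) (simp add: v_def[abs_def])
    have le: "(\<integral>\<^sup>+x. ennreal ((v k x - u x)\<^sup>2) \<partial>lebesgue_on \<Omega>) \<le> 3 * ?m f0 k + 3 * ?c f0 k" for k
    proof -
      have "(\<integral>\<^sup>+x. ennreal ((v k x - u x)\<^sup>2) \<partial>lebesgue_on \<Omega>) \<le>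
        (\<integral>\<^sup>+z. ennreal 3 * ennreal ((F k z - f0 z)\<^sup>2) + ennreal 3 * ennreal (((cutoff k z - 1) * f0 z)\<^sup>2) \<partial>lborel)"
      proof (rule nn_integral_lebesgue_on_le[OF \<Omega>])
        show "AE z in lborel. z \<in> \<Omega> \<longrightarrow> ennreal ((v k z - u z)\<^sup>2) \<le> ennreal 3 * ennreal ((F k z - f0 z)\<^sup>2) + ennreal 3 * ennreal (((cutoff k z - 1) * f0 z)\<^sup>2)"
          using f0(3)
        proof (eventually_elim, intro impI)
          fix z assume "z \<in> \<Omega> \<longrightarrow> u z = f0 z" "z \<in> \<Omega>"
          then have "v k z - u z = cutoff k z * (F k z - f0 z) + (cutoff k z - 1) * f0 z + 0"
            by (simp add: v_def algebra_simps)
          then have "(v k z - u z)\<^sup>2 \<le> 3 * ((cutoff k z * (F k z - f0 z))\<^sup>2 + ((cutoff k z - 1) * f0 z)\<^sup>2 + 0\<^sup>2)"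
            by (simp only: sq3)
          also have "\<dots> \<le> 3 * (F k z - f0 z)\<^sup>2 + 3 * ((cutoff k z - 1) * f0 z)\<^sup>2"
            using cut[of k z "F k z - f0 z"] by simp
          finally show "ennreal ((v k z - u z)\<^sup>2) \<le> ennreal 3 * ennreal ((F k z - f0 z)\<^sup>2) + ennreal 3 * ennreal (((cutoff k z - 1) * f0 z)\<^sup>2)"
            by (simp add: ennreal_mult[symmetric] ennreal_plus[symmetric] ennreal_leI del: ennreal_plus ennreal_numeral)
        qed
      qed
      then show ?thesis by (simp add: nn_integral_add nn_integral_cmult flip: F_def)
    qed
    have "(\<lambda>k. 3 * ?m f0 k + 3 * ?c f0 k) \<longlonglongrightarrow> 3 * 0 + 3 * 0"
      by (intro tendsto_add ennreal_tendsto_cmult m cc f0 f02) auto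
    then have "(\<lambda>k. 3 * ?m f0 k + 3 * ?c f0 k) \<longlonglongrightarrow> 0" by simp
    from tendsto_sandwich[OF _ _ tendsto_const this] le
    show "(\<lambda>k. \<integral>\<^sup>+x. ennreal ((v k x - u x)\<^sup>2) \<partial>lebesgue_on \<Omega>) \<longlonglongrightarrow> 0" by simp
  qed auto
  define E where "E b k = (\<integral>\<^sup>+x. ennreal (((grad (v k) x - g x) \<bullet> b)\<^sup>2) \<partial>lebesgue_on \<Omega>)" for b k
  have E: "(\<lambda>k. E b k) \<longlonglongrightarrow> 0" if b: "b \<in> Basis" for b
  proof -
    let ?B = "\<lambda>k. ennreal (3 * 2 * (B / real (Suc k))\<^sup>2)"
    have [measurable]: "conv (g0 b) (\<psi> k) \<in> borel_measurable borel" for k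
      using conv_Ck[OF L2_loc_integrable[OF g0(1) g02[OF that]] \<psi>, of 0 k] by (simp add: borel_measurable_continuous_onI)
    have le: "E b k \<le> 3 * ?m (g0 b) k + 3 * ?c (g0 b) k + ?B k * (?m f0 k + (\<integral>\<^sup>+z. ennreal ((f0 z)\<^sup>2) \<partial>lborel))" for k
    proof -
      have "E b k \<le> (\<integral>\<^sup>+z. ennreal 3 * ennreal ((conv (g0 b) (\<psi> k) z - g0 b z)\<^sup>2) + ennreal 3 * ennreal (((cutoff k z - 1) * g0 b z)\<^sup>2)
          + ?B k * (ennreal ((F k z - f0 z)\<^sup>2) + ennreal ((f0 z)\<^sup>2)) \<partial>lborel)"
        unfolding E_def
      proof (rule nn_integral_lebesgue_on_le[OF \<Omega>])
        show "AE z in lborel. z \<in> \<Omega> \<longrightarrow> ennreal (((grad (v k) z - g z) \<bullet> b)\<^sup>2) \<le>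
          ennreal 3 * ennreal ((conv (g0 b) (\<psi> k) z - g0 b z)\<^sup>2) + ennreal 3 * ennreal (((cutoff k z - 1) * g0 b z)\<^sup>2)
          + ?B k * (ennreal ((F k z - f0 z)\<^sup>2) + ennreal ((f0 z)\<^sup>2))"
          using g0(3)[of b]
        proof (eventually_elim, intro impI)
          fix z assume z: "z \<in> \<Omega> \<longrightarrow> g z \<bullet> b = g0 b z" "z \<in> \<Omega>"
          have Fb: "grad (F k) z \<bullet> b = conv (g0 b) (\<psi> k) z"
            unfolding F_def \<psi>_def by (rule conv_weak_grad[OF f0 g0 loc b z(2)])
          let ?r = "F k z * (grad (cutoff k) z \<bullet> b)"
          have "(grad (v k) z - g z) \<bullet> b = cutoff k z * (conv (g0 b) (\<psi> k) z - g0 b z) + (cutoff k z - 1) * g0 b z + ?r"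
            using z Fb by (simp add: gradv inner_add_left inner_diff_left algebra_simps)
          then have "((grad (v k) z - g z) \<bullet> b)\<^sup>2 \<le> 3 * ((cutoff k z * (conv (g0 b) (\<psi> k) z - g0 b z))\<^sup>2 + ((cutoff k z - 1) * g0 b z)\<^sup>2 + ?r\<^sup>2)"
            by (simp only: sq3)
          \<comment> \<open>The mollified function F is bounded but not small; it is compared with
            f0, and the decay comes from the gradient of the cutoff alone.\<close>
          moreover have "?r\<^sup>2 \<le> 2 * (B / real (Suc k))\<^sup>2 * ((F k z - f0 z)\<^sup>2 + (f0 z)\<^sup>2)"
          proof -
            have "\<bar>grad (cutoff k) z \<bullet> b\<bar> \<le> B / real (Suc k)"
              using Basis_le_norm[OF b] B(2) by (rule order_trans)
            then have "(grad (cutoff k) z \<bullet> b)\<^sup>2 \<le> (B / real (Suc k))\<^sup>2"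
              by (rule sqrt_le_D[OF order_trans[OF eq_refl[OF real_sqrt_abs]]])
            moreover have "(F k z)\<^sup>2 \<le> 2 * ((F k z - f0 z)\<^sup>2 + (f0 z)\<^sup>2)"
            proof -
              have "0 \<le> (F k z - 2 * f0 z)\<^sup>2" by simp
              then show ?thesis by (simp add: power2_eq_square algebra_simps)
            qed
            ultimately have "(F k z)\<^sup>2 * (grad (cutoff k) z \<bullet> b)\<^sup>2 \<le> 2 * ((F k z - f0 z)\<^sup>2 + (f0 z)\<^sup>2) * (B / real (Suc k))\<^sup>2"
              by (intro mult_mono) auto
            then show ?thesis by (simp only: power_mult_distrib mult_ac)
          qed
          ultimately have "((grad (v k) z - g z) \<bullet> b)\<^sup>2 \<le> 3 * (conv (g0 b) (\<psi> k) z - g0 b z)\<^sup>2 + 3 * ((cutoff k z - 1) * g0 b z)\<^sup>2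
             + 3 * 2 * (B / real (Suc k))\<^sup>2 * ((F k z - f0 z)\<^sup>2 + (f0 z)\<^sup>2)"
            using cut[of k z "conv (g0 b) (\<psi> k) z - g0 b z"] by (rule arith)
          then show "ennreal (((grad (v k) z - g z) \<bullet> b)\<^sup>2) \<le>
            ennreal 3 * ennreal ((conv (g0 b) (\<psi> k) z - g0 b z)\<^sup>2) + ennreal 3 * ennreal (((cutoff k z - 1) * g0 b z)\<^sup>2)
            + ?B k * (ennreal ((F k z - f0 z)\<^sup>2) + ennreal ((f0 z)\<^sup>2))"
            by (simp add: ennreal_mult[symmetric] ennreal_plus[symmetric] ennreal_leI del: ennreal_plus ennreal_numeral)
        qed
      qed
      also have "\<dots> = 3 * ?m (g0 b) k + 3 * ?c (g0 b) k + ?B k * (?m f0 k + (\<integral>\<^sup>+z. ennreal ((f0 z)\<^sup>2) \<partial>lborel))"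
        by (simp add: nn_integral_add nn_integral_cmult flip: F_def)
      finally show ?thesis .
    qed
    have fin: "(\<integral>\<^sup>+z. ennreal ((f0 z)\<^sup>2) \<partial>lborel) < \<infinity>" using f02 by (simp add: integrable_iff_bounded)
    have Bl: "?B \<longlonglongrightarrow> 0"
    proof -
      have "(\<lambda>k. 3 * 2 * (B / real (Suc k))\<^sup>2) \<longlonglongrightarrow> 3 * 2 * 0\<^sup>2"
        by (intro tendsto_intros LIMSEQ_Suc lim_const_over_n)
      then have "?B \<longlonglongrightarrow> ennreal (3 * 2 * 0\<^sup>2)" by (rule tendsto_ennrealI)
      then show ?thesis by simp
    qed
    have "(\<lambda>k. ?B k * (?m f0 k + (\<integral>\<^sup>+z. ennreal ((f0 z)\<^sup>2) \<partial>lborel))) \<longlonglongrightarrow> 0 * (0 + (\<integral>\<^sup>+z. ennreal ((f0 z)\<^sup>2) \<partial>lborel))"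
      by (intro tendsto_mult_ennreal Bl tendsto_add m f0 f02 tendsto_const) (use fin in auto)
    then have "(\<lambda>k. 3 * ?m (g0 b) k + 3 * ?c (g0 b) k + ?B k * (?m f0 k + (\<integral>\<^sup>+z. ennreal ((f0 z)\<^sup>2) \<partial>lborel))) \<longlonglongrightarrow> 3 * 0 + 3 * 0 + 0 * (0 + (\<integral>\<^sup>+z. ennreal ((f0 z)\<^sup>2) \<partial>lborel))"
      by (intro tendsto_add ennreal_tendsto_cmult m cc g0 g02[OF b]) auto
    then have "(\<lambda>k. 3 * ?m (g0 b) k + 3 * ?c (g0 b) k + ?B k * (?m f0 k + (\<integral>\<^sup>+z. ennreal ((f0 z)\<^sup>2) \<partial>lborel))) \<longlonglongrightarrow> 0" by simp
    from tendsto_sandwich[OF _ _ tendsto_const this] le show ?thesis by simp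
  qed
  have gvm: "(\<lambda>x. grad (v k) x - g x) \<in> borel_measurable (lebesgue_on \<Omega>)" for k
    by (intro borel_measurable_diff gm borel_measurable_lebesgue_on borel_measurable_continuous_onI test_functions_grad_continuous[OF v])
  have lim2: "(\<lambda>k. LINT x|lebesgue_on \<Omega>. (norm (grad (v k) x - g x))\<^sup>2) \<longlonglongrightarrow> 0"
  proof (rule integral_tendsto_0)
    show "(\<lambda>x. (norm (grad (v k) x - g x))\<^sup>2) \<in> borel_measurable (lebesgue_on \<Omega>)" for k
      using gvm by (intro borel_measurable_power borel_measurable_norm) auto
    have "(\<lambda>k. \<Sum>b\<in>Basis. E b k) \<longlonglongrightarrow> (\<Sum>b\<in>(Basis::'a set). 0)" by (intro tendsto_sum E)
    moreover have "(\<Sum>b\<in>Basis. E b k) = (\<integral>\<^sup>+x. ennreal ((norm (grad (v k) x - g x))\<^sup>2) \<partial>lebesgue_on \<Omega>)" for k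
    proof -
      have "(norm x)\<^sup>2 = (\<Sum>b\<in>Basis. (x \<bullet> b)\<^sup>2)" for x :: 'a
        unfolding norm_eq_sqrt_inner euclidean_inner[of x x] by (simp add: power2_eq_square sum_nonneg)
      then have "(\<integral>\<^sup>+x. ennreal ((norm (grad (v k) x - g x))\<^sup>2) \<partial>lebesgue_on \<Omega>) = (\<integral>\<^sup>+x. (\<Sum>b\<in>Basis. ennreal (((grad (v k) x - g x) \<bullet> b)\<^sup>2)) \<partial>lebesgue_on \<Omega>)"
        by (simp add: sum_ennreal)
      also have "\<dots> = (\<Sum>b\<in>Basis. E b k)"
        unfolding E_def using gvm[of k]
        by (intro nn_integral_sum measurable_compose[OF _ measurable_ennreal] borel_measurable_power borel_measurable_inner) auto
      finally show ?thesis by simp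
    qed
    ultimately show "(\<lambda>k. \<integral>\<^sup>+x. ennreal ((norm (grad (v k) x - g x))\<^sup>2) \<partial>lebesgue_on \<Omega>) \<longlonglongrightarrow> 0" by simp
  qed auto
  from v lim1 lim2 show ?thesis by (rule that)
qed

end

section \<open>Finsler norms and their duals\<close>

text \<open>The sublinearity, size and duality properties of the two norms on which the later
  estimates rest. One constant L bounds both norms from above.\<close>

locale norm_pair =
  fixes H H0 :: "'a::euclidean_space \<Rightarrow> real" and l L :: real
  assumes l: "0 < l" and L: "0 < L"
    and H_nonneg: "0 \<le> H \<xi>" and H_le: "H \<xi> \<le> L * norm \<xi>"
    and H_triangle: "H (\<xi> + \<eta>) \<le> H \<xi> + H \<eta>"
    and H0_scale: "H0 (c *\<^sub>R x) = \<bar>c\<bar> * H0 x"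
    and H0_ge: "l * norm x \<le> H0 x" and H0_le: "H0 x \<le> L * norm x"
    and H0_triangle: "H0 (x + y) \<le> H0 x + H0 y"
    and duality: "\<xi> \<bullet> x \<le> H \<xi> * H0 x"
begin

lemma H0_nonneg: "0 \<le> H0 x"
  using H0_ge[of x] l by (meson mult_nonneg_nonneg norm_ge_zero less_imp_le order_trans)

lemma H0_zero [simp]: "H0 0 = 0"
  using H0_scale[of 0 0] by simp

lemma H0_pos: "x \<noteq> 0 \<Longrightarrow> 0 < H0 x"
  using H0_ge[of x] l by (smt (verit) mult_pos_pos zero_less_norm_iff)

lemma sublinear_lipschitz:
  fixes f :: "'a \<Rightarrow> real"
  assumes "\<And>x y. f (x + y) \<le> f x + f y" "\<And>x. f x \<le> L * norm x"
  shows "\<bar>f x - f y\<bar> \<le> L * norm (x - y)"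
proof -
  have "f x \<le> f (x - y) + f y" "f y \<le> f (y - x) + f x"
    using assms(1)[of "x - y" y] assms(1)[of "y - x" x] by simp_all
  with assms(2)[of "x - y"] assms(2)[of "y - x"] show ?thesis by (simp add: norm_minus_commute)
qed

lemmas H_lipschitz = sublinear_lipschitz[of H, OF H_triangle H_le]
lemmas H0_lipschitz = sublinear_lipschitz[of H0, OF H0_triangle H0_le]

lemma lipschitz_continuous:
  fixes f :: "'a \<Rightarrow> real"
  assumes "\<And>x y. \<bar>f x - f y\<bar> \<le> L * norm (x - y)"
  shows "continuous_on UNIV f"
proof (rule continuous_on_iff[THEN iffD2], intro ballI allI impI)
  fix x and e :: real assume "e > 0"
  then show "\<exists>d>0. \<forall>x'\<in>UNIV. dist x' x < d \<longrightarrow> dist (f x') (f x) < e"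
    using L assms by (intro exI[of _ "e / L"])
      (auto simp: dist_real_def dist_norm field_simps intro: le_less_trans)
qed

lemma continuous_H: "continuous_on UNIV H" by (rule lipschitz_continuous[OF H_lipschitz])
lemma continuous_H0: "continuous_on UNIV H0" by (rule lipschitz_continuous[OF H0_lipschitz])

lemma measurable_H [measurable]: "H \<in> borel_measurable borel"
  and measurable_H0 [measurable]: "H0 \<in> borel_measurable borel"
  using continuous_H continuous_H0 by (simp_all add: borel_measurable_continuous_onI)

end

section \<open>The dual of a Finsler norm\<close>

context
  fixes H :: "'a::euclidean_space \<Rightarrow> real" and \<gamma>1 \<gamma>2 :: real
  assumes fin: "finsler_norm H" and g12: "0 < \<gamma>1" "\<gamma>1 \<le> \<gamma>2"
    and bnd: "\<And>\<xi>. \<gamma>1 * norm \<xi> \<le> H \<xi>" "\<And>\<xi>. H \<xi> \<le> \<gamma>2 * norm \<xi>"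
begin

lemma finsler_scale: "H (c *\<^sub>R \<xi>) = \<bar>c\<bar> * H \<xi>"
  using fin by (simp add: finsler_norm_def)

lemma finsler_pos: "\<xi> \<noteq> 0 \<Longrightarrow> 0 < H \<xi>"
  using bnd(1)[of \<xi>] g12 by (smt (verit) mult_pos_pos zero_less_norm_iff)

lemma finsler_nonneg: "0 \<le> H \<xi>"
  using fin by (simp add: finsler_norm_def)

lemma finsler_triangle: "H (\<xi> + \<eta>) \<le> H \<xi> + H \<eta>"
proof -
  have "convex_on UNIV H" using fin by (simp add: finsler_norm_def)
  then have "H ((1 - 1/2) *\<^sub>R (2 *\<^sub>R \<xi>) + (1/2) *\<^sub>R (2 *\<^sub>R \<eta>)) \<le> (1 - 1/2) * H (2 *\<^sub>R \<xi>) + (1/2) * H (2 *\<^sub>R \<eta>)"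
    by (intro convex_onD) auto
  then show ?thesis by (simp add: finsler_scale)
qed

lemma dual_norm_bdd: "bdd_above ((\<lambda>\<xi>. (\<xi> \<bullet> x) / H \<xi>) ` (- {0}))"
proof (rule bdd_aboveI2)
  fix \<xi> :: 'a assume "\<xi> \<in> - {0}"
  then have p: "0 < norm \<xi>" "0 < H \<xi>" using finsler_pos by auto
  have "\<xi> \<bullet> x \<le> norm \<xi> * norm x" by (rule norm_cauchy_schwarz)
  also have "\<dots> \<le> (H \<xi> / \<gamma>1) * norm x"
    using bnd(1)[of \<xi>] g12 by (intro mult_right_mono) (auto simp: field_simps)
  finally show "(\<xi> \<bullet> x) / H \<xi> \<le> norm x / \<gamma>1" using p g12 by (simp add: field_simps)
qed

lemma compl_zero_ne: "- {0 :: 'a} \<noteq> {}"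
proof -
  have "(SOME b. b \<in> Basis) \<noteq> (0 :: 'a)" using SOME_Basis nonzero_Basis by blast
  then show ?thesis by auto
qed

lemma dual_norm_duality: "\<xi> \<bullet> x \<le> H \<xi> * dual_norm H x"
proof (cases "\<xi> = 0")
  case False
  then have "(\<xi> \<bullet> x) / H \<xi> \<le> dual_norm H x"
    unfolding dual_norm_def by (intro cSUP_upper dual_norm_bdd) auto
  with finsler_pos[OF False] show ?thesis by (simp add: field_simps)
next
  case True
  then show ?thesis using finsler_scale[of 0 0] by simp
qed

lemma dual_norm_leI:
  assumes "\<And>\<xi>. \<xi> \<bullet> x \<le> H \<xi> * B"
  shows "dual_norm H x \<le> B"
  unfolding dual_norm_def
proof (rule cSUP_least[OF compl_zero_ne])
  fix \<xi> :: 'a assume "\<xi> \<in> - {0}"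
  then have "0 < H \<xi>" using finsler_pos by auto
  with assms[of \<xi>] show "(\<xi> \<bullet> x) / H \<xi> \<le> B" by (simp add: field_simps)
qed

lemma dual_norm_le: "dual_norm H x \<le> norm x / \<gamma>1"
proof (rule dual_norm_leI)
  fix \<xi>
  have "\<xi> \<bullet> x \<le> norm \<xi> * norm x" by (rule norm_cauchy_schwarz)
  also have "\<dots> \<le> (H \<xi> / \<gamma>1) * norm x"
    using bnd(1)[of \<xi>] g12 by (intro mult_right_mono) (auto simp: field_simps)
  finally show "\<xi> \<bullet> x \<le> H \<xi> * (norm x / \<gamma>1)" by simp
qed

text \<open>Testing the supremum with \<xi> = x gives |x|^2 <= H x * \<open>dual_norm H x\<close>,
  and H x <= \<gamma>2 |x|.\<close>

lemma dual_norm_ge: "norm x / \<gamma>2 \<le> dual_norm H x"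
proof (cases "x = 0")
  case False
  have "norm x * norm x \<le> H x * dual_norm H x"
    using dual_norm_duality[of x x] by (simp add: dot_square_norm power2_eq_square)
  moreover have d: "dual_norm H x \<ge> 0"
  proof -
    have "0 < norm x * norm x" using False by simp
    with \<open>norm x * norm x \<le> H x * dual_norm H x\<close> have "0 < H x * dual_norm H x" by linarith
    then show ?thesis using finsler_pos[OF False] by (simp add: zero_less_mult_iff)
  qed
  then have "H x * dual_norm H x \<le> \<gamma>2 * norm x * dual_norm H x"
    by (intro mult_right_mono bnd)
  ultimately have "norm x * norm x \<le> norm x * (\<gamma>2 * dual_norm H x)" by (simp add: mult_ac)
  then show ?thesis using False g12 by (simp add: field_simps)
next
  case True
  have "dual_norm H 0 = 0"
    unfolding dual_norm_def using compl_zero_ne by (simp add: image_constant_conv)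
  with True show ?thesis by simp
qed

lemma dual_norm_nonneg: "0 \<le> dual_norm H x"
  using dual_norm_ge[of x] g12 by (meson divide_nonneg_nonneg less_imp_le norm_ge_zero order_trans)

lemma dual_norm_triangle: "dual_norm H (x + y) \<le> dual_norm H x + dual_norm H y"
  by (rule dual_norm_leI) (use dual_norm_duality[of _ x] dual_norm_duality[of _ y] in
    \<open>auto simp: inner_add_right distrib_left intro: add_mono\<close>)

lemma dual_norm_scale: "dual_norm H (c *\<^sub>R x) = \<bar>c\<bar> * dual_norm H x"
proof -
  have le: "dual_norm H (c *\<^sub>R x) \<le> \<bar>c\<bar> * dual_norm H x" for c x
  proof (rule dual_norm_leI)
    fix \<xi>
    have "\<xi> \<bullet> (c *\<^sub>R x) = (c *\<^sub>R \<xi>) \<bullet> x" by simp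
    also have "\<dots> \<le> \<bar>c\<bar> * H \<xi> * dual_norm H x"
      using dual_norm_duality[of "c *\<^sub>R \<xi>" x] by (simp only: finsler_scale)
    finally show "\<xi> \<bullet> (c *\<^sub>R x) \<le> H \<xi> * (\<bar>c\<bar> * dual_norm H x)" by (simp add: mult_ac)
  qed
  show ?thesis
  proof (cases "c = 0")
    case True
    have "dual_norm H 0 = 0"
      unfolding dual_norm_def using compl_zero_ne by (simp add: image_constant_conv)
    with True show ?thesis by simp
  next
    case False
    have "dual_norm H x = dual_norm H (inverse c *\<^sub>R (c *\<^sub>R x))" using False by simp
    also have "\<dots> \<le> \<bar>inverse c\<bar> * dual_norm H (c *\<^sub>R x)" by (rule le)
    finally have "\<bar>c\<bar> * dual_norm H x \<le> dual_norm H (c *\<^sub>R x)"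
      using False by (simp add: abs_inverse field_simps)
    with le[of c x] show ?thesis by simp
  qed
qed

lemma norm_pair_dual: "norm_pair H (dual_norm H) (1 / \<gamma>2) (max \<gamma>2 (1 / \<gamma>1))"
proof
  fix x :: 'a and \<xi> \<eta> :: 'a and y and c :: real
  show "0 < 1 / \<gamma>2" "0 < max \<gamma>2 (1 / \<gamma>1)" using g12 by auto
  show "H \<xi> \<le> max \<gamma>2 (1 / \<gamma>1) * norm \<xi>"
    using bnd(2)[of \<xi>] by (rule order_trans) (auto intro: mult_right_mono)
  have "norm x / \<gamma>1 = (1 / \<gamma>1) * norm x" by simp
  also have "\<dots> \<le> max \<gamma>2 (1 / \<gamma>1) * norm x" by (intro mult_right_mono) auto
  finally show "dual_norm H x \<le> max \<gamma>2 (1 / \<gamma>1) * norm x"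
    using dual_norm_le[of x] by simp
  show "1 / \<gamma>2 * norm x \<le> dual_norm H x" using dual_norm_ge[of x] by simp
qed (rule finsler_nonneg finsler_triangle dual_norm_scale dual_norm_triangle dual_norm_duality)+

section \<open>Differentiability of the dual norm away from the origin\<close>

lemma compact_unit_ball: "compact {\<xi>. H \<xi> \<le> 1}"
proof -
  have c: "continuous_on UNIV H" using fin by (simp add: finsler_norm_def)
  then have "closed {\<xi>. H \<xi> \<le> 1}" by (intro closed_Collect_le) auto
  moreover have "bounded {\<xi>. H \<xi> \<le> 1}"
  proof (rule boundedI)
    fix \<xi> assume "\<xi> \<in> {\<xi>. H \<xi> \<le> 1}"
    then have "\<gamma>1 * norm \<xi> \<le> 1" using bnd(1)[of \<xi>] by simp
    then show "norm \<xi> \<le> 1 / \<gamma>1" using g12 by (simp add: field_simps)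
  qed
  ultimately show ?thesis by (simp add: compact_eq_bounded_closed)
qed

text \<open>A maximiser of the linear functional given by x on the unit ball of H. For x different
  from 0 it turns out to be the gradient of the dual norm, which is how measurability and
  boundedness of the area factor are obtained.\<close>

definition dual_max :: "'a \<Rightarrow> 'a" where
  "dual_max x = (SOME \<xi>. H \<xi> \<le> 1 \<and> \<xi> \<bullet> x = dual_norm H x)"

lemma dual_max: "H (dual_max x) \<le> 1" "dual_max x \<bullet> x = dual_norm H x"
proof -
  let ?B = "{\<xi>. H \<xi> \<le> 1}"
  have "0 \<in> ?B" using finsler_scale[of 0 0] by simp
  then obtain \<xi> where \<xi>: "H \<xi> \<le> 1" "\<And>\<eta>. H \<eta> \<le> 1 \<Longrightarrow> \<eta> \<bullet> x \<le> \<xi> \<bullet> x"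
    using continuous_attains_sup[OF compact_unit_ball, of "\<lambda>\<xi>. \<xi> \<bullet> x"]
    by (fastforce intro: continuous_intros)
  have "dual_norm H x \<le> \<xi> \<bullet> x"
  proof (rule dual_norm_leI)
    fix \<eta>
    show "\<eta> \<bullet> x \<le> H \<eta> * (\<xi> \<bullet> x)"
    proof (cases "\<eta> = 0")
      case False
      then have p: "H \<eta> > 0" by (rule finsler_pos)
      have "H ((1 / H \<eta>) *\<^sub>R \<eta>) \<le> 1" unfolding finsler_scale using p by simp
      from \<xi>(2)[OF this] show ?thesis using p by (simp add: field_simps)
    qed (use finsler_scale[of 0 0] in simp)
  qed
  moreover have "\<xi> \<bullet> x \<le> dual_norm H x"
    using dual_norm_duality[of \<xi> x] \<xi>(1) dual_norm_nonneg[of x] mult_right_mono[of "H \<xi>" 1 "dual_norm H x"] by simp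
  ultimately have "H \<xi> \<le> 1 \<and> \<xi> \<bullet> x = dual_norm H x" using \<xi> by auto
  then have "H (dual_max x) \<le> 1 \<and> dual_max x \<bullet> x = dual_norm H x"
    unfolding dual_max_def by (rule someI)
  then show "H (dual_max x) \<le> 1" "dual_max x \<bullet> x = dual_norm H x" by blast+
qed

text \<open>The midpoint of two maximisers attains the same value, but by strict convexity it has H
  < 1, which duality forbids when the dual norm of x is positive.\<close>

lemma dual_max_unique:
  assumes x: "x \<noteq> 0" and \<xi>: "H \<xi> \<le> 1" "\<xi> \<bullet> x = dual_norm H x" and \<eta>: "H \<eta> \<le> 1" "\<eta> \<bullet> x = dual_norm H x"
  shows "\<xi> = \<eta>"
proof (rule ccontr)
  assume ne: "\<xi> \<noteq> \<eta>"
  let ?B = "{\<xi>. H \<xi> < 1}"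
  \<comment> \<open>Strict convexity is stated for the closure of the open ball, so points with H =
    1 are exhibited as limits along their own ray.\<close>
  have cl: "\<zeta> \<in> closure ?B" if "H \<zeta> \<le> 1" for \<zeta>
  proof -
    have "(\<lambda>n. (1 - 1 / real (Suc n)) *\<^sub>R \<zeta>) \<longlonglongrightarrow> (1 - 0) *\<^sub>R \<zeta>"
      by (intro tendsto_intros LIMSEQ_Suc lim_const_over_n)
    moreover have "(1 - 1 / real (Suc n)) *\<^sub>R \<zeta> \<in> ?B" for n
    proof -
      have "(1 - 1 / real (Suc n)) * H \<zeta> \<le> (1 - 1 / real (Suc n)) * 1"
        using that by (intro mult_left_mono) auto
      also have "\<dots> < 1" by simp
      finally show ?thesis by (simp add: finsler_scale)
    qed
    ultimately show ?thesis unfolding closure_sequential by (intro exI[of _ "\<lambda>n. (1 - 1 / real (Suc n)) *\<^sub>R \<zeta>"]) auto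
  qed
  have "strictly_convex_set ?B" using fin by (simp add: finsler_norm_def)
  then have "open_segment \<xi> \<eta> \<subseteq> interior ?B"
    unfolding strictly_convex_set_def using cl \<xi> \<eta> ne by blast
  moreover have "midpoint \<xi> \<eta> \<in> open_segment \<xi> \<eta>" using ne by simp
  ultimately have "midpoint \<xi> \<eta> \<in> interior ?B" by blast
  then have lt: "H (midpoint \<xi> \<eta>) < 1" using interior_subset by blast
  have "midpoint \<xi> \<eta> \<bullet> x = dual_norm H x"
    using \<xi> \<eta> by (simp add: midpoint_def inner_add_left)
  then have "dual_norm H x \<le> H (midpoint \<xi> \<eta>) * dual_norm H x"
    using dual_norm_duality[of "midpoint \<xi> \<eta>" x] by simp
  moreover have "dual_norm H x > 0"
    using dual_norm_ge[of x] x g12 by (smt (verit) divide_pos_pos zero_less_norm_iff)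
  ultimately show False using lt by simp
qed

text \<open>By compactness any sequence of maximisers staying away from \<open>dual_max x\<close>
  has a convergent subsequence; its limit is again a maximiser at x, and that one is unique.\<close>

lemma dual_max_continuous:
  assumes x: "x \<noteq> 0"
  shows "isCont dual_max x"
proof (rule ccontr)
  interpret norm_pair H "dual_norm H" "1 / \<gamma>2" "max \<gamma>2 (1 / \<gamma>1)" by (rule norm_pair_dual)
  assume "\<not> isCont dual_max x"
  then obtain X where X: "X \<longlonglongrightarrow> x" "\<not> (\<lambda>n. dual_max (X n)) \<longlonglongrightarrow> dual_max x"
    unfolding continuous_at_sequentially by (auto simp: comp_def)
  then obtain e where e: "e > 0" "\<And>n. \<exists>k\<ge>n. dist (dual_max (X k)) (dual_max x) \<ge> e"
    unfolding lim_sequentially by (force simp: not_less)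
  define P where "P k \<longleftrightarrow> dist (dual_max (X k)) (dual_max x) \<ge> e" for k
  have "infinite {k. P k}" unfolding infinite_nat_iff_unbounded_le using e(2) by (auto simp: P_def)
  from infinite_enumerate[OF this] obtain r :: "nat \<Rightarrow> nat"
    where r: "strict_mono r" "\<And>n. P (r n)" by auto
  have "\<forall>n. dual_max (X (r n)) \<in> {\<xi>. H \<xi> \<le> 1}" using dual_max(1) by simp
  then obtain \<xi> q where q: "\<xi> \<in> {\<xi>. H \<xi> \<le> 1}" "strict_mono q" "((\<lambda>n. dual_max (X (r n))) \<circ> q) \<longlonglongrightarrow> \<xi>"
    using compact_unit_ball unfolding compact_def by metis
  have Xr: "(\<lambda>n. X (r (q n))) \<longlonglongrightarrow> x"
    using LIMSEQ_subseq_LIMSEQ[OF X(1) strict_mono_o[OF r(1) q(2)]] by (simp add: comp_def)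
  have "(\<lambda>n. dual_max (X (r (q n))) \<bullet> X (r (q n))) \<longlonglongrightarrow> \<xi> \<bullet> x"
    using q(3) Xr by (intro tendsto_inner) (auto simp: comp_def)
  moreover have "(\<lambda>n. dual_norm H (X (r (q n)))) \<longlonglongrightarrow> dual_norm H x"
    by (rule continuous_on_tendsto_compose[OF continuous_H0 Xr]) auto
  ultimately have "\<xi> \<bullet> x = dual_norm H x" unfolding dual_max(2) by (rule LIMSEQ_unique)
  then have "\<xi> = dual_max x" using q(1) by (intro dual_max_unique[OF x _ _ dual_max]) auto
  with q(3) have "(\<lambda>n. dual_max (X (r (q n)))) \<longlonglongrightarrow> dual_max x" by (simp add: comp_def)
  then have "eventually (\<lambda>n. dist (dual_max (X (r (q n)))) (dual_max x) < e) sequentially"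
    using e(1) by (rule tendstoD)
  then obtain n where "dist (dual_max (X (r (q n)))) (dual_max x) < e"
    by (meson eventually_sequentially order_refl)
  with r(2)[of "q n"] show False by (simp add: P_def)
qed

text \<open>The increment of the dual norm lies between \<open>dual_max x\<close> . h and
  \<open>dual_max (x + h)\<close> . h, because each maximiser is admissible at the other point.
  Continuity of \<open>dual_max\<close> closes the gap.\<close>

lemma dual_norm_GDERIV:
  assumes x: "x \<noteq> 0"
  shows "GDERIV (dual_norm H) x :> dual_max x"
  unfolding gderiv_def has_derivative_at
proof (intro conjI)
  let ?f = "\<lambda>h. norm (dual_norm H (x + h) - dual_norm H x - dual_max x \<bullet> h) / norm h"
  show "bounded_linear (\<lambda>h. h \<bullet> dual_max x)" by (rule bounded_linear_inner_left)
  have upper: "\<zeta> \<bullet> y \<le> dual_norm H y" if "H \<zeta> \<le> 1" for \<zeta> y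
    using dual_norm_duality[of \<zeta> y] that dual_norm_nonneg[of y] mult_right_mono[of "H \<zeta>" 1 "dual_norm H y"] by simp
  have bound: "?f h \<le> norm (dual_max (x + h) - dual_max x)" for h
  proof -
    have 1: "dual_norm H x + dual_max x \<bullet> h \<le> dual_norm H (x + h)"
      using upper[OF dual_max(1), of x "x + h"] by (simp add: inner_add_right dual_max)
    have 2: "dual_norm H (x + h) \<le> dual_norm H x + dual_max (x + h) \<bullet> h"
      using upper[OF dual_max(1), of "x + h" x] dual_max(2)[of "x + h"] by (simp add: inner_add_right)
    have "norm (dual_norm H (x + h) - dual_norm H x - dual_max x \<bullet> h) \<le> (dual_max (x + h) - dual_max x) \<bullet> h"
      using 1 2 by (simp add: inner_diff_left)
    also have "\<dots> \<le> norm (dual_max (x + h) - dual_max x) * norm h" by (rule norm_cauchy_schwarz)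
    finally show ?thesis by (cases "h = 0") (auto simp: field_simps)
  qed
  have "((\<lambda>h. dual_max (x + h)) \<longlongrightarrow> dual_max x) (at 0)"
    using dual_max_continuous[OF x] by (simp add: isCont_iff)
  then have "((\<lambda>h. norm (dual_max (x + h) - dual_max x)) \<longlongrightarrow> norm (dual_max x - dual_max x)) (at 0)"
    by (intro tendsto_intros)
  then have lim: "((\<lambda>h. norm (dual_max (x + h) - dual_max x)) \<longlongrightarrow> 0) (at 0)" by simp
  have "(?f \<longlongrightarrow> 0) (at 0)"
  proof (rule Lim_null_comparison[OF always_eventually lim], intro allI)
    fix h
    have "norm (?f h) = ?f h" unfolding real_norm_def by (rule abs_of_nonneg) simp
    then show "norm (?f h) \<le> norm (dual_max (x + h) - dual_max x)" using bound[of h] by linarith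
  qed
  then show "(\<lambda>h. norm (dual_norm H (x + h) - dual_norm H x - h \<bullet> dual_max x) / norm h) \<midarrow>0\<rightarrow> 0"
    by (simp add: inner_commute)
qed

end

section \<open>The cone over a norm pair\<close>

locale cone_pair = norm_pair H H0 l L for H H0 :: "'a::euclidean_space \<Rightarrow> real" and l L +
  fixes \<alpha> B :: real
  assumes alpha: "- pi / 2 < \<alpha>" "\<alpha> < pi / 2"
    and area_measurable [measurable]: "area_factor H0 \<alpha> \<in> borel_measurable borel"
    and area_le: "area_factor H0 \<alpha> x \<le> B" and dim: "DIM('a) \<ge> 2"

lemma area_factor_ge_1: "area_factor H0 \<alpha> x \<ge> 1"
  by (simp add: area_factor_def)

text \<open>The surface measure is defined through \<open>grad (dual_norm H)\<close>, so this
  gradient must be measurable and bounded. It equals \<open>dual_max\<close> off the origin, which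
  is continuous there and lies in the unit ball of H.\<close>

lemma finsler_cone_pair:
  fixes H :: "'a::euclidean_space \<Rightarrow> real"
  assumes fin: "finsler_norm H" and alpha: "- pi / 2 < \<alpha>" "\<alpha> < pi / 2" and dim: "DIM('a) \<ge> 2"
  obtains l L B where "cone_pair H (dual_norm H) l L \<alpha> B"
proof -
  obtain \<gamma>1 \<gamma>2 where g: "0 < \<gamma>1" "\<gamma>1 \<le> \<gamma>2" "\<And>\<xi>. \<gamma>1 * norm \<xi> \<le> H \<xi>" "\<And>\<xi>. H \<xi> \<le> \<gamma>2 * norm \<xi>"
    using fin unfolding finsler_norm_def by blast
  note G = fin g(1,2,3,4)
  interpret norm_pair H "dual_norm H" "1 / \<gamma>2" "max \<gamma>2 (1 / \<gamma>1)" by (rule norm_pair_dual[OF G])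
  let ?g = "grad (dual_norm H)"
  have gr: "?g x = dual_max H x" if "x \<noteq> 0" for x
    by (rule grad_eqI[OF dual_norm_GDERIV[OF G that]])
  have "continuous_on (- {0}) ?g"
    by (subst continuous_on_cong[OF refl, of _ _ "dual_max H"])
      (auto simp: gr intro!: continuous_at_imp_continuous_on dual_max_continuous[OF G])
  then have "(\<lambda>x. if x \<in> - {0} then ?g x else ?g 0) \<in> borel_measurable borel"
    by (intro borel_measurable_continuous_on_if) auto
  moreover have "(\<lambda>x. if x \<in> - {0} then ?g x else ?g 0) = ?g" by auto
  ultimately have gm: "?g \<in> borel_measurable borel" by simp
  \<comment> \<open>At the origin \<open>grad\<close> is an unspecified vector; including its norm
    in the bound makes the estimate hold at every point.\<close>
  have gb: "norm (?g x) \<le> max (1 / \<gamma>1) (norm (?g 0))" for x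
  proof (cases "x = 0")
    case False
    have "\<gamma>1 * norm (?g x) \<le> 1"
      using g(3)[of "?g x"] dual_max(1)[OF G, of x] gr[OF False] by simp
    then have "norm (?g x) \<le> 1 / \<gamma>1" using g by (simp add: field_simps)
    then show ?thesis by linarith
  qed simp
  have "cone_pair H (dual_norm H) (1 / \<gamma>2) (max \<gamma>2 (1 / \<gamma>1)) \<alpha>
     (sqrt (1 + (tan \<alpha>)\<^sup>2 * (max (1 / \<gamma>1) (norm (?g 0)))\<^sup>2))"
  proof
    show "area_factor (dual_norm H) \<alpha> \<in> borel_measurable borel"
      unfolding area_factor_def[abs_def] using gm by measurable
    show "area_factor (dual_norm H) \<alpha> x \<le> sqrt (1 + (tan \<alpha>)\<^sup>2 * (max (1 / \<gamma>1) (norm (?g 0)))\<^sup>2)" for x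
      unfolding area_factor_def using gb[of x] by (intro real_sqrt_le_mono add_left_mono mult_left_mono power_mono) auto
  qed (use alpha dim in auto)
  then show ?thesis by (rule that)
qed

section \<open>The weighted inequality for test functions\<close>

text \<open>Dyadic balls: on the k-th one the weight 4^(k+1) / R^2 is charged, and its volume is
  proportional to 2^(-kd). From d >= 3 the k-th term is at most a constant times (1/2)^k.\<close>

lemma inverse_square_nn_integral:
  fixes R :: real
  assumes dim: "DIM('b::euclidean_space) \<ge> 3" and R: "R > 0"
  shows "(\<integral>\<^sup>+z. ennreal (indicator (cball 0 R) z / (norm (z::'b))\<^sup>2) \<partial>lborel) < \<infinity>"
proof -
  let ?d = "DIM('b)"
  let ?f = "\<lambda>k (z::'b). ennreal (4 ^ Suc k / R\<^sup>2) * indicator (cball 0 (R / 2 ^ k)) z"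
  have "ennreal (indicator (cball 0 R) z / (norm z)\<^sup>2) \<le> (\<Sum>k. ?f k z)" for z :: 'b
  proof (cases "norm z \<le> R \<and> z \<noteq> 0")
    case True
    define x where "x = norm z / R"
    have x: "0 < x" "x \<le> 1" using True R by (auto simp: x_def)
    obtain n where "(1/2) ^ n < x" using real_arch_pow_inv[of x "1/2"] x by auto
    then have ex: "(1/2) ^ Suc n < x" using x power_Suc_le_self[of "1/2::real" n] power_decreasing[of n "Suc n" "1/2::real"] by linarith
    \<comment> \<open>The index of the dyadic shell of z: 2^(-k-1) < |z|/R <= 2^(-k).\<close>
    define k where "k = (LEAST n. (1/2) ^ Suc n < x)"
    have k1: "(1/2) ^ Suc k < x" unfolding k_def by (rule LeastI[of _ n], rule ex)
    have k2: "x \<le> (1/2) ^ k"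
    proof (cases k)
      case (Suc j)
      then have "\<not> (1/2) ^ Suc j < x" using not_less_Least[of j "\<lambda>n. (1/2) ^ Suc n < x"] by (simp add: k_def)
      then show ?thesis using Suc by simp
    qed (use x in simp)
    have zk: "z \<in> cball 0 (R / 2 ^ k)" using k2 R by (simp add: x_def field_simps power_divide)
    have "(1/4) ^ Suc k \<le> x\<^sup>2"
    proof -
      have "((1/2) ^ Suc k)\<^sup>2 \<le> x\<^sup>2" using k1 by (intro power_mono) auto
      moreover have "((1/2::real) ^ Suc k)\<^sup>2 = (1/4) ^ Suc k"
        unfolding power2_eq_square power_mult_distrib[symmetric] by simp
      ultimately show ?thesis by simp
    qed
    then have "1 / (norm z)\<^sup>2 \<le> 4 ^ Suc k / R\<^sup>2"
      using True R by (simp add: x_def power_divide field_simps)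
    then have "ennreal (indicator (cball 0 R) z / (norm z)\<^sup>2) \<le> ?f k z"
      using zk True by (simp add: ennreal_leI)
    also have "\<dots> \<le> (\<Sum>k. ?f k z)"
    proof -
      have "F k \<le> suminf F" for F :: "nat \<Rightarrow> ennreal"
        using sum_le_suminf[OF summableI, of "{k}" F] by simp
      then show ?thesis .
    qed
    finally show ?thesis .
  qed (auto simp: indicator_def)
  then have "(\<integral>\<^sup>+z. ennreal (indicator (cball 0 R) z / (norm (z::'b))\<^sup>2) \<partial>lborel) \<le> (\<integral>\<^sup>+z. (\<Sum>k. ?f k z) \<partial>lborel)"
    by (intro nn_integral_mono)
  also have "\<dots> = (\<Sum>k. \<integral>\<^sup>+z. ?f k z \<partial>lborel)" by (rule nn_integral_suminf) (intro borel_measurable_times_ennreal borel_measurable_const borel_measurable_indicator, simp)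
  also have "\<dots> \<le> (\<Sum>k. ennreal (4 * unit_ball_vol ?d * R ^ ?d / R\<^sup>2 * (1/2) ^ k))"
  proof (intro suminf_le summableI)
    fix k
    have "(\<integral>\<^sup>+z. ?f k z \<partial>lborel) = ennreal (4 ^ Suc k / R\<^sup>2) * ennreal (unit_ball_vol ?d * (R / 2 ^ k) ^ ?d)"
      using R by (simp add: nn_integral_cmult_indicator emeasure_cball)
    also have "\<dots> = ennreal (4 ^ Suc k / R\<^sup>2 * (unit_ball_vol ?d * (R / 2 ^ k) ^ ?d))"
      using R by (intro ennreal_mult[symmetric]) auto
    also have "4 ^ Suc k / R\<^sup>2 * (unit_ball_vol ?d * (R / 2 ^ k) ^ ?d) = 4 * unit_ball_vol ?d * R ^ ?d / R\<^sup>2 * (4 ^ k / (2 ^ k) ^ ?d)"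
      by (simp add: power_divide)
    also have "\<dots> \<le> 4 * unit_ball_vol ?d * R ^ ?d / R\<^sup>2 * (1/2) ^ k"
    proof (rule mult_left_mono)
      have "(2::real) ^ 3 \<le> 2 ^ ?d" using dim by (intro power_increasing) auto
      then have "(8::real) ^ k \<le> (2 ^ ?d) ^ k" by (intro power_mono) auto
      then have "(4::real) ^ k / (2 ^ ?d) ^ k \<le> 4 ^ k / 8 ^ k" by (intro divide_left_mono) auto
      also have "(4::real) ^ k / 8 ^ k = (1/2) ^ k" by (simp add: power_divide[symmetric])
      finally show "(4::real) ^ k / (2 ^ k) ^ ?d \<le> (1/2) ^ k" by (simp add: power_mult[symmetric] mult.commute)
    qed (use R in auto)
    finally show "(\<integral>\<^sup>+z. ?f k z \<partial>lborel) \<le> ennreal (4 * unit_ball_vol ?d * R ^ ?d / R\<^sup>2 * (1/2) ^ k)"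
      by (simp add: ennreal_leI)
  qed
  also have "\<dots> < \<infinity>"
    unfolding infinity_ennreal_def using R by (intro ennreal_suminf_neq_top[THEN top.not_eq_extremum[THEN iffD1]] summable_mult summable_geometric) auto
  finally show ?thesis .
qed

lemma inverse_square_indicator_integrable:
  fixes R :: real
  assumes "DIM('b::euclidean_space) \<ge> 3" "R > 0"
  shows "integrable lborel (\<lambda>z::'b. indicator (cball 0 R) z / (norm z)\<^sup>2)"
proof (rule integrableI_nonneg)
  show "(\<lambda>z::'b. indicator (cball 0 R) z / (norm z)\<^sup>2) \<in> borel_measurable lborel"
    by (intro borel_measurable_divide borel_measurable_indicator) auto
qed (use inverse_square_nn_integral[OF assms] in auto)

lemma inverse_square_integrable:
  fixes f :: "'b::euclidean_space \<Rightarrow> real"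
  assumes dim: "DIM('b) \<ge> 3" and f: "f \<in> borel_measurable borel"
    and bound: "\<And>z. z \<noteq> 0 \<Longrightarrow> \<bar>f z\<bar> \<le> K / (norm z)\<^sup>2" and supp: "\<And>z. norm z \<ge> R \<Longrightarrow> f z = 0" and R: "R > 0"
  shows "integrable lborel f"
proof -
  have "integrable lborel (\<lambda>z::'b. indicator (cball 0 R) z / (norm z)\<^sup>2)"
    by (rule inverse_square_indicator_integrable[OF dim R])
  then have "integrable lborel (\<lambda>z::'b. K * (indicator (cball 0 R) z / (norm z)\<^sup>2))"
    by (rule integrable_mult_right)
  then show ?thesis
  proof (rule Bochner_Integration.integrable_bound)
    have "AE z::'b in lborel. z \<noteq> 0" by (rule AE_lborel_singleton)
    then show "AE z in lborel. norm (f z) \<le> norm (K * (indicator (cball 0 R) z / (norm z)\<^sup>2))"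
    proof eventually_elim
      case (elim z)
      then show ?case
        using order_trans[OF bound[of z] divide_right_mono[OF abs_ge_self, of "(norm z)\<^sup>2" K]] supp[of z]
        by (cases "norm z < R") auto
    qed
  qed (use f in simp)
qed

text \<open>Both sides are the derivative at c = 1 of the scaling identity between the integral of
  \<psi>(c z) a(z) and c^(2 - d) times the integral of \<psi> a, with d the dimension. The weight a
  enters only through its homogeneity of degree -2.\<close>

lemma radial_identity:
  fixes \<psi> a :: "'b::euclidean_space \<Rightarrow> real" and D :: "'b \<Rightarrow> 'b"
  assumes dim: "DIM('b) \<ge> 3"
    and \<psi>: "\<And>z. GDERIV \<psi> z :> D z" and Dc: "continuous_on UNIV D"
    and supp: "\<And>z. norm z \<ge> R \<Longrightarrow> \<psi> z = 0" "\<And>z. norm z \<ge> R \<Longrightarrow> D z = 0" and R: "R > 0"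
    and a [measurable]: "a \<in> borel_measurable borel" and a_bound: "\<And>z. z \<noteq> 0 \<Longrightarrow> \<bar>a z\<bar> \<le> M / (norm z)\<^sup>2"
    and a_hom: "\<And>c z. c > 0 \<Longrightarrow> a (c *\<^sub>R z) = a z / c\<^sup>2"
  shows "(LINT z|lborel. (D z \<bullet> z) * a z) = - (real (DIM('b)) - 2) * (LINT z|lborel. \<psi> z * a z)"
proof -
  let ?k = "DIM('b) - 2"
  obtain K where K: "K > 0" "\<And>z. norm (D z) \<le> K"
    using bounded_of_compact_support[OF Dc supp(2)] by metis
  have \<psi>c: "continuous_on UNIV \<psi>"
    using GDERIV_D[OF \<psi>] by (auto intro!: continuous_at_imp_continuous_on differentiable_imp_continuous_within)
  have [measurable]: "\<psi> \<in> borel_measurable borel" "D \<in> borel_measurable borel"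
    using \<psi>c Dc by (auto intro: borel_measurable_continuous_onI)
  obtain P where P: "P > 0" "\<And>z. norm (\<psi> z) \<le> P"
    using bounded_of_compact_support[OF \<psi>c supp(1)] by metis
  have M0: "M \<ge> 0"
  proof -
    have z: "(SOME b. b \<in> Basis) \<noteq> (0 :: 'b)" using SOME_Basis nonzero_Basis by blast
    then show ?thesis using order_trans[OF abs_ge_zero a_bound[OF z]] by (simp add: zero_le_divide_iff)
  qed
  have \<psi>D: "((\<lambda>t. \<psi> (t *\<^sub>R z)) has_real_derivative D (t *\<^sub>R z) \<bullet> z) (at t)" for t z
  proof -
    have "((\<lambda>t. t *\<^sub>R z) has_derivative (\<lambda>s. s *\<^sub>R z)) (at t)" by (auto intro!: derivative_eq_intros)
    from has_derivative_compose[OF this \<psi>[unfolded gderiv_def]]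
    show ?thesis by (simp add: has_field_derivative_def mult_commute_abs inner_commute)
  qed
  have int_a: "integrable lborel (\<lambda>z. g z * a z)"
    if [measurable]: "g \<in> borel_measurable borel" and g: "\<And>z. \<bar>g z\<bar> \<le> Q" "\<And>z. norm z \<ge> R \<Longrightarrow> g z = 0" for g :: "'b \<Rightarrow> real" and Q
  proof (rule inverse_square_integrable[OF dim _ _ _ R])
    show "\<bar>g z * a z\<bar> \<le> (Q * M) / (norm z)\<^sup>2" if "z \<noteq> 0" for z
    proof -
      have "\<bar>g z\<bar> * \<bar>a z\<bar> \<le> Q * (M / (norm z)\<^sup>2)"
        using g(1) order_trans[OF abs_ge_zero g(1)] by (intro mult_mono a_bound that) auto
      then show ?thesis by (simp add: abs_mult)
    qed
  qed (use g in auto)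
  \<comment> \<open>Approaching 1 from above keeps \<psi>(c z) supported in the ball of radius R, so
    one dominating function serves all n.\<close>
  define c where "c n = 1 + 1 / real (Suc n)" for n
  have c1: "c n > 1" for n by (simp add: c_def)
  have cl: "c \<longlonglongrightarrow> 1"
  proof -
    have "(\<lambda>n. 1 + 1 / real (Suc n)) \<longlonglongrightarrow> 1 + 0" by (intro tendsto_intros LIMSEQ_Suc lim_const_over_n)
    then show ?thesis by (simp add: c_def[abs_def])
  qed
  have cat: "filterlim c (at 1) sequentially"
    using cl c1 by (auto simp: filterlim_at intro!: always_eventually dest: less_imp_neq[OF c1, THEN not_sym, THEN notE] )
  let ?I = "LINT z|lborel. \<psi> z * a z"
  have \<psi>_far: "\<psi> (c n *\<^sub>R z) = 0" if "norm z \<ge> R" for n z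
  proof (rule supp)
    have "1 * norm z \<le> c n * norm z" using c1[of n] by (intro mult_right_mono) auto
    then show "R \<le> norm (c n *\<^sub>R z)" using that c1[of n] by simp
  qed
  \<comment> \<open>The change of variables contributes c^d, the homogeneity of a contributes
    c^(-2).\<close>
  have scaled: "(LINT z|lborel. \<psi> (c n *\<^sub>R z) * a z) = ?I / c n ^ ?k" for n
  proof -
    have "?I = \<bar>c n\<bar> ^ DIM('b) * (LINT z|lborel. \<psi> (0 + c n *\<^sub>R z) * a (0 + c n *\<^sub>R z))"
      by (rule lborel_integral_affine) (use c1[of n] in auto)
    also have "\<dots> = c n ^ DIM('b) * (LINT z|lborel. \<psi> (c n *\<^sub>R z) * a z) / (c n)\<^sup>2"
      using c1[of n] by (simp add: a_hom)
    also have "c n ^ DIM('b) = c n ^ ?k * (c n)\<^sup>2"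
    proof -
      have "DIM('b) = ?k + 2" using dim by simp
      then show ?thesis by (metis power_add)
    qed
    finally show ?thesis using c1[of n] by simp
  qed
  have L1: "(\<lambda>n. LINT z|lborel. (\<psi> (c n *\<^sub>R z) - \<psi> z) / (c n - 1) * a z) \<longlonglongrightarrow> (LINT z|lborel. (D z \<bullet> z) * a z)"
  proof (rule integral_dominated_convergence[where w="\<lambda>z. K * R * (M * (indicator (cball 0 R) z / (norm z)\<^sup>2))"])
    show "integrable lborel (\<lambda>z::'b. K * R * (M * (indicator (cball 0 R) z / (norm z)\<^sup>2)))"
      by (intro integrable_mult_right inverse_square_indicator_integrable dim R)
    show "AE z in lborel. (\<lambda>n. (\<psi> (c n *\<^sub>R z) - \<psi> z) / (c n - 1) * a z) \<longlonglongrightarrow> (D z \<bullet> z) * a z"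
    proof (rule AE_I2)
      fix z
      have "((\<lambda>t. (\<psi> (t *\<^sub>R z) - \<psi> (1 *\<^sub>R z)) / (t - 1)) \<longlongrightarrow> D (1 *\<^sub>R z) \<bullet> z) (at 1)"
        using \<psi>D[of z 1] unfolding has_field_derivative_iff .
      from filterlim_compose[OF this cat]
      show "(\<lambda>n. (\<psi> (c n *\<^sub>R z) - \<psi> z) / (c n - 1) * a z) \<longlonglongrightarrow> (D z \<bullet> z) * a z"
        by (intro tendsto_mult_right) simp
    qed
    show "AE z in lborel. norm ((\<psi> (c n *\<^sub>R z) - \<psi> z) / (c n - 1) * a z) \<le> K * R * (M * (indicator (cball 0 R) z / (norm z)\<^sup>2))" for n
    proof -
      have "AE z::'b in lborel. z \<noteq> 0" by (rule AE_lborel_singleton)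
      then show ?thesis
      proof eventually_elim
        case (elim z)
        show ?case
        proof (cases "norm z < R")
          case True
          have "\<exists>t. 1 < t \<and> t < c n \<and> \<psi> (c n *\<^sub>R z) - \<psi> (1 *\<^sub>R z) = (c n - 1) * (D (t *\<^sub>R z) \<bullet> z)"
            by (rule MVT2) (use c1[of n] \<psi>D in auto)
          then obtain t where "\<psi> (c n *\<^sub>R z) - \<psi> z = (c n - 1) * (D (t *\<^sub>R z) \<bullet> z)" by auto
          then have "(\<psi> (c n *\<^sub>R z) - \<psi> z) / (c n - 1) = D (t *\<^sub>R z) \<bullet> z" using c1[of n] by simp
          moreover have "\<bar>D (t *\<^sub>R z) \<bullet> z\<bar> \<le> K * R"
            using Cauchy_Schwarz_ineq2[of "D (t *\<^sub>R z)" z] mult_mono[OF K(2) less_imp_le[OF True], of "t *\<^sub>R z"] K(1) by simp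
          ultimately have "norm ((\<psi> (c n *\<^sub>R z) - \<psi> z) / (c n - 1) * a z) \<le> (K * R) * (M / (norm z)\<^sup>2)"
            unfolding norm_mult using a_bound[OF elim] K R by (intro mult_mono) auto
          then show ?thesis using True by simp
        next
          case False
          then have "\<psi> (c n *\<^sub>R z) = 0" "\<psi> z = 0" using supp \<psi>_far by auto
          then show ?thesis using M0 K R by simp
        qed
      qed
    qed
  qed auto
  have EQ: "(LINT z|lborel. (\<psi> (c n *\<^sub>R z) - \<psi> z) / (c n - 1) * a z) = (1 / c n ^ ?k - 1) / (c n - 1) * ?I" for n
  proof -
    have i1: "integrable lborel (\<lambda>z. \<psi> (c n *\<^sub>R z) * a z)"
      by (rule int_a[where Q=P]) (use P \<psi>_far in auto)
    have i2: "integrable lborel (\<lambda>z. \<psi> z * a z)"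
      by (rule int_a[where Q=P]) (use P supp in auto)
    have "(LINT z|lborel. (\<psi> (c n *\<^sub>R z) - \<psi> z) / (c n - 1) * a z) = (LINT z|lborel. (\<psi> (c n *\<^sub>R z) * a z - \<psi> z * a z) * (1 / (c n - 1)))"
      by (intro Bochner_Integration.integral_cong) (auto simp: algebra_simps diff_divide_distrib)
    also have "\<dots> = (?I / c n ^ ?k - ?I) * (1 / (c n - 1))"
      unfolding integral_mult_left_zero using i1 i2 by (simp add: scaled)
    also have "\<dots> = (1 / c n ^ ?k - 1) / (c n - 1) * ?I" by (simp add: field_simps)
    finally show ?thesis .
  qed
  have L2: "(\<lambda>n. (1 / c n ^ ?k - 1) / (c n - 1) * ?I) \<longlonglongrightarrow> - real ?k * ?I"
  proof -
    have "((\<lambda>x::real. 1 / x ^ ?k) has_real_derivative - real ?k) (at 1)"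
      by (auto intro!: derivative_eq_intros)
    then have "((\<lambda>x::real. (1 / x ^ ?k - 1 / 1 ^ ?k) / (x - 1)) \<longlongrightarrow> - real ?k) (at 1)"
      unfolding has_field_derivative_iff .
    from filterlim_compose[OF this cat] show ?thesis by (intro tendsto_mult_right) simp
  qed
  have "(LINT z|lborel. (D z \<bullet> z) * a z) = - real ?k * ?I"
    using L1 unfolding EQ by (rule LIMSEQ_unique[OF _ L2])
  then show ?thesis using dim by (simp add: of_nat_diff)
qed

section \<open>Radius and angle\<close>

context norm_pair
begin

abbreviation "rad \<equiv> ext_norm H0"

lemma rad_scale: "rad (c *\<^sub>R z) = \<bar>c\<bar> * rad z"
proof -
  have "(\<bar>c\<bar> * H0 (fst z))\<^sup>2 + (c * snd z)\<^sup>2 = c\<^sup>2 * ((H0 (fst z))\<^sup>2 + (snd z)\<^sup>2)"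
    by (simp add: power_mult_distrib algebra_simps)
  then show ?thesis by (simp add: ext_norm_def H0_scale real_sqrt_mult)
qed

lemma rad_ge: "min l 1 * norm z \<le> rad z"
proof -
  have "(min l 1 * norm z)\<^sup>2 = (min l 1)\<^sup>2 * (norm (fst z))\<^sup>2 + (min l 1)\<^sup>2 * (snd z)\<^sup>2"
    by (cases z) (simp add: norm_Pair power_mult_distrib algebra_simps)
  also have "\<dots> \<le> (H0 (fst z))\<^sup>2 + 1 * (snd z)\<^sup>2"
  proof (intro add_mono mult_right_mono)
    have "min l 1 * norm (fst z) \<le> l * norm (fst z)" by (intro mult_right_mono) auto
    also have "\<dots> \<le> H0 (fst z)" by (rule H0_ge)
    finally have "(min l 1 * norm (fst z))\<^sup>2 \<le> (H0 (fst z))\<^sup>2" using l by (intro power_mono) auto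
    then show "(min l 1)\<^sup>2 * (norm (fst z))\<^sup>2 \<le> (H0 (fst z))\<^sup>2" by (simp add: power_mult_distrib)
    show "(min l 1)\<^sup>2 \<le> 1" using l by (simp add: abs_square_le_1)
  qed auto
  finally show ?thesis unfolding ext_norm_def by (simp add: real_le_rsqrt)
qed

lemma rad_nonneg: "0 \<le> rad z"
  by (simp add: ext_norm_def)

lemma rad_pos: "z \<noteq> 0 \<Longrightarrow> 0 < rad z"
  using rad_ge[of z] l by (smt (verit) mult_pos_pos zero_less_norm_iff)

lemma rad_sq: "(rad z)\<^sup>2 = (H0 (fst z))\<^sup>2 + (snd z)\<^sup>2"
  by (simp add: ext_norm_def)

lemma continuous_rad: "continuous_on S rad"
  unfolding ext_norm_def[abs_def]
  by (intro continuous_intros continuous_on_compose2[OF continuous_H0]) auto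

lemma measurable_rad [measurable]: "rad \<in> borel_measurable borel"
  by (intro borel_measurable_continuous_onI continuous_rad)

lemma snd_le_rad: "\<bar>snd z\<bar> \<le> rad z"
  unfolding ext_norm_def by (rule real_le_rsqrt) simp

lemma inverse_rad_sq_le: "z \<noteq> 0 \<Longrightarrow> 1 / (rad z)\<^sup>2 \<le> (1 / (min l 1)\<^sup>2) / (norm z)\<^sup>2"
proof -
  assume z: "z \<noteq> 0"
  have "(min l 1 * norm z)\<^sup>2 \<le> (rad z)\<^sup>2" using l by (intro power_mono rad_ge) auto
  moreover have "0 < (min l 1 * norm z)\<^sup>2" using l z by auto
  ultimately have "1 / (rad z)\<^sup>2 \<le> 1 / (min l 1 * norm z)\<^sup>2"
    by (intro divide_left_mono mult_pos_pos) (auto simp: rad_pos z)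
  then show ?thesis by (simp add: power_mult_distrib)
qed

text \<open>The variable s of the differential equation: the sine of the latitude with respect to
  \<open>rad\<close>. On the boundary of the cone away from the origin it equals sin \<alpha>, and
  on the positive axis it equals 1.\<close>

definition ang :: "'a \<times> real \<Rightarrow> real" where
  "ang z = snd z / rad z"

lemma measurable_ang [measurable]: "ang \<in> borel_measurable borel"
  unfolding ang_def[abs_def] by (intro borel_measurable_divide measurable_rad borel_measurable_continuous_onI continuous_intros)

lemma ang_le_1: "\<bar>ang z\<bar> \<le> 1"
proof (cases "z = 0")
  case False
  then show ?thesis using snd_le_rad[of z] rad_pos[of z] by (simp add: ang_def abs_divide)
qed (simp add: ang_def)

lemma ang_scale: "c > 0 \<Longrightarrow> ang (c *\<^sub>R z) = ang z"
  by (simp add: ang_def rad_scale)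

lemma ang_sq: "z \<noteq> 0 \<Longrightarrow> 1 - (ang z)\<^sup>2 = (H0 (fst z))\<^sup>2 / (rad z)\<^sup>2"
proof -
  assume "z \<noteq> 0"
  then have r: "(rad z)\<^sup>2 \<noteq> 0" using rad_pos[of z] by simp
  have "(H0 (fst z))\<^sup>2 = (rad z)\<^sup>2 - (snd z)\<^sup>2" by (simp add: rad_sq)
  then show ?thesis using r by (simp only: ang_def power_divide diff_divide_distrib divide_self[OF r])
qed

end

section \<open>Geometry of the cone and integration along vertical lines\<close>

context cone_pair
begin

abbreviation "C \<equiv> cone_dom H0 \<alpha>"

lemma cos_pos: "cos \<alpha> > 0"
  using alpha by (intro cos_gt_zero_pi) auto

lemma open_C: "open C"
proof -
  have "C = {z. tan \<alpha> * H0 (fst z) < snd z}" by (auto simp: cone_dom_def)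
  then show ?thesis
    by (simp only:) (intro open_Collect_less continuous_intros continuous_on_compose2[OF continuous_H0], auto)
qed

lemma sets_C [measurable]: "C \<in> sets borel"
  using open_C by simp

lemma C_scale: "c > 0 \<Longrightarrow> c *\<^sub>R z \<in> C \<longleftrightarrow> z \<in> C"
  by (cases z) (auto simp: cone_dom_def H0_scale mult.left_commute)

lemma zero_notin_C: "0 \<notin> C"
  by (simp add: cone_dom_def zero_prod_def)

lemma rad_boundary: "rad (x, tan \<alpha> * H0 x) = H0 x / cos \<alpha>"
proof -
  have "(H0 x)\<^sup>2 + (tan \<alpha> * H0 x)\<^sup>2 = (H0 x)\<^sup>2 * (1 + (tan \<alpha>)\<^sup>2)" by (simp add: power_mult_distrib algebra_simps)
  also have "1 + (tan \<alpha>)\<^sup>2 = 1 / (cos \<alpha>)\<^sup>2"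
    using tan_sec[of \<alpha>] cos_pos by (simp add: power_divide inverse_eq_divide)
  finally have "(H0 x)\<^sup>2 + (tan \<alpha> * H0 x)\<^sup>2 = (H0 x / cos \<alpha>)\<^sup>2" by (simp add: power_divide)
  then show ?thesis using H0_nonneg[of x] cos_pos by (simp add: ext_norm_def)
qed

lemma ang_boundary: "x \<noteq> 0 \<Longrightarrow> ang (x, tan \<alpha> * H0 x) = sin \<alpha>"
  using H0_pos[of x] cos_pos by (simp add: ang_def rad_boundary) (simp add: tan_def)

text \<open>Writing \<open>ang z\<close> as sin \<theta>, the condition defining the cone becomes
  sin(\<theta> - \<alpha>) > 0, hence \<theta> > \<alpha> in the range where sine increases.\<close>

lemma ang_gt:
  assumes z: "z \<in> C" shows "sin \<alpha> < ang z"
proof -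
  have nz: "z \<noteq> 0" using z zero_notin_C by auto
  then have r: "rad z > 0" by (rule rad_pos)
  define \<theta> where "\<theta> = arcsin (ang z)"
  have th: "- (pi / 2) \<le> \<theta>" "\<theta> \<le> pi / 2" "sin \<theta> = ang z"
    using ang_le_1[of z] arcsin_bounded[of "ang z"] by (auto simp: \<theta>_def abs_le_iff)
  have cth: "cos \<theta> = H0 (fst z) / rad z"
  proof -
    have "cos \<theta> = sqrt (1 - (ang z)\<^sup>2)" unfolding \<theta>_def
      using ang_le_1[of z] by (intro cos_arcsin) (auto simp: abs_le_iff)
    also have "\<dots> = H0 (fst z) / rad z"
      unfolding ang_sq[OF nz] using H0_nonneg r by (simp add: real_sqrt_divide)
    finally show ?thesis .
  qed
  have "tan \<alpha> * H0 (fst z) < snd z" using z by (auto simp: cone_dom_def)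
  then have "sin \<alpha> * H0 (fst z) < snd z * cos \<alpha>" using cos_pos by (simp add: tan_def field_simps)
  then have "sin \<alpha> * H0 (fst z) / rad z < snd z * cos \<alpha> / rad z" using r by (intro divide_strict_right_mono)
  then have "sin \<alpha> * cos \<theta> < sin \<theta> * cos \<alpha>" by (simp add: th cth ang_def mult.commute)
  then have "sin (\<theta> - \<alpha>) > 0" by (simp add: sin_diff mult.commute)
  have "\<alpha> < \<theta>"
  proof (rule ccontr)
    assume "\<not> \<alpha> < \<theta>"
    then have "sin (\<alpha> - \<theta>) \<ge> 0" using alpha th by (intro sin_ge_zero) auto
    then show False using \<open>sin (\<theta> - \<alpha>) > 0\<close> sin_minus[of "\<theta> - \<alpha>"] by simp
  qed
  then have "sin \<alpha> < sin \<theta>" using alpha th by (intro sin_monotone_2pi) auto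
  then show ?thesis by (simp add: th)
qed

lemma ang_lt_1: "fst z \<noteq> 0 \<Longrightarrow> ang z < 1"
proof -
  assume x: "fst z \<noteq> 0"
  then have nz: "z \<noteq> 0" by auto
  have "1 - (ang z)\<^sup>2 > 0" unfolding ang_sq[OF nz] using H0_pos[OF x] rad_pos[OF nz] by simp
  then show ?thesis by (simp add: abs_square_less_1 abs_less_iff)
qed

lemma dim3: "DIM('a \<times> real) \<ge> 3"
  using dim by simp

text \<open>The fundamental theorem of calculus for \<psi> m(s) / r on each half-line over x inside
  the cone, followed by Fubini. Along such a line ds/dt = (1 - s^2)/r and dr/dt = s, so
  \<open>bt\<close> is the vertical derivative of \<open>b\<close>. At the lower end s = sin
  \<alpha> and r = \<open>H0 x / cos \<alpha>\<close>; integrability of the boundary term is a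
  by-product of Fubini.\<close>

lemma vertical_identity:
  fixes \<psi> :: "'a \<times> real \<Rightarrow> real" and D :: "'a \<times> real \<Rightarrow> 'a \<times> real" and m md :: "real \<Rightarrow> real"
  assumes \<psi>: "\<And>z. GDERIV \<psi> z :> D z" and Dc: "continuous_on UNIV D"
    and supp: "\<And>z. norm z \<ge> R \<Longrightarrow> \<psi> z = 0" "\<And>z. norm z \<ge> R \<Longrightarrow> D z = 0" and R: "R > 0"
    and mc: "continuous_on UNIV m" and mdm [measurable]: "md \<in> borel_measurable borel"
    and M: "\<And>s. \<bar>m s\<bar> \<le> M" "\<And>s. \<bar>md s\<bar> \<le> M"
    and der: "\<And>s. sin \<alpha> < s \<Longrightarrow> s < 1 \<Longrightarrow> s \<noteq> s1 \<Longrightarrow> (m has_real_derivative md s) (at s)"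
  defines "b \<equiv> \<lambda>z. m (ang z) / rad z"
    and "bt \<equiv> \<lambda>z. (md (ang z) * (1 - (ang z)\<^sup>2) - m (ang z) * ang z) / (rad z)\<^sup>2"
  shows "integrable lborel (\<lambda>z. indicator C z * ((D z \<bullet> (0, 1)) * b z))"
    and "integrable lborel (\<lambda>z. indicator C z * (\<psi> z * bt z))"
    and "integrable lborel (\<lambda>x. \<psi> (x, tan \<alpha> * H0 x) * (m (sin \<alpha>) * cos \<alpha> / H0 x))"
    and "(LINT z|lborel. indicator C z * ((D z \<bullet> (0, 1)) * b z)) + (LINT z|lborel. indicator C z * (\<psi> z * bt z)) =
      - (LINT x|lborel. \<psi> (x, tan \<alpha> * H0 x) * (m (sin \<alpha>) * cos \<alpha> / H0 x))"
proof -
  obtain K where K: "K > 0" "\<And>z. norm (D z) \<le> K"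
    using bounded_of_compact_support[OF Dc supp(2)] by metis
  have \<psi>c: "continuous_on UNIV \<psi>"
    using GDERIV_D[OF \<psi>] by (auto intro!: continuous_at_imp_continuous_on differentiable_imp_continuous_within)
  have [measurable]: "\<psi> \<in> borel_measurable borel" "D \<in> borel_measurable borel" "m \<in> borel_measurable borel"
    using \<psi>c Dc mc by (auto intro: borel_measurable_continuous_onI)
  obtain P where P: "P > 0" "\<And>z. norm (\<psi> z) \<le> P"
    using bounded_of_compact_support[OF \<psi>c supp(1)] by metis
  have M0: "M \<ge> 0" using order_trans[OF abs_ge_zero M(1)] .
  have [measurable]: "b \<in> borel_measurable borel" "bt \<in> borel_measurable borel"
    unfolding b_def bt_def by measurable
  have l': "min l 1 > 0" using l by simp
  show i1: "integrable lborel (\<lambda>z. indicator C z * ((D z \<bullet> (0, 1)) * b z))"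
  proof (rule inverse_square_integrable[OF dim3 _ _ _ R, where K="K * M * (1 / min l 1) * R"])
    fix z :: "'a \<times> real" assume z: "z \<noteq> 0"
    show "\<bar>indicator C z * ((D z \<bullet> (0, 1)) * b z)\<bar> \<le> K * M * (1 / min l 1) * R / (norm z)\<^sup>2"
    proof (cases "norm z < R")
      case True
      have "\<bar>D z \<bullet> (0, 1)\<bar> \<le> norm (D z) * norm ((0 :: 'a, 1 :: real))" by (rule Cauchy_Schwarz_ineq2)
      also have "\<dots> \<le> K" using K by (simp add: norm_Pair)
      finally have 1: "\<bar>D z \<bullet> (0, 1)\<bar> \<le> K" .
      have "1 / rad z \<le> 1 / (min l 1 * norm z)"
        using rad_ge[of z] l' z by (intro divide_left_mono mult_pos_pos rad_pos) auto
      also have "\<dots> = (1 / min l 1) * norm z / (norm z)\<^sup>2" using z by (simp add: power2_eq_square)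
      also have "\<dots> \<le> (1 / min l 1) * R / (norm z)\<^sup>2"
        using True l' by (intro divide_right_mono mult_left_mono) auto
      finally have 2: "1 / rad z \<le> (1 / min l 1) * R / (norm z)\<^sup>2" .
      have "\<bar>b z\<bar> = \<bar>m (ang z)\<bar> * (1 / rad z)" using rad_nonneg[of z] by (simp add: b_def abs_divide)
      also have "\<dots> \<le> M * ((1 / min l 1) * R / (norm z)\<^sup>2)"
        using 2 M M0 rad_nonneg[of z] by (intro mult_mono) auto
      finally have "\<bar>D z \<bullet> (0, 1)\<bar> * \<bar>b z\<bar> \<le> K * (M * ((1 / min l 1) * R / (norm z)\<^sup>2))"
        using 1 K by (intro mult_mono) auto
      moreover have "\<bar>indicator C z * ((D z \<bullet> (0, 1)) * b z)\<bar> \<le> \<bar>D z \<bullet> (0, 1)\<bar> * \<bar>b z\<bar>"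
        by (simp add: indicator_def abs_mult)
      ultimately show ?thesis by simp
    next
      case False
      then show ?thesis using supp[of z] K M0 l' R by simp
    qed
  qed (use supp in auto)
  have bt_le: "\<bar>bt z\<bar> \<le> 2 * M * (1 / (rad z)\<^sup>2)" for z
  proof -
    have "\<bar>md (ang z) * (1 - (ang z)\<^sup>2)\<bar> \<le> M * 1"
      unfolding abs_mult using M M0 ang_le_1[of z]
      by (intro mult_mono) (auto simp: abs_square_le_1)
    moreover have "\<bar>m (ang z) * ang z\<bar> \<le> M * 1"
      unfolding abs_mult using M M0 ang_le_1[of z] by (intro mult_mono) auto
    ultimately have "\<bar>md (ang z) * (1 - (ang z)\<^sup>2) - m (ang z) * ang z\<bar> \<le> 2 * M" by linarith
    then have "\<bar>md (ang z) * (1 - (ang z)\<^sup>2) - m (ang z) * ang z\<bar> / (rad z)\<^sup>2 \<le> 2 * M / (rad z)\<^sup>2"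
      by (rule divide_right_mono) simp
    then show ?thesis by (simp add: bt_def abs_divide)
  qed
  show i2: "integrable lborel (\<lambda>z. indicator C z * (\<psi> z * bt z))"
  proof (rule inverse_square_integrable[OF dim3 _ _ _ R, where K="P * (2 * M * (1 / (min l 1)\<^sup>2))"])
    fix z :: "'a \<times> real" assume z: "z \<noteq> 0"
    have "\<bar>bt z\<bar> \<le> 2 * M * ((1 / (min l 1)\<^sup>2) / (norm z)\<^sup>2)"
      using M0 by (intro order_trans[OF bt_le[of z] mult_left_mono[OF inverse_rad_sq_le[OF z]]]) simp
    then have "\<bar>\<psi> z\<bar> * \<bar>bt z\<bar> \<le> P * (2 * M * ((1 / (min l 1)\<^sup>2) / (norm z)\<^sup>2))"
      using P by (intro mult_mono) auto
    moreover have "\<bar>indicator C z * (\<psi> z * bt z)\<bar> \<le> \<bar>\<psi> z\<bar> * \<bar>bt z\<bar>"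
      by (simp add: indicator_def abs_mult)
    ultimately show "\<bar>indicator C z * (\<psi> z * bt z)\<bar> \<le> P * (2 * M * (1 / (min l 1)\<^sup>2)) / (norm z)\<^sup>2" by simp
  qed (use supp in auto)
  define g where "g z = (D z \<bullet> (0, 1)) * b z + \<psi> z * bt z" for z
  define G where "G z = indicator C z * g z" for z
  have Gi: "integrable lborel G"
    using Bochner_Integration.integrable_add[OF i1 i2] by (simp add: G_def[abs_def] g_def distrib_left)
  then have Gi': "integrable (lborel \<Otimes>\<^sub>M lborel) G" by (simp add: lborel_prod)
  let ?B = "\<lambda>x. \<psi> (x, tan \<alpha> * H0 x) * (m (sin \<alpha>) * cos \<alpha> / H0 x)"
  \<comment> \<open>The line over x = 0 passes through the origin, where r vanishes; it is excluded
    as a null set.\<close>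
  have slice: "(LINT t|lborel. G (x, t)) = - ?B x" if x: "x \<noteq> 0" and ix: "integrable lborel (\<lambda>t. G (x, t))" for x
  proof -
    define s where "s = H0 x"
    have s: "s > 0" using H0_pos[OF x] by (simp add: s_def)
    define \<rho> where "\<rho> t = sqrt (s\<^sup>2 + t\<^sup>2)" for t
    have \<rho>: "\<rho> t > 0" "(\<rho> t)\<^sup>2 = s\<^sup>2 + t\<^sup>2" for t
    proof -
      have "0 < s\<^sup>2 + t\<^sup>2" using s by (intro add_pos_nonneg) auto
      then show "\<rho> t > 0" "(\<rho> t)\<^sup>2 = s\<^sup>2 + t\<^sup>2" by (simp_all add: \<rho>_def)
    qed
    have rx: "rad (x, t) = \<rho> t" "ang (x, t) = t / \<rho> t" for t
      by (simp_all add: ext_norm_def \<rho>_def s_def ang_def)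
    define t0 where "t0 = tan \<alpha> * s"
    \<comment> \<open>A height beyond the support of \<psi> and strictly above the boundary point,
      so the upper boundary term is 0.\<close>
    define T where "T = max R \<bar>t0\<bar> + 1"
    have T: "t0 < T" "R \<le> T" by (auto simp: T_def)
    define f where "f t = \<psi> (x, t) * (m (t / \<rho> t) / \<rho> t)" for t
    have dpsi: "((\<lambda>t. \<psi> (x, t)) has_real_derivative D (x, t) \<bullet> (0, 1)) (at t)" for t
    proof -
      have "((\<lambda>t. (x, t)) has_derivative (\<lambda>h. (0, h))) (at t)" by (auto intro!: derivative_eq_intros)
      from has_derivative_compose[OF this \<psi>[unfolded gderiv_def]]
      show ?thesis by (cases "D (x, t)") (simp add: has_field_derivative_def mult_commute_abs)
    qed
    have d\<rho>: "(\<rho> has_real_derivative t / \<rho> t) (at t)" for t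
      unfolding \<rho>_def[abs_def] using s
      by (auto intro!: derivative_eq_intros simp: add_pos_nonneg field_simps not_sum_power2_lt_zero)
    have d\<sigma>: "((\<lambda>t. t / \<rho> t) has_real_derivative s\<^sup>2 / (\<rho> t) ^ 3) (at t)" for t
    proof -
      have "((\<lambda>t. t / \<rho> t) has_real_derivative (1 * \<rho> t - t * (t / \<rho> t)) / (\<rho> t * \<rho> t)) (at t)"
        by (intro DERIV_divide DERIV_ident d\<rho>) (use \<rho>(1)[of t] in auto)
      also have "(1 * \<rho> t - t * (t / \<rho> t)) / (\<rho> t * \<rho> t) = ((\<rho> t)\<^sup>2 - t\<^sup>2) / (\<rho> t) ^ 3"
        using \<rho>(1)[of t] by (simp add: field_simps power2_eq_square power3_eq_cube)
      finally show ?thesis by (simp add: \<rho>(2))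
    qed
    have inC: "(x, t) \<in> C \<longleftrightarrow> t0 < t" for t by (simp add: cone_dom_def t0_def s_def)
    have \<rho>c: "continuous_on S \<rho>" for S unfolding \<rho>_def[abs_def] by (intro continuous_intros)
    \<comment> \<open>The corner s1 of m is met at most twice on each line, so the fundamental
      theorem with a finite exceptional set applies.\<close>
    define S where "S = {t. t / \<rho> t = s1}"
    have finS: "finite S"
    proof (cases "s1\<^sup>2 < 1")
      case True
      have "S \<subseteq> {- sqrt (s1\<^sup>2 * s\<^sup>2 / (1 - s1\<^sup>2)), sqrt (s1\<^sup>2 * s\<^sup>2 / (1 - s1\<^sup>2))}"
      proof
        fix t assume "t \<in> S"
        then have "t = s1 * \<rho> t" using \<rho>(1)[of t] by (auto simp: S_def field_simps)
        then have "t\<^sup>2 = s1\<^sup>2 * (s\<^sup>2 + t\<^sup>2)" using \<rho>(2)[of t] by (metis power_mult_distrib)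
        then have "t\<^sup>2 = s1\<^sup>2 * s\<^sup>2 / (1 - s1\<^sup>2)" using True by (simp add: field_simps)
        then have "\<bar>t\<bar> = sqrt (s1\<^sup>2 * s\<^sup>2 / (1 - s1\<^sup>2))" by (metis real_sqrt_abs)
        then show "t \<in> {- sqrt (s1\<^sup>2 * s\<^sup>2 / (1 - s1\<^sup>2)), sqrt (s1\<^sup>2 * s\<^sup>2 / (1 - s1\<^sup>2))}" by auto
      qed
      then show ?thesis by (rule finite_subset) simp
    next
      case False
      have "S = {}"
      proof (rule ccontr)
        assume "S \<noteq> {}"
        then obtain t where "t / \<rho> t = s1" by (auto simp: S_def)
        then have "t = s1 * \<rho> t" using \<rho>(1)[of t] by (auto simp: field_simps)
        then have "t\<^sup>2 = s1\<^sup>2 * (s\<^sup>2 + t\<^sup>2)" using \<rho>(2)[of t] by (metis power_mult_distrib)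
        moreover have "1 * (s\<^sup>2 + t\<^sup>2) \<le> s1\<^sup>2 * (s\<^sup>2 + t\<^sup>2)" using False by (intro mult_right_mono) auto
        ultimately show False using s by simp
      qed
      then show ?thesis by simp
    qed
    have "((\<lambda>t. g (x, t)) has_integral (f T - f t0)) {t0..T}"
    proof (rule fundamental_theorem_of_calculus_interior_strong[OF finS])
      show "continuous_on {t0..T} f"
        unfolding f_def[abs_def]
        by (intro continuous_intros continuous_on_compose2[OF \<psi>c] continuous_on_compose2[OF mc] \<rho>c)
          (use \<rho>(1) in \<open>auto simp: less_imp_neq[THEN not_sym]\<close>)
      fix t assume t: "t \<in> {t0<..<T} - S"
      have "sin \<alpha> < t / \<rho> t" using ang_gt[of "(x, t)"] inC[of t] t by (simp add: rx)
      moreover have "t / \<rho> t < 1" using ang_lt_1[of "(x, t)"] x by (simp add: rx)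
      moreover have "t / \<rho> t \<noteq> s1" using t by (auto simp: S_def)
      ultimately have dm: "((\<lambda>t. m (t / \<rho> t)) has_real_derivative md (t / \<rho> t) * (s\<^sup>2 / (\<rho> t) ^ 3)) (at t)"
        by (intro DERIV_chain2[OF der d\<sigma>])
      have "(f has_real_derivative (D (x, t) \<bullet> (0, 1)) * (m (t / \<rho> t) / \<rho> t) +
         ((md (t / \<rho> t) * (s\<^sup>2 / (\<rho> t) ^ 3)) * \<rho> t - m (t / \<rho> t) * (t / \<rho> t)) / (\<rho> t * \<rho> t) * \<psi> (x, t)) (at t)"
        unfolding f_def[abs_def]
        by (intro DERIV_mult DERIV_divide dpsi dm d\<rho>) (use \<rho>(1)[of t] in auto)
      also have "(D (x, t) \<bullet> (0, 1)) * (m (t / \<rho> t) / \<rho> t) +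
         ((md (t / \<rho> t) * (s\<^sup>2 / (\<rho> t) ^ 3)) * \<rho> t - m (t / \<rho> t) * (t / \<rho> t)) / (\<rho> t * \<rho> t) * \<psi> (x, t) = g (x, t)"
      proof -
        have "1 - (t / \<rho> t)\<^sup>2 = s\<^sup>2 / (\<rho> t)\<^sup>2"
          using ang_sq[of "(x, t)"] x by (simp add: rx s_def zero_prod_def)
        moreover have "(md (t / \<rho> t) * (s\<^sup>2 / (\<rho> t) ^ 3)) * \<rho> t = md (t / \<rho> t) * (s\<^sup>2 / (\<rho> t)\<^sup>2)"
          using \<rho>(1)[of t] by (simp add: power2_eq_square power3_eq_cube)
        ultimately show ?thesis
          unfolding g_def b_def bt_def rx by (simp add: power2_eq_square mult.commute)
      qed
      finally show "(f has_vector_derivative g (x, t)) (at t)"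
        by (simp add: has_real_derivative_iff_has_vector_derivative)
    qed (use T in auto)
    moreover have "f T = 0"
    proof -
      have "R \<le> \<bar>T\<bar>" using T by simp
      also have "\<dots> \<le> norm (x, T)" by (simp add: norm_Pair)
      finally show ?thesis unfolding f_def using supp(1) by simp
    qed
    moreover have "f t0 = ?B x"
    proof -
      have "t0 / \<rho> t0 = sin \<alpha>" using ang_boundary[OF x] by (simp add: rx t0_def s_def)
      moreover have "\<rho> t0 = H0 x / cos \<alpha>" using rad_boundary[of x] by (simp add: rx t0_def s_def)
      ultimately show ?thesis by (simp add: f_def t0_def s_def)
    qed
    ultimately have "((\<lambda>t. g (x, t)) has_integral (- ?B x)) {t0..T}" by simp
    then have "((\<lambda>t. if t \<in> {t0..T} then g (x, t) else 0) has_integral (- ?B x)) UNIV"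
      by (simp only: has_integral_restrict_UNIV)
    then have "((\<lambda>t. G (x, t)) has_integral (- ?B x)) UNIV"
    proof (rule has_integral_spike_finite[of "{t0}", rotated 2])
      fix t assume t: "t \<in> UNIV - {t0}"
      show "G (x, t) = (if t \<in> {t0..T} then g (x, t) else 0)"
      proof (cases "t > T")
        case True
        have "R \<le> \<bar>t\<bar>" using T True by simp
        also have "\<dots> \<le> norm (x, t)" by (simp add: norm_Pair)
        finally show ?thesis using supp[of "(x, t)"] True by (simp add: G_def g_def)
      next
        case False
        then show ?thesis using t by (auto simp: G_def inC indicator_def)
      qed
    qed simp
    moreover have "((\<lambda>t. G (x, t)) has_integral (LINT t|lborel. G (x, t))) UNIV"
      using ix by (rule has_integral_integral_lborel)
    ultimately show ?thesis using has_integral_unique by blast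
  qed
  \<comment> \<open>Fubini provides integrable slices for almost every x only; elsewhere the slice
    formula is not claimed.\<close>
  have AEs: "AE x in lborel. (LINT t|lborel. G (x, t)) = - ?B x"
    using lborel_pair.AE_integrable_fst'[OF Gi'] AE_lborel_singleton[of "0::'a"]
    by eventually_elim (rule slice)
  have Bm: "?B \<in> borel_measurable lborel"
  proof -
    have [measurable]: "(\<lambda>x. (x, tan \<alpha> * H0 x)) \<in> borel \<rightarrow>\<^sub>M borel"
      by (intro borel_measurable_continuous_onI continuous_intros continuous_H0)
    show ?thesis by measurable
  qed
  have fi: "integrable lborel (\<lambda>x. LINT t|lborel. G (x, t))" by (rule lborel_pair.integrable_fst'[OF Gi'])
  have "integrable lborel (\<lambda>x. - ?B x)"
    using fi by (rule integrable_cong_AE_imp) (use Bm AEs in \<open>auto elim!: eventually_mono\<close>)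
  then show "integrable lborel ?B" by simp
  have "(LINT z|lborel. indicator C z * ((D z \<bullet> (0, 1)) * b z)) + (LINT z|lborel. indicator C z * (\<psi> z * bt z)) = (LINT z|lborel. G z)"
    using i1 i2 by (simp add: G_def g_def distrib_left)
  also have "\<dots> = integral\<^sup>L (lborel \<Otimes>\<^sub>M lborel) G" by (simp add: lborel_prod)
  also have "\<dots> = (LINT x|lborel. LINT t|lborel. G (x, t))" using lborel_pair.integral_fst'[OF Gi'] by simp
  also have "\<dots> = (LINT x|lborel. - ?B x)"
    by (rule integral_cong_AE) (use AEs Bm fi in auto)
  finally show "(LINT z|lborel. indicator C z * ((D z \<bullet> (0, 1)) * b z)) + (LINT z|lborel. indicator C z * (\<psi> z * bt z)) =
      - (LINT x|lborel. ?B x)" by simp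
qed

end

section \<open>From a Riccati subsolution to the inequality for test functions\<close>

context cone_pair
begin

text \<open>Duality in the horizontal component, then Cauchy-Schwarz in the plane of the two
  components.\<close>

lemma ext_norm_H_duality: "w \<bullet> y \<le> ext_norm H w * rad y"
proof -
  obtain \<xi> \<tau> where w: "w = (\<xi>, \<tau>)" by (cases w)
  obtain x t where y: "y = (x, t)" by (cases y)
  have cs: "a * c + b * d \<le> sqrt (a\<^sup>2 + b\<^sup>2) * sqrt (c\<^sup>2 + d\<^sup>2)" for a b c d :: real
  proof -
    have "(a, b) \<bullet> (c, d) \<le> norm (a, b) * norm (c, d)" by (rule norm_cauchy_schwarz)
    then show ?thesis by (simp add: norm_Pair)
  qed
  have "w \<bullet> y = \<xi> \<bullet> x + \<tau> * t" by (simp add: w y)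
  also have "\<dots> \<le> H \<xi> * H0 x + \<tau> * t" using duality[of \<xi> x] by simp
  also have "\<dots> \<le> sqrt ((H \<xi>)\<^sup>2 + \<tau>\<^sup>2) * sqrt ((H0 x)\<^sup>2 + t\<^sup>2)" by (rule cs)
  finally show ?thesis by (simp add: ext_norm_def w y)
qed

lemma ext_norm_H_le: "ext_norm H w \<le> (L + 1) * norm w"
proof -
  obtain \<xi> \<tau> where w: "w = (\<xi>, \<tau>)" by (cases w)
  have "sqrt ((H \<xi>)\<^sup>2 + \<tau>\<^sup>2) \<le> \<bar>H \<xi>\<bar> + \<bar>\<tau>\<bar>" by (rule sqrt_sum_squares_le_sum_abs)
  also have "\<dots> \<le> L * norm \<xi> + \<bar>\<tau>\<bar>" using H_le[of \<xi>] H_nonneg[of \<xi>] by simp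
  also have "\<dots> \<le> L * norm w + 1 * norm w"
    using L by (intro add_mono mult_left_mono) (auto simp: w norm_Pair intro!: real_le_rsqrt)
  finally show ?thesis by (simp add: ext_norm_def w algebra_simps)
qed

lemma continuous_ext_norm_H: "continuous_on S (ext_norm H)"
  unfolding ext_norm_def[abs_def]
  by (intro continuous_intros continuous_on_compose2[OF continuous_H]) auto

lemma measurable_ext_norm_H [measurable]: "ext_norm H \<in> borel_measurable borel"
  by (intro borel_measurable_continuous_onI continuous_ext_norm_H)

lemma cone_inverse_square_integrable:
  fixes h :: "'a \<times> real \<Rightarrow> real"
  assumes h [measurable]: "h \<in> borel_measurable borel" and Q: "\<And>z. \<bar>h z\<bar> \<le> Q" and R: "\<And>z. norm z \<ge> R \<Longrightarrow> h z = 0" "R > 0"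
  shows "integrable lborel (\<lambda>z. indicator C z * (h z / (rad z)\<^sup>2))"
proof (rule inverse_square_integrable[OF dim3 _ _ _ R(2), where K="Q * (1 / (min l 1)\<^sup>2)"])
  fix z :: "'a \<times> real" assume z: "z \<noteq> 0"
  have Q0: "Q \<ge> 0" by (rule order_trans[OF abs_ge_zero Q])
  have "\<bar>h z\<bar> * (1 / (rad z)\<^sup>2) \<le> Q * ((1 / (min l 1)\<^sup>2) / (norm z)\<^sup>2)"
    using Q0 by (intro mult_mono Q inverse_rad_sq_le z) auto
  moreover have "\<bar>indicator C z * (h z / (rad z)\<^sup>2)\<bar> \<le> \<bar>h z\<bar> * (1 / (rad z)\<^sup>2)"
    by (simp add: indicator_def abs_divide)
  ultimately show "\<bar>indicator C z * (h z / (rad z)\<^sup>2)\<bar> \<le> Q * (1 / (min l 1)\<^sup>2) / (norm z)\<^sup>2" by simp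
qed (use R in auto)

lemma test_square:
  fixes v :: "'a \<times> real \<Rightarrow> real"
  assumes v: "v \<in> test_functions UNIV"
  shows "GDERIV (\<lambda>z. (v z)\<^sup>2) z :> (2 * v z) *\<^sub>R grad v z" "continuous_on UNIV (\<lambda>z. (2 * v z) *\<^sub>R grad v z)"
proof -
  have "GDERIV (\<lambda>z. v z * v z) z :> v z *\<^sub>R grad v z + v z *\<^sub>R grad v z"
    by (intro GDERIV_mult test_functions_GDERIV[OF v])
  then show "GDERIV (\<lambda>z. (v z)\<^sup>2) z :> (2 * v z) *\<^sub>R grad v z"
    by (simp add: power2_eq_square scaleR_add_left[symmetric])
  show "continuous_on UNIV (\<lambda>z. (2 * v z) *\<^sub>R grad v z)"
    by (intro continuous_intros test_functions_continuous[OF v] test_functions_grad_continuous[OF v])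
qed

lemma test_boundary_integrable:
  fixes v :: "'a \<times> real \<Rightarrow> real"
  assumes v: "v \<in> test_functions UNIV"
  shows "integrable lborel (\<lambda>x. (v (x, tan \<alpha> * H0 x))\<^sup>2 / H0 x)"
proof -
  obtain B R where R: "R > 0" "\<And>z. norm z \<ge> R \<Longrightarrow> v z = 0" "\<And>z. norm z \<ge> R \<Longrightarrow> grad v z = 0"
    using test_functions_bounds[OF v] by metis
  \<comment> \<open>The boundary integrability in \<open>vertical_identity\<close> for the constant
    multiplier m = 1.\<close>
  have "integrable lborel (\<lambda>x. (v (x, tan \<alpha> * H0 x))\<^sup>2 * (1 * cos \<alpha> / H0 x))"
    by (rule vertical_identity(3)[OF test_square[OF v], of R "\<lambda>_. 1" "\<lambda>_. 0" 1]) (use R in auto)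
  then have "integrable lborel (\<lambda>x. (1 / cos \<alpha>) * ((v (x, tan \<alpha> * H0 x))\<^sup>2 * (1 * cos \<alpha> / H0 x)))"
    by (rule integrable_mult_right)
  then show ?thesis using cos_pos by (simp add: field_simps)
qed

lemma test_grad_integrable:
  fixes v :: "'a \<times> real \<Rightarrow> real"
  assumes v: "v \<in> test_functions UNIV"
  shows "integrable lborel (\<lambda>z. indicator C z * (ext_norm H (grad v z))\<^sup>2)"
proof -
  obtain B R where R: "B > 0" "R > 0" "\<And>z. norm (grad v z) \<le> B" "\<And>z. norm z \<ge> R \<Longrightarrow> grad v z = 0"
    using test_functions_bounds[OF v] by metis
  have [measurable]: "grad v \<in> borel_measurable borel"
    by (intro borel_measurable_continuous_onI test_functions_grad_continuous[OF v])
  have i: "integrable lborel (\<lambda>z::'a\<times>real. ((L + 1) * B)\<^sup>2 * indicator (cball 0 R) z)"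
    by (intro integrable_mult_right integrable_real_indicator emeasure_bounded_finite) auto
  show ?thesis
  proof (rule Bochner_Integration.integrable_bound[OF i])
    show "AE z in lborel. norm (indicator C z * (ext_norm H (grad v z))\<^sup>2) \<le> norm (((L + 1) * B)\<^sup>2 * indicator (cball 0 R) z)"
    proof (rule AE_I2)
      fix z :: "'a \<times> real"
      show "norm (indicator C z * (ext_norm H (grad v z))\<^sup>2) \<le> norm (((L + 1) * B)\<^sup>2 * indicator (cball 0 R) z)"
      proof (cases "norm z \<le> R")
        case True
        have "ext_norm H (grad v z) \<le> (L + 1) * norm (grad v z)" by (rule ext_norm_H_le)
        also have "\<dots> \<le> (L + 1) * B" using L by (intro mult_left_mono R) auto
        finally have "(ext_norm H (grad v z))\<^sup>2 \<le> ((L + 1) * B)\<^sup>2" by (intro power_mono) (simp_all add: ext_norm_def)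
        then show ?thesis using True by (auto simp: indicator_def)
      next
        case False
        have "H 0 = 0" using H_le[of 0] H_nonneg[of 0] by simp
        then show ?thesis using False R(4)[of z] by (simp add: ext_norm_def)
      qed
    qed
  qed simp
qed

text \<open>The assumption \<open>ric\<close> is what remains of the bulk terms after integration by
  parts. The value of m at sin \<alpha> enters the boundary term with a minus sign, so a negative m
  there yields a positive boundary coefficient.\<close>

lemma test_inequality:
  fixes v :: "'a \<times> real \<Rightarrow> real" and m md :: "real \<Rightarrow> real"
  assumes v: "v \<in> test_functions UNIV"
    and mc: "continuous_on UNIV m" and mdm [measurable]: "md \<in> borel_measurable borel"
    and M: "\<And>s. \<bar>m s\<bar> \<le> M" "\<And>s. \<bar>md s\<bar> \<le> M"
    and der: "\<And>s. sin \<alpha> < s \<Longrightarrow> s < 1 \<Longrightarrow> s \<noteq> s1 \<Longrightarrow> (m has_real_derivative md s) (at s)"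
    and ric: "\<And>s. sin \<alpha> < s \<Longrightarrow> s \<le> 1 \<Longrightarrow>
      c \<le> ((real DIM('a) - 1) / 2)\<^sup>2 + real DIM('a) * s * m s - (1 - s\<^sup>2) * (md s + (m s)\<^sup>2)"
  shows "c * (LINT z|lborel. indicator C z * ((v z)\<^sup>2 / (rad z)\<^sup>2))
     - m (sin \<alpha>) * cos \<alpha> * (LINT x|lborel. (v (x, tan \<alpha> * H0 x))\<^sup>2 / H0 x)
     \<le> (LINT z|lborel. indicator C z * (ext_norm H (grad v z))\<^sup>2)"
proof -
  let ?d = "real DIM('a)"
  define q where "q = (?d - 1) / 2"
  obtain B R where BR: "B > 0" "R > 0" "\<And>z. \<bar>v z\<bar> \<le> B" "\<And>z. norm (grad v z) \<le> B"
    "\<And>z. norm z \<ge> R \<Longrightarrow> v z = 0" "\<And>z. norm z \<ge> R \<Longrightarrow> grad v z = 0"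
    using test_functions_bounds[OF v] by metis
  note R = BR(2,5,6)
  define \<psi> where "\<psi> z = (v z)\<^sup>2" for z
  define D where "D z = (2 * v z) *\<^sub>R grad v z" for z
  have \<psi>: "GDERIV \<psi> z :> D z" for z unfolding \<psi>_def[abs_def] D_def by (rule test_square[OF v])
  have Dc: "continuous_on UNIV D" unfolding D_def[abs_def] by (rule test_square[OF v])
  have supp: "\<And>z. norm z \<ge> R \<Longrightarrow> \<psi> z = 0" "\<And>z. norm z \<ge> R \<Longrightarrow> D z = 0" using R by (auto simp: \<psi>_def D_def)
  have [measurable]: "v \<in> borel_measurable borel" "grad v \<in> borel_measurable borel" "m \<in> borel_measurable borel" "D \<in> borel_measurable borel"
    using test_functions_continuous[OF v, of UNIV] test_functions_grad_continuous[OF v, of UNIV] mc Dc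
    by (auto intro: borel_measurable_continuous_onI)
  have \<psi>m [measurable]: "\<psi> \<in> borel_measurable borel" unfolding \<psi>_def[abs_def] by measurable
  have M0: "M \<ge> 0" using order_trans[OF abs_ge_zero M(1)] .
  have q0: "q \<ge> 0" using dim by (simp add: q_def)
  \<comment> \<open>For the logarithmic gradient of r^(-q) G(s), the identity s = t/r splits the
    derivative of s into a vertical part 1/r and a radial part -s/r. Collecting the radial parts
    gives -(q + s m)/r, the vertical part is m/r.\<close>
  define k where "k z = q + ang z * m (ang z)" for z
  have km [measurable]: "k \<in> borel_measurable borel" unfolding k_def[abs_def] by measurable
  have k_le: "\<bar>k z\<bar> \<le> q + M" for z
  proof -
    have "\<bar>ang z * m (ang z)\<bar> \<le> 1 * M" unfolding abs_mult using M0 by (intro mult_mono ang_le_1 M) auto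
    then show ?thesis using q0 by (simp add: k_def)
  qed
  \<comment> \<open>The indicator of the cone is put into the weight: the cone is invariant under
    dilation, so the radial integration by parts produces no boundary term.\<close>
  define a where "a z = - (indicator C z * (k z / (rad z)\<^sup>2))" for z
  have am [measurable]: "a \<in> borel_measurable borel" unfolding a_def[abs_def] by measurable
  have a_bound: "\<bar>a z\<bar> \<le> (q + M) * (1 / (min l 1)\<^sup>2) / (norm z)\<^sup>2" if z: "z \<noteq> 0" for z
  proof -
    have "\<bar>k z\<bar> * (1 / (rad z)\<^sup>2) \<le> (q + M) * ((1 / (min l 1)\<^sup>2) / (norm z)\<^sup>2)"
      using q0 M0 by (intro mult_mono k_le inverse_rad_sq_le z) auto
    moreover have "\<bar>a z\<bar> \<le> \<bar>k z\<bar> * (1 / (rad z)\<^sup>2)"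
      by (simp add: a_def indicator_def abs_divide)
    ultimately show ?thesis by simp
  qed
  have a_hom: "a (c *\<^sub>R z) = a z / c\<^sup>2" if "c > 0" for c z
    using that by (simp add: a_def k_def rad_scale ang_scale C_scale indicator_def power_mult_distrib)
  have rad_id: "(LINT z|lborel. (D z \<bullet> z) * a z) = - (2 * q) * (LINT z|lborel. \<psi> z * a z)"
  proof -
    have eq: "real DIM('a \<times> real) - 2 = 2 * q" by (simp add: q_def)
    show ?thesis by (rule radial_identity[OF dim3 \<psi> Dc supp R(1) am a_bound a_hom, unfolded eq])
  qed
  define b where "b z = m (ang z) / rad z" for z
  define bt where "bt z = (md (ang z) * (1 - (ang z)\<^sup>2) - m (ang z) * ang z) / (rad z)\<^sup>2" for z
  note vid = vertical_identity[OF \<psi> Dc supp R(1) mc mdm M der, folded b_def bt_def]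
  define J2 where "J2 = (LINT z|lborel. indicator C z * ((D z \<bullet> (0, 1)) * b z))"
  define J3 where "J3 = (LINT z|lborel. indicator C z * (\<psi> z * bt z))"
  define Bd where "Bd = m (sin \<alpha>) * cos \<alpha> * (LINT x|lborel. (v (x, tan \<alpha> * H0 x))\<^sup>2 / H0 x)"
  have v4: "J2 + J3 = - Bd"
  proof -
    have "(LINT x|lborel. \<psi> (x, tan \<alpha> * H0 x) * (m (sin \<alpha>) * cos \<alpha> / H0 x)) = Bd"
      unfolding Bd_def \<psi>_def by (subst integral_mult_right_zero[symmetric]) (simp add: mult_ac)
    then show ?thesis using vid(4) by (simp add: J2_def J3_def)
  qed
  have \<psi>_le: "\<bar>\<psi> z\<bar> \<le> B\<^sup>2" for z
    unfolding \<psi>_def using power_mono[OF BR(3) abs_ge_zero, of z 2] by simp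
  have iDa: "integrable lborel (\<lambda>z. (D z \<bullet> z) * a z)"
  proof -
    have "integrable lborel (\<lambda>z. indicator C z * (((D z \<bullet> z) * - k z) / (rad z)\<^sup>2))"
    proof (rule cone_inverse_square_integrable[where Q="(2 * B * B) * R * (q + M)" and R=R])
      fix z :: "'a \<times> real"
      show "\<bar>(D z \<bullet> z) * - k z\<bar> \<le> (2 * B * B) * R * (q + M)"
      proof (cases "norm z < R")
        case True
        have "\<bar>D z \<bullet> z\<bar> \<le> norm (D z) * norm z" by (rule Cauchy_Schwarz_ineq2)
        also have "norm (D z) = 2 * \<bar>v z\<bar> * norm (grad v z)" by (simp add: D_def abs_mult)
        also have "2 * \<bar>v z\<bar> * norm (grad v z) * norm z \<le> 2 * B * B * R"
          using BR True by (intro mult_mono) auto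
        finally show ?thesis unfolding abs_mult abs_minus using k_le[of z] BR by (intro mult_mono) auto
      next
        case False
        then show ?thesis using supp BR q0 M0 by simp
      qed
    qed (use supp R in auto)
    then show ?thesis by (simp add: a_def mult_ac)
  qed
  \<comment> \<open>Chosen so that \<open>e z / (rad z)^2\<close> is v^2 times the squared dual norm
    of the vector field, as \<open>radw\<close> shows below.\<close>
  define e where "e z = \<psi> z * (q\<^sup>2 + (m (ang z))\<^sup>2 * (1 - (ang z)\<^sup>2))" for z
  have m2: "(m (ang z))\<^sup>2 * (1 - (ang z)\<^sup>2) \<le> M\<^sup>2 * 1" "0 \<le> (m (ang z))\<^sup>2 * (1 - (ang z)\<^sup>2)" for z
  proof -
    have 1: "(m (ang z))\<^sup>2 \<le> M\<^sup>2" using power_mono[OF M(1) abs_ge_zero, of "ang z" 2] by simp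
    have 2: "0 \<le> 1 - (ang z)\<^sup>2" "1 - (ang z)\<^sup>2 \<le> 1" using ang_le_1[of z] by (auto simp: abs_square_le_1)
    show "(m (ang z))\<^sup>2 * (1 - (ang z)\<^sup>2) \<le> M\<^sup>2 * 1" using 1 2 by (intro mult_mono) auto
    show "0 \<le> (m (ang z))\<^sup>2 * (1 - (ang z)\<^sup>2)" using 2 by simp
  qed
  have iJ4: "integrable lborel (\<lambda>z. indicator C z * (e z / (rad z)\<^sup>2))"
  proof (rule cone_inverse_square_integrable[where Q="B\<^sup>2 * (q\<^sup>2 + M\<^sup>2)" and R=R])
    show "\<bar>e z\<bar> \<le> B\<^sup>2 * (q\<^sup>2 + M\<^sup>2)" for z
      unfolding e_def abs_mult using m2[of z] \<psi>_le[of z] by (intro mult_mono) auto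
    show "e \<in> borel_measurable borel" unfolding e_def[abs_def] by measurable
  qed (use supp R in \<open>auto simp: e_def\<close>)
  define J4 where "J4 = (LINT z|lborel. indicator C z * (e z / (rad z)\<^sup>2))"
  have i\<psi>a: "integrable lborel (\<lambda>z. \<psi> z * a z)"
  proof -
    have "integrable lborel (\<lambda>z. indicator C z * ((\<psi> z * - k z) / (rad z)\<^sup>2))"
    proof (rule cone_inverse_square_integrable[where Q="B\<^sup>2 * (q + M)" and R=R])
      show "\<bar>\<psi> z * - k z\<bar> \<le> B\<^sup>2 * (q + M)" for z
        unfolding abs_mult abs_minus using k_le[of z] \<psi>_le[of z] by (intro mult_mono) auto
    qed (use supp R in auto)
    then show ?thesis by (simp add: a_def mult_ac)
  qed
  have i\<psi>: "integrable lborel (\<lambda>z. indicator C z * (\<psi> z / (rad z)\<^sup>2))"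
    by (rule cone_inverse_square_integrable[where Q="B\<^sup>2" and R=R]) (use supp R \<psi>_le in auto)
  have pointwise: "(D z \<bullet> z) * a z + indicator C z * ((D z \<bullet> (0, 1)) * b z) - indicator C z * (e z / (rad z)\<^sup>2)
      \<le> indicator C z * (ext_norm H (grad v z))\<^sup>2" for z
  proof (cases "z \<in> C")
    case True
    then have nz: "z \<noteq> 0" using zero_notin_C by auto
    then have r: "rad z > 0" by (rule rad_pos)
    let ?s = "ang z" and ?m = "m (ang z)"
    \<comment> \<open>This is the vector field Y on the cone. The mixed terms in its squared dual
      norm cancel and leave q^2 + m^2 (1 - s^2) over r^2.\<close>
    define w where "w = a z *\<^sub>R z + b z *\<^sub>R (0, 1)"
    have az: "a z = - (q + ?s * ?m) / (rad z)\<^sup>2" using True by (simp add: a_def k_def minus_divide_left)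
    have radw: "(rad w)\<^sup>2 = (q\<^sup>2 + ?m\<^sup>2 * (1 - ?s\<^sup>2)) / (rad z)\<^sup>2"
    proof -
      have t: "snd z = ?s * rad z" using r by (simp add: ang_def)
      have "(rad w)\<^sup>2 = (a z)\<^sup>2 * (H0 (fst z))\<^sup>2 + (a z * snd z + b z)\<^sup>2"
        by (simp add: rad_sq w_def H0_scale power_mult_distrib)
      also have "\<dots> = (a z)\<^sup>2 * (rad z)\<^sup>2 + 2 * (a z * (b z * snd z)) + (b z)\<^sup>2"
        unfolding rad_sq by (simp add: power2_eq_square algebra_simps)
      also have "(a z)\<^sup>2 * (rad z)\<^sup>2 = (q + ?s * ?m)\<^sup>2 / (rad z)\<^sup>2"
      proof -
        have "(a z)\<^sup>2 = (q + ?s * ?m)\<^sup>2 / ((rad z)\<^sup>2)\<^sup>2" by (simp only: az power_divide power2_minus)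
        then show ?thesis using r by (simp add: power2_eq_square)
      qed
      also have "b z * snd z = ?m * ?s" unfolding t b_def using r by simp
      also have "a z * (?m * ?s) = - (q + ?s * ?m) * (?m * ?s) / (rad z)\<^sup>2" unfolding az by simp
      also have "(b z)\<^sup>2 = ?m\<^sup>2 / (rad z)\<^sup>2" by (simp add: b_def power_divide)
      also have "(q + ?s * ?m)\<^sup>2 / (rad z)\<^sup>2 + 2 * (- (q + ?s * ?m) * (?m * ?s) / (rad z)\<^sup>2) + ?m\<^sup>2 / (rad z)\<^sup>2
         = ((q + ?s * ?m)\<^sup>2 + 2 * (- (q + ?s * ?m) * (?m * ?s)) + ?m\<^sup>2) / (rad z)\<^sup>2"
        by (simp only: add_divide_distrib times_divide_eq_right)
      also have "(q + ?s * ?m)\<^sup>2 + 2 * (- (q + ?s * ?m) * (?m * ?s)) + ?m\<^sup>2 = q\<^sup>2 + ?m\<^sup>2 * (1 - ?s\<^sup>2)"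
        by (simp add: power2_eq_square algebra_simps)
      finally show ?thesis .
    qed
    have "(D z \<bullet> z) * a z + (D z \<bullet> (0, 1)) * b z = 2 * (grad v z \<bullet> (v z *\<^sub>R w))"
      unfolding D_def w_def inner_scaleR_left inner_add_right inner_scaleR_right
      by (simp only: distrib_left mult_ac)
    also have "\<dots> \<le> 2 * (ext_norm H (grad v z) * (\<bar>v z\<bar> * rad w))"
      using ext_norm_H_duality[of "grad v z" "v z *\<^sub>R w"] by (simp only: rad_scale)
    also have "\<dots> \<le> (ext_norm H (grad v z))\<^sup>2 + (\<bar>v z\<bar> * rad w)\<^sup>2"
      using sum_squares_bound[of "ext_norm H (grad v z)" "\<bar>v z\<bar> * rad w"] by simp
    also have "(\<bar>v z\<bar> * rad w)\<^sup>2 = e z / (rad z)\<^sup>2"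
      by (simp add: power_mult_distrib radw e_def \<psi>_def)
    finally show ?thesis using True by simp
  qed (simp add: a_def)
  have "(LINT z|lborel. (D z \<bullet> z) * a z) + J2 - J4 \<le> (LINT z|lborel. indicator C z * (ext_norm H (grad v z))\<^sup>2)"
  proof -
    have "(LINT z|lborel. (D z \<bullet> z) * a z) + J2 - J4 = (LINT z|lborel. (D z \<bullet> z) * a z + indicator C z * ((D z \<bullet> (0, 1)) * b z) - indicator C z * (e z / (rad z)\<^sup>2))"
      unfolding J2_def J4_def by (simp only: Bochner_Integration.integral_add Bochner_Integration.integral_diff Bochner_Integration.integrable_add iDa vid(1) iJ4)
    also have "\<dots> \<le> (LINT z|lborel. indicator C z * (ext_norm H (grad v z))\<^sup>2)"
      by (intro integral_mono pointwise Bochner_Integration.integrable_add Bochner_Integration.integrable_diff iDa vid(1) iJ4 test_grad_integrable v)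
    finally show ?thesis .
  qed
  \<comment> \<open>All bulk terms are now multiples of \<psi> / r^2; with 2q + 1 =
    \<open>DIM('a)\<close> their common factor is exactly the right-hand side of
    \<open>ric\<close>.\<close>
  moreover have "c * (LINT z|lborel. indicator C z * (\<psi> z / (rad z)\<^sup>2)) \<le> - (2 * q) * (LINT z|lborel. \<psi> z * a z) - J3 - J4"
  proof -
    have "- (2 * q) * (LINT z|lborel. \<psi> z * a z) - J3 - J4 = (LINT z|lborel. - (2 * q) * (\<psi> z * a z) - indicator C z * (\<psi> z * bt z) - indicator C z * (e z / (rad z)\<^sup>2))"
      unfolding J3_def J4_def integral_mult_right_zero[symmetric]
      by (simp only: Bochner_Integration.integral_diff Bochner_Integration.integrable_diff integrable_mult_right i\<psi>a vid(2) iJ4)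
    moreover have "c * (LINT z|lborel. indicator C z * (\<psi> z / (rad z)\<^sup>2)) = (LINT z|lborel. c * (indicator C z * (\<psi> z / (rad z)\<^sup>2)))"
      by (rule integral_mult_right_zero[symmetric])
    moreover have "(LINT z|lborel. c * (indicator C z * (\<psi> z / (rad z)\<^sup>2))) \<le>
       (LINT z|lborel. - (2 * q) * (\<psi> z * a z) - indicator C z * (\<psi> z * bt z) - indicator C z * (e z / (rad z)\<^sup>2))"
    proof (rule integral_mono)
      fix z
      show "c * (indicator C z * (\<psi> z / (rad z)\<^sup>2)) \<le> - (2 * q) * (\<psi> z * a z) - indicator C z * (\<psi> z * bt z) - indicator C z * (e z / (rad z)\<^sup>2)"
      proof (cases "z \<in> C")
        case True
        let ?s = "ang z" and ?m = "m (ang z)" and ?md = "md (ang z)"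
        have s: "sin \<alpha> < ?s" "?s \<le> 1" using ang_gt[OF True] ang_le_1[of z] by auto
        have "- (2 * q) * (\<psi> z * a z) - \<psi> z * bt z - e z / (rad z)\<^sup>2 =
           (2 * q * (q + ?s * ?m) - (?md * (1 - ?s\<^sup>2) - ?m * ?s) - (q\<^sup>2 + ?m\<^sup>2 * (1 - ?s\<^sup>2))) * (\<psi> z / (rad z)\<^sup>2)"
        proof -
          have gen: "- (2 * q) * (p * (- (k / X))) - p * (Y / X) - p * E / X = (2 * q * k - Y - E) * (p / X)"
            for p k X Y E :: real by (simp add: divide_inverse algebra_simps)
          have "a z = - ((q + ?s * ?m) / (rad z)\<^sup>2)" using True by (simp add: a_def k_def)
          then show ?thesis unfolding bt_def e_def by (simp only: gen)
        qed
        also have "2 * q * (q + ?s * ?m) - (?md * (1 - ?s\<^sup>2) - ?m * ?s) - (q\<^sup>2 + ?m\<^sup>2 * (1 - ?s\<^sup>2)) =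
            q\<^sup>2 + (2 * q + 1) * ?s * ?m - (1 - ?s\<^sup>2) * (?md + ?m\<^sup>2)"
          by (simp add: power2_eq_square algebra_simps)
        also have "2 * q + 1 = ?d"
        proof -
          have "2 * ((x - 1) / 2) + 1 = x" for x :: real by (simp add: field_simps)
          then show ?thesis unfolding q_def .
        qed
        finally have eq: "- (2 * q) * (\<psi> z * a z) - \<psi> z * bt z - e z / (rad z)\<^sup>2 =
           (q\<^sup>2 + ?d * ?s * ?m - (1 - ?s\<^sup>2) * (?md + ?m\<^sup>2)) * (\<psi> z / (rad z)\<^sup>2)" .
        have "c * (\<psi> z / (rad z)\<^sup>2) \<le> (q\<^sup>2 + ?d * ?s * ?m - (1 - ?s\<^sup>2) * (?md + ?m\<^sup>2)) * (\<psi> z / (rad z)\<^sup>2)"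
          using ric[OF s, folded q_def] by (intro mult_right_mono) (auto simp: \<psi>_def)
        then show ?thesis using True eq by simp
      qed (simp add: a_def)
    qed (intro Bochner_Integration.integrable_diff integrable_mult_right i\<psi>a vid(2) iJ4 i\<psi>)+
    ultimately show ?thesis by simp
  qed
  ultimately show ?thesis using rad_id v4 unfolding Bd_def \<psi>_def by linarith
qed

end

section \<open>Traces and passage to the limit\<close>

lemma square_add_le:
  fixes a b \<eta> :: real
  assumes \<eta>: "\<eta> > 0"
  shows "(a + b)\<^sup>2 \<le> (1 + \<eta>) * a\<^sup>2 + (1 + 1 / \<eta>) * b\<^sup>2"
proof -
  have "0 \<le> (\<eta> * a - b)\<^sup>2 / \<eta>" using \<eta> by simp
  also have "(\<eta> * a - b)\<^sup>2 / \<eta> = \<eta> * a\<^sup>2 + 1 / \<eta> * b\<^sup>2 - 2 * (a * b)"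
    using \<eta> by (simp add: power2_eq_square field_simps)
  finally have "2 * (a * b) \<le> \<eta> * a\<^sup>2 + 1 / \<eta> * b\<^sup>2" by simp
  then show ?thesis by (simp add: power2_sum distrib_right mult.assoc)
qed

lemma sq_integrable_nn: "sq_integrable M f \<longleftrightarrow> f \<in> borel_measurable M \<and> (\<integral>\<^sup>+x. ennreal ((norm (f x))\<^sup>2) \<partial>M) < \<infinity>"
  by (auto simp: sq_integrable_def integrable_iff_bounded)

lemma sq_integrable_diff_nn:
  assumes f: "sq_integrable M f" and g: "sq_integrable M g"
  shows "(\<integral>\<^sup>+x. ennreal ((norm (f x - g x))\<^sup>2) \<partial>M) = ennreal (LINT x|M. (norm (f x - g x))\<^sup>2)"
proof (rule nn_integral_eq_integral)
  have [measurable]: "f \<in> borel_measurable M" "g \<in> borel_measurable M" using f g by (auto simp: sq_integrable_def)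
  have i: "integrable M (\<lambda>x. 2 * (norm (f x))\<^sup>2 + 2 * (norm (g x))\<^sup>2)"
    using f g by (auto simp: sq_integrable_def)
  show "integrable M (\<lambda>x. (norm (f x - g x))\<^sup>2)"
  proof (rule Bochner_Integration.integrable_bound[OF i])
    show "AE x in M. norm ((norm (f x - g x))\<^sup>2) \<le> norm (2 * (norm (f x))\<^sup>2 + 2 * (norm (g x))\<^sup>2)"
    proof (rule AE_I2)
      fix x
      have "(norm (f x - g x))\<^sup>2 \<le> (norm (f x) + norm (g x))\<^sup>2" by (intro power_mono norm_triangle_ineq4) simp
      also have "\<dots> \<le> 2 * (norm (f x))\<^sup>2 + 2 * (norm (g x))\<^sup>2"
        using square_add_le[of 1 "norm (f x)" "norm (g x)"] by simp
      finally show "norm ((norm (f x - g x))\<^sup>2) \<le> norm (2 * (norm (f x))\<^sup>2 + 2 * (norm (g x))\<^sup>2)" by simp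
    qed
  qed simp
qed simp

text \<open>Riesz-Fischer: a fast subsequence converges almost everywhere, and Fatou's lemma turns
  the Cauchy bound of the whole sequence into convergence to that limit.\<close>

lemma L2_complete:
  fixes f :: "nat \<Rightarrow> 'a \<Rightarrow> real"
  assumes fm [measurable]: "\<And>i. f i \<in> borel_measurable M"
    and cauchy: "\<And>e::real. e > 0 \<Longrightarrow> \<exists>n. \<forall>i\<ge>n. \<forall>j\<ge>n. (\<integral>\<^sup>+x. ennreal ((f i x - f j x)\<^sup>2) \<partial>M) \<le> ennreal e"
  obtains g where "g \<in> borel_measurable M" "(\<lambda>i. \<integral>\<^sup>+x. ennreal ((f i x - g x)\<^sup>2) \<partial>M) \<longlonglongrightarrow> 0"
proof -
  \<comment> \<open>Squared distances below 4^(-k) leave room for the weights 2^k, whose sum still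
    converges.\<close>
  have "\<exists>N. \<forall>k. \<forall>i\<ge>N k. \<forall>j\<ge>N k. (\<integral>\<^sup>+x. ennreal ((f i x - f j x)\<^sup>2) \<partial>M) \<le> ennreal ((1/4) ^ k)"
    by (intro choice allI cauchy) simp
  then obtain N where N: "\<And>k i j. i \<ge> N k \<Longrightarrow> j \<ge> N k \<Longrightarrow> (\<integral>\<^sup>+x. ennreal ((f i x - f j x)\<^sup>2) \<partial>M) \<le> ennreal ((1/4) ^ k)" by blast
  define r where "r k = (\<Sum>i\<le>k. N i) + k" for k
  have rN: "N k \<le> r k" for k
    unfolding r_def by (rule trans_le_add1) (auto intro: member_le_sum)
  have rS: "r k < r (Suc k)" for k by (simp add: r_def)
  then have rmono: "strict_mono r" by (rule strict_mono_Suc_iff[THEN iffD2, rule_format])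
  define h where "h k x = f (r (Suc k)) x - f (r k) x" for k x
  have [measurable]: "h k \<in> borel_measurable M" for k unfolding h_def[abs_def] by simp
  have hI: "(\<integral>\<^sup>+x. ennreal ((h k x)\<^sup>2) \<partial>M) \<le> ennreal ((1/4) ^ k)" for k
    unfolding h_def using rN[of k] less_imp_le[OF rS[of k]] by (intro N) (auto intro: order_trans)
  have "(\<integral>\<^sup>+x. (\<Sum>k. ennreal (2 ^ k * (h k x)\<^sup>2)) \<partial>M) = (\<Sum>k. \<integral>\<^sup>+x. ennreal (2 ^ k * (h k x)\<^sup>2) \<partial>M)"
    by (rule nn_integral_suminf) simp
  also have "\<dots> \<le> (\<Sum>k. ennreal ((1/2) ^ k))"
  proof (intro suminf_le summableI)
    fix k
    have "(\<integral>\<^sup>+x. ennreal (2 ^ k * (h k x)\<^sup>2) \<partial>M) = ennreal (2 ^ k) * (\<integral>\<^sup>+x. ennreal ((h k x)\<^sup>2) \<partial>M)"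
      by (subst nn_integral_cmult[symmetric]) (auto simp: ennreal_mult)
    also have "\<dots> \<le> ennreal (2 ^ k) * ennreal ((1/4) ^ k)" by (intro mult_left_mono hI) simp
    also have "\<dots> = ennreal (2 ^ k * (1/4) ^ k)" by (rule ennreal_mult[symmetric]) auto
    also have "(2::real) ^ k * (1/4) ^ k = (1/2) ^ k" by (simp add: power_mult_distrib[symmetric])
    finally show "(\<integral>\<^sup>+x. ennreal (2 ^ k * (h k x)\<^sup>2) \<partial>M) \<le> ennreal ((1/2) ^ k)" .
  qed
  also have "\<dots> < \<infinity>"
    unfolding infinity_ennreal_def
    by (intro ennreal_suminf_neq_top[THEN top.not_eq_extremum[THEN iffD1]] summable_geometric) auto
  finally have "(\<integral>\<^sup>+x. (\<Sum>k. ennreal (2 ^ k * (h k x)\<^sup>2)) \<partial>M) \<noteq> \<infinity>"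
    by simp
  then have "AE x in M. (\<Sum>k. ennreal (2 ^ k * (h k x)\<^sup>2)) \<noteq> \<infinity>"
    by (intro nn_integral_PInf_AE) auto
  then have conv: "AE x in M. convergent (\<lambda>k. f (r k) x)"
  proof eventually_elim
    case (elim x)
    have "summable (\<lambda>k. 2 ^ k * (h k x)\<^sup>2)"
      using elim by (intro summable_suminf_not_top) auto
    then have "summable (\<lambda>k. 2 ^ k * (h k x)\<^sup>2 + (1/2) ^ k)"
      by (intro summable_add summable_geometric) auto
    then have "summable (\<lambda>k. h k x)"
    proof (rule summable_comparison_test[rotated], intro exI allI impI)
      fix k
      \<comment> \<open>Arithmetic-geometric mean: 2 |h| <= 2^k h^2 + 2^(-k), so the weighted
        squares control the increments themselves.\<close>
      have "0 \<le> (2 ^ k * \<bar>h k x\<bar> - 1)\<^sup>2 / 2 ^ k" by simp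
      also have "(2 ^ k * \<bar>h k x\<bar> - 1)\<^sup>2 / 2 ^ k = 2 ^ k * (h k x)\<^sup>2 + (1/2) ^ k - 2 * \<bar>h k x\<bar>"
      proof -
        have "(X * y - 1)\<^sup>2 / X = X * y\<^sup>2 + 1 / X - 2 * y" if "X > 0" for X y :: real
          using that by (simp add: power2_eq_square field_simps)
        from this[of "2 ^ k" "\<bar>h k x\<bar>"] show ?thesis by (simp add: power_one_over)
      qed
      finally show "norm (h k x) \<le> 2 ^ k * (h k x)\<^sup>2 + (1/2) ^ k" by simp
    qed
    then have "convergent (\<lambda>n. \<Sum>k<n. h k x)" by (simp add: summable_iff_convergent)
    moreover have "(\<Sum>k<n. h k x) = f (r n) x - f (r 0) x" for n
      unfolding h_def by (rule sum_lessThan_telescope)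
    ultimately have "convergent (\<lambda>n. f (r n) x - f (r 0) x)" by simp
    then show ?case using convergent_diff_const_right_iff[of "\<lambda>n. f (r n) x" "f (r 0) x"] by simp
  qed
  define g where "g x = lim (\<lambda>k. f (r k) x)" for x
  have gm [measurable]: "g \<in> borel_measurable M"
    unfolding g_def[abs_def] by (rule borel_measurable_lim_metric) simp
  have "(\<lambda>i. \<integral>\<^sup>+x. ennreal ((f i x - g x)\<^sup>2) \<partial>M) \<longlonglongrightarrow> 0"
  proof (rule ennreal_tendsto_0I)
    fix e :: real assume "e > 0"
    then obtain n where n: "\<And>i j. i \<ge> n \<Longrightarrow> j \<ge> n \<Longrightarrow> (\<integral>\<^sup>+x. ennreal ((f i x - f j x)\<^sup>2) \<partial>M) \<le> ennreal e"
      using cauchy by blast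
    have "(\<integral>\<^sup>+x. ennreal ((f i x - g x)\<^sup>2) \<partial>M) \<le> ennreal e" if i: "i \<ge> n" for i
    proof -
      \<comment> \<open>Fatou in the second index only; the first stays fixed.\<close>
      have "(\<integral>\<^sup>+x. ennreal ((f i x - g x)\<^sup>2) \<partial>M) \<le> (\<integral>\<^sup>+x. liminf (\<lambda>k. ennreal ((f i x - f (r k) x)\<^sup>2)) \<partial>M)"
      proof (rule nn_integral_mono_AE)
        show "AE x in M. ennreal ((f i x - g x)\<^sup>2) \<le> liminf (\<lambda>k. ennreal ((f i x - f (r k) x)\<^sup>2))"
          using conv
        proof eventually_elim
          case (elim x)
          then have "(\<lambda>k. f (r k) x) \<longlonglongrightarrow> g x" unfolding g_def by (simp add: convergent_LIMSEQ_iff)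
          then have "(\<lambda>k. ennreal ((f i x - f (r k) x)\<^sup>2)) \<longlonglongrightarrow> ennreal ((f i x - g x)\<^sup>2)"
            by (intro tendsto_intros)
          then show ?case using lim_imp_Liminf[OF sequentially_bot] by (metis order_refl)
        qed
      qed
      also have "\<dots> \<le> liminf (\<lambda>k. \<integral>\<^sup>+x. ennreal ((f i x - f (r k) x)\<^sup>2) \<partial>M)"
        by (rule nn_integral_liminf) simp
      also have "\<dots> \<le> ennreal e"
      proof (rule Liminf_le)
        show "eventually (\<lambda>k. (\<integral>\<^sup>+x. ennreal ((f i x - f (r k) x)\<^sup>2) \<partial>M) \<le> ennreal e) sequentially"
          using eventually_ge_at_top[of n]
        proof eventually_elim
          case (elim k)
          have "n \<le> r k" using elim seq_suble[OF rmono, of k] by linarith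
          then show ?case using n i by blast
        qed
      qed simp
      finally show ?thesis .
    qed
    then show "eventually (\<lambda>i. (\<integral>\<^sup>+x. ennreal ((f i x - g x)\<^sup>2) \<partial>M) \<le> ennreal e) sequentially"
      by (auto simp: eventually_sequentially)
  qed
  with gm show ?thesis by (rule that)
qed

text \<open>For a bounded weight an L2 error costs only a finite factor, while the main term is
  multiplied by 1 + \<eta> with \<eta> as small as desired.\<close>

lemma weighted_L2_le:
  fixes f g :: "'a \<Rightarrow> real" and w :: "'a \<Rightarrow> real"
  assumes [measurable]: "f \<in> borel_measurable M" "g \<in> borel_measurable M" "w \<in> borel_measurable M"
    and w: "\<And>x. 0 \<le> w x" "\<And>x. w x \<le> n" and \<eta>: "\<eta> > 0"
  shows "(\<integral>\<^sup>+x. ennreal (w x * (f x)\<^sup>2) \<partial>M) \<le> ennreal (1 + \<eta>) * (\<integral>\<^sup>+x. ennreal (w x * (g x)\<^sup>2) \<partial>M)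
     + ennreal ((1 + 1 / \<eta>) * n) * (\<integral>\<^sup>+x. ennreal ((g x - f x)\<^sup>2) \<partial>M)"
proof -
  have n0: "n \<ge> 0" using w order_trans by blast
  have "(\<integral>\<^sup>+x. ennreal (w x * (f x)\<^sup>2) \<partial>M) \<le> (\<integral>\<^sup>+x. ennreal (1 + \<eta>) * ennreal (w x * (g x)\<^sup>2) + ennreal ((1 + 1 / \<eta>) * n) * ennreal ((g x - f x)\<^sup>2) \<partial>M)"
  proof (rule nn_integral_mono)
    fix x
    have "w x * (f x)\<^sup>2 \<le> w x * ((1 + \<eta>) * (g x)\<^sup>2 + (1 + 1 / \<eta>) * (g x - f x)\<^sup>2)"
      using square_add_le[OF \<eta>, of "g x" "f x - g x"] w by (intro mult_left_mono) (auto simp: power2_commute)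
    also have "\<dots> \<le> (1 + \<eta>) * (w x * (g x)\<^sup>2) + ((1 + 1 / \<eta>) * n) * (g x - f x)\<^sup>2"
    proof -
      have "w x * ((1 + 1 / \<eta>) * (g x - f x)\<^sup>2) \<le> n * ((1 + 1 / \<eta>) * (g x - f x)\<^sup>2)"
        using w \<eta> by (intro mult_right_mono) auto
      moreover have "w x * ((1 + \<eta>) * (g x)\<^sup>2 + (1 + 1 / \<eta>) * (g x - f x)\<^sup>2) = (1 + \<eta>) * (w x * (g x)\<^sup>2) + w x * ((1 + 1 / \<eta>) * (g x - f x)\<^sup>2)"
        by (simp only: distrib_left mult_ac)
      moreover have "n * ((1 + 1 / \<eta>) * (g x - f x)\<^sup>2) = ((1 + 1 / \<eta>) * n) * (g x - f x)\<^sup>2"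
        by (simp only: mult_ac)
      ultimately show ?thesis by linarith
    qed
    finally show "ennreal (w x * (f x)\<^sup>2) \<le> ennreal (1 + \<eta>) * ennreal (w x * (g x)\<^sup>2) + ennreal ((1 + 1 / \<eta>) * n) * ennreal ((g x - f x)\<^sup>2)"
      using w \<eta> n0 by (simp add: ennreal_mult[symmetric] ennreal_plus[symmetric] ennreal_leI del: ennreal_plus)
  qed
  also have "\<dots> = ennreal (1 + \<eta>) * (\<integral>\<^sup>+x. ennreal (w x * (g x)\<^sup>2) \<partial>M)
     + ennreal ((1 + 1 / \<eta>) * n) * (\<integral>\<^sup>+x. ennreal ((g x - f x)\<^sup>2) \<partial>M)"
    by (simp add: nn_integral_add nn_integral_cmult)
  finally show ?thesis .
qed

lemma nn_integral_truncate_SUP: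
  fixes w f :: "'a \<Rightarrow> real"
  assumes [measurable]: "f \<in> borel_measurable M" "w \<in> borel_measurable M" and w: "\<And>x. 0 \<le> w x"
  shows "(\<lambda>n. \<integral>\<^sup>+x. ennreal (min (w x) (real n) * (f x)\<^sup>2) \<partial>M) \<longlonglongrightarrow> (\<integral>\<^sup>+x. ennreal (w x * (f x)\<^sup>2) \<partial>M)"
proof (rule nn_integral_LIMSEQ)
  show "incseq (\<lambda>n x. ennreal (min (w x) (real n) * (f x)\<^sup>2))"
    by (auto simp: incseq_def le_fun_def intro!: ennreal_leI mult_right_mono)
  fix x
  have "eventually (\<lambda>n. ennreal (min (w x) (real n) * (f x)\<^sup>2) = ennreal (w x * (f x)\<^sup>2)) sequentially"
    using eventually_ge_at_top[of "nat \<lceil>w x\<rceil>"]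
    by eventually_elim (simp add: min_absorb1 nat_ceiling_le_eq)
  then show "(\<lambda>n. ennreal (min (w x) (real n) * (f x)\<^sup>2)) \<longlonglongrightarrow> ennreal (w x * (f x)\<^sup>2)"
    by (rule tendsto_eventually)
qed simp

text \<open>Truncating the singular weights makes them continuous for \<open>L\<^sup>2\<close>-convergence, so an inequality
  between quadratic forms passes to limits without any a priori weighted convergence.\<close>

lemma quadratic_inequality_limit:
  fixes V :: "nat \<Rightarrow> 'a \<Rightarrow> real" and u w1 :: "'a \<Rightarrow> real" and DV :: "nat \<Rightarrow> 'a \<Rightarrow> 'b::euclidean_space" and g :: "'a \<Rightarrow> 'b"
    and VV :: "nat \<Rightarrow> 'c \<Rightarrow> real" and tr w2 :: "'c \<Rightarrow> real" and \<Phi> :: "'b \<Rightarrow> real"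
  assumes m1 [measurable]: "\<And>k. V k \<in> borel_measurable M1" "u \<in> borel_measurable M1" "w1 \<in> borel_measurable M1"
      "\<And>k. DV k \<in> borel_measurable M1" "g \<in> borel_measurable M1"
    and m2 [measurable]: "\<And>k. VV k \<in> borel_measurable M2" "tr \<in> borel_measurable M2" "w2 \<in> borel_measurable M2"
    and \<Phi>m [measurable]: "\<Phi> \<in> borel_measurable borel"
    and w: "\<And>x. 0 \<le> w1 x" "\<And>x. 0 \<le> w2 x" and cK: "c \<ge> 0" "K \<ge> 0"
    and \<Phi>: "\<And>x. 0 \<le> \<Phi> x" "\<And>x y. \<Phi> (x + y) \<le> \<Phi> x + \<Phi> y" "\<And>x. \<Phi> x \<le> \<Lambda> * norm x"
    and ineq: "\<And>k. ennreal c * (\<integral>\<^sup>+x. ennreal (w1 x * (V k x)\<^sup>2) \<partial>M1) + ennreal K * (\<integral>\<^sup>+x. ennreal (w2 x * (VV k x)\<^sup>2) \<partial>M2)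
        \<le> (\<integral>\<^sup>+x. ennreal ((\<Phi> (DV k x))\<^sup>2) \<partial>M1)"
    and l1: "(\<lambda>k. \<integral>\<^sup>+x. ennreal ((V k x - u x)\<^sup>2) \<partial>M1) \<longlonglongrightarrow> 0"
    and l2: "(\<lambda>k. \<integral>\<^sup>+x. ennreal ((VV k x - tr x)\<^sup>2) \<partial>M2) \<longlonglongrightarrow> 0"
    and l3: "(\<lambda>k. \<integral>\<^sup>+x. ennreal ((norm (DV k x - g x))\<^sup>2) \<partial>M1) \<longlonglongrightarrow> 0"
    and fin: "(\<integral>\<^sup>+x. ennreal ((\<Phi> (g x))\<^sup>2) \<partial>M1) < \<infinity>"
  shows "ennreal c * (\<integral>\<^sup>+x. ennreal (w1 x * (u x)\<^sup>2) \<partial>M1) + ennreal K * (\<integral>\<^sup>+x. ennreal (w2 x * (tr x)\<^sup>2) \<partial>M2)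
        \<le> (\<integral>\<^sup>+x. ennreal ((\<Phi> (g x))\<^sup>2) \<partial>M1)"
proof -
  let ?I = "\<integral>\<^sup>+x. ennreal ((\<Phi> (g x))\<^sup>2) \<partial>M1"
  let ?e1 = "\<lambda>k. \<integral>\<^sup>+x. ennreal ((V k x - u x)\<^sup>2) \<partial>M1"
  let ?e2 = "\<lambda>k. \<integral>\<^sup>+x. ennreal ((VV k x - tr x)\<^sup>2) \<partial>M2"
  let ?e3 = "\<lambda>k. \<integral>\<^sup>+x. ennreal ((norm (DV k x - g x))\<^sup>2) \<partial>M1"
  have grad_le: "(\<integral>\<^sup>+x. ennreal ((\<Phi> (DV k x))\<^sup>2) \<partial>M1) \<le> ennreal (1 + \<eta>) * ?I + ennreal ((1 + 1 / \<eta>) * \<Lambda>\<^sup>2) * ?e3 k"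
    if \<eta>: "\<eta> > 0" for \<eta> :: real and k
  proof -
    have "(\<integral>\<^sup>+x. ennreal ((\<Phi> (DV k x))\<^sup>2) \<partial>M1) \<le> (\<integral>\<^sup>+x. ennreal (1 + \<eta>) * ennreal ((\<Phi> (g x))\<^sup>2) + ennreal ((1 + 1 / \<eta>) * \<Lambda>\<^sup>2) * ennreal ((norm (DV k x - g x))\<^sup>2) \<partial>M1)"
    proof (rule nn_integral_mono)
      fix x
      have "\<Phi> (DV k x) \<le> \<Phi> (g x) + \<Phi> (DV k x - g x)" using \<Phi>(2)[of "g x" "DV k x - g x"] by simp
      then have "(\<Phi> (DV k x))\<^sup>2 \<le> (\<Phi> (g x) + \<Phi> (DV k x - g x))\<^sup>2" by (intro power_mono \<Phi>)
      also have "\<dots> \<le> (1 + \<eta>) * (\<Phi> (g x))\<^sup>2 + (1 + 1 / \<eta>) * (\<Phi> (DV k x - g x))\<^sup>2" by (rule square_add_le[OF \<eta>])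
      also have "\<dots> \<le> (1 + \<eta>) * (\<Phi> (g x))\<^sup>2 + (1 + 1 / \<eta>) * (\<Lambda> * norm (DV k x - g x))\<^sup>2"
        using \<eta> by (intro add_left_mono mult_left_mono power_mono \<Phi>) auto
      finally show "ennreal ((\<Phi> (DV k x))\<^sup>2) \<le> ennreal (1 + \<eta>) * ennreal ((\<Phi> (g x))\<^sup>2) + ennreal ((1 + 1 / \<eta>) * \<Lambda>\<^sup>2) * ennreal ((norm (DV k x - g x))\<^sup>2)"
        using \<eta> by (simp add: ennreal_mult[symmetric] ennreal_plus[symmetric] ennreal_leI power_mult_distrib mult.assoc del: ennreal_plus)
    qed
    also have "\<dots> = ennreal (1 + \<eta>) * ?I + ennreal ((1 + 1 / \<eta>) * \<Lambda>\<^sup>2) * ?e3 k"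
      by (simp add: nn_integral_add nn_integral_cmult)
    finally show ?thesis .
  qed
  have trunc: "ennreal c * (\<integral>\<^sup>+x. ennreal (min (w1 x) (real n) * (u x)\<^sup>2) \<partial>M1) + ennreal K * (\<integral>\<^sup>+x. ennreal (min (w2 x) (real n) * (tr x)\<^sup>2) \<partial>M2) \<le> ?I" for n
  proof -
    let ?J = "ennreal c * (\<integral>\<^sup>+x. ennreal (min (w1 x) (real n) * (u x)\<^sup>2) \<partial>M1) + ennreal K * (\<integral>\<^sup>+x. ennreal (min (w2 x) (real n) * (tr x)\<^sup>2) \<partial>M2)"
    \<comment> \<open>One factor 1 + \<eta> comes from the left-hand terms and one from the gradient
      term; k tends to infinity first, with n and \<eta> fixed.\<close>
    have step: "?J \<le> ennreal (1 + \<eta>) * (ennreal (1 + \<eta>) * ?I)" if \<eta>: "\<eta> > 0" for \<eta> :: real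
    proof -
      let ?a = "ennreal (1 + \<eta>)" and ?b = "ennreal ((1 + 1 / \<eta>) * real n)" and ?d = "ennreal ((1 + 1 / \<eta>) * \<Lambda>\<^sup>2)"
      have le: "?J \<le> ?a * (?a * ?I + ?d * ?e3 k) + (ennreal c * (?b * ?e1 k) + ennreal K * (?b * ?e2 k))" for k
      proof -
        have "?J \<le> ennreal c * (?a * (\<integral>\<^sup>+x. ennreal (min (w1 x) (real n) * (V k x)\<^sup>2) \<partial>M1) + ?b * ?e1 k)
            + ennreal K * (?a * (\<integral>\<^sup>+x. ennreal (min (w2 x) (real n) * (VV k x)\<^sup>2) \<partial>M2) + ?b * ?e2 k)"
          using w \<eta> by (intro add_mono mult_left_mono weighted_L2_le) auto
        also have "\<dots> \<le> ennreal c * (?a * (\<integral>\<^sup>+x. ennreal (w1 x * (V k x)\<^sup>2) \<partial>M1) + ?b * ?e1 k)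
            + ennreal K * (?a * (\<integral>\<^sup>+x. ennreal (w2 x * (VV k x)\<^sup>2) \<partial>M2) + ?b * ?e2 k)"
          by (intro add_mono mult_left_mono nn_integral_mono order_refl ennreal_leI mult_right_mono) auto
        also have "\<dots> = ?a * (ennreal c * (\<integral>\<^sup>+x. ennreal (w1 x * (V k x)\<^sup>2) \<partial>M1) + ennreal K * (\<integral>\<^sup>+x. ennreal (w2 x * (VV k x)\<^sup>2) \<partial>M2))
           + (ennreal c * (?b * ?e1 k) + ennreal K * (?b * ?e2 k))"
          by (simp add: distrib_left mult_ac add_ac)
        also have "\<dots> \<le> ?a * (?a * ?I + ?d * ?e3 k) + (ennreal c * (?b * ?e1 k) + ennreal K * (?b * ?e2 k))"
          by (intro add_mono mult_left_mono order_refl order_trans[OF ineq grad_le[OF \<eta>]]) simp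
        finally show ?thesis .
      qed
      have "(\<lambda>k. ?a * (?a * ?I + ?d * ?e3 k) + (ennreal c * (?b * ?e1 k) + ennreal K * (?b * ?e2 k))) \<longlonglongrightarrow>
         ?a * (?a * ?I + ?d * 0) + (ennreal c * (?b * 0) + ennreal K * (?b * 0))"
        by (intro tendsto_add ennreal_tendsto_cmult tendsto_const l1 l2 l3) auto
      from LIMSEQ_le_const[OF this] le show ?thesis by simp
    qed
    \<comment> \<open>Then \<eta> tends to 0 in the real numbers, for which the energy has to be
      finite; the truncation level n is removed last by monotone convergence.\<close>
    obtain i where i: "?I = ennreal i" "i \<ge> 0" using fin by (cases ?I) auto
    have "((\<lambda>\<eta>. ennreal ((1 + \<eta>) * ((1 + \<eta>) * i))) \<longlongrightarrow> ennreal ((1 + 0) * ((1 + 0) * i))) (at_right (0::real))"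
      by (intro tendsto_intros)
    moreover have "eventually (\<lambda>\<eta>. ?J \<le> ennreal ((1 + \<eta>) * ((1 + \<eta>) * i))) (at_right (0::real))"
    proof (rule eventually_at_rightI[of 0 1])
      fix \<eta> :: real assume "\<eta> \<in> {0<..<1}"
      then show "?J \<le> ennreal ((1 + \<eta>) * ((1 + \<eta>) * i))" using step[of \<eta>] i by (simp add: ennreal_mult)
    qed simp
    ultimately have "?J \<le> ennreal ((1 + 0) * ((1 + 0) * i))"
      by (intro tendsto_lowerbound[of _ _ "at_right (0::real)"]) auto
    then show ?thesis using i by simp
  qed
  have "(\<lambda>n. ennreal c * (\<integral>\<^sup>+x. ennreal (min (w1 x) (real n) * (u x)\<^sup>2) \<partial>M1) + ennreal K * (\<integral>\<^sup>+x. ennreal (min (w2 x) (real n) * (tr x)\<^sup>2) \<partial>M2))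
     \<longlonglongrightarrow> ennreal c * (\<integral>\<^sup>+x. ennreal (w1 x * (u x)\<^sup>2) \<partial>M1) + ennreal K * (\<integral>\<^sup>+x. ennreal (w2 x * (tr x)\<^sup>2) \<partial>M2)"
    by (intro tendsto_add ennreal_tendsto_cmult nn_integral_truncate_SUP m1 m2 w) auto
  from LIMSEQ_le_const2[OF this] trunc show ?thesis by blast
qed

section \<open>Traces on the boundary of the cone\<close>

context cone_pair
begin

abbreviation "\<sigma> \<equiv> cone_surface H0 \<alpha>"
abbreviation "bd x \<equiv> (x, tan \<alpha> * H0 x)"

lemma sets_sigma [measurable_cong]: "sets \<sigma> = sets borel"
  by (simp add: cone_surface_def)

lemma measurable_sigma: "f \<in> borel_measurable \<sigma> \<longleftrightarrow> f \<in> borel_measurable borel"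
  by (simp add: measurable_cong_sets[OF sets_sigma refl])

lemma nn_integral_sigma:
  assumes [measurable]: "f \<in> borel_measurable borel"
  shows "(\<integral>\<^sup>+z. f z \<partial>\<sigma>) = (\<integral>\<^sup>+x. ennreal (area_factor H0 \<alpha> x) * f (bd x) \<partial>lborel)"
  unfolding cone_surface_def by (simp add: nn_integral_distr nn_integral_density)

lemma nn_integral_sigma_le:
  assumes [measurable]: "f \<in> borel_measurable borel"
  shows "(\<integral>\<^sup>+z. f z \<partial>\<sigma>) \<le> ennreal B * (\<integral>\<^sup>+x. f (bd x) \<partial>lborel)"
proof -
  have "(\<integral>\<^sup>+z. f z \<partial>\<sigma>) \<le> (\<integral>\<^sup>+x. ennreal B * f (bd x) \<partial>lborel)"
    unfolding nn_integral_sigma[OF assms] by (intro nn_integral_mono mult_right_mono ennreal_leI area_le) simp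
  also have "\<dots> = ennreal B * (\<integral>\<^sup>+x. f (bd x) \<partial>lborel)" by (rule nn_integral_cmult) simp
  finally show ?thesis .
qed

text \<open>The weight of the boundary integral with respect to the surface measure. The area factor
  cancels the density of that measure, and by \<open>area_bweight\<close> the weight
  \<open>cos \<alpha> / H0 x\<close> with respect to dx remains.\<close>

definition bweight :: "'a \<times> real \<Rightarrow> real" where
  "bweight z = 1 / rad z / area_factor H0 \<alpha> (fst z)"

lemma bweight_nonneg: "0 \<le> bweight z"
  using area_factor_ge_1[of H0 \<alpha> "fst z"] rad_nonneg[of z] by (simp add: bweight_def)

lemma measurable_bweight [measurable]: "bweight \<in> borel_measurable borel"
proof -
  have [measurable]: "fst \<in> borel \<rightarrow>\<^sub>M (borel :: 'a measure)"
    by (intro borel_measurable_continuous_onI continuous_intros)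
  show ?thesis unfolding bweight_def[abs_def] by measurable
qed

lemma area_bweight: "area_factor H0 \<alpha> x * bweight (bd x) = cos \<alpha> / H0 x"
  using area_factor_ge_1[of H0 \<alpha> x] by (simp add: bweight_def rad_boundary)

text \<open>The square of v at the boundary point over x is minus the integral of its vertical
  derivative above that point, and |2 v dv/dt| <= v^2 + |grad v|^2. The area factor is bounded by
  B.\<close>

lemma test_trace_le:
  fixes v :: "'a \<times> real \<Rightarrow> real"
  assumes v: "v \<in> test_functions UNIV"
  shows "(\<integral>\<^sup>+z. ennreal ((v z)\<^sup>2) \<partial>\<sigma>) \<le> ennreal B * ((\<integral>\<^sup>+z. ennreal ((v z)\<^sup>2) \<partial>lebesgue_on C) + (\<integral>\<^sup>+z. ennreal ((norm (grad v z))\<^sup>2) \<partial>lebesgue_on C))"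
proof -
  have vc: "continuous_on UNIV v" and gc: "continuous_on UNIV (grad v)"
    using v by (rule test_functions_continuous test_functions_grad_continuous)+
  have [measurable]: "v \<in> borel_measurable borel" "grad v \<in> borel_measurable borel"
    using vc gc by (auto intro: borel_measurable_continuous_onI)
  obtain R where R: "R > 0" "\<And>z. norm z \<ge> R \<Longrightarrow> v z = 0" using test_functions_support[OF v] by metis
  define h where "h z = ennreal (indicator C z * ((v z)\<^sup>2 + (norm (grad v z))\<^sup>2))" for z
  have hm [measurable]: "h \<in> borel_measurable borel" unfolding h_def[abs_def] by measurable
  have slice: "ennreal ((v (bd x))\<^sup>2) \<le> (\<integral>\<^sup>+t. h (x, t) \<partial>lborel)" for x
  proof -
    define t0 where "t0 = tan \<alpha> * H0 x"
    define T where "T = max R \<bar>t0\<bar> + 1"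
    have T: "t0 \<le> T" "R \<le> T" by (auto simp: T_def)
    define f where "f t = 2 * v (x, t) * (grad v (x, t) \<bullet> (0, 1))" for t
    have D: "((\<lambda>t. (v (x, t))\<^sup>2) has_real_derivative f t) (at t)" for t
    proof -
      have "((\<lambda>t. (x, t)) has_derivative (\<lambda>h. (0, h))) (at t)" by (auto intro!: derivative_eq_intros)
      from has_derivative_compose[OF this test_square(1)[OF v, unfolded gderiv_def]]
      show ?thesis
        by (cases "grad v (x, t)") (simp add: f_def has_field_derivative_def mult_commute_abs)
    qed
    have fc: "continuous_on UNIV f"
      unfolding f_def[abs_def]
      by (intro continuous_intros continuous_on_compose2[OF vc] continuous_on_compose2[OF gc]) auto
    have "has_bochner_integral lborel (\<lambda>t. f t * indicator {t0..T} t) ((v (x, T))\<^sup>2 - (v (x, t0))\<^sup>2)"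
      by (rule has_bochner_integral_FTC_Icc_real[OF T(1) D]) (use fc in \<open>simp add: continuous_on_eq_continuous_at\<close>)
    then have i: "integrable lborel (\<lambda>t. f t * indicator {t0..T} t)"
      and eq: "(LINT t|lborel. f t * indicator {t0..T} t) = (v (x, T))\<^sup>2 - (v (x, t0))\<^sup>2"
      by (auto simp: has_bochner_integral_iff)
    have "v (x, T) = 0"
    proof (rule R)
      have "R \<le> \<bar>T\<bar>" using T by simp
      also have "\<dots> \<le> norm (x, T)" by (simp add: norm_Pair)
      finally show "R \<le> norm (x, T)" .
    qed
    then have "ennreal ((v (x, t0))\<^sup>2) = ennreal (norm (LINT t|lborel. f t * indicator {t0..T} t))"
      unfolding eq by simp
    also have "\<dots> \<le> (\<integral>\<^sup>+t. norm (f t * indicator {t0..T} t) \<partial>lborel)"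
      by (rule integral_norm_bound_ennreal[OF i])
    also have "\<dots> \<le> (\<integral>\<^sup>+t. h (x, t) \<partial>lborel)"
    proof (rule nn_integral_mono_AE)
      \<comment> \<open>The endpoint of the line lies on the boundary, outside the open cone, where
        h vanishes.\<close>
      have "AE t in lborel. t \<noteq> t0" by (rule AE_lborel_singleton)
      then show "AE t in lborel. ennreal (norm (f t * indicator {t0..T} t)) \<le> h (x, t)"
      proof eventually_elim
        case (elim t)
        show ?case
        proof (cases "t \<in> {t0..T}")
          case True
          then have inC: "(x, t) \<in> C" using elim by (auto simp: cone_dom_def t0_def)
          have "\<bar>grad v (x, t) \<bullet> (0, 1)\<bar> \<le> norm (grad v (x, t)) * norm ((0 :: 'a, 1 :: real))" by (rule Cauchy_Schwarz_ineq2)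
          then have "\<bar>f t\<bar> \<le> 2 * \<bar>v (x, t)\<bar> * norm (grad v (x, t))"
            by (simp add: f_def abs_mult norm_Pair mult_left_mono)
          also have "\<dots> \<le> (v (x, t))\<^sup>2 + (norm (grad v (x, t)))\<^sup>2"
            using sum_squares_bound[of "\<bar>v (x, t)\<bar>" "norm (grad v (x, t))"] by simp
          finally show ?thesis using True inC by (simp add: h_def ennreal_leI del: ennreal_plus)
        qed (simp add: h_def)
      qed
    qed
    finally show ?thesis by (simp add: t0_def)
  qed
  have "(\<integral>\<^sup>+z. ennreal ((v z)\<^sup>2) \<partial>\<sigma>) \<le> ennreal B * (\<integral>\<^sup>+x. ennreal ((v (bd x))\<^sup>2) \<partial>lborel)"
    by (rule nn_integral_sigma_le) simp
  also have "\<dots> \<le> ennreal B * (\<integral>\<^sup>+x. (\<integral>\<^sup>+t. h (x, t) \<partial>lborel) \<partial>lborel)"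
    by (intro mult_left_mono nn_integral_mono slice) simp
  also have "(\<integral>\<^sup>+x. (\<integral>\<^sup>+t. h (x, t) \<partial>lborel) \<partial>lborel) = (\<integral>\<^sup>+z. h z \<partial>lborel)"
    using lborel.nn_integral_fst[of h lborel] hm by (simp add: lborel_prod)
  also have "\<dots> = (\<integral>\<^sup>+z. ennreal ((v z)\<^sup>2 + (norm (grad v z))\<^sup>2) \<partial>lebesgue_on C)"
    by (rule nn_integral_lebesgue_on_eq[OF open_C, symmetric]) (auto simp: h_def)
  also have "\<dots> = (\<integral>\<^sup>+z. ennreal ((v z)\<^sup>2) \<partial>lebesgue_on C) + (\<integral>\<^sup>+z. ennreal ((norm (grad v z))\<^sup>2) \<partial>lebesgue_on C)"
  proof -
    have "(\<lambda>z. ennreal ((v z)\<^sup>2)) \<in> borel_measurable (lebesgue_on C)" "(\<lambda>z. ennreal ((norm (grad v z))\<^sup>2)) \<in> borel_measurable (lebesgue_on C)"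
      by (intro measurable_restrict_space1 measurable_completion; simp)+
    then show ?thesis by (simp add: nn_integral_add)
  qed
  finally show ?thesis .
qed

lemma test_sq_integrable:
  fixes v :: "'a \<times> real \<Rightarrow> real"
  assumes v: "v \<in> test_functions UNIV"
  shows "sq_integrable (lebesgue_on C) v" "sq_integrable (lebesgue_on C) (grad v)" "sq_integrable \<sigma> v"
proof -
  obtain Q R where R: "Q > 0" "R > 0" "\<And>z. \<bar>v z\<bar> \<le> Q" "\<And>z. norm (grad v z) \<le> Q"
    "\<And>z. norm z \<ge> R \<Longrightarrow> v z = 0" "\<And>z. norm z \<ge> R \<Longrightarrow> grad v z = 0"
    using test_functions_bounds[OF v] by metis
  have vm: "v \<in> borel_measurable borel" and gm: "grad v \<in> borel_measurable borel"
    using test_functions_continuous[OF v, of UNIV] test_functions_grad_continuous[OF v, of UNIV]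
    by (auto intro: borel_measurable_continuous_onI)
  have fin: "(\<integral>\<^sup>+z. ennreal ((norm (f z))\<^sup>2) \<partial>lebesgue_on C) < \<infinity>"
    if f: "\<And>z. norm (f z) \<le> Q" "\<And>z. norm z \<ge> R \<Longrightarrow> f z = 0" for f :: "'a \<times> real \<Rightarrow> 'c::real_normed_vector"
  proof -
    have le: "ennreal ((norm (f z))\<^sup>2) \<le> ennreal (Q\<^sup>2) * indicator (cball 0 R) z" for z
    proof -
      have "(norm (f z))\<^sup>2 \<le> Q\<^sup>2" using f(1) by (intro power_mono) auto
      then show ?thesis
        using f(2)[of z] by (cases "norm z \<le> R") (auto simp: ennreal_leI)
    qed
    have "(\<integral>\<^sup>+z. ennreal ((norm (f z))\<^sup>2) \<partial>lebesgue_on C) \<le> (\<integral>\<^sup>+z. ennreal (Q\<^sup>2) * indicator (cball (0 :: 'a \<times> real) R) z \<partial>lborel)"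
      by (rule nn_integral_lebesgue_on_le[OF open_C]) (intro AE_I2 impI le)
    also have "\<dots> = ennreal (Q\<^sup>2) * emeasure lborel (cball (0 :: 'a \<times> real) R)" by (rule nn_integral_cmult_indicator) simp
    also have "\<dots> < \<infinity>" using emeasure_bounded_finite[of "cball (0 :: 'a \<times> real) R"] by (simp add: ennreal_mult_less_top)
    finally show ?thesis .
  qed
  show s1: "sq_integrable (lebesgue_on C) v"
    unfolding sq_integrable_nn using fin[of v] R vm by (auto intro: borel_measurable_lebesgue_on)
  show s2: "sq_integrable (lebesgue_on C) (grad v)"
    unfolding sq_integrable_nn
    by (intro conjI measurable_restrict_space1 measurable_completion fin[of "grad v"] R) (use gm in simp_all)
  have "(\<integral>\<^sup>+z. ennreal ((v z)\<^sup>2) \<partial>\<sigma>) < \<infinity>"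
    by (rule le_less_trans[OF test_trace_le[OF v]])
      (use s1 s2 in \<open>auto simp: sq_integrable_nn ennreal_mult_less_top\<close>)
  then show "sq_integrable \<sigma> v"
    unfolding sq_integrable_nn using vm by (simp add: measurable_sigma)
qed

lemma W12_weak_grad:
  assumes "u \<in> W12 C" shows "sq_integrable (lebesgue_on C) u" "is_weak_grad C u (weak_grad C u)"
proof -
  show "sq_integrable (lebesgue_on C) u" using assms by (simp add: W12_def)
  obtain g where "is_weak_grad C u g" using assms by (auto simp: W12_def)
  then show "is_weak_grad C u (weak_grad C u)" unfolding weak_grad_def by (rule someI[where P="is_weak_grad C u"])
qed

text \<open>Since \<open>trace_on\<close> is a choice, nothing is known about it before a trace is
  exhibited. Smooth approximants of u have boundary values that form a Cauchy sequence in L2 of the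
  surface by \<open>test_trace_le\<close>.\<close>

lemma trace_exists:
  fixes u :: "'a \<times> real \<Rightarrow> real"
  assumes u: "u \<in> W12 C"
  shows "is_trace C \<sigma> u (trace_on C \<sigma> u)"
proof -
  let ?g = "weak_grad C u"
  note ug = W12_weak_grad[OF u]
  have gs: "sq_integrable (lebesgue_on C) ?g" using ug(2) by (simp add: is_weak_grad_def)
  \<comment> \<open>If |y - e| <= 1, the vertical part of y is at least |tan \<alpha>| L and the
    horizontal part has length at most 1. A step along y then rises at least as much as tan \<alpha>
    times \<open>H0\<close> can grow, since \<open>H0\<close> is Lipschitz with constant L.\<close>
  define e where "e = (0 :: 'a, 1 + \<bar>tan \<alpha>\<bar> * L)"
  have cone: "z + c *\<^sub>R y \<in> C" if z: "z \<in> C" and y: "norm (y - e) \<le> 1" and c: "c > 0" for z y :: "'a \<times> real" and c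
  proof -
    obtain x t where zz: "z = (x, t)" by (cases z)
    obtain y1 y2 where yy: "y = (y1, y2)" by (cases y)
    have "norm y1 \<le> norm (y - e)" "\<bar>y2 - (1 + \<bar>tan \<alpha>\<bar> * L)\<bar> \<le> norm (y - e)"
      by (auto simp: yy e_def norm_Pair intro!: real_le_rsqrt)
    then have y1: "norm y1 \<le> 1" and y2: "\<bar>tan \<alpha>\<bar> * L \<le> y2" using y by auto
    have "tan \<alpha> * (H0 (x + c *\<^sub>R y1) - H0 x) \<le> \<bar>tan \<alpha>\<bar> * \<bar>H0 (x + c *\<^sub>R y1) - H0 x\<bar>"
      by (metis abs_ge_self abs_mult)
    also have "\<dots> \<le> \<bar>tan \<alpha>\<bar> * (L * norm (c *\<^sub>R y1))"
      using H0_lipschitz[of "x + c *\<^sub>R y1" x] by (intro mult_left_mono) auto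
    also have "\<dots> \<le> \<bar>tan \<alpha>\<bar> * (L * (c * 1))" using y1 c L by (intro mult_left_mono) auto
    also have "\<dots> = c * (\<bar>tan \<alpha>\<bar> * L)" by simp
    also have "\<dots> \<le> c * y2" using y2 c by (intro mult_left_mono) auto
    finally show ?thesis using z by (simp add: zz yy cone_dom_def right_diff_distrib)
  qed
  obtain v where v: "\<And>k. v k \<in> test_functions UNIV"
    and l1: "(\<lambda>k. LINT x|lebesgue_on C. (v k x - u x)\<^sup>2) \<longlonglongrightarrow> 0"
    and l2: "(\<lambda>k. LINT x|lebesgue_on C. (norm (grad (v k) x - ?g x))\<^sup>2) \<longlonglongrightarrow> 0"
    by (rule W12_density[where e=e, OF open_C _ ug], erule (2) cone, rule that)
  define d where "d k = (LINT x|lebesgue_on C. (v k x - u x)\<^sup>2) + (LINT x|lebesgue_on C. (norm (grad (v k) x - ?g x))\<^sup>2)" for k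
  have d0: "d k \<ge> 0" for k unfolding d_def by (intro add_nonneg_nonneg integral_nonneg_AE) auto
  have dl: "d \<longlonglongrightarrow> 0" using tendsto_add[OF l1 l2] by (simp add: d_def[abs_def])
  have [measurable]: "v k \<in> borel_measurable \<sigma>" for k
    using test_sq_integrable(3)[OF v] by (simp add: sq_integrable_nn)
  have B0: "B \<ge> 1" using area_factor_ge_1 area_le order_trans by blast
  have diff: "(\<integral>\<^sup>+z. ennreal ((v i z - v j z)\<^sup>2) \<partial>\<sigma>) \<le> ennreal (B * (2 * d i + 2 * d j))" for i j
  proof -
    let ?w = "\<lambda>z. v i z - v j z"
    have gw: "grad ?w z = grad (v i) z - grad (v j) z" for z
      by (intro grad_eqI GDERIV_diff test_functions_GDERIV[OF v])
    have sum: "(\<integral>\<^sup>+z. ennreal ((norm (f z - f' z))\<^sup>2) \<partial>lebesgue_on C) \<le>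
        ennreal (2 * (LINT z|lebesgue_on C. (norm (f z - h z))\<^sup>2) + 2 * (LINT z|lebesgue_on C. (norm (f' z - h z))\<^sup>2))"
      if f: "sq_integrable (lebesgue_on C) f" "sq_integrable (lebesgue_on C) f'" "sq_integrable (lebesgue_on C) h"
      for f f' h :: "'a \<times> real \<Rightarrow> 'c::euclidean_space"
    proof -
      have m: "f \<in> borel_measurable (lebesgue_on C)" "f' \<in> borel_measurable (lebesgue_on C)" "h \<in> borel_measurable (lebesgue_on C)"
        using f by (auto simp: sq_integrable_def)
      note [measurable] = m
      have "(\<integral>\<^sup>+z. ennreal ((norm (f z - f' z))\<^sup>2) \<partial>lebesgue_on C) \<le>
          (\<integral>\<^sup>+z. ennreal 2 * ennreal ((norm (f z - h z))\<^sup>2) + ennreal 2 * ennreal ((norm (f' z - h z))\<^sup>2) \<partial>lebesgue_on C)"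
      proof (rule nn_integral_mono)
        fix z
        have "norm (f z - f' z) \<le> norm (f z - h z) + norm (f' z - h z)"
          using norm_triangle_ineq4[of "f z - h z" "f' z - h z"] by simp
        then have "(norm (f z - f' z))\<^sup>2 \<le> (norm (f z - h z) + norm (f' z - h z))\<^sup>2" by (intro power_mono) auto
        also have "\<dots> \<le> 2 * (norm (f z - h z))\<^sup>2 + 2 * (norm (f' z - h z))\<^sup>2"
          using square_add_le[of 1 "norm (f z - h z)" "norm (f' z - h z)"] by simp
        finally show "ennreal ((norm (f z - f' z))\<^sup>2) \<le> ennreal 2 * ennreal ((norm (f z - h z))\<^sup>2) + ennreal 2 * ennreal ((norm (f' z - h z))\<^sup>2)"
          by (simp add: ennreal_mult[symmetric] ennreal_plus[symmetric] ennreal_leI del: ennreal_plus ennreal_numeral)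
      qed
      also have "\<dots> = ennreal 2 * (\<integral>\<^sup>+z. ennreal ((norm (f z - h z))\<^sup>2) \<partial>lebesgue_on C) + ennreal 2 * (\<integral>\<^sup>+z. ennreal ((norm (f' z - h z))\<^sup>2) \<partial>lebesgue_on C)"
        by (subst nn_integral_add) (auto simp: nn_integral_cmult)
      also have "\<dots> = ennreal (2 * (LINT z|lebesgue_on C. (norm (f z - h z))\<^sup>2) + 2 * (LINT z|lebesgue_on C. (norm (f' z - h z))\<^sup>2))"
        unfolding sq_integrable_diff_nn[OF f(1,3)] sq_integrable_diff_nn[OF f(2,3)]
        by (simp add: ennreal_mult[symmetric] ennreal_plus[symmetric] del: ennreal_plus ennreal_numeral)
      finally show ?thesis .
    qed
    have "(\<integral>\<^sup>+z. ennreal ((?w z)\<^sup>2) \<partial>\<sigma>) \<le> ennreal B * ((\<integral>\<^sup>+z. ennreal ((?w z)\<^sup>2) \<partial>lebesgue_on C) + (\<integral>\<^sup>+z. ennreal ((norm (grad ?w z))\<^sup>2) \<partial>lebesgue_on C))"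
      by (intro test_trace_le test_functions_diff v)
    also have "\<dots> \<le> ennreal B * (ennreal (2 * (LINT z|lebesgue_on C. (v i z - u z)\<^sup>2) + 2 * (LINT z|lebesgue_on C. (v j z - u z)\<^sup>2))
       + ennreal (2 * (LINT z|lebesgue_on C. (norm (grad (v i) z - ?g z))\<^sup>2) + 2 * (LINT z|lebesgue_on C. (norm (grad (v j) z - ?g z))\<^sup>2)))"
      using sum[OF test_sq_integrable(1)[OF v] test_sq_integrable(1)[OF v] ug(1), of i j]
        sum[OF test_sq_integrable(2)[OF v] test_sq_integrable(2)[OF v] gs, of i j]
      by (intro mult_left_mono add_mono) (simp_all add: gw)
    also have "\<dots> = ennreal (B * (2 * d i + 2 * d j))"
      using B0 by (simp add: d_def ennreal_mult[symmetric] ennreal_plus[symmetric] algebra_simps del: ennreal_plus)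
    finally show ?thesis .
  qed
  \<comment> \<open>The limit is taken with respect to the surface measure; 4 B in the choice below
    balances the factor B and the four terms of the distance estimate.\<close>
  obtain tr where tr: "tr \<in> borel_measurable \<sigma>" "(\<lambda>i. \<integral>\<^sup>+z. ennreal ((v i z - tr z)\<^sup>2) \<partial>\<sigma>) \<longlonglongrightarrow> 0"
  proof (rule L2_complete[of v \<sigma>])
    fix \<epsilon> :: real assume \<epsilon>: "\<epsilon> > 0"
    have "eventually (\<lambda>k. d k < \<epsilon> / (4 * B)) sequentially"
      using dl \<epsilon> B0 by (intro order_tendstoD(2)[of d 0]) auto
    then obtain n where n: "\<And>k. k \<ge> n \<Longrightarrow> d k < \<epsilon> / (4 * B)" by (auto simp: eventually_sequentially)
    show "\<exists>n. \<forall>i\<ge>n. \<forall>j\<ge>n. (\<integral>\<^sup>+z. ennreal ((v i z - v j z)\<^sup>2) \<partial>\<sigma>) \<le> ennreal \<epsilon>"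
    proof (intro exI[of _ n] allI impI)
      fix i j assume ij: "n \<le> i" "n \<le> j"
      have "B * (2 * d i + 2 * d j) \<le> B * (2 * (\<epsilon> / (4 * B)) + 2 * (\<epsilon> / (4 * B)))"
        using n[OF ij(1)] n[OF ij(2)] B0 by (intro mult_left_mono) auto
      also have "\<dots> = \<epsilon>" using B0 by (simp add: field_simps)
      finally show "(\<integral>\<^sup>+z. ennreal ((v i z - v j z)\<^sup>2) \<partial>\<sigma>) \<le> ennreal \<epsilon>"
        using diff[of i j] by (meson ennreal_leI order_trans)
    qed
  qed simp_all
  have tr_sq: "sq_integrable \<sigma> tr"
  proof -
    have "eventually (\<lambda>i. (\<integral>\<^sup>+z. ennreal ((v i z - tr z)\<^sup>2) \<partial>\<sigma>) < 1) sequentially"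
      using tr(2) by (rule order_tendstoD) simp
    then obtain i where i: "(\<integral>\<^sup>+z. ennreal ((v i z - tr z)\<^sup>2) \<partial>\<sigma>) < 1" by (auto simp: eventually_sequentially)
    have "(\<integral>\<^sup>+z. ennreal (1 * (tr z)\<^sup>2) \<partial>\<sigma>) \<le> ennreal (1 + 1) * (\<integral>\<^sup>+z. ennreal (1 * (v i z)\<^sup>2) \<partial>\<sigma>)
       + ennreal ((1 + 1 / 1) * 1) * (\<integral>\<^sup>+z. ennreal ((v i z - tr z)\<^sup>2) \<partial>\<sigma>)"
      by (rule weighted_L2_le) (use tr in auto)
    also have "\<dots> < \<infinity>"
      using i test_sq_integrable(3)[OF v, of i] order.strict_trans[OF i ennreal_one_less_top]
      by (simp add: sq_integrable_nn ennreal_mult_less_top)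
    finally show ?thesis using tr(1) by (simp add: sq_integrable_nn)
  qed
  have "is_trace C \<sigma> u tr"
    unfolding is_trace_def
  proof (intro conjI exI[of _ v] allI v l1 l2 tr_sq)
    show "(\<lambda>k. LINT x|\<sigma>. (v k x - tr x)\<^sup>2) \<longlonglongrightarrow> 0"
      by (rule integral_tendsto_0) (use tr in auto)
  qed
  then show ?thesis unfolding trace_on_def by (rule someI[where P="is_trace C \<sigma> u"])
qed

lemma ext_norm_H_triangle: "ext_norm H (x + y) \<le> ext_norm H x + ext_norm H y"
proof -
  have "ext_norm H (x + y) \<le> sqrt ((H (fst x) + H (fst y))\<^sup>2 + (snd x + snd y)\<^sup>2)"
    unfolding ext_norm_def
    unfolding fst_add snd_add by (intro real_sqrt_le_mono add_right_mono power_mono H_triangle H_nonneg)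
  also have "\<dots> \<le> sqrt ((H (fst x))\<^sup>2 + (snd x)\<^sup>2) + sqrt ((H (fst y))\<^sup>2 + (snd y)\<^sup>2)"
    by (rule real_sqrt_sum_squares_triangle_ineq)
  finally show ?thesis by (simp add: ext_norm_def)
qed

text \<open>The inequality is moved to extended nonnegative integrals, where it makes sense before
  integrability of the weighted terms is known. The division by cos \<alpha> compensates the factor
  in \<open>area_bweight\<close>.\<close>

lemma W12_inequality:
  fixes u :: "'a \<times> real \<Rightarrow> real"
  assumes u: "u \<in> W12 C" and c: "c \<ge> 0" and K: "K \<ge> 0"
    and test: "\<And>v. v \<in> test_functions UNIV \<Longrightarrow>
      c * (LINT z|lborel. indicator C z * ((v z)\<^sup>2 / (rad z)\<^sup>2)) + K * (LINT x|lborel. (v (bd x))\<^sup>2 / H0 x)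
      \<le> (LINT z|lborel. indicator C z * (ext_norm H (grad v z))\<^sup>2)"
  shows "ennreal c * (\<integral>\<^sup>+z. ennreal (1 / (rad z)\<^sup>2 * (u z)\<^sup>2) \<partial>lebesgue_on C)
     + ennreal (K / cos \<alpha>) * (\<integral>\<^sup>+z. ennreal (bweight z * (trace_on C \<sigma> u z)\<^sup>2) \<partial>\<sigma>)
     \<le> (\<integral>\<^sup>+z. ennreal ((ext_norm H (weak_grad C u z))\<^sup>2) \<partial>lebesgue_on C)"
    and "(\<integral>\<^sup>+z. ennreal ((ext_norm H (weak_grad C u z))\<^sup>2) \<partial>lebesgue_on C) < \<infinity>"
proof -
  let ?g = "weak_grad C u"
  note ug = W12_weak_grad[OF u]
  have gs: "sq_integrable (lebesgue_on C) ?g" using ug(2) by (simp add: is_weak_grad_def)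
  \<comment> \<open>The approximants are those in the definition of the trace, so one sequence
    converges to u, to its weak gradient and to its trace simultaneously.\<close>
  obtain v where trs: "sq_integrable \<sigma> (trace_on C \<sigma> u)" and v: "\<And>k. v k \<in> test_functions UNIV"
    and l1: "(\<lambda>k. LINT x|lebesgue_on C. (v k x - u x)\<^sup>2) \<longlonglongrightarrow> 0"
    and l2: "(\<lambda>k. LINT x|lebesgue_on C. (norm (grad (v k) x - ?g x))\<^sup>2) \<longlonglongrightarrow> 0"
    and l3: "(\<lambda>k. LINT x|\<sigma>. (v k x - trace_on C \<sigma> u x)\<^sup>2) \<longlonglongrightarrow> 0"
    using trace_exists[OF u] unfolding is_trace_def by blast
  have n1: "(\<integral>\<^sup>+x. ennreal ((v k x - u x)\<^sup>2) \<partial>lebesgue_on C) = ennreal (LINT x|lebesgue_on C. (v k x - u x)\<^sup>2)" for k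
    using sq_integrable_diff_nn[OF test_sq_integrable(1)[OF v] ug(1), of k] by simp
  have n2: "(\<integral>\<^sup>+x. ennreal ((norm (grad (v k) x - ?g x))\<^sup>2) \<partial>lebesgue_on C) = ennreal (LINT x|lebesgue_on C. (norm (grad (v k) x - ?g x))\<^sup>2)" for k
    by (rule sq_integrable_diff_nn[OF test_sq_integrable(2)[OF v] gs])
  have n3: "(\<integral>\<^sup>+x. ennreal ((v k x - trace_on C \<sigma> u x)\<^sup>2) \<partial>\<sigma>) = ennreal (LINT x|\<sigma>. (v k x - trace_on C \<sigma> u x)\<^sup>2)" for k
    using sq_integrable_diff_nn[OF test_sq_integrable(3)[OF v] trs, of k] by simp
  have to0: "(\<lambda>k. ennreal (f k)) \<longlonglongrightarrow> 0" if "f \<longlonglongrightarrow> 0" for f :: "nat \<Rightarrow> real"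
    using tendsto_ennrealI[OF that] by simp
  have bl: "f \<in> borel_measurable (lebesgue_on C)" if "f \<in> borel_measurable borel" for f :: "'a \<times> real \<Rightarrow> 'c::euclidean_space"
    using that by (intro measurable_restrict_space1 measurable_completion) simp
  show fin: "(\<integral>\<^sup>+z. ennreal ((ext_norm H (?g z))\<^sup>2) \<partial>lebesgue_on C) < \<infinity>"
  proof -
    have gm: "?g \<in> borel_measurable (lebesgue_on C)" using gs by (simp add: sq_integrable_def)
    have "(\<integral>\<^sup>+z. ennreal ((ext_norm H (?g z))\<^sup>2) \<partial>lebesgue_on C) \<le> (\<integral>\<^sup>+z. ennreal ((L + 1)\<^sup>2) * ennreal ((norm (?g z))\<^sup>2) \<partial>lebesgue_on C)"
    proof (rule nn_integral_mono)
      fix z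
      have "(ext_norm H (?g z))\<^sup>2 \<le> ((L + 1) * norm (?g z))\<^sup>2"
        by (intro power_mono ext_norm_H_le) (simp add: ext_norm_def)
      then show "ennreal ((ext_norm H (?g z))\<^sup>2) \<le> ennreal ((L + 1)\<^sup>2) * ennreal ((norm (?g z))\<^sup>2)"
        by (simp add: ennreal_mult[symmetric] ennreal_leI power_mult_distrib)
    qed
    also have "\<dots> = ennreal ((L + 1)\<^sup>2) * (\<integral>\<^sup>+z. ennreal ((norm (?g z))\<^sup>2) \<partial>lebesgue_on C)"
      using gm by (intro nn_integral_cmult) measurable
    also have "\<dots> < \<infinity>" using gs by (simp add: sq_integrable_nn ennreal_mult_less_top)
    finally show ?thesis .
  qed
  show "ennreal c * (\<integral>\<^sup>+z. ennreal (1 / (rad z)\<^sup>2 * (u z)\<^sup>2) \<partial>lebesgue_on C)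
     + ennreal (K / cos \<alpha>) * (\<integral>\<^sup>+z. ennreal (bweight z * (trace_on C \<sigma> u z)\<^sup>2) \<partial>\<sigma>)
     \<le> (\<integral>\<^sup>+z. ennreal ((ext_norm H (?g z))\<^sup>2) \<partial>lebesgue_on C)"
  proof (rule quadratic_inequality_limit[where V=v and VV=v and DV="\<lambda>k. grad (v k)" and \<Lambda>="L + 1"])
    show "v k \<in> borel_measurable (lebesgue_on C)" "grad (v k) \<in> borel_measurable (lebesgue_on C)" "v k \<in> borel_measurable \<sigma>" for k
      using test_sq_integrable[OF v] by (auto simp: sq_integrable_def)
    show "u \<in> borel_measurable (lebesgue_on C)" "?g \<in> borel_measurable (lebesgue_on C)" "trace_on C \<sigma> u \<in> borel_measurable \<sigma>"
      using ug gs trs by (auto simp: sq_integrable_def)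
    show "(\<lambda>z. 1 / (rad z)\<^sup>2) \<in> borel_measurable (lebesgue_on C)" by (rule bl) simp
    show "bweight \<in> borel_measurable \<sigma>" by (simp add: measurable_sigma)
    show "0 \<le> K / cos \<alpha>" using K cos_pos by simp
    show "(\<lambda>k. \<integral>\<^sup>+x. ennreal ((v k x - u x)\<^sup>2) \<partial>lebesgue_on C) \<longlonglongrightarrow> 0" unfolding n1 by (rule to0[OF l1])
    show "(\<lambda>k. \<integral>\<^sup>+x. ennreal ((norm (grad (v k) x - ?g x))\<^sup>2) \<partial>lebesgue_on C) \<longlonglongrightarrow> 0" unfolding n2 by (rule to0[OF l2])
    show "(\<lambda>k. \<integral>\<^sup>+x. ennreal ((v k x - trace_on C \<sigma> u x)\<^sup>2) \<partial>\<sigma>) \<longlonglongrightarrow> 0" unfolding n3 by (rule to0[OF l3])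
    fix k
    have [measurable]: "v k \<in> borel_measurable borel" "grad (v k) \<in> borel_measurable borel"
      using test_functions_continuous[OF v, of UNIV] test_functions_grad_continuous[OF v, of UNIV]
      by (auto intro: borel_measurable_continuous_onI)
    obtain Q R where R: "Q > 0" "R > 0" "\<And>z. \<bar>v k z\<bar> \<le> Q" "\<And>z. norm z \<ge> R \<Longrightarrow> v k z = 0"
      using test_functions_bounds[OF v] by metis
    let ?I1 = "LINT z|lborel. indicator C z * ((v k z)\<^sup>2 / (rad z)\<^sup>2)"
    let ?I2 = "LINT x|lborel. (v k (bd x))\<^sup>2 / H0 x"
    let ?I3 = "LINT z|lborel. indicator C z * (ext_norm H (grad (v k) z))\<^sup>2"
    have i1: "integrable lborel (\<lambda>z. indicator C z * ((v k z)\<^sup>2 / (rad z)\<^sup>2))"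
      by (rule cone_inverse_square_integrable[where Q="Q\<^sup>2" and R=R])
        (use R power_mono[OF R(3) abs_ge_zero, of _ 2] in auto)
    have e1: "(\<integral>\<^sup>+z. ennreal (1 / (rad z)\<^sup>2 * (v k z)\<^sup>2) \<partial>lebesgue_on C) = ennreal ?I1"
    proof -
      have "(\<integral>\<^sup>+z. ennreal (1 / (rad z)\<^sup>2 * (v k z)\<^sup>2) \<partial>lebesgue_on C) = (\<integral>\<^sup>+z. ennreal (indicator C z * ((v k z)\<^sup>2 / (rad z)\<^sup>2)) \<partial>lborel)"
        by (rule nn_integral_lebesgue_on_eq[OF open_C]) auto
      also have "\<dots> = ennreal ?I1" by (rule nn_integral_eq_integral[OF i1]) simp
      finally show ?thesis .
    qed
    have e2: "(\<integral>\<^sup>+z. ennreal (bweight z * (v k z)\<^sup>2) \<partial>\<sigma>) = ennreal (cos \<alpha> * ?I2)"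
    proof -
      have "(\<integral>\<^sup>+z. ennreal (bweight z * (v k z)\<^sup>2) \<partial>\<sigma>) = (\<integral>\<^sup>+x. ennreal (area_factor H0 \<alpha> x) * ennreal (bweight (bd x) * (v k (bd x))\<^sup>2) \<partial>lborel)"
        by (rule nn_integral_sigma) simp
      also have "\<dots> = (\<integral>\<^sup>+x. ennreal (cos \<alpha> * ((v k (bd x))\<^sup>2 / H0 x)) \<partial>lborel)"
      proof (rule nn_integral_cong)
        fix x
        have "ennreal (area_factor H0 \<alpha> x) * ennreal (bweight (bd x) * (v k (bd x))\<^sup>2) = ennreal (area_factor H0 \<alpha> x * (bweight (bd x) * (v k (bd x))\<^sup>2))"
          using area_factor_ge_1[of H0 \<alpha> x] bweight_nonneg[of "bd x"] by (intro ennreal_mult[symmetric]) auto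
        also have "area_factor H0 \<alpha> x * (bweight (bd x) * (v k (bd x))\<^sup>2) = cos \<alpha> * ((v k (bd x))\<^sup>2 / H0 x)"
          unfolding mult.assoc[symmetric] area_bweight by simp
        finally show "ennreal (area_factor H0 \<alpha> x) * ennreal (bweight (bd x) * (v k (bd x))\<^sup>2) = ennreal (cos \<alpha> * ((v k (bd x))\<^sup>2 / H0 x))" .
      qed
      also have "\<dots> = ennreal (LINT x|lborel. cos \<alpha> * ((v k (bd x))\<^sup>2 / H0 x))"
        using cos_pos H0_nonneg by (intro nn_integral_eq_integral integrable_mult_right test_boundary_integrable v) auto
      also have "\<dots> = ennreal (cos \<alpha> * ?I2)" by (simp only: integral_mult_right_zero)
      finally show ?thesis .
    qed
    have e3: "(\<integral>\<^sup>+z. ennreal ((ext_norm H (grad (v k) z))\<^sup>2) \<partial>lebesgue_on C) = ennreal ?I3"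
    proof -
      have "(\<integral>\<^sup>+z. ennreal ((ext_norm H (grad (v k) z))\<^sup>2) \<partial>lebesgue_on C) = (\<integral>\<^sup>+z. ennreal (indicator C z * (ext_norm H (grad (v k) z))\<^sup>2) \<partial>lborel)"
        by (rule nn_integral_lebesgue_on_eq[OF open_C]) auto
      also have "\<dots> = ennreal ?I3" by (rule nn_integral_eq_integral[OF test_grad_integrable[OF v]]) simp
      finally show ?thesis .
    qed
    have I1: "?I1 \<ge> 0" by (intro integral_nonneg_AE) simp
    have I2: "?I2 \<ge> 0" by (intro integral_nonneg_AE) (simp add: H0_nonneg)
    have "ennreal c * ennreal ?I1 + ennreal (K / cos \<alpha>) * ennreal (cos \<alpha> * ?I2) = ennreal (c * ?I1 + K / cos \<alpha> * (cos \<alpha> * ?I2))"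
    proof -
      have "ennreal c * ennreal ?I1 = ennreal (c * ?I1)" using c I1 by (intro ennreal_mult[symmetric])
      moreover have "ennreal (K / cos \<alpha>) * ennreal (cos \<alpha> * ?I2) = ennreal (K / cos \<alpha> * (cos \<alpha> * ?I2))"
        using K cos_pos I2 by (intro ennreal_mult[symmetric] divide_nonneg_nonneg mult_nonneg_nonneg) auto
      moreover have "0 \<le> c * ?I1" "0 \<le> K / cos \<alpha> * (cos \<alpha> * ?I2)"
        using c K cos_pos I1 I2 by (intro mult_nonneg_nonneg divide_nonneg_nonneg; simp)+
      ultimately show ?thesis by (simp only: ennreal_plus)
    qed
    also have "K / cos \<alpha> * (cos \<alpha> * ?I2) = K * ?I2" using cos_pos by simp
    also have "ennreal (c * ?I1 + K * ?I2) \<le> ennreal ?I3" by (rule ennreal_leI[OF test[OF v]])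
    finally show "ennreal c * (\<integral>\<^sup>+z. ennreal (1 / (rad z)\<^sup>2 * (v k z)\<^sup>2) \<partial>lebesgue_on C) + ennreal (K / cos \<alpha>) * (\<integral>\<^sup>+z. ennreal (bweight z * (v k z)\<^sup>2) \<partial>\<sigma>)
       \<le> (\<integral>\<^sup>+z. ennreal ((ext_norm H (grad (v k) z))\<^sup>2) \<partial>lebesgue_on C)"
      unfolding e1 e2 e3 .
  qed (use c fin in \<open>auto simp: bweight_nonneg ext_norm_H_triangle ext_norm_H_le\<close>, auto simp: ext_norm_def)
qed

end

section \<open>The choices of the multiplier and the final assembly\<close>

lemma twice_eq_diff_1:
  fixes x d :: real
  assumes "2 * x = d - 1"
  shows "(d - 1) / 2 = x" "d \<ge> 2 \<Longrightarrow> x \<ge> 1/2" "2 * x + 1 = d"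
  using assms by auto

context cone_pair
begin

text \<open>The constant multiplier m = -\<kappa>, with the crude bounds s <= 1 and 1 - s^2 <= 1.
  For \<kappa> = 0 it is the Hardy inequality on the cone without boundary term; for small \<kappa>
  > 0 both weighted integrals appear with positive coefficients.\<close>

lemma test_Hardy:
  fixes v :: "'a \<times> real \<Rightarrow> real"
  assumes v: "v \<in> test_functions UNIV" and \<kappa>: "\<kappa> \<ge> 0"
    and c: "c \<le> ((real DIM('a) - 1) / 2)\<^sup>2 - real DIM('a) * \<kappa> - \<kappa>\<^sup>2"
  shows "c * (LINT z|lborel. indicator C z * ((v z)\<^sup>2 / (rad z)\<^sup>2)) + \<kappa> * cos \<alpha> * (LINT x|lborel. (v (bd x))\<^sup>2 / H0 x)
      \<le> (LINT z|lborel. indicator C z * (ext_norm H (grad v z))\<^sup>2)"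
proof -
  have "c * (LINT z|lborel. indicator C z * ((v z)\<^sup>2 / (rad z)\<^sup>2)) - (- \<kappa>) * cos \<alpha> * (LINT x|lborel. (v (bd x))\<^sup>2 / H0 x)
      \<le> (LINT z|lborel. indicator C z * (ext_norm H (grad v z))\<^sup>2)"
  proof (rule test_inequality[OF v, where m="\<lambda>_. - \<kappa>" and md="\<lambda>_. 0" and M=\<kappa> and ?s1.0=0])
    fix s :: real assume s: "s \<le> 1"
    have 1: "real DIM('a) * s * (- \<kappa>) \<ge> - (real DIM('a) * \<kappa>)"
      using s \<kappa> mult_left_mono[OF s, of "real DIM('a) * \<kappa>"] by (simp add: mult_ac)
    have 2: "(1 - s\<^sup>2) * (0 + (- \<kappa>)\<^sup>2) \<le> \<kappa>\<^sup>2"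
      using mult_right_mono[of "1 - s\<^sup>2" 1 "\<kappa>\<^sup>2"] by simp
    show "c \<le> ((real DIM('a) - 1) / 2)\<^sup>2 + real DIM('a) * s * - \<kappa> - (1 - s\<^sup>2) * (0 + (- \<kappa>)\<^sup>2)"
      using 1 2 c by argo
  qed (use \<kappa> in auto)
  then show ?thesis by simp
qed

text \<open>Proved for every K below \<open>Gamma_ratio a b\<close>, where the truncated multiplier
  is bounded, and then passed to the limit K -> \<open>Gamma_ratio a b\<close>, which is harmless
  since K occurs only in G and G' at the fixed point sin \<alpha> < 1.\<close>

lemma test_sharp:
  fixes v :: "'a \<times> real \<Rightarrow> real" and a b :: real
  assumes v: "v \<in> test_functions UNIV" and ab: "a > 0" "b > 0" "2 * (a + b) = real DIM('a) - 1" and \<alpha>0: "\<alpha> \<ge> 0"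
  shows "((a + b)\<^sup>2 - 4 * a * b) * (LINT z|lborel. indicator C z * ((v z)\<^sup>2 / (rad z)\<^sup>2))
      - dGfun a b (Gamma_ratio a b) (sin \<alpha>) / Gfun a b (Gamma_ratio a b) (sin \<alpha>) * cos \<alpha> * (LINT x|lborel. (v (bd x))\<^sup>2 / H0 x)
      \<le> (LINT z|lborel. indicator C z * (ext_norm H (grad v z))\<^sup>2)"
proof -
  let ?I1 = "LINT z|lborel. indicator C z * ((v z)\<^sup>2 / (rad z)\<^sup>2)"
  let ?I2 = "LINT x|lborel. (v (bd x))\<^sup>2 / H0 x"
  let ?I3 = "LINT z|lborel. indicator C z * (ext_norm H (grad v z))\<^sup>2"
  let ?K = "Gamma_ratio a b" and ?s = "sin \<alpha>" and ?c = "(a + b)\<^sup>2 - 4 * a * b"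
  have "real DIM('a) \<ge> 2" using dim by simp
  then have "a + b \<ge> 1/2" by (rule twice_eq_diff_1(2)[OF ab(3)])
  note ab' = ab(1,2) this
  have q: "((real DIM('a) - 1) / 2)\<^sup>2 = (a + b)\<^sup>2"
    proof -
      have "(real DIM('a) - 1) / 2 = a + b" by (rule twice_eq_diff_1(1)[OF ab(3)])
      then show ?thesis by (simp only:)
    qed
  have s: "0 \<le> ?s" "?s < 1"
  proof -
    show "0 \<le> ?s" using alpha \<alpha>0 by (intro sin_ge_zero) auto
    have "?s\<^sup>2 < 1" using cos_pos by (simp add: sin_squared_eq)
    then show "?s < 1" by (simp add: abs_square_less_1)
  qed
  have I2: "?I2 \<ge> 0" by (intro integral_nonneg_AE) (simp add: H0_nonneg)
  have sub: "?c * ?I1 - dGfun a b K ?s / Gfun a b K ?s * cos \<alpha> * ?I2 \<le> ?I3" if K: "0 \<le> K" "K < ?K" for K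
  proof (cases "dGfun a b K ?s \<le> 0")
    case True
    obtain m md M s1 where m: "continuous_on UNIV m" "md \<in> borel_measurable borel" "\<And>s. \<bar>m s\<bar> \<le> M" "\<And>s. \<bar>md s\<bar> \<le> M"
      "m ?s = dGfun a b K ?s / Gfun a b K ?s"
      "\<And>s. ?s < s \<Longrightarrow> s \<noteq> s1 \<Longrightarrow> (m has_real_derivative md s) (at s)"
      "\<And>s. ?s < s \<Longrightarrow> (1 - s\<^sup>2) * (md s + (m s)\<^sup>2) - (2 * (a + b) + 1) * s * m s \<le> 4 * a * b"
      using Riccati_subsolution_ex[OF ab' K s True] by metis
    have "?c * ?I1 - m ?s * cos \<alpha> * ?I2 \<le> ?I3"
    proof (rule test_inequality[OF v m(1-4)])
      show "(m has_real_derivative md s) (at s)" if "?s < s" "s < 1" "s \<noteq> s1" for s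
        using m(6) that by blast
      show "?c \<le> ((real DIM('a) - 1) / 2)\<^sup>2 + real DIM('a) * s * m s - (1 - s\<^sup>2) * (md s + (m s)\<^sup>2)" if "?s < s" for s
      proof -
        have "2 * (a + b) + 1 = real DIM('a)" by (rule twice_eq_diff_1(3)[OF ab(3)])
        with m(7)[OF that] have "(1 - s\<^sup>2) * (md s + (m s)\<^sup>2) - real DIM('a) * s * m s \<le> 4 * a * b" by (simp only:)
        then show ?thesis unfolding q by linarith
      qed
    qed
    then show ?thesis by (simp only: m(5))
  next
    case False
    \<comment> \<open>For this K the slope at sin \<alpha> is already positive, so the boundary
      coefficient is not positive and the case \<kappa> = 0 suffices.\<close>
    have "?c * ?I1 + 0 * cos \<alpha> * ?I2 \<le> ?I3"
    proof (rule test_Hardy[OF v])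
      show "?c \<le> ((real DIM('a) - 1) / 2)\<^sup>2 - real DIM('a) * 0 - 0\<^sup>2" unfolding q using ab(1,2) by simp
    qed simp
    moreover have "dGfun a b K ?s / Gfun a b K ?s * cos \<alpha> * ?I2 \<ge> 0"
      using False Gfun_pos[OF ab' s, of K] K cos_pos I2 by (intro mult_nonneg_nonneg divide_nonneg_nonneg) auto
    ultimately show ?thesis by simp
  qed
  have s1: "\<bar>?s\<bar> < 1" using s by simp
  have G: "((\<lambda>K. Gfun a b K ?s) \<longlongrightarrow> Gfun a b ?K ?s) (at_left ?K)"
  proof -
    have "((\<lambda>K. Gfun a b 0 ?s - K * (Gfun a b 0 ?s - Gfun a b 1 ?s)) \<longlongrightarrow> Gfun a b 0 ?s - ?K * (Gfun a b 0 ?s - Gfun a b 1 ?s)) (at_left ?K)"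
      by (intro tendsto_intros)
    then show ?thesis by (simp only: flip: Gfun_split[OF ab' s1])
  qed
  have dG: "((\<lambda>K. dGfun a b K ?s) \<longlongrightarrow> dGfun a b ?K ?s) (at_left ?K)"
  proof -
    have "((\<lambda>K. dGfun a b 0 ?s - K * (dGfun a b 0 ?s - dGfun a b 1 ?s)) \<longlongrightarrow> dGfun a b 0 ?s - ?K * (dGfun a b 0 ?s - dGfun a b 1 ?s)) (at_left ?K)"
      by (intro tendsto_intros)
    then show ?thesis by (simp only: flip: dGfun_split[OF ab' s1])
  qed
  have "((\<lambda>K. ?c * ?I1 - dGfun a b K ?s / Gfun a b K ?s * cos \<alpha> * ?I2) \<longlongrightarrow> ?c * ?I1 - dGfun a b ?K ?s / Gfun a b ?K ?s * cos \<alpha> * ?I2) (at_left ?K)"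
    using Gfun_pos[OF ab' s order_refl] by (intro tendsto_intros G dG) auto
  moreover have "eventually (\<lambda>K. ?c * ?I1 - dGfun a b K ?s / Gfun a b K ?s * cos \<alpha> * ?I2 \<le> ?I3) (at_left ?K)"
    using Gamma_ratio_pos[OF ab(1,2)] by (intro eventually_at_leftI[of 0] sub) auto
  ultimately show ?thesis by (rule tendsto_upperbound) simp
qed

lemma bochner_of_nn:
  fixes f :: "'z \<Rightarrow> real"
  assumes "f \<in> borel_measurable M" "\<And>x. 0 \<le> f x" "(\<integral>\<^sup>+x. ennreal (f x) \<partial>M) < \<infinity>"
  shows "integrable M f" "(\<integral>\<^sup>+x. ennreal (f x) \<partial>M) = ennreal (LINT x|M. f x)"
proof -
  show i: "integrable M f" using assms by (intro integrableI_nonneg) auto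
  show "(\<integral>\<^sup>+x. ennreal (f x) \<partial>M) = ennreal (LINT x|M. f x)"
    using assms by (intro nn_integral_eq_integral[OF i]) auto
qed

lemma cone_Hardy_trace:
  fixes N :: nat and \<beta> :: real
  assumes N: "N \<ge> 3" "DIM('a) = N - 1" and beta: "2 \<le> \<beta>" "\<beta> < real N"
  shows "\<exists>K::real. is_K_const N \<alpha> \<beta> K \<and>
    (\<forall>u\<in>W12 C.
       integrable \<sigma> (\<lambda>z. (trace_on C \<sigma> u z)\<^sup>2 / rad z / area_factor H0 \<alpha> (fst z)) \<and>
       integrable (lebesgue_on C) (\<lambda>z. (ext_norm H (weak_grad C u z))\<^sup>2) \<and>
       integrable (lebesgue_on C) (\<lambda>z. (u z)\<^sup>2 / (rad z)\<^sup>2) \<and>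
       K * sqrt (1 + (tan \<alpha>)\<^sup>2) *
         (\<integral>z. (trace_on C \<sigma> u z)\<^sup>2 / rad z / area_factor H0 \<alpha> (fst z) \<partial>\<sigma>)
       \<le> (\<integral>z. (ext_norm H (weak_grad C u z))\<^sup>2 \<partial>lebesgue_on C)
          - (\<beta> - 2)\<^sup>2 / 4 * (\<integral>z. (u z)\<^sup>2 / (rad z)\<^sup>2 \<partial>lebesgue_on C))"
proof -
  define a where "a = (real N + \<beta>) / 4 - 1"
  define b where "b = (real N - \<beta>) / 4"
  have dN: "real DIM('a) = real N - 1" using N by simp
  have ab: "a > 0" "b > 0" "2 * (a + b) = real DIM('a) - 1" "a + b \<ge> 1/2"
    using N beta unfolding dN a_def b_def by (auto simp: field_simps)
  have cab: "(a + b)\<^sup>2 - 4 * a * b = (\<beta> - 2)\<^sup>2 / 4"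
    by (simp add: a_def b_def power2_eq_square field_simps)
  let ?k = "dGfun a b (Gamma_ratio a b) \<bar>sin \<alpha>\<bar> / Gfun a b (Gamma_ratio a b) \<bar>sin \<alpha>\<bar>"
  define K where "K = - (if \<alpha> < 0 then -1 else 1) * cos \<alpha> * dGfun a b (Gamma_ratio a b) \<bar>sin \<alpha>\<bar> / Gfun a b (Gamma_ratio a b) \<bar>sin \<alpha>\<bar>"
  have isK: "is_K_const N \<alpha> \<beta> K"
    unfolding K_def a_def b_def by (rule is_K_const_ex[OF N(1) beta alpha])
  have s: "0 \<le> \<bar>sin \<alpha>\<bar>" "\<bar>sin \<alpha>\<bar> < 1"
  proof -
    have "(sin \<alpha>)\<^sup>2 < 1" using cos_pos by (simp add: sin_squared_eq)
    then show "\<bar>sin \<alpha>\<bar> < 1" by (simp add: abs_square_less_1)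
  qed simp
  have k0: "?k \<le> 0"
    using dGfun_nonpos[OF ab(1,2,4) s] Gfun_pos[OF ab(1,2,4) s order_refl] by (simp add: divide_nonpos_pos)
  have Kk: "K = (if \<alpha> < 0 then ?k else - ?k) * cos \<alpha>" by (simp add: K_def)
  \<comment> \<open>Passing to the limit requires nonnegative coefficients. For \<alpha> < 0 the
    constant K is nonpositive and is replaced by 0, which only strengthens the inequality.\<close>
  define K' where "K' = (if \<alpha> < 0 then 0 else K)"
  have K': "0 \<le> K'" "K \<le> K'"
  proof -
    have "?k * cos \<alpha> \<le> 0" using k0 cos_pos by (intro mult_nonpos_nonneg) auto
    then show "0 \<le> K'" "K \<le> K'" unfolding K'_def Kk by (auto simp only: if_splits mult_minus_left split: if_split; linarith)+
  qed
  have test: "(\<beta> - 2)\<^sup>2 / 4 * (LINT z|lborel. indicator C z * ((v z)\<^sup>2 / (rad z)\<^sup>2)) + K' * (LINT x|lborel. (v (bd x))\<^sup>2 / H0 x)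
      \<le> (LINT z|lborel. indicator C z * (ext_norm H (grad v z))\<^sup>2)"
    if v: "v \<in> test_functions UNIV" for v :: "'a \<times> real \<Rightarrow> real"
  proof (cases "\<alpha> < 0")
    case True
    have q: "((real DIM('a) - 1) / 2)\<^sup>2 = (a + b)\<^sup>2"
    proof -
      have "(real DIM('a) - 1) / 2 = a + b" by (rule twice_eq_diff_1(1)[OF ab(3)])
      then show ?thesis by (simp only:)
    qed
    have "(\<beta> - 2)\<^sup>2 / 4 * (LINT z|lborel. indicator C z * ((v z)\<^sup>2 / (rad z)\<^sup>2)) + 0 * cos \<alpha> * (LINT x|lborel. (v (bd x))\<^sup>2 / H0 x)
      \<le> (LINT z|lborel. indicator C z * (ext_norm H (grad v z))\<^sup>2)"
    proof (rule test_Hardy[OF v])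
      show "(\<beta> - 2)\<^sup>2 / 4 \<le> ((real DIM('a) - 1) / 2)\<^sup>2 - real DIM('a) * 0 - 0\<^sup>2"
        unfolding q cab[symmetric] using ab(1,2) by simp
    qed simp
    then show ?thesis using True by (simp add: K'_def)
  next
    case False
    then have sg: "\<bar>sin \<alpha>\<bar> = sin \<alpha>" using alpha by (intro abs_of_nonneg sin_ge_zero) auto
    show ?thesis using test_sharp[OF v ab(1-3)] False unfolding cab K'_def Kk sg by simp
  qed
  define q where "q = (real DIM('a) - 1) / 2"
  \<comment> \<open>Since \<kappa> <= 1, one has d \<kappa> + \<kappa>^2 <= (d + 1) \<kappa> <= q^2
    / 2 with d = \<open>DIM('a)\<close>, which leaves the coefficient q^2 / 2 for the bulk
    term.\<close>
  define \<kappa> where "\<kappa> = min 1 (q\<^sup>2 / (2 * (real DIM('a) + 1)))"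
  have q0: "q > 0" using dim by (simp add: q_def)
  have \<kappa>: "\<kappa> > 0" "\<kappa> \<le> 1" using q0 by (auto simp: \<kappa>_def intro!: divide_pos_pos)
  have \<kappa>c: "q\<^sup>2 / 2 \<le> ((real DIM('a) - 1) / 2)\<^sup>2 - real DIM('a) * \<kappa> - \<kappa>\<^sup>2"
  proof -
    have "\<kappa>\<^sup>2 \<le> \<kappa>" using \<kappa> by (simp add: power2_eq_square mult_left_le_one_le)
    moreover have "(real DIM('a) + 1) * \<kappa> \<le> q\<^sup>2 / 2"
    proof -
      have "(real DIM('a) + 1) * \<kappa> \<le> (real DIM('a) + 1) * (q\<^sup>2 / (2 * (real DIM('a) + 1)))"
        by (intro mult_left_mono) (auto simp: \<kappa>_def)
      also have "\<dots> = q\<^sup>2 / 2"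
      proof -
        have "(x + 1) * (y / (2 * (x + 1))) = y / 2" if "x + 1 > 0" for x y :: real using that by (simp add: field_simps)
        then show ?thesis by simp
      qed
      finally show ?thesis .
    qed
    then have "real DIM('a) * \<kappa> + \<kappa> \<le> q\<^sup>2 / 2" by (simp only: distrib_right mult_1)
    ultimately show ?thesis unfolding q_def[symmetric] by linarith
  qed
  have main: "integrable \<sigma> (\<lambda>z. (trace_on C \<sigma> u z)\<^sup>2 / rad z / area_factor H0 \<alpha> (fst z)) \<and>
       integrable (lebesgue_on C) (\<lambda>z. (ext_norm H (weak_grad C u z))\<^sup>2) \<and>
       integrable (lebesgue_on C) (\<lambda>z. (u z)\<^sup>2 / (rad z)\<^sup>2) \<and>
       K * sqrt (1 + (tan \<alpha>)\<^sup>2) *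
         (\<integral>z. (trace_on C \<sigma> u z)\<^sup>2 / rad z / area_factor H0 \<alpha> (fst z) \<partial>\<sigma>)
       \<le> (\<integral>z. (ext_norm H (weak_grad C u z))\<^sup>2 \<partial>lebesgue_on C)
          - (\<beta> - 2)\<^sup>2 / 4 * (\<integral>z. (u z)\<^sup>2 / (rad z)\<^sup>2 \<partial>lebesgue_on C)" if u: "u \<in> W12 C" for u
  proof -
    let ?g = "weak_grad C u" and ?tr = "trace_on C \<sigma> u"
    let ?A = "\<lambda>z. 1 / (rad z)\<^sup>2 * (u z)\<^sup>2" and ?T = "\<lambda>z. bweight z * (?tr z)\<^sup>2" and ?P = "\<lambda>z. (ext_norm H (?g z))\<^sup>2"
    note ug = W12_weak_grad[OF u]
    have gs: "sq_integrable (lebesgue_on C) ?g" using ug(2) by (simp add: is_weak_grad_def)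
    have trs: "sq_integrable \<sigma> ?tr" using trace_exists[OF u] by (simp add: is_trace_def)
    have bl: "f \<in> borel_measurable (lebesgue_on C)" if "f \<in> borel_measurable borel" for f :: "'a \<times> real \<Rightarrow> real"
      using that by (rule borel_measurable_lebesgue_on)
    have mA: "?A \<in> borel_measurable (lebesgue_on C)"
    proof (intro borel_measurable_times borel_measurable_power)
      show "(\<lambda>z. 1 / (rad z)\<^sup>2) \<in> borel_measurable (lebesgue_on C)" by (rule bl) simp
      show "u \<in> borel_measurable (lebesgue_on C)" using ug(1) by (simp add: sq_integrable_def)
    qed
    have mT: "?T \<in> borel_measurable \<sigma>"
      using trs by (intro borel_measurable_times borel_measurable_power) (auto simp: sq_integrable_def measurable_sigma)
    have mP: "?P \<in> borel_measurable (lebesgue_on C)"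
      using gs by (intro borel_measurable_power measurable_compose[OF _ measurable_ext_norm_H]) (auto simp: sq_integrable_def)
    have nn: "0 \<le> ?A z" "0 \<le> ?P z" for z by auto
    have nT: "0 \<le> ?T z" for z using bweight_nonneg by simp
    \<comment> \<open>Both coefficients are positive here, so finite energy makes both weighted
      integrals finite, whatever \<beta> and \<alpha> are.\<close>
    have Hardy: "ennreal (q\<^sup>2 / 2) * (\<integral>\<^sup>+z. ennreal (?A z) \<partial>lebesgue_on C) + ennreal (\<kappa> * cos \<alpha> / cos \<alpha>) * (\<integral>\<^sup>+z. ennreal (?T z) \<partial>\<sigma>)
        \<le> (\<integral>\<^sup>+z. ennreal (?P z) \<partial>lebesgue_on C)"
      using \<kappa> cos_pos by (intro W12_inequality(1)[OF u] test_Hardy[OF _ _ \<kappa>c]) auto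
    have finP: "(\<integral>\<^sup>+z. ennreal (?P z) \<partial>lebesgue_on C) < \<infinity>"
      using K' test by (intro W12_inequality(2)[OF u, of "(\<beta> - 2)\<^sup>2 / 4" K']) auto
    have finA: "(\<integral>\<^sup>+z. ennreal (?A z) \<partial>lebesgue_on C) < \<infinity>"
    proof -
      have "ennreal (q\<^sup>2 / 2) * (\<integral>\<^sup>+z. ennreal (?A z) \<partial>lebesgue_on C) < \<infinity>"
        by (rule le_less_trans[OF order_trans[OF _ Hardy] finP]) (rule add_increasing2, simp_all)
      then show ?thesis using q0 by (auto simp: ennreal_mult_less_top)
    qed
    have finT: "(\<integral>\<^sup>+z. ennreal (?T z) \<partial>\<sigma>) < \<infinity>"
    proof -
      have "ennreal (\<kappa> * cos \<alpha> / cos \<alpha>) * (\<integral>\<^sup>+z. ennreal (?T z) \<partial>\<sigma>) < \<infinity>"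
        by (rule le_less_trans[OF order_trans[OF _ Hardy] finP]) (rule add_increasing, simp_all)
      then show ?thesis using \<kappa> cos_pos by (auto simp: ennreal_mult_less_top)
    qed
    note A = bochner_of_nn[OF mA nn(1) finA] and T = bochner_of_nn[OF mT nT finT] and P = bochner_of_nn[OF mP nn(2) finP]
    have "ennreal ((\<beta> - 2)\<^sup>2 / 4) * (\<integral>\<^sup>+z. ennreal (?A z) \<partial>lebesgue_on C) + ennreal (K' / cos \<alpha>) * (\<integral>\<^sup>+z. ennreal (?T z) \<partial>\<sigma>)
        \<le> (\<integral>\<^sup>+z. ennreal (?P z) \<partial>lebesgue_on C)"
      using K' test by (intro W12_inequality(1)[OF u]) auto
    then have "ennreal ((\<beta> - 2)\<^sup>2 / 4 * (LINT z|lebesgue_on C. ?A z) + K' / cos \<alpha> * (LINT z|\<sigma>. ?T z)) \<le> ennreal (LINT z|lebesgue_on C. ?P z)"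
    proof -
      have "0 \<le> (LINT z|lebesgue_on C. ?A z)" "0 \<le> (LINT z|\<sigma>. ?T z)"
        using nn nT by (auto intro!: integral_nonneg_AE)
      then show ?thesis
        using \<open>ennreal ((\<beta> - 2)\<^sup>2 / 4) * _ + _ \<le> _\<close> K' cos_pos unfolding A(2) T(2) P(2)
        by (simp add: ennreal_mult[symmetric] ennreal_plus[symmetric] del: ennreal_plus)
    qed
    then have ineq: "(\<beta> - 2)\<^sup>2 / 4 * (LINT z|lebesgue_on C. ?A z) + K' / cos \<alpha> * (LINT z|\<sigma>. ?T z) \<le> (LINT z|lebesgue_on C. ?P z)"
      by (subst (asm) ennreal_le_iff) (auto intro!: integral_nonneg_AE)
    have T0: "0 \<le> (LINT z|\<sigma>. ?T z)" using nT by (auto intro!: integral_nonneg_AE)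
    \<comment> \<open>Back from K' to K, using that the boundary integral is nonnegative; 1 / cos
      \<alpha> is the factor sqrt(1 + tan^2 \<alpha>) of the theorem.\<close>
    have "K / cos \<alpha> * (LINT z|\<sigma>. ?T z) \<le> K' / cos \<alpha> * (LINT z|\<sigma>. ?T z)"
      using K' cos_pos T0 by (intro mult_right_mono divide_right_mono) auto
    with ineq have ineq': "K / cos \<alpha> * (LINT z|\<sigma>. ?T z) \<le> (LINT z|lebesgue_on C. ?P z) - (\<beta> - 2)\<^sup>2 / 4 * (LINT z|lebesgue_on C. ?A z)"
      by linarith
    have sq: "sqrt (1 + (tan \<alpha>)\<^sup>2) = 1 / cos \<alpha>"
    proof -
      have "1 + (tan \<alpha>)\<^sup>2 = (1 / cos \<alpha>)\<^sup>2"
        using tan_sec[of \<alpha>] cos_pos by (simp add: power_divide inverse_eq_divide)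
      then show ?thesis using cos_pos by simp
    qed
    have eT: "(\<lambda>z. (?tr z)\<^sup>2 / rad z / area_factor H0 \<alpha> (fst z)) = ?T" by (auto simp: bweight_def)
    have eA: "(\<lambda>z. (u z)\<^sup>2 / (rad z)\<^sup>2) = ?A" by auto
    show ?thesis unfolding eT eA sq using A(1) T(1) P(1) ineq' by simp
  qed
  with isK show ?thesis by blast
qed

end

theorem theorem1p2:
  fixes N :: nat and \<alpha> \<beta> :: real and H H0 :: "real ^ 'n \<Rightarrow> real"
    and \<Phi> \<Phi>0 :: "(real ^ 'n) \<times> real \<Rightarrow> real"
    and C :: "((real ^ 'n) \<times> real) set" and \<sigma> :: "((real ^ 'n) \<times> real) measure"
  assumes "N \<ge> 3" and "CARD('n) = N - 1"
    and "2 \<le> \<beta>" and "\<beta> < real N"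
    and "- pi / 2 < \<alpha>" and "\<alpha> < pi / 2"
    and "finsler_norm H"
    and "H0 = dual_norm H"
    and "\<Phi> = ext_norm H" and "\<Phi>0 = ext_norm H0"
    and "C = cone_dom H0 \<alpha>" and "\<sigma> = cone_surface H0 \<alpha>"
  shows "\<exists>K::real. is_K_const N \<alpha> \<beta> K \<and>
    (\<forall>u\<in>W12 C.
       integrable \<sigma> (\<lambda>z. (trace_on C \<sigma> u z)\<^sup>2 / \<Phi>0 z / area_factor H0 \<alpha> (fst z)) \<and>
       integrable (lebesgue_on C) (\<lambda>z. (\<Phi> (weak_grad C u z))\<^sup>2) \<and>
       integrable (lebesgue_on C) (\<lambda>z. (u z)\<^sup>2 / (\<Phi>0 z)\<^sup>2) \<and>
       K * sqrt (1 + (tan \<alpha>)\<^sup>2) *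
         (\<integral>z. (trace_on C \<sigma> u z)\<^sup>2 / \<Phi>0 z / area_factor H0 \<alpha> (fst z) \<partial>\<sigma>)
       \<le> (\<integral>z. (\<Phi> (weak_grad C u z))\<^sup>2 \<partial>lebesgue_on C)
          - (\<beta> - 2)\<^sup>2 / 4 * (\<integral>z. (u z)\<^sup>2 / (\<Phi>0 z)\<^sup>2 \<partial>lebesgue_on C))"
proof -
  have dim: "DIM(real ^ 'n) \<ge> 2" "DIM(real ^ 'n) = N - 1" using assms(1,2) by auto
  obtain l L B where cp: "cone_pair H (dual_norm H) l L \<alpha> B"
    using finsler_cone_pair[OF assms(7,5,6) dim(1)] by blast
  show ?thesis
    unfolding assms(8-12) using cone_pair.cone_Hardy_trace[OF cp assms(1) dim(2) assms(3,4)] .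
qed

end
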